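(* Consider functionals on $\mathcal P(C([0,1];\mathbb T^d))$ endowed with the topology of narrow convergence. 1. The following $\Gamma$-convergence holds: $$\Gamma\text{-}\lim_{\nu\to0}\{\overline{\mathcal H}_\nu+\iota_{\mathrm{Inc}}\}=\overline{\mathcal A}+\iota_{\mathrm{Inc}}.$$ 2. If $\gamma\in\mathcal P(\mathbb T^d\times\mathbb T^d)$ is bistochastic (both of its marginals are the Lebesgue measure) and satisfies $H(\gamma\,|\,\mathrm{Leb}\otimes\mathrm{Leb})<+\infty$, then $$\Gamma\text{-}\lim_{\nu\to0}\{\overline{\mathcal H}_\nu+\iota_{\mathrm{Inc}}+\iota_\gamma\}=\overline{\mathcal A}+\iota_{\mathrm{Inc}}+\iota_\gamma.$$
   Context: $\mathbb T^d=\mathbb R^d/\mathbb Z^d$ is the flat torus with normalized Lebesgue measure $\mathrm{Leb}$. $C([0,1];\mathbb T^d)$ carries the uniform topology; elements of $\mathcal P(C([0,1];\mathbb T^d))$ (Borel probability measures) are called generalized flows. For a generalized flow $P$, $P_t$ denotes the law of $\omega_t$ and $P_{0,1}$ the joint law of $(\omega_0,\omega_1)$ under $P$. The relative entropy of a probability measure $p$ with respect to a finite positive measure $r$ is $H(p\,|\,r)=\int\log\frac{dp}{dr}\,dp$ if $p\ll r$, and $+\infty$ otherwise. $R^\nu$ is the reversible Brownian motion on $\mathbb T^d$ with diffusivity $\nu>0$: the law of the Brownian motion with generator $\frac{\nu}{2}\Delta$ on $\mathbb T^d$, on the time interval $[0,1]$, with initial law $\mathrm{Leb}$. $\overline{\mathcal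 H}_\nu(P):=\nu H(P\,|\,R^\nu)$. $\overline{\mathcal A}(P):=\int A(\omega)\,dP(\omega)$, where $A(\omega):=\frac12\int_0^1|\dot\omega_t|^2dt$ if $\omega$ is absolutely continuous and $A(\omega)=+\infty$ otherwise. $\iota_{\mathrm{Inc}}(P)=0$ if $P_t=\mathrm{Leb}$ for all $t\in[0,1]$, and $+\infty$ otherwise. $\iota_\gamma(P)=0$ if $P_{0,1}=\gamma$, and $+\infty$ otherwise. $\Gamma\text{-}\lim_{\nu\to0}F_\nu=F$ means: for every $P^\nu\to P$ as $\nu\to0$, $\liminf_{\nu\to0}F_\nu(P^\nu)\ge F(P)$; and for every $P$ there is $P^\nu\to P$ with $\limsup_{\nu\to0}F_\nu(P^\nu)\le F(P)$. *)

theory Defs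
  imports "HOL-Probability.Probability"
begin

section \<open>The flat torus\<close>

definition int_lattice_rel :: "real ^ 'n \<Rightarrow> real ^ 'n \<Rightarrow> bool" where
  "int_lattice_rel x y \<longleftrightarrow> (\<forall>i. x $ i - y $ i \<in> \<int>)"

lemma equivp_int_lattice_rel: "equivp int_lattice_rel"
proof (rule equivpI)
  show "reflp int_lattice_rel"
    by (simp add: reflp_def int_lattice_rel_def)
  show "symp int_lattice_rel"
    unfolding symp_def int_lattice_rel_def by (metis Ints_minus minus_diff_eq)
  show "transp int_lattice_rel"
    unfolding transp_def int_lattice_rel_def by (metis Ints_add diff_add_cancel add_diff_eq)
qed

text \<open>The dimension of the torus is \<open>CARD('n)\<close>; \<open>proj\<close> is the canonical
  projection from Euclidean space onto the quotient by the integer lattice.\<close>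

quotient_type 'n torus = "real ^ 'n::finite" / int_lattice_rel
  morphisms rep_torus proj
  by (rule equivp_int_lattice_rel)

lemma proj_eq_iff: "proj x = proj y \<longleftrightarrow> (\<forall>i. x $ i - y $ i \<in> \<int>)"
  by (simp add: torus.abs_eq_iff int_lattice_rel_def)

lemma proj_surj: "\<exists>x. p = proj x"
  by (metis Quotient_abs_rep Quotient_torus)

instantiation torus :: (finite) ab_group_add
begin

lift_definition zero_torus :: "'a torus" is 0 .

lift_definition plus_torus :: "'a torus \<Rightarrow> 'a torus \<Rightarrow> 'a torus" is "(+)"
  unfolding int_lattice_rel_def by (simp add: add_diff_add)

lift_definition uminus_torus :: "'a torus \<Rightarrow> 'a torus" is uminus
  unfolding int_lattice_rel_def
  by (metis (no_types, opaque_lifting) Ints_minus minus_diff_minus vector_uminus_component)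

lift_definition minus_torus :: "'a torus \<Rightarrow> 'a torus \<Rightarrow> 'a torus" is "(-)"
proof -
  fix x x' y y' :: "real ^ 'a"
  assume "int_lattice_rel x x'" "int_lattice_rel y y'"
  then have "(x $ i - x' $ i) - (y $ i - y' $ i) \<in> \<int>" for i
    unfolding int_lattice_rel_def by (blast intro: Ints_diff)
  then show "int_lattice_rel (x - y) (x' - y')"
    unfolding int_lattice_rel_def by (simp add: algebra_simps)
qed

instance
  by standard (transfer; simp add: int_lattice_rel_def algebra_simps)+

end

lemma proj_add: "proj (x + y) = proj x + proj y"
  by (simp add: plus_torus.abs_eq)

lemma proj_diff: "proj (x - y) = proj x - proj y"
  by (simp add: minus_torus.abs_eq)

lemma closed_proj_fibre: "closed {y. proj y = (q :: 'n::finite torus)}"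
proof -
  obtain x where q: "q = proj x" using proj_surj by blast
  have "closed ((\<lambda>y :: real ^ 'n. y $ i - x $ i) -` \<int>)" for i
    by (intro closed_vimage closed_Ints continuous_intros)
  moreover have "{y. proj y = q} = (\<Inter>i. (\<lambda>y. y $ i - x $ i) -` \<int>)"
    by (auto simp: q proj_eq_iff)
  ultimately show ?thesis by (simp add: closed_INT)
qed

lemma setdist_proj_fibres:
  fixes q :: "'n::finite torus"
  shows "setdist {y. proj y = proj x} {z. proj z = q} = infdist x {z. proj z = q}"
proof -
  let ?S = "{y. proj y = proj x}" and ?T = "{z. proj z = q}"
  have ne: "?T \<noteq> {}" using proj_surj[of q] by auto
  have "infdist y ?T \<ge> infdist x ?T" if y: "proj y = proj x" for y
  proof -
    have "infdist x ?T \<le> dist y z" if z: "proj z = q" for z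
    proof -
      have "proj (z + (x - y)) = q" by (simp add: proj_add proj_diff y z)
      then have "infdist x ?T \<le> dist x (z + (x - y))" by (intro infdist_le) simp
      also have "\<dots> = dist y z" by (simp add: dist_norm algebra_simps)
      finally show ?thesis .
    qed
    then show ?thesis
      unfolding infdist_notempty[OF ne, of y] using ne by (intro cINF_greatest) auto
  qed
  then have "setdist ?S ?T \<ge> infdist x ?T"
    using ne by (intro le_setdistI) (auto intro: order_trans[OF _ infdist_le])
  moreover have "setdist ?S ?T \<le> setdist {x} ?T"
    by (rule setdist_subset_left) auto
  ultimately show ?thesis by (simp add: infdist_eq_setdist)
qed

instantiation torus :: (finite) metric_space
begin

definition dist_torus :: "'a torus \<Rightarrow> 'a torus \<Rightarrow> real" where
  "dist_torus p q = setdist {x. proj x = p} {y. proj y = q}"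

definition uniformity_torus :: "('a torus \<times> 'a torus) filter" where
  "uniformity_torus = (INF e\<in>{0 <..}. principal {(x, y). dist x y < e})"

definition open_torus :: "'a torus set \<Rightarrow> bool" where
  "open_torus U = (\<forall>x\<in>U. \<forall>\<^sub>F (x', y) in uniformity. x' = x \<longrightarrow> y \<in> U)"

instance
proof
  fix p q r :: "'a torus"
  obtain x where p: "p = proj x" using proj_surj by blast
  obtain y where q: "q = proj y" using proj_surj by blast
  have ne: "{z. proj z = s} \<noteq> {}" for s :: "'a torus"
    using proj_surj[of s] by auto
  show "dist p q = 0 \<longleftrightarrow> p = q"
  proof -
    have "dist p q = infdist x {z. proj z = q}"
      by (simp add: dist_torus_def p setdist_proj_fibres)
    then have "dist p q = 0 \<longleftrightarrow> x \<in> {z. proj z = q}"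
      using in_closed_iff_infdist_zero[OF closed_proj_fibre ne] by metis
    then show ?thesis by (simp add: p)
  qed
  show "dist p q \<le> dist p r + dist q r"
  proof -
    have "infdist x {z. proj z = q} \<le> infdist x {z. proj z = r} + infdist y {z. proj z = r}"
    proof (rule field_le_epsilon)
      fix e :: real assume e: "e > 0"
      have "\<exists>z\<in>{z. proj z = r}. dist u z < infdist u {z. proj z = r} + e / 2" for u
      proof (rule ccontr)
        assume "\<not> ?thesis"
        then have "infdist u {z. proj z = r} + e / 2 \<le> infdist u {z. proj z = r}"
          by (subst (2) infdist_notempty[OF ne], intro cINF_greatest ne) (auto simp: not_less)
        then show False using e by simp
      qed
      then obtain z w where z: "proj z = r" "dist x z < infdist x {z. proj z = r} + e / 2"
        and w: "proj w = r" "dist y w < infdist y {z. proj z = r} + e / 2" by (metis mem_Collect_eq)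
      have "proj (y + (z - w)) = q" by (simp add: proj_add proj_diff z w q)
      then have "infdist x {z. proj z = q} \<le> dist x (y + (z - w))" by (intro infdist_le) simp
      also have "\<dots> \<le> dist x z + dist z (y + (z - w))" by (rule dist_triangle)
      also have "dist z (y + (z - w)) = dist y w" by (simp add: dist_norm norm_minus_commute)
      finally show "infdist x {z. proj z = q}
          \<le> infdist x {z. proj z = r} + infdist y {z. proj z = r} + e"
        using z w by simp
    qed
    then show ?thesis by (simp add: dist_torus_def p q setdist_proj_fibres)
  qed
qed (simp_all add: uniformity_torus_def open_torus_def)

end

lemma dist_proj_le: "dist (proj x) (proj y) \<le> dist x y"
  unfolding dist_torus_def by (rule setdist_le_dist) auto

lemma continuous_on_proj [continuous_intros]: "continuous_on S proj"
  unfolding continuous_on_iff using dist_proj_le le_less_trans by blast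

lemma borel_measurable_proj [measurable]: "proj \<in> borel_measurable borel"
  by (intro borel_measurable_continuous_onI continuous_on_proj)

instance torus :: (finite) second_countable_topology
proof
  obtain D :: "(real ^ 'a) set" where D: "countable D"
    "\<And>X. open X \<Longrightarrow> X \<noteq> {} \<Longrightarrow> \<exists>d\<in>D. d \<in> X"
    using countable_dense_exists[where 'a = "real ^ 'a"] by blast
  let ?B = "(\<lambda>(d, n). ball (proj d) (1 / Suc n)) ` (D \<times> (UNIV :: nat set))"
  have "topological_basis ?B"
  proof (rule topological_basisI)
    fix U :: "'a torus set" and p assume U: "open U" "p \<in> U"
    then obtain e where e: "e > 0" "ball p e \<subseteq> U" by (meson openE)
    obtain n where n: "1 / Suc n < e / 2" using e nat_approx_posE[of "e / 2"] by auto
    obtain x where x: "p = proj x" using proj_surj by blast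
    obtain d where d: "d \<in> D" "d \<in> ball x (1 / Suc n)" using D(2)[of "ball x (1 / Suc n)"] by auto
    have pd: "dist p (proj d) < 1 / Suc n"
      using d dist_proj_le[of x d] by (simp add: x del: of_nat_Suc)
    have "ball (proj d) (1 / Suc n) \<subseteq> ball p e"
    proof
      fix q assume "q \<in> ball (proj d) (1 / Suc n)"
      then show "q \<in> ball p e"
        using dist_triangle[of p q "proj d"] pd n by (simp del: of_nat_Suc)
    qed
    then show "\<exists>V\<in>?B. p \<in> V \<and> V \<subseteq> U"
      using d(1) e(2) pd by (intro bexI[of _ "ball (proj d) (1 / Suc n)"])
        (auto simp: dist_commute simp del: of_nat_Suc)
  qed auto
  then show "\<exists>B :: 'a torus set set. countable B \<and> open = generate_topology B"
    using D(1) by (intro exI[of _ ?B] conjI)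
      (auto simp: topological_basis_imp_subbasis intro!: ext)
qed

text \<open>The image of Lebesgue measure on the unit cube.\<close>

definition leb_torus :: "'n::finite torus measure" where
  "leb_torus = distr (uniform_measure lborel (cbox 0 1 :: (real ^ 'n) set)) borel proj"


section \<open>Continuous paths with the uniform topology\<close>

text \<open>Paths are functions on the reals that are \<open>undefined\<close> outside the unit
  interval, so that equality of paths is equality on \<open>{0..1}\<close>.\<close>

typedef (overloaded) 'a cpath =
  "{\<omega> :: real \<Rightarrow> 'a::metric_space. continuous_on {0..1} \<omega> \<and> \<omega> \<in> extensional {0..1}}"
  morphisms path_at Abs_cpath
proof -
  have "continuous_on {0..1::real} (restrict (\<lambda>_. undefined :: 'a) {0..1})"
    by (simp add: continuous_on_cong[of _ _ _ "\<lambda>_. undefined"])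
  then show ?thesis by (intro exI[of _ "restrict (\<lambda>_. undefined) {0..1}"]) auto
qed

lemma continuous_on_path_at: "continuous_on {0..1} (path_at \<omega>)"
  using path_at[of \<omega>] by simp

lemma cpath_eqI: "(\<And>t. t \<in> {0..1} \<Longrightarrow> path_at \<omega> t = path_at \<eta> t) \<Longrightarrow> \<omega> = \<eta>"
  using path_at[of \<omega>] path_at[of \<eta>]
  by (metis (mono_tags, lifting) extensionalityI mem_Collect_eq path_at_inject)

lemma bdd_above_dist_paths: "bdd_above ((\<lambda>t. dist (path_at \<omega> t) (path_at \<eta> t)) ` {0..1})"
  by (intro bounded_imp_bdd_above compact_imp_bounded compact_continuous_image
      continuous_on_dist continuous_on_path_at compact_Icc)

instantiation cpath :: (metric_space) metric_space
begin

definition dist_cpath :: "'a cpath \<Rightarrow> 'a cpath \<Rightarrow> real" where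
  "dist_cpath \<omega> \<eta> = (SUP t\<in>{0..1}. dist (path_at \<omega> t) (path_at \<eta> t))"

definition uniformity_cpath :: "('a cpath \<times> 'a cpath) filter" where
  "uniformity_cpath = (INF e\<in>{0 <..}. principal {(x, y). dist x y < e})"

definition open_cpath :: "'a cpath set \<Rightarrow> bool" where
  "open_cpath U = (\<forall>x\<in>U. \<forall>\<^sub>F (x', y) in uniformity. x' = x \<longrightarrow> y \<in> U)"

instance
proof
  fix \<omega> \<eta> \<zeta> :: "'a cpath"
  have le: "dist (path_at \<omega> t) (path_at \<eta> t) \<le> dist \<omega> \<eta>" if "t \<in> {0..1}" for t and \<omega> \<eta> :: "'a cpath"
    unfolding dist_cpath_def by (rule cSUP_upper[OF that bdd_above_dist_paths])
  show "dist \<omega> \<eta> = 0 \<longleftrightarrow> \<omega> = \<eta>"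
  proof
    assume "dist \<omega> \<eta> = 0"
    then show "\<omega> = \<eta>" using le[of _ \<omega> \<eta>] by (intro cpath_eqI) simp
  qed (simp add: dist_cpath_def)
  show "dist \<omega> \<eta> \<le> dist \<omega> \<zeta> + dist \<eta> \<zeta>"
    unfolding dist_cpath_def[of \<omega> \<eta>]
  proof (rule cSUP_least)
    fix t :: real assume t: "t \<in> {0..1}"
    show "dist (path_at \<omega> t) (path_at \<eta> t) \<le> dist \<omega> \<zeta> + dist \<eta> \<zeta>"
      using le[OF t, of \<omega> \<zeta>] le[OF t, of \<eta> \<zeta>]
        dist_triangle2[of "path_at \<omega> t" "path_at \<eta> t" "path_at \<zeta> t"] by linarith
  qed simp
qed (simp_all add: uniformity_cpath_def open_cpath_def)

end

lemma dist_path_at_le: "t \<in> {0..1} \<Longrightarrow> dist (path_at \<omega> t) (path_at \<eta> t) \<le> dist \<omega> \<eta>"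
  unfolding dist_cpath_def by (rule cSUP_upper[OF _ bdd_above_dist_paths])

lemma continuous_on_eval: "t \<in> {0..1} \<Longrightarrow> continuous_on S (\<lambda>\<omega>. path_at \<omega> t)"
  unfolding continuous_on_iff using dist_path_at_le le_less_trans by blast

lemma borel_measurable_eval: "t \<in> {0..1} \<Longrightarrow> (\<lambda>\<omega>. path_at \<omega> t) \<in> borel_measurable borel"
  by (intro borel_measurable_continuous_onI continuous_on_eval)


section \<open>Narrow convergence and Gamma-convergence\<close>

text \<open>\<open>space (prob_algebra borel)\<close> is the set of Borel probability measures.\<close>

definition narrow_topology :: "'a::topological_space measure topology" where
  "narrow_topology = topology_generated_by
     {{P \<in> space (prob_algebra borel). (\<integral>x. f x \<partial>P) \<in> U} | (f :: 'a \<Rightarrow> real) U.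
        f \<in> bcontfun \<and> open U}"

lemma topspace_narrow_topology [simp]: "topspace narrow_topology = space (prob_algebra borel)"
proof -
  have "(\<lambda>_. 0 :: real) \<in> bcontfun" by (rule const_bcontfun)
  then have "space (prob_algebra (borel :: 'a measure)) \<in>
      {{P \<in> space (prob_algebra borel). (\<integral>x. f x \<partial>P) \<in> U} | (f :: 'a \<Rightarrow> real) U.
        f \<in> bcontfun \<and> open U}"
    by (intro CollectI exI[of _ "\<lambda>_. 0"] exI[of _ UNIV]) auto
  then show ?thesis unfolding narrow_topology_def topology_generated_by_topspace by blast
qed

lemma limitin_narrow_topology:
  fixes P :: "'b \<Rightarrow> 'a::topological_space measure"
  assumes P: "\<And>i. P i \<in> space (prob_algebra borel)" and Q: "Q \<in> space (prob_algebra borel)"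
  shows "limitin narrow_topology P Q F \<longleftrightarrow>
    (\<forall>f :: 'a \<Rightarrow> real. f \<in> bcontfun \<longrightarrow> ((\<lambda>i. \<integral>x. f x \<partial>P i) \<longlongrightarrow> (\<integral>x. f x \<partial>Q)) F)"
    (is "?L \<longleftrightarrow> ?R")
proof
  assume L: ?L
  show ?R
  proof (intro allI impI topological_tendstoI)
    fix f :: "'a \<Rightarrow> real" and U assume "f \<in> bcontfun" "open U" "(\<integral>x. f x \<partial>Q) \<in> U"
    then have "openin narrow_topology {P \<in> space (prob_algebra borel). (\<integral>x. f x \<partial>P) \<in> U}"
      and "Q \<in> {P \<in> space (prob_algebra borel). (\<integral>x. f x \<partial>P) \<in> U}"
      unfolding narrow_topology_def using Q by (auto intro!: topology_generated_by_Basis)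
    with L have "\<forall>\<^sub>F i in F. P i \<in> {P \<in> space (prob_algebra borel). (\<integral>x. f x \<partial>P) \<in> U}"
      unfolding limitin_def by blast
    then show "\<forall>\<^sub>F i in F. (\<integral>x. f x \<partial>P i) \<in> U" by eventually_elim simp
  qed
next
  assume R: ?R
  have "\<forall>\<^sub>F i in F. P i \<in> W" if "openin narrow_topology W" "Q \<in> W" for W
  proof -
    from that(1) have "generate_topology_on {{P \<in> space (prob_algebra borel). (\<integral>x. f x \<partial>P) \<in> U} |
        (f :: 'a \<Rightarrow> real) U. f \<in> bcontfun \<and> open U} W"
      unfolding narrow_topology_def openin_topology_generated_by_iff .
    then show ?thesis using that(2)
    proof induction
      case (Int A B)
      then show ?case by (auto intro: eventually_conj)
    next
      case (UN K)
      then obtain k where "k \<in> K" "Q \<in> k" by blast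
      with UN(2) have "\<forall>\<^sub>F i in F. P i \<in> k" by blast
      then show ?case by eventually_elim (use \<open>k \<in> K\<close> in blast)
    next
      case (Basis S)
      then obtain f :: "'a \<Rightarrow> real" and U where "f \<in> bcontfun" "open U"
        "S = {P \<in> space (prob_algebra borel). (\<integral>x. f x \<partial>P) \<in> U}" by blast
      with R Basis(2) P show ?case by (auto dest!: topological_tendstoD)
    qed simp
  qed
  then show ?L unfolding limitin_def using Q by simp
qed

definition Gamma_lim :: "'b topology \<Rightarrow> (real \<Rightarrow> 'b \<Rightarrow> ereal) \<Rightarrow> ('b \<Rightarrow> ereal) \<Rightarrow> bool" where
  "Gamma_lim X F G \<longleftrightarrow>
    (\<forall>P p. (\<forall>\<nu>>0. P \<nu> \<in> topspace X) \<and> limitin X P p (at_right 0) \<longrightarrow>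
       G p \<le> Liminf (at_right 0) (\<lambda>\<nu>. F \<nu> (P \<nu>))) \<and>
    (\<forall>p\<in>topspace X. \<exists>P. (\<forall>\<nu>>0. P \<nu> \<in> topspace X) \<and> limitin X P p (at_right 0) \<and>
       Limsup (at_right 0) (\<lambda>\<nu>. F \<nu> (P \<nu>)) \<le> G p)"


section \<open>Relative entropy\<close>

text \<open>The library's \<open>KL_divergence\<close> is a real-valued Bochner integral, hence \<open>0\<close> when the
  log-density is not integrable, and it does not test absolute continuity. Here the integral of
  the log-density is the difference of the integrals of its positive and negative part; the
  latter is finite whenever \<open>r\<close> is finite and \<open>p\<close> is a probability measure
  absolutely continuous with respect to \<open>r\<close>.\<close>

definition rel_entropy :: "'a measure \<Rightarrow> 'a measure \<Rightarrow> ereal" where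
  "rel_entropy p r =
    (if absolutely_continuous r p
     then enn2ereal (\<integral>\<^sup>+ x. ennreal (ln (enn2real (RN_deriv r p x))) \<partial>p)
        - enn2ereal (\<integral>\<^sup>+ x. ennreal (- ln (enn2real (RN_deriv r p x))) \<partial>p)
     else \<infinity>)"


section \<open>Reversible Brownian motion on the torus\<close>

text \<open>The centred Gaussian law on Euclidean space with covariance \<open>v\<close> times the
  identity (for \<open>v > 0\<close>), projected to the torus. With \<open>v = \<nu> * t\<close> this is the heat kernel at
  time \<open>t\<close> of the generator \<open>\<nu>/2\<close> times the Laplacian, started at the origin.\<close>

definition wrapped_gaussian :: "real \<Rightarrow> 'n::finite torus measure" where
  "wrapped_gaussian v =
     distr (density lborel (\<lambda>x :: real ^ 'n. ennreal (\<Prod>i\<in>UNIV. normal_density 0 (sqrt v) (x $ i))))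
       borel proj"

text \<open>The law on path space of the Brownian motion with uniform initial law: the
  initial position and the increments over consecutive time intervals are independent, and the
  increments are projected Gaussians. These conditions determine the finite-dimensional
  distributions, hence the law.\<close>

definition is_reversible_brownian :: "real \<Rightarrow> 'n::finite torus cpath measure \<Rightarrow> bool" where
  "is_reversible_brownian \<nu> R \<longleftrightarrow>
     R \<in> space (prob_algebra borel) \<and>
     distr R borel (\<lambda>\<omega>. path_at \<omega> 0) = leb_torus \<and>
     (\<forall>s t. 0 \<le> s \<and> s < t \<and> t \<le> 1 \<longrightarrow>
        distr R borel (\<lambda>\<omega>. path_at \<omega> t - path_at \<omega> s) = wrapped_gaussian (\<nu> * (t - s))) \<and>
     (\<forall>(n::nat) \<tau>. \<tau> 0 = 0 \<and> (\<forall>k<n. \<tau> k < \<tau> (Suc k)) \<and> \<tau> n \<le> 1 \<longrightarrow>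
        prob_space.indep_vars R (\<lambda>_. borel)
          (\<lambda>k \<omega>. case k of 0 \<Rightarrow> path_at \<omega> 0 | Suc j \<Rightarrow> path_at \<omega> (\<tau> (Suc j)) - path_at \<omega> (\<tau> j))
          {..n})"


section \<open>Action\<close>

definition abs_continuous_path :: "(real \<Rightarrow> 'a::metric_space) \<Rightarrow> bool" where
  "abs_continuous_path \<omega> \<longleftrightarrow>
    (\<forall>\<epsilon>>0. \<exists>\<delta>>0. \<forall>(n::nat) a b.
       (\<forall>i<n. 0 \<le> a i \<and> a i < b i \<and> b i \<le> 1) \<and>
       disjoint_family_on (\<lambda>i. {a i<..<b i}) {..<n} \<and>
       (\<Sum>i<n. b i - a i) < \<delta> \<longrightarrow>
       (\<Sum>i<n. dist (\<omega> (a i)) (\<omega> (b i))) < \<epsilon>)"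

text \<open>The derivative of a torus-valued curve, as a vector of Euclidean space (the tangent
  space at every point of the torus).\<close>

definition has_velocity :: "(real \<Rightarrow> 'n::finite torus) \<Rightarrow> real ^ 'n \<Rightarrow> real \<Rightarrow> bool" where
  "has_velocity \<omega> v t \<longleftrightarrow>
    ((\<lambda>s. dist (\<omega> s) (\<omega> t + proj ((s - t) *\<^sub>R v)) / \<bar>s - t\<bar>) \<longlongrightarrow> 0) (at t within {0..1})"

text \<open>At times without a velocity, a null set for absolutely continuous curves, the value is
  irrelevant.\<close>

definition velocity :: "(real \<Rightarrow> 'n::finite torus) \<Rightarrow> real \<Rightarrow> real ^ 'n" where
  "velocity \<omega> t = (THE v. has_velocity \<omega> v t)"

definition action :: "'n::finite torus cpath \<Rightarrow> ennreal" where
  "action \<omega> =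
    (if abs_continuous_path (path_at \<omega>)
     then (1 / 2) * (\<integral>\<^sup>+ t\<in>{0..1}. ennreal ((norm (velocity (path_at \<omega>) t))\<^sup>2) \<partial>lborel)
     else \<infinity>)"


section \<open>Functionals on generalized flows\<close>

definition mean_action :: "'n::finite torus cpath measure \<Rightarrow> ereal" where
  "mean_action P = enn2ereal (\<integral>\<^sup>+ \<omega>. action \<omega> \<partial>P)"

definition iota_inc :: "'n::finite torus cpath measure \<Rightarrow> ereal" where
  "iota_inc P = (if \<forall>t\<in>{0..1}. distr P borel (\<lambda>\<omega>. path_at \<omega> t) = leb_torus then 0 else \<infinity>)"

definition iota_endpoints ::
    "('n::finite torus \<times> 'n torus) measure \<Rightarrow> 'n torus cpath measure \<Rightarrow> ereal" where
  "iota_endpoints \<gamma> P = (if distr P borel (\<lambda>\<omega>. (path_at \<omega> 0, path_at \<omega> 1)) = \<gamma> then 0 else \<infinity>)"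

definition bistochastic :: "('n::finite torus \<times> 'n torus) measure \<Rightarrow> bool" where
  "bistochastic \<gamma> \<longleftrightarrow>
     \<gamma> \<in> space (prob_algebra borel) \<and>
     distr \<gamma> borel fst = leb_torus \<and> distr \<gamma> borel snd = leb_torus"

end

theory Submission
  imports Defs
begin

text \<open>Lower bound: the Donsker--Varadhan inequality, applied to the discrete energy on a grid, which
 under Brownian motion has an explicit exponential moment, bounds \<open>\<nu> H(P | R\<^sup>\<nu>)\<close> from below by the
 mean discrete energy up to \<open>O(\<nu>)\<close>; refining the grid, the discrete energies increase to the action.

 Recovery sequence: add to every path of \<open>P\<close> an independent small noise \<open>B(\<nu>t) - B(0)\<close>, pinned at both
 ends in part 2. Translation invariance of the Lebesgue measure keeps the flow incompressible.
 On a grid, Jensen's inequality and a Cameron--Martin shift, whose linear term vanishes by symmetry of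
 the noise, bound the entropy by the discrete energy divided by \<open>\<nu>\<close> plus a constant; in part 2 the
 constant contains \<open>H(\<gamma> | Leb \<otimes> Leb)\<close>, because the heat kernel at time \<open>\<nu>\<close> is at
 least its Gaussian exponential once \<open>2\<pi>\<nu> \<le> 1\<close>.\<close>

section \<open>The logarithm on the torus\<close>

text \<open>The flow P is arbitrary, so no density of the perturbed flow is at hand; its entropy is
  bounded by duality, with bounded functions of finitely many dyadic times as tests. Any grid may
  occur, so every constant must be uniform in the number N of steps. The torus is the obstacle:
  increments lift to Euclidean space only up to the lattice. Noise conditioned to stay within 1/8 of
  the origin has additive shortest lifts, at the price ln 2; the lift of one short step of variance
  \<nu>/N has a law at most 1 + 8 (\<nu>/N) l times the Gaussian, l a lattice constant, and the
  N-fold product stays below exp (8 \<nu> l). Multiplied by \<nu>, these costs vanish. One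
  computation with a switch \<theta> in {0, 1} serves both parts: \<theta> = 1 removes the linear
  interpolation from noise and drift. Centring the drift lowers the cost of the shift by |A|^2 / (2
  \<nu>), A the total drift, and this Gaussian factor of A pays for the endpoint constraint. All
  noises come from the one process \<open>R 1\<close>, run up to time \<nu>, so their concentration
  at zero is mere continuity of paths.\<close>

definition zlat :: "(real ^ 'n) set" where
 "zlat = {k. \<forall>i. k $ i \<in> \<int>}"

lemma proj_eq_iff_zlat: "proj x = proj y \<longleftrightarrow> x - y \<in> zlat"
 by (simp add: proj_eq_iff zlat_def)

lemma zlat_add: "x \<in> zlat ==> y \<in> zlat ==> x + y \<in> zlat"
 and zlat_minus: "x \<in> zlat ==> - x \<in> zlat"
 and zlat_diff: "x \<in> zlat ==> y \<in> zlat ==> x - y \<in> zlat"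
 and zlat_0 [simp]: "0 \<in> zlat"
 by (simp_all add: zlat_def)

lemma proj_zlat: "k \<in> zlat ==> proj (x + k) = proj x"
 by (simp add: proj_eq_iff_zlat)

lemma proj_0 [simp]: "proj 0 = 0"
 by (simp add: zero_torus.abs_eq)

lemma proj_minus: "proj (- x) = - proj x"
 by (simp add: uminus_torus.abs_eq)

lemma countable_zlat: "countable (zlat :: (real ^ 'n::finite) set)"
proof -
 have "countable (range (\<lambda>f :: 'n => int. (\<chi> i. real_of_int (f i)) :: real ^ 'n))"
  by (intro countable_image) (rule countableI_type)
 moreover have "zlat \<subseteq> range (\<lambda>f :: 'n => int. (\<chi> i. real_of_int (f i)) :: real ^ 'n)"
 proof
  fix k :: "real ^ 'n" assume "k \<in> zlat"
  then have "k = (\<chi> i. real_of_int \<lfloor>k $ i\<rfloor>)" by (auto simp: zlat_def vec_eq_iff elim!: Ints_cases)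
  then show "k \<in> range (\<lambda>f :: 'n => int. (\<chi> i. real_of_int (f i)) :: real ^ 'n)"
   by (rule range_eqI[where x = "\<lambda>i. \<lfloor>k $ i\<rfloor>"])
 qed
 ultimately show ?thesis by (rule countable_subset[rotated])
qed

lemma zlat_norm_ge_1: "k \<in> zlat ==> k \<noteq> 0 ==> norm k \<ge> 1"
proof -
 assume k: "k \<in> zlat" "k \<noteq> 0"
 then obtain i where i: "k $ i \<noteq> 0" by (auto simp: vec_eq_iff)
 have "k $ i \<in> \<int>" using k by (simp add: zlat_def)
 then obtain m where m: "k $ i = of_int m" by (rule Ints_cases)
 then have "\<bar>k $ i\<bar> \<ge> 1" using i by auto
 then show ?thesis using component_le_norm_cart[of k i] by linarith
qed

text \<open>Subtracting the nearest integer in each coordinate makes the value independent of the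
  representative picked by \<open>rep_torus\<close>; ties go to -1/2, so the range is the half-open
  \<open>cell\<close>.\<close>

definition tlog :: "'n::finite torus => real ^ 'n" where
 "tlog q = (\<chi> i. rep_torus q $ i - of_int \<lfloor>rep_torus q $ i + 1 / 2\<rfloor>)"

definition cell :: "(real ^ 'n) set" where
 "cell = {x. \<forall>i. - 1 / 2 \<le> x $ i \<and> x $ i < 1 / 2}"

lemma proj_rep_torus: "proj (rep_torus q) = q"
 by (rule Quotient_abs_rep[OF Quotient_torus])

lemma proj_tlog [simp]: "proj (tlog q) = q"
proof -
 have "proj (tlog q) = proj (rep_torus q)"
  by (simp add: proj_eq_iff tlog_def)
 then show ?thesis by (simp add: proj_rep_torus)
qed

lemma tlog_cell: "tlog q \<in> cell"
 unfolding cell_def tlog_def by (auto simp: algebra_simps) linarith+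

lemma cell_unique: "x \<in> cell ==> y \<in> cell ==> x - y \<in> zlat ==> x = y"
proof -
 assume a: "x \<in> cell" "y \<in> cell" "x - y \<in> zlat"
 have "x $ i = y $ i" for i
 proof -
  obtain m where m: "x $ i - y $ i = of_int m" using a(3) by (auto simp: zlat_def elim: Ints_cases)
  have "- 1 / 2 \<le> x $ i \<and> x $ i < 1 / 2" "- 1 / 2 \<le> y $ i \<and> y $ i < 1 / 2"
   using a by (auto simp: cell_def)
  then have "\<bar>x $ i - y $ i\<bar> < 1" by linarith
  then have "m = 0" unfolding m by linarith
  then show ?thesis using m by simp
 qed
 then show "x = y" by (simp add: vec_eq_iff)
qed

lemma tlog_proj: "x \<in> cell ==> tlog (proj x) = x"
 by (rule cell_unique[OF tlog_cell]) (simp_all add: proj_eq_iff_zlat[symmetric])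

lemma tlog_proj_small: "norm x < 1 / 2 ==> tlog (proj x) = x"
proof (rule tlog_proj)
 assume n: "norm x < 1 / 2"
 show "x \<in> cell" unfolding cell_def
 proof (intro CollectI allI)
  fix i show "- 1 / 2 \<le> x $ i \<and> x $ i < 1 / 2"
   using component_le_norm_cart[of x i] n by (auto simp: abs_le_iff)
 qed
qed

text \<open>A coordinate that differs by a nonzero integer from a number in [-1/2, 1/2) has modulus
  at least 1/2, so the centred representative is shortest coordinate by coordinate.\<close>

lemma norm_tlog_le: "norm (tlog (proj x)) \<le> norm x"
proof (rule norm_le_componentwise_cart)
 fix i
 let ?t = "tlog (proj x)"
 have "proj ?t = proj x" by simp
 then have "?t $ i - x $ i \<in> \<int>" unfolding proj_eq_iff by blast
 then obtain m where m: "?t $ i - x $ i = of_int m" by (rule Ints_cases)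
 have t: "- 1 / 2 \<le> ?t $ i" "?t $ i < 1 / 2" using tlog_cell[of "proj x"] by (auto simp: cell_def)
 show "norm (?t $ i) \<le> norm (x $ i)"
 proof (cases "m = 0")
  case False
  then have "\<bar>real_of_int m\<bar> \<ge> 1" by linarith
  then show ?thesis using m t by (auto simp: abs_if split: if_splits)
 qed (use m in simp)
qed

text \<open>The shortest representative attains the distance of the two fibres; from here on the
  metric is the norm of a logarithm and set distances disappear.\<close>

lemma dist_torus_eq: "dist p q = norm (tlog (p - q))"
proof -
 have "norm (tlog (p - q)) \<le> dist p q"
  unfolding dist_torus_def
 proof (rule le_setdistI)
  show "{x. proj x = p} \<noteq> {}" "{x. proj x = q} \<noteq> {}" using proj_surj[of p] proj_surj[of q] by auto
  fix x y assume "x \<in> {x. proj x = p}" "y \<in> {x. proj x = q}"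
  then show "norm (tlog (p - q)) \<le> dist x y"
   using norm_tlog_le[of "x - y"] by (simp add: proj_diff dist_norm)
 qed
 moreover have "dist p q \<le> norm (tlog (p - q))"
 proof -
  have "dist p q = dist (proj (tlog q + tlog (p - q))) (proj (tlog q))" by (simp add: proj_add)
  also have "... \<le> norm (tlog (p - q))" by (rule order_trans[OF dist_proj_le]) (simp add: dist_norm)
  finally show ?thesis .
 qed
 ultimately show ?thesis by simp
qed

lemma dist_torus_diff: "dist (p + r) (q + r) = dist p (q :: 'n::finite torus)"
 by (simp add: dist_torus_eq)

lemma dist_torus_diff_left: "dist (r + p) (r + q) = dist p (q :: 'n::finite torus)"
 by (simp add: dist_torus_eq)

lemma dist_torus_0: "dist q 0 = norm (tlog q)"
 by (simp add: dist_torus_eq)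

lemma dist_torus_diff_0: "dist p q = dist (p - q) (0 :: 'n::finite torus)"
 by (simp add: dist_torus_eq)

lemma norm_tlog_bound: "norm (tlog (q :: 'n::finite torus)) \<le> real CARD('n)"
proof -
 have "norm (tlog q) \<le> (\<Sum>i\<in>UNIV. \<bar>tlog q $ i\<bar>)" by (rule norm_le_l1_cart)
 also have "... \<le> (\<Sum>i\<in>(UNIV::'n set). 1)"
 proof (rule sum_mono)
  fix i :: 'n
  have "- 1 / 2 \<le> tlog q $ i" "tlog q $ i < 1 / 2" using tlog_cell[of q] by (auto simp: cell_def)
  then show "\<bar>tlog q $ i\<bar> \<le> 1" by linarith
 qed
 finally show ?thesis by simp
qed

lemma dist_torus_le: "dist p q \<le> real CARD('n)" for p q :: "'n::finite torus"
 unfolding dist_torus_eq by (rule norm_tlog_bound)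

lemma tlog_minus: "norm (tlog q) < 1 / 2 ==> tlog (- q) = - tlog q"
 using tlog_proj_small[of "- tlog q"] by (simp add: proj_minus)

lemma norm_tlog_minus [simp]: "norm (tlog (- q)) = norm (tlog q)"
 using norm_tlog_le[of "- tlog q"] norm_tlog_le[of "- tlog (- q)"] by (simp add: proj_minus)

text \<open>\<open>tlog\<close> is additive only near the origin. Two logarithms below 1/4 have a
  difference below 1/2, where \<open>tlog\<close> inverts \<open>proj\<close>; this is the origin of
  the thresholds 1/4 and 1/8 below.\<close>

lemma tlog_small_diff:
 assumes "norm (tlog p) < 1 / 4" "norm (tlog q) < 1 / 4"
 shows "tlog (p - q) = tlog p - tlog q"
proof -
 have "norm (tlog p - tlog q) < 1 / 2" using norm_triangle_ineq4[of "tlog p" "tlog q"] assms by linarith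
 from tlog_proj_small[OF this] show ?thesis by (simp add: proj_diff)
qed

lemma uniformly_continuous_add_torus: "dist (a + b) (c + d) \<le> dist a c + dist b (d :: 'n::finite torus)"
proof -
 have "dist (a + b) (c + d) \<le> dist (a + b) (c + b) + dist (c + b) (c + d)" by (rule dist_triangle)
 then show ?thesis by (simp only: dist_torus_diff dist_torus_diff_left)
qed

lemma dist_torus_minus [simp]: "dist (- a) (- b) = dist a (b :: 'n::finite torus)"
proof -
 have "dist (- a) (- b) = norm (tlog (- (a - b)))" by (simp add: dist_torus_eq)
 then show ?thesis by (simp add: dist_torus_eq del: minus_diff_eq)
qed

lemma continuous_on_add_torus [continuous_intros]:
 fixes f g :: "_ => 'n::finite torus"
 assumes "continuous_on S f" "continuous_on S g"
 shows "continuous_on S (\<lambda>x. f x + g x)"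
proof -
 have "((\<lambda>x. f x + g x) \<longlongrightarrow> f a + g a) (at a within S)" if a: "a \<in> S" for a
 proof -
  have "((\<lambda>x. dist (f x) (f a) + dist (g x) (g a)) \<longlongrightarrow> 0 + 0) (at a within S)"
   using assms a unfolding continuous_on_def by (intro tendsto_add) (metis tendsto_dist_iff)+
  then have lim: "((\<lambda>x. dist (f x) (f a) + dist (g x) (g a)) \<longlongrightarrow> 0) (at a within S)" by simp
  have "((\<lambda>x. dist (f x + g x) (f a + g a)) \<longlongrightarrow> 0) (at a within S)"
  proof (rule tendsto_sandwich[OF _ _ tendsto_const lim])
   show "\<forall>\<^sub>F x in at a within S. 0 \<le> dist (f x + g x) (f a + g a)" by simp
   show "\<forall>\<^sub>F x in at a within S. dist (f x + g x) (f a + g a) \<le> dist (f x) (f a) + dist (g x) (g a)"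
    by (rule always_eventually) (simp add: uniformly_continuous_add_torus)
  qed
  then show ?thesis by (subst tendsto_dist_iff)
 qed
 then show ?thesis by (simp add: continuous_on_def)
qed

lemma continuous_on_minus_torus [continuous_intros]:
 fixes f :: "_ => 'n::finite torus"
 shows "continuous_on S f ==> continuous_on S (\<lambda>x. - f x)"
proof (rule continuous_on_compose2[of UNIV uminus])
 show "continuous_on UNIV (uminus :: 'n torus => 'n torus)"
  unfolding continuous_on_iff by (auto simp: dist_torus_minus)
qed simp_all

lemma continuous_on_diff_torus [continuous_intros]:
 fixes f g :: "_ => 'n::finite torus"
 assumes "continuous_on S f" "continuous_on S g"
 shows "continuous_on S (\<lambda>x. f x - g x)"
 using continuous_on_add_torus[OF assms(1) continuous_on_minus_torus[OF assms(2)]] by simp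

lemma borel_measurable_add_torus [measurable (raw)]:
 fixes f g :: "_ => 'n::finite torus"
 assumes "f \<in> borel_measurable M" "g \<in> borel_measurable M"
 shows "(\<lambda>x. f x + g x) \<in> borel_measurable M"
 by (rule borel_measurable_continuous_Pair[OF assms]) (intro continuous_on_add_torus continuous_on_fst continuous_on_snd continuous_on_id)

lemma borel_measurable_diff_torus [measurable (raw)]:
 fixes f g :: "_ => 'n::finite torus"
 assumes "f \<in> borel_measurable M" "g \<in> borel_measurable M"
 shows "(\<lambda>x. f x - g x) \<in> borel_measurable M"
 by (rule borel_measurable_continuous_Pair[OF assms]) (intro continuous_on_diff_torus continuous_on_fst continuous_on_snd continuous_on_id)

text \<open>\<open>tlog\<close> jumps on the boundary of the cell, so continuity is of no use: a
  nontrivial sublevel set of a coordinate is a countable union of images of compact boxes.\<close>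

lemma borel_measurable_tlog [measurable]: "(tlog :: 'n::finite torus => _) \<in> borel_measurable borel"
proof -
 have "(\<lambda>q :: 'n torus. tlog q $ i) \<in> borel_measurable borel" for i
 proof (rule borel_measurableI_less)
  fix c :: real
  show "{q \<in> space borel. tlog q $ i < c} \<in> sets (borel :: 'n torus measure)"
  proof (cases "c \<ge> 1 / 2")
   case True
   then have "{q \<in> space borel. tlog q $ i < c} = (UNIV :: 'n torus set)"
   proof -
    have "tlog q $ i < c" for q :: "'n torus"
     using tlog_cell[of q] True unfolding cell_def by (auto dest: spec[of _ i])
    then show ?thesis by auto
   qed
   then show ?thesis by simp
  next
   case False
   \<comment> \<open>The closed box has faces x_j = 1/2 that \<open>tlog\<close> folds over to -1/2.
     Only coordinate i is tested, and there the box ends below c, hence below 1/2.\<close>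
   define K where "K m = (cbox (\<chi> j. - 1 / 2) (\<chi> j. if j = i then c - 1 / Suc m else 1 / 2) :: (real ^ 'n) set)" for m :: nat
   have "closed (proj ` K m)" for m
    unfolding K_def by (intro compact_imp_closed compact_continuous_image continuous_on_proj compact_cbox)
   then have "(\<Union>m. proj ` K m) \<in> sets borel" by auto
   moreover have "{q \<in> space borel. tlog q $ i < c} = (\<Union>m. proj ` K m)"
   proof safe
    fix q :: "'n torus" assume q: "tlog q $ i < c"
    then obtain m where m: "1 / Suc m < c - tlog q $ i" using nat_approx_posE[of "c - tlog q $ i"] by auto
    have "tlog q \<in> K m" using tlog_cell[of q] m unfolding K_def
     by (auto simp: mem_box_cart cell_def less_imp_le)
    then show "q \<in> (\<Union>m. proj ` K m)" by (metis UNIV_I UN_iff imageI proj_tlog)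
   next
    fix m and x :: "real ^ 'n" assume x: "x \<in> K m"
    have xi: "- 1 / 2 \<le> x $ j \<and> x $ j \<le> (if j = i then c - 1 / Suc m else 1 / 2)" for j
     using x unfolding K_def mem_box_cart by simp
    have "1 / real (Suc m) > 0" by simp
    then have xc: "x $ i < c" using xi[of i] unfolding if_P[OF refl] by linarith
    define t where "t = tlog (proj x)"
    have "proj t = proj x" by (simp add: t_def)
    then have "t $ i - x $ i \<in> \<int>" unfolding proj_eq_iff by blast
    then obtain k where k: "t $ i - x $ i = of_int k" by (rule Ints_cases)
    have t: "- 1 / 2 \<le> t $ i" "t $ i < 1 / 2" using tlog_cell[of "proj x"] by (auto simp: cell_def t_def)
    have "\<bar>t $ i - x $ i\<bar> < 1" using t xi[of i] xc False by (auto simp: abs_less_iff)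
    then have "k = 0" unfolding k by linarith
    then show "tlog (proj x) $ i < c" using k xc by (simp add: t_def)
   qed simp_all
   ultimately show ?thesis by simp
  qed
 qed
 then have "(\<lambda>q :: 'n torus. tlog q \<bullet> b) \<in> borel_measurable borel" if b: "b \<in> Basis" for b
 proof -
  obtain i where "b = axis i 1" using b unfolding Basis_vec_def by auto
  then show ?thesis using \<open>\<And>i. (\<lambda>q :: 'n torus. tlog q $ i) \<in> borel_measurable borel\<close>[of i] by (simp add: inner_axis)
 qed
 then show ?thesis using borel_measurable_euclidean_space[of tlog borel] by blast
qed

section \<open>Differentiability of functions of bounded variation\<close>

text \<open>Intervals are coded as sets so that increments can be summed over the members of a
  division.\<close>

definition incr :: "(real => 'a::real_normed_vector) => real set => 'a" where
 "incr f K = f (Sup K) - f (Inf K)"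

lemma incr_Icc [simp]: "u \<le> v ==> incr f {u..v} = f v - f u"
 by (simp add: incr_def)

lemma incr_singleton [simp]: "incr f {u} = 0"
 by (simp add: incr_def)

lemma sum_incr_division:
 fixes f :: "real => 'a::real_normed_vector"
 assumes "a \<le> b" "d division_of {a..b}"
 shows "(\<Sum>K\<in>d. incr f K) = f b - f a"
proof -
 let ?p = "(\<lambda>K. (Inf K, K)) ` d"
 have K: "\<exists>u v. K = {u..v} \<and> u \<le> v" if "K \<in> d" for K
  using division_ofD(3,4)[OF assms(2) that] by (metis atLeastatMost_empty_iff interval_cbox)
 have "?p tagged_division_of {a..b}"
 proof (rule tagged_division_ofI)
  show "finite ?p" using division_ofD(1)[OF assms(2)] by simp
  fix x k assume "(x, k) \<in> ?p"
  then have k: "k \<in> d" "x = Inf k" by auto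
  then show "x \<in> k" using K[OF k(1)] by auto
  show "k \<subseteq> {a..b}" using division_ofD(2)[OF assms(2) k(1)] .
  show "\<exists>u v. k = cbox u v" using division_ofD(4)[OF assms(2) k(1)] .
 next
  fix x1 k1 x2 k2 assume "(x1, k1) \<in> ?p" "(x2, k2) \<in> ?p" "(x1, k1) \<noteq> (x2, k2)"
  then show "interior k1 \<inter> interior k2 = {}"
   using division_ofD(5)[OF assms(2)] by blast
 next
  show "\<Union> {k. \<exists>x. (x, k) \<in> ?p} = {a..b}" using division_ofD(6)[OF assms(2)] by blast
 qed
 from additive_tagged_division_1[OF assms(1) this, of f] show ?thesis
  by (subst (asm) sum.reindex) (auto simp: inj_on_def incr_def)
qed

text \<open>If \<open>V\<close> is the total variation, a division with variation close to \<open>V\<close> can be refined, inside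
 each cell, by intervals on which the increment has the sign opposite to that of the cell;
 each of them raises the variation by twice its increment.\<close>

lemma negligible_two_slopes:
 fixes f :: "real => real"
 assumes bv: "\<And>d. d division_of {a..b} ==> (\<Sum>K\<in>d. \<bar>incr f K\<bar>) \<le> B"
  and ab: "a < b" and c: "c > 0" and S: "S \<subseteq> {a<..<b}"
  and up: "\<And>x \<delta>. x \<in> S ==> \<delta> > 0 ==> \<exists>u v. u < v \<and> x \<in> {u..v} \<and> v - u < \<delta> \<and> f v - f u \<ge> c * (v - u)"
  and dn: "\<And>x \<delta>. x \<in> S ==> \<delta> > 0 ==> \<exists>u v. u < v \<and> x \<in> {u..v} \<and> v - u < \<delta> \<and> f v - f u \<le> - c * (v - u)"
 shows "negligible S"
proof (rule ccontr)
 assume "\<not> negligible S"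
 then obtain e where e: "e > 0" "\<And>T. S \<subseteq> T ==> T \<in> lmeasurable ==> measure lebesgue T > e"
  unfolding negligible_outer_le by (auto simp: not_le)
 define VV where "VV = (\<lambda>d. \<Sum>K\<in>d. \<bar>incr f K\<bar>) ` {d. d division_of {a..b}}"
 have VV_ne: "VV \<noteq> {}"
 proof -
  have "{{a..b}} division_of {a..b}" using division_of_self[of a b] ab by simp
  then show ?thesis unfolding VV_def by blast
 qed
 have VV_bdd: "bdd_above VV" unfolding VV_def using bv by (intro bdd_aboveI) auto
 \<comment> \<open>The refinement below gains 2 c times a total length above e / 2, hence more than
   c * e; a start within c * e of the supremum makes this a contradiction.\<close>
 have "\<exists>y\<in>VV. Sup VV - c * e < y"
  using less_cSup_iff[OF VV_ne VV_bdd, of "Sup VV - c * e"] c e(1) by simp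
 then obtain d0 where d0: "d0 division_of {a..b}" "Sup VV - c * e < (\<Sum>K\<in>d0. \<bar>incr f K\<bar>)"
  unfolding VV_def by auto
 note fin0 = division_ofD(1)[OF d0(1)]
 have d0K: "\<exists>u v. K = {u..v} \<and> u \<le> v" if "K \<in> d0" for K
  using division_ofD(3,4)[OF d0(1) that] by (metis atLeastatMost_empty_iff interval_cbox)
 \<comment> \<open>The endpoints of cells are discarded, so that every remaining point has room for
   short intervals inside its cell.\<close>
 define D where "D = (\<Union>K\<in>d0. {Inf K, Sup K})"
 have finD: "finite D" unfolding D_def using fin0 by auto
 define sg where "sg K p \<longleftrightarrow> (if incr f K \<ge> 0 then f (snd p) - f (fst p) \<le> - c * (snd p - fst p)
  else f (snd p) - f (fst p) \<ge> c * (snd p - fst p))" for K and p :: "real \<times> real"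
 define Q where "Q = {p. fst p < snd p \<and> (\<exists>K\<in>d0. {fst p..snd p} \<subseteq> interior K \<and> sg K p)}"
 have cb: "cball ((fst p + snd p) / 2) ((snd p - fst p) / 2) = {fst p..snd p}" for p :: "real \<times> real"
  by (auto simp: cball_def dist_real_def abs_le_iff field_simps)
 have ex: "\<exists>p. p \<in> Q \<and> x \<in> cball ((fst p + snd p) / 2) ((snd p - fst p) / 2) \<and> (snd p - fst p) / 2 < \<delta>"
  if x: "x \<in> S - D" and dl: "0 < \<delta>" for x \<delta>
 proof -
  have "x \<in> \<Union>d0" using x S division_ofD(6)[OF d0(1)] by auto
  then obtain K where K: "K \<in> d0" "x \<in> K" by blast
  obtain u v where uv: "K = {u..v}" "u \<le> v" using d0K[OF K(1)] by blast
  have "u \<in> D" "v \<in> D" using K(1) uv unfolding D_def by force+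
  then have xi: "u < x" "x < v" using x K(2) uv by (auto simp: less_le)
  define \<delta>' where "\<delta>' = min \<delta> (min (x - u) (v - x))"
  have d': "\<delta>' > 0" using dl xi by (simp add: \<delta>'_def)
  obtain p where p: "fst p < snd p" "x \<in> {fst p..snd p}" "snd p - fst p < \<delta>'" "sg K p"
  proof (cases "incr f K \<ge> 0")
   case True
   with dn[of x, OF _ d'] x that show ?thesis unfolding sg_def by (metis DiffD1 fst_conv snd_conv)
  next
   case False
   with up[of x, OF _ d'] x that show ?thesis unfolding sg_def by (metis DiffD1 fst_conv snd_conv)
  qed
  have "{fst p..snd p} \<subseteq> interior K"
   using p uv(1) by (auto simp: \<delta>'_def interior_atLeastAtMost_real)
  then have "p \<in> Q" unfolding Q_def using p(1,4) K(1) by blast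
  then show ?thesis using p(1,2,3) cb dl by (intro exI[of _ p]) (auto simp: \<delta>'_def)
 qed
 obtain C where C: "countable C" "C \<subseteq> Q"
  "pairwise (\<lambda>i j. disjnt (cball ((fst i + snd i) / 2) ((snd i - fst i) / 2)) (cball ((fst j + snd j) / 2) ((snd j - fst j) / 2))) C"
  "negligible ((S - D) - (\<Union>i\<in>C. cball ((fst i + snd i) / 2) ((snd i - fst i) / 2)))"
  using Vitali_covering_theorem_cballs[of Q "\<lambda>p. (snd p - fst p) / 2" "S - D" "\<lambda>p. (fst p + snd p) / 2", OF _ ex]
  by (auto simp: Q_def)
 note C3 = C(3)[unfolded cb] and C4 = C(4)[unfolded cb]
 \<comment> \<open>The disjoint intervals cover S up to a null set, and every measurable set around
   S has measure above e; if all finite subfamilies had length at most e / 2, so would the whole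
   family.\<close>
 have "\<exists>C'. C' \<subseteq> C \<and> finite C' \<and> (\<Sum>p\<in>C'. snd p - fst p) > e / 2"
 proof (rule ccontr)
  assume no: "\<not> ?thesis"
  have bnd: "measure lebesgue (\<Union>p\<in>C'. {fst p..snd p}) \<le> e / 2" if "C' \<subseteq> C" "finite C'" for C'
  proof -
   have "measure lebesgue (\<Union>p\<in>C'. {fst p..snd p}) \<le> (\<Sum>p\<in>C'. measure lebesgue {fst p..snd p})"
    by (intro measure_UNION_le that) auto
   also have "... = (\<Sum>p\<in>C'. snd p - fst p)"
    using that C(2) by (intro sum.cong) (auto simp: Q_def)
   also have "... \<le> e / 2" using no that by (auto simp: not_less)
   finally show ?thesis .
  qed
  let ?U = "\<Union>p\<in>C. {fst p..snd p}"
  have U: "?U \<in> lmeasurable" "measure lebesgue ?U \<le> e / 2"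
   by (rule fmeasurable_UN_bound[OF C(1) _ bnd]; simp)
    (rule measure_UN_bound[OF C(1) _ bnd]; simp)
  let ?T = "?U \<union> (((S - D) - ?U) \<union> D)"
  have neg: "negligible (((S - D) - ?U) \<union> D)"
   using C4 finD by (simp add: negligible_finite)
  have "?T \<in> lmeasurable" using U(1) neg negligible_iff_measure by blast
  moreover have "measure lebesgue ?T \<le> e / 2"
   using U neg by (simp add: measure_Un_null_set negligible_iff_null_sets fmeasurableD)
  ultimately show False using e(2)[of ?T] e(1) by force
 qed
 then obtain C' where C': "C' \<subseteq> C" "finite C'" "(\<Sum>p\<in>C'. snd p - fst p) > e / 2" by blast
 define IK where "IK K = {p\<in>C'. {fst p..snd p} \<subseteq> interior K}" for K
 let ?I = "\<lambda>p. {fst p..snd p}"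
 have C'Q: "fst p < snd p" if "p \<in> C'" for p using that C' C(2) by (auto simp: Q_def)
 have finIK: "finite (IK K)" for K unfolding IK_def using C'(2) by simp
 have injI: "inj_on ?I C'"
 proof (rule inj_onI)
  fix p q assume pq: "p \<in> C'" "q \<in> C'" "?I p = ?I q"
  then show "p = q" using C'Q[OF pq(1)] C'Q[OF pq(2)] by (auto simp: prod_eq_iff)
 qed
 have disjI: "?I p \<inter> ?I q = {}" if "p \<in> C'" "q \<in> C'" "p \<noteq> q" for p q
  using C3 C'(1) that by (meson disjnt_def pairwiseD subsetD)
 have sgK: "sg K p" if "p \<in> IK K" "K \<in> d0" for p K
 proof -
  have p: "p \<in> Q" "?I p \<subseteq> interior K" "p \<in> C'" using that C' C(2) by (auto simp: IK_def)
  then obtain K' where K': "K' \<in> d0" "?I p \<subseteq> interior K'" "sg K' p" unfolding Q_def by blast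
  have "K = K'"
  proof (rule ccontr)
   assume "K \<noteq> K'"
   then have "interior K \<inter> interior K' = {}" by (rule division_ofD(5)[OF d0(1) that(2) K'(1)])
   moreover have "fst p \<in> ?I p" using C'Q[OF p(3)] by simp
   ultimately show False using p(2) K'(2) by blast
  qed
  with K' show ?thesis by simp
 qed
 have "\<exists>q. q division_of K \<and> (\<Sum>L\<in>q. \<bar>incr f L\<bar>) \<ge> \<bar>incr f K\<bar> + 2 * c * (\<Sum>p\<in>IK K. snd p - fst p)"
  if K: "K \<in> d0" for K
 proof -
  obtain u v where uv: "K = {u..v}" "u \<le> v" using d0K[OF K] by blast
  have "(?I ` IK K) division_of \<Union>(?I ` IK K)"
  proof (rule division_ofI)
   show "finite (?I ` IK K)" using finIK by simp
   show "\<And>L. L \<in> ?I ` IK K ==> L \<noteq> {}" using C'Q unfolding IK_def by (auto simp: less_imp_le)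
   show "\<exists>a b. L = cbox a b" if "L \<in> ?I ` IK K" for L
    using that unfolding image_iff by (metis box_real(2))
   fix L1 L2 assume L: "L1 \<in> ?I ` IK K" "L2 \<in> ?I ` IK K" "L1 \<noteq> L2"
   obtain p1 where p1: "L1 = ?I p1" "p1 \<in> IK K" using L(1) by (rule imageE)
   obtain p2 where p2: "L2 = ?I p2" "p2 \<in> IK K" using L(2) by (rule imageE)
   have "p1 \<in> C'" "p2 \<in> C'" "p1 \<noteq> p2" using p1 p2 L(3) by (simp_all add: IK_def) blast
   then have "L1 \<inter> L2 = {}" using disjI[of p1 p2] p1(1) p2(1) by simp
   then show "interior L1 \<inter> interior L2 = {}" using interior_subset by blast
  qed auto
  moreover have "{K} division_of K" unfolding uv(1) using uv(2) division_of_self[of u v] by simp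
  moreover have "\<Union>(?I ` IK K) \<subseteq> K" unfolding IK_def using interior_subset by force
  ultimately obtain q where q: "?I ` IK K \<subseteq> q" "q division_of K"
   by (rule partial_division_extend)
  have fq: "finite q" using q(2) by blast
  have tot: "(\<Sum>L\<in>q. incr f L) = incr f K"
   using sum_incr_division[OF uv(2), of q f] q(2) uv by simp
  have IKs: "(\<Sum>L\<in>?I ` IK K. g L) = (\<Sum>p\<in>IK K. g (?I p))" for g :: "real set => real"
   using inj_on_subset[OF injI, of "IK K"] by (subst sum.reindex) (auto simp: IK_def)
  have inc: "incr f (?I p) = f (snd p) - f (fst p)" if "p \<in> IK K" for p
   using that C'Q[of p] by (simp add: IK_def)
  let ?s = "\<Sum>p\<in>IK K. incr f (?I p)"
  let ?l = "\<Sum>p\<in>IK K. snd p - fst p"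
  have sgn: "if incr f K \<ge> 0 then ?s \<le> - c * ?l else ?s \<ge> c * ?l"
  proof (cases "incr f K \<ge> 0")
   case True
   then have "\<And>p. p \<in> IK K ==> incr f (?I p) \<le> - c * (snd p - fst p)"
    using sgK[OF _ K] inc unfolding sg_def by presburger
   then have "?s \<le> (\<Sum>p\<in>IK K. - c * (snd p - fst p))" by (rule sum_mono)
   then show ?thesis using True by (simp add: sum_distrib_left sum_negf)
  next
   case False
   then have "\<And>p. p \<in> IK K ==> incr f (?I p) \<ge> c * (snd p - fst p)"
    using sgK[OF _ K] inc unfolding sg_def by presburger
   then have "?s \<ge> (\<Sum>p\<in>IK K. c * (snd p - fst p))" by (rule sum_mono)
   then show ?thesis using False by (simp add: sum_distrib_left)
  qed
  have l0: "?l \<ge> 0" using C'Q by (intro sum_nonneg) (force simp: IK_def less_imp_le)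
  have sp: "(\<Sum>L\<in>q. g L) = (\<Sum>p\<in>IK K. g (?I p)) + (\<Sum>L\<in>q - ?I ` IK K. g L)" for g :: "real set => real"
   using sum.subset_diff[OF q(1) fq, of g] IKs[of g] by simp
  \<comment> \<open>With s the sum over the chosen intervals, these contribute at least |s| and the
    other pieces at least |incr f K - s|; as s is opposite in sign to \<open>incr f K\<close>, the
    total exceeds |incr f K| by 2 |s|.\<close>
  have "(\<Sum>L\<in>q. \<bar>incr f L\<bar>) \<ge> \<bar>?s\<bar> + \<bar>incr f K - ?s\<bar>"
  proof -
   have "\<bar>?s\<bar> \<le> (\<Sum>p\<in>IK K. \<bar>incr f (?I p)\<bar>)" by (rule sum_abs)
   moreover have "\<bar>incr f K - ?s\<bar> \<le> (\<Sum>L\<in>q - ?I ` IK K. \<bar>incr f L\<bar>)"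
    using sp[of "incr f"] tot sum_abs[of "incr f" "q - ?I ` IK K"] by linarith
   ultimately show ?thesis using sp[of "\<lambda>L. \<bar>incr f L\<bar>"] by linarith
  qed
  moreover have "\<bar>?s\<bar> + \<bar>incr f K - ?s\<bar> \<ge> \<bar>incr f K\<bar> + 2 * c * ?l"
  proof (cases "incr f K \<ge> 0")
   case True
   then have "?s \<le> - (c * ?l)" using sgn by simp
   moreover have "c * ?l \<ge> 0" using c l0 by simp
   ultimately show ?thesis using True by (simp add: mult.assoc abs_if)
  next
   case False
   then have "?s \<ge> c * ?l" using sgn by simp
   moreover have "c * ?l \<ge> 0" using c l0 by simp
   ultimately show ?thesis using False by (simp add: mult.assoc abs_if)
  qed
  ultimately show ?thesis using q(2) by (intro exI[of _ q]) linarith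
 qed
 then obtain q where q: "\<And>K. K \<in> d0 ==> q K division_of K"
  "\<And>K. K \<in> d0 ==> (\<Sum>L\<in>q K. \<bar>incr f L\<bar>) \<ge> \<bar>incr f K\<bar> + 2 * c * (\<Sum>p\<in>IK K. snd p - fst p)"
  by metis
 let ?r = "\<Union>(q ` d0)"
 have ov: "interior L1 \<inter> interior L2 = {}"
  if "K1 \<in> d0" "K2 \<in> d0" "L1 \<in> q K1" "L2 \<in> q K2" "K1 \<noteq> K2" for K1 K2 L1 L2
  using division_ofD(5)[OF d0(1) that(1,2,5)] division_ofD(2)[OF q(1)[OF that(1)] that(3)]
   division_ofD(2)[OF q(1)[OF that(2)] that(4)] interior_mono by blast
 have "?r division_of \<Union>?r"
 proof (rule division_of_Union)
  show "finite (q ` d0)" using fin0 by simp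
  show "p division_of \<Union>p" if "p \<in> q ` d0" for p
   using that q(1) by (metis division_ofD(6) imageE)
  show "interior k1 \<inter> interior k2 = {}" if k: "k1 \<in> ?r" "k2 \<in> ?r" "k1 \<noteq> k2" for k1 k2
  proof -
   obtain K1 K2 where "K1 \<in> d0" "K2 \<in> d0" "k1 \<in> q K1" "k2 \<in> q K2" using k by blast
   then show ?thesis using ov[of K1 K2 k1 k2] division_ofD(5)[OF q(1)] k(3) by (cases "K1 = K2") blast+
  qed
 qed
 moreover have "\<Union>?r = {a..b}"
 proof -
  have "\<Union>?r = (\<Union>K\<in>d0. \<Union>(q K))" by blast
  also have "... = (\<Union>K\<in>d0. K)" using division_ofD(6)[OF q(1)] by simp
  finally show ?thesis using division_ofD(6)[OF d0(1)] by simp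
 qed
 ultimately have rd: "?r division_of {a..b}" by simp
 have "(\<Sum>L\<in>?r. \<bar>incr f L\<bar>) = (\<Sum>K\<in>d0. \<Sum>L\<in>q K. \<bar>incr f L\<bar>)"
 proof -
  have "(\<Sum>K\<in>d0. \<Sum>L\<in>q K. \<bar>incr f L\<bar>) = (\<Sum>x\<in>Sigma d0 q. \<bar>incr f (snd x)\<bar>)"
   using fin0 division_ofD(1)[OF q(1)] by (subst sum.Sigma) (auto simp: case_prod_beta)
  \<comment> \<open>A set that occurs in the divisions of two cells is a single point, with
    increment 0, so counting it once or twice is the same.\<close>
  also have "... = (\<Sum>L\<in>snd ` Sigma d0 q. \<bar>incr f L\<bar>)"
  proof (subst sum.reindex_nontrivial)
   show "finite (Sigma d0 q)" using fin0 division_ofD(1)[OF q(1)] by auto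
   fix x y assume xy: "x \<in> Sigma d0 q" "y \<in> Sigma d0 q" "x \<noteq> y" "snd x = snd y"
   obtain K1 K2 L where *: "x = (K1, L)" "y = (K2, L)" "K1 \<noteq> K2" using xy by (metis prod.collapse)
   then have "K1 \<in> d0" "K2 \<in> d0" "L \<in> q K1" "L \<in> q K2" using xy by auto
   with ov *(3) have i: "interior L = {}" by blast
   obtain s t where L: "L = cbox s t" using division_ofD(4)[OF q(1)] \<open>K1 \<in> d0\<close> \<open>L \<in> q K1\<close> by meson
   have "L \<noteq> {}" by (rule division_ofD(3)[OF q(1)[OF \<open>K1 \<in> d0\<close>] \<open>L \<in> q K1\<close>])
   then have st: "L = {s..t}" "s \<le> t" unfolding L by simp_all
   have "s = t"
   proof (rule ccontr)
    assume "s \<noteq> t"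
    then have "(s + t) / 2 \<in> interior L" using st by (simp add: interior_atLeastAtMost_real)
    then show False using i by simp
   qed
   then have "L = {s..s}" using st by simp
   then have "incr f L = 0" by simp
   then show "\<bar>incr f (snd x)\<bar> = 0" using * by simp
  qed simp
  also have "snd ` Sigma d0 q = ?r" by force
  finally show ?thesis by simp
 qed
 also have "... \<ge> (\<Sum>K\<in>d0. \<bar>incr f K\<bar> + 2 * c * (\<Sum>p\<in>IK K. snd p - fst p))"
  using q(2) by (intro sum_mono) auto
 also have "(\<Sum>K\<in>d0. \<bar>incr f K\<bar> + 2 * c * (\<Sum>p\<in>IK K. snd p - fst p))
  = (\<Sum>K\<in>d0. \<bar>incr f K\<bar>) + 2 * c * (\<Sum>K\<in>d0. \<Sum>p\<in>IK K. snd p - fst p)"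
  by (simp add: sum.distrib sum_distrib_left)
 finally have r1: "(\<Sum>K\<in>d0. \<bar>incr f K\<bar>) + 2 * c * (\<Sum>K\<in>d0. \<Sum>p\<in>IK K. snd p - fst p) \<le> (\<Sum>L\<in>?r. \<bar>incr f L\<bar>)" .
 have r2: "(\<Sum>K\<in>d0. \<Sum>p\<in>IK K. snd p - fst p) \<ge> (\<Sum>p\<in>C'. snd p - fst p)"
 proof -
  have "C' \<subseteq> (\<Union>K\<in>d0. IK K)" using C' C(2) unfolding Q_def IK_def by blast
  then have "(\<Sum>p\<in>C'. snd p - fst p) \<le> (\<Sum>p\<in>(\<Union>K\<in>d0. IK K). snd p - fst p)"
   using fin0 finIK C'Q by (intro sum_mono2) (auto simp: IK_def less_imp_le)
  also have "... \<le> (\<Sum>K\<in>d0. \<Sum>p\<in>IK K. snd p - fst p)"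
   using fin0
  proof (induction d0 rule: finite_induct)
   case (insert K F)
   have "(\<Sum>p\<in>(\<Union>L\<in>insert K F. IK L). snd p - fst p)
     \<le> (\<Sum>p\<in>IK K. snd p - fst p) + (\<Sum>p\<in>(\<Union>L\<in>F. IK L). snd p - fst p)"
    using insert(1) finIK C'Q by (simp add: sum_Un) (intro sum_nonneg, auto simp: IK_def less_imp_le)
   then show ?case using insert by simp
  qed simp
  finally show ?thesis .
 qed
 have "2 * c * (\<Sum>p\<in>C'. snd p - fst p) \<le> 2 * c * (\<Sum>K\<in>d0. \<Sum>p\<in>IK K. snd p - fst p)"
  using r2 c by simp
 with r1 have "(\<Sum>L\<in>?r. \<bar>incr f L\<bar>) \<ge> (\<Sum>K\<in>d0. \<bar>incr f K\<bar>) + 2 * c * (\<Sum>p\<in>C'. snd p - fst p)"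
  by linarith
 moreover have "2 * c * (\<Sum>p\<in>C'. snd p - fst p) > c * e" using C'(3) c by (simp add: field_simps)
 moreover have "(\<Sum>L\<in>?r. \<bar>incr f L\<bar>) \<le> Sup VV"
  using rd VV_bdd unfolding VV_def by (intro cSup_upper) auto
 ultimately show False using d0(2) by linarith
qed

text \<open>Disjoint intervals whose slopes are at least c in modulus have total length at most B /
  c, by the bound on the variation, and c may be chosen as large as desired.\<close>

lemma negligible_infinite_slope:
 fixes f :: "real => real"
 assumes bv: "\<And>d. d division_of {a..b} ==> (\<Sum>K\<in>d. \<bar>incr f K\<bar>) \<le> B"
  and ab: "a < b" and S: "S \<subseteq> {a<..<b}"
  and big: "\<And>x \<delta> c. x \<in> S ==> \<delta> > 0 ==> \<exists>u v. u < v \<and> x \<in> {u..v} \<and> v - u < \<delta> \<and> \<bar>f v - f u\<bar> \<ge> c * (v - u)"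
 shows "negligible S"
 unfolding negligible_outer_le
proof (intro allI impI)
 fix e :: real assume e: "e > 0"
 have B0: "B \<ge> 0"
 proof -
  have "{{a..b}} division_of {a..b}" using division_of_self[of a b] ab by simp
  from bv[OF this] show ?thesis by (simp add: order_trans[OF abs_ge_zero])
 qed
 \<comment> \<open>Makes B / c at most e; the added 1 keeps c positive when B = 0.\<close>
 define c where "c = (B + 1) / e"
 have c: "c > 0" using B0 e by (simp add: c_def)
 define Q where "Q = {p. fst p < snd p \<and> {fst p..snd p} \<subseteq> {a..b} \<and> \<bar>f (snd p) - f (fst p)\<bar> \<ge> c * (snd p - fst p)}"
 have cb: "cball ((fst p + snd p) / 2) ((snd p - fst p) / 2) = {fst p..snd p}" for p :: "real \<times> real"
  by (auto simp: cball_def dist_real_def abs_le_iff field_simps)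
 have ex: "\<exists>p. p \<in> Q \<and> x \<in> cball ((fst p + snd p) / 2) ((snd p - fst p) / 2) \<and> (snd p - fst p) / 2 < \<delta>"
  if x: "x \<in> S" and dl: "0 < \<delta>" for x \<delta>
 proof -
  have xi: "a < x" "x < b" using x S by auto
  then have "min \<delta> (min (x - a) (b - x)) > 0" using dl by simp
  from big[OF x this, of c] obtain u v where "u < v" "x \<in> {u..v}" "v - u < min \<delta> (min (x - a) (b - x))"
   "\<bar>f v - f u\<bar> \<ge> c * (v - u)" by blast
  then show ?thesis using dl unfolding cb Q_def by (intro exI[of _ "(u, v)"]) auto
 qed
 obtain C where C: "countable C" "C \<subseteq> Q"
  "pairwise (\<lambda>i j. disjnt (cball ((fst i + snd i) / 2) ((snd i - fst i) / 2)) (cball ((fst j + snd j) / 2) ((snd j - fst j) / 2))) C"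
  "negligible (S - (\<Union>i\<in>C. cball ((fst i + snd i) / 2) ((snd i - fst i) / 2)))"
  using Vitali_covering_theorem_cballs[of Q "\<lambda>p. (snd p - fst p) / 2" S "\<lambda>p. (fst p + snd p) / 2", OF _ ex]
  by (auto simp: Q_def)
 note C3 = C(3)[unfolded cb] and C4 = C(4)[unfolded cb]
 let ?I = "\<lambda>p. {fst p..snd p} :: real set"
 have bnd: "measure lebesgue (\<Union>p\<in>C'. {fst p..snd p}) \<le> e" if C': "C' \<subseteq> C" "finite C'" for C'
 proof -
  have C'Q: "fst p < snd p" "?I p \<subseteq> {a..b}" "\<bar>f (snd p) - f (fst p)\<bar> \<ge> c * (snd p - fst p)" if "p \<in> C'" for p
   using that C' C(2) by (auto simp: Q_def)
  have injI: "inj_on ?I C'"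
  proof (rule inj_onI)
   fix p q assume pq: "p \<in> C'" "q \<in> C'" "?I p = ?I q"
   then show "p = q" using C'Q(1)[OF pq(1)] C'Q(1)[OF pq(2)] by (auto simp: prod_eq_iff)
  qed
  have disjI: "?I p \<inter> ?I q = {}" if "p \<in> C'" "q \<in> C'" "p \<noteq> q" for p q
   using C3 C'(1) that by (meson disjnt_def pairwiseD subsetD)
  have "(?I ` C') division_of \<Union>(?I ` C')"
  proof (rule division_ofI)
   show "finite (?I ` C')" using C' by simp
   show "L \<noteq> {}" if "L \<in> ?I ` C'" for L using that C'Q(1) by (fastforce intro: less_imp_le)
   show "\<exists>a b. L = cbox a b" if "L \<in> ?I ` C'" for L
    using that unfolding image_iff by (metis box_real(2))
   fix L1 L2 assume L: "L1 \<in> ?I ` C'" "L2 \<in> ?I ` C'" "L1 \<noteq> L2"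
   obtain p1 where p1: "L1 = ?I p1" "p1 \<in> C'" using L(1) by (rule imageE)
   obtain p2 where p2: "L2 = ?I p2" "p2 \<in> C'" using L(2) by (rule imageE)
   have "p1 \<noteq> p2" using p1 p2 L(3) by blast
   then have "L1 \<inter> L2 = {}" using disjI[of p1 p2] p1 p2 by simp
   then show "interior L1 \<inter> interior L2 = {}" using interior_subset by blast
  qed auto
  moreover have "{{a..b}} division_of {a..b}" using division_of_self[of a b] ab by simp
  moreover have "\<Union>(?I ` C') \<subseteq> {a..b}" using C'Q(2) by blast
  ultimately obtain q where q: "?I ` C' \<subseteq> q" "q division_of {a..b}"
   by (rule partial_division_extend)
  have "c * (\<Sum>p\<in>C'. snd p - fst p) \<le> (\<Sum>p\<in>C'. \<bar>incr f (?I p)\<bar>)"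
   unfolding sum_distrib_left using C'Q(1,3) by (intro sum_mono) (auto simp: less_imp_le)
  also have "... = (\<Sum>L\<in>?I ` C'. \<bar>incr f L\<bar>)"
   using injI by (subst sum.reindex) auto
  also have "... \<le> (\<Sum>L\<in>q. \<bar>incr f L\<bar>)" using q by (intro sum_mono2) auto
  also have "... \<le> B" by (rule bv[OF q(2)])
  finally have *: "c * (\<Sum>p\<in>C'. snd p - fst p) \<le> B" .
  have "measure lebesgue (\<Union>p\<in>C'. {fst p..snd p}) \<le> (\<Sum>p\<in>C'. measure lebesgue {fst p..snd p})"
   by (intro measure_UNION_le C') auto
  also have "... = (\<Sum>p\<in>C'. snd p - fst p)"
   using C'Q(1) by (intro sum.cong) (auto simp: less_imp_le)
  also have "... \<le> B / c" using * c by (simp add: pos_le_divide_eq mult.commute)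
  also have "... \<le> e" using B0 e by (simp add: c_def field_simps)
  finally show ?thesis .
 qed
 let ?U = "\<Union>p\<in>C. {fst p..snd p}"
 have U: "?U \<in> lmeasurable" "measure lebesgue ?U \<le> e"
  by (rule fmeasurable_UN_bound[OF C(1) _ bnd], auto)
   (rule measure_UN_bound[OF C(1) _ bnd], auto)
 let ?T = "?U \<union> (S - ?U)"
 have "?T \<in> lmeasurable" using U(1) C4 negligible_iff_measure by blast
 moreover have "measure lebesgue ?T \<le> e"
  using U C4 by (simp only: measure_Un_null_set negligible_iff_null_sets fmeasurableD)
 ultimately show "\<exists>T. S \<subseteq> T \<and> T \<in> lmeasurable \<and> measure lebesgue T \<le> e" by (intro exI[of _ ?T]) auto
qed

text \<open>Differentiability is read off the slopes over short intervals containing x. If it fails,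
  either these slopes are unbounded, or two rationals r < s separate arbitrarily short intervals of
  small slope from arbitrarily short ones of large slope; both kinds of points form null
  sets.\<close>

lemma bv_imp_differentiable_ae:
 fixes f :: "real => real"
 assumes bv: "\<And>d. d division_of {a..b} ==> (\<Sum>K\<in>d. \<bar>incr f K\<bar>) \<le> B" and ab: "a < b"
 obtains Z where "negligible Z" "\<And>x. x \<in> {a<..<b} - Z ==> f differentiable (at x)"
proof -
 let ?P = "\<lambda>x \<delta> p. fst p < snd p \<and> x \<in> {fst p..snd p} \<and> snd p - fst p < (\<delta>::real)"
 let ?sl = "\<lambda>p. (f (snd p) - f (fst p)) / (snd p - fst p)"
 define Z0 where "Z0 = {x\<in>{a<..<b}. \<forall>c. \<forall>\<delta>>0. \<exists>p. ?P x \<delta> p \<and> \<bar>?sl p\<bar> \<ge> c}"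
 define Z1 where "Z1 r s = {x\<in>{a<..<b}. (\<forall>\<delta>>0. \<exists>p. ?P x \<delta> p \<and> ?sl p \<le> r) \<and> (\<forall>\<delta>>0. \<exists>p. ?P x \<delta> p \<and> ?sl p \<ge> s)}" for r s
 have "negligible Z0"
 proof (rule negligible_infinite_slope[OF bv ab])
  show "Z0 \<subseteq> {a<..<b}" by (auto simp: Z0_def)
  fix x \<delta> c :: real assume "x \<in> Z0" "\<delta> > 0"
  then obtain p where p: "?P x \<delta> p" "\<bar>?sl p\<bar> \<ge> c" unfolding Z0_def by blast
  then have "\<bar>f (snd p) - f (fst p)\<bar> \<ge> c * (snd p - fst p)"
   by (simp add: abs_divide pos_le_divide_eq)
  with p(1) show "\<exists>u v. u < v \<and> x \<in> {u..v} \<and> v - u < \<delta> \<and> \<bar>f v - f u\<bar> \<ge> c * (v - u)" by blast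
 qed simp
 moreover have n1: "negligible (Z1 r s)" if rs: "r < s" for r s
 proof -
  \<comment> \<open>Subtracting the line of slope m, half way between r and s, turns slopes at most
    r and at least s into slopes at most -c and at least c with c = (s - r) / 2.\<close>
  define m where "m = (r + s) / 2"
  define g where "g x = f x - m * x" for x
  have "negligible (Z1 r s)"
  proof (rule negligible_two_slopes[where f = g and c = "(s - r) / 2", OF _ ab])
   show "0 < (s - r) / 2" using rs by simp
   show "Z1 r s \<subseteq> {a<..<b}" by (auto simp: Z1_def)
   fix d assume d: "d division_of {a..b}"
   have "\<bar>incr g K\<bar> \<le> \<bar>incr f K\<bar> + \<bar>m\<bar> * incr (\<lambda>x. x) K" if "K \<in> d" for K
   proof -
    have "\<exists>u v. K = {u..v} \<and> u \<le> v"
     using division_ofD(3,4)[OF d that] by (metis atLeastatMost_empty_iff interval_cbox)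
    then obtain u v where uv: "K = {u..v}" "u \<le> v" by blast
    have "incr g K = incr f K - m * incr (\<lambda>x. x) K" using uv by (simp add: g_def algebra_simps)
    also have "\<bar>...\<bar> \<le> \<bar>incr f K\<bar> + \<bar>m * incr (\<lambda>x. x) K\<bar>" by (rule abs_triangle_ineq4)
    also have "\<bar>m * incr (\<lambda>x. x) K\<bar> = \<bar>m\<bar> * incr (\<lambda>x. x) K" using uv by (simp add: abs_mult)
    finally show ?thesis .
   qed
   then have "(\<Sum>K\<in>d. \<bar>incr g K\<bar>) \<le> (\<Sum>K\<in>d. \<bar>incr f K\<bar>) + \<bar>m\<bar> * (\<Sum>K\<in>d. incr (\<lambda>x. x) K)"
    unfolding sum_distrib_left sum.distrib[symmetric] by (rule sum_mono)
   also have "... \<le> B + \<bar>m\<bar> * (b - a)"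
    using bv[OF d] sum_incr_division[OF _ d, of "\<lambda>x. x"] ab by simp
   finally show "(\<Sum>K\<in>d. \<bar>incr g K\<bar>) \<le> B + \<bar>m\<bar> * (b - a)" .
  next
   fix x \<delta> :: real assume x: "x \<in> Z1 r s" "\<delta> > 0"
   obtain p where p: "?P x \<delta> p" "?sl p \<ge> s" using x unfolding Z1_def by blast
   then have "f (snd p) - f (fst p) \<ge> s * (snd p - fst p)" by (simp add: pos_le_divide_eq)
   then have "g (snd p) - g (fst p) \<ge> (s - r) / 2 * (snd p - fst p)"
    by (simp add: g_def m_def field_simps)
   with p(1) show "\<exists>u v. u < v \<and> x \<in> {u..v} \<and> v - u < \<delta> \<and> g v - g u \<ge> (s - r) / 2 * (v - u)" by blast
   obtain p where p: "?P x \<delta> p" "?sl p \<le> r" using x unfolding Z1_def by blast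
   then have "f (snd p) - f (fst p) \<le> r * (snd p - fst p)" by (simp add: pos_divide_le_eq)
   then have "g (snd p) - g (fst p) \<le> - ((s - r) / 2) * (snd p - fst p)"
    by (simp add: g_def m_def field_simps)
   with p(1) show "\<exists>u v. u < v \<and> x \<in> {u..v} \<and> v - u < \<delta> \<and> g v - g u \<le> - ((s - r) / 2) * (v - u)" by blast
  qed
  then show ?thesis .
 qed
 define Z where "Z = Z0 \<union> (\<Union>(r, s)\<in>{(r, s). r \<in> \<rat> \<and> s \<in> \<rat> \<and> r < s}. Z1 r s)"
 have "countable {(r, s). r \<in> \<rat> \<and> s \<in> \<rat> \<and> r < (s::real)}"
  by (rule countable_subset[of _ "\<rat> \<times> \<rat>"]) (auto intro: countable_rat)
 then have "negligible (\<Union>(r, s)\<in>{(r, s). r \<in> \<rat> \<and> s \<in> \<rat> \<and> r < s}. Z1 r s)"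
  using n1 by (intro negligible_countable_Union countable_image) auto
 then have "negligible Z" unfolding Z_def using \<open>negligible Z0\<close> by simp
 moreover have "f differentiable (at x)" if x: "x \<in> {a<..<b} - Z" for x
 proof -
  define q where "q y = (f y - f x) / (y - x)" for y
  have sl: "\<exists>p. ?P x \<delta> p \<and> ?sl p = q y" if "y \<noteq> x" "\<bar>y - x\<bar> < \<delta>" for y \<delta>
  proof (cases "x < y")
   case True
   then show ?thesis using that by (intro exI[of _ "(x, y)"]) (auto simp: q_def)
  next
   case False
   then show ?thesis using that
    by (intro exI[of _ "(y, x)"]) (auto simp: q_def minus_divide_divide[symmetric, of "f x - f y"])
  qed
  obtain c \<delta> where c: "\<delta> > 0" "\<And>p. ?P x \<delta> p ==> \<bar>?sl p\<bar> < c"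
  proof -
   have "x \<notin> Z0" using x by (simp add: Z_def)
   then have "\<exists>c \<delta>. \<delta> > 0 \<and> (\<forall>p. ?P x \<delta> p \<longrightarrow> \<bar>?sl p\<bar> < c)"
    using x unfolding Z0_def mem_Collect_eq by (meson DiffD1 not_le)
   then show ?thesis using that by blast
  qed
  have qb: "\<bar>q y\<bar> < c" if "y \<noteq> x" "\<bar>y - x\<bar> < \<delta>" for y
   using sl[OF that] c(2) by metis
  define L where "L = Limsup (at x) (\<lambda>y. ereal (q y))"
  define l where "l = Liminf (at x) (\<lambda>y. ereal (q y))"
  have nb: "at x \<noteq> (bot :: real filter)" by simp
  have ev: "eventually (\<lambda>y. y \<noteq> x \<and> \<bar>y - x\<bar> < \<delta>') (at x)" if "\<delta>' > 0" for \<delta>'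
   unfolding eventually_at using that by (auto simp: dist_real_def)
  have Lc: "L \<le> ereal c" unfolding L_def
   proof (rule Limsup_bounded, rule eventually_mono[OF ev[OF c(1)]])
   fix y assume "y \<noteq> x \<and> \<bar>y - x\<bar> < \<delta>"
   with qb[of y] show "ereal (q y) \<le> ereal c" by simp
  qed
  have lc: "ereal (- c) \<le> l" unfolding l_def
   proof (rule Liminf_bounded, rule eventually_mono[OF ev[OF c(1)]])
   fix y assume "y \<noteq> x \<and> \<bar>y - x\<bar> < \<delta>"
   with qb[of y] show "ereal (- c) \<le> ereal (q y)" by simp
  qed
  have lL: "l \<le> L" unfolding l_def L_def by (rule Liminf_le_Limsup[OF nb])
  have "L \<le> l"
  proof (rule ccontr)
   assume "\<not> L \<le> l"
   then have "l < L" by simp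
   obtain l' L' where lL': "l = ereal l'" "L = ereal L'"
    using lc Lc lL by (cases l; cases L) auto
   obtain r where r: "r \<in> \<rat>" "l' < r" "r < L'" using \<open>l < L\<close> lL' Rats_dense_in_real[of l' L'] by auto
   obtain s where s: "s \<in> \<rat>" "r < s" "s < L'" using r(3) Rats_dense_in_real[of r L'] by auto
   have "x \<in> Z1 r s"
   proof -
    have "\<exists>p. ?P x \<delta>' p \<and> ?sl p \<le> r" if d: "\<delta>' > 0" for \<delta>'
    proof (rule ccontr)
     assume no: "\<not> ?thesis"
     have "ereal r \<le> l" unfolding l_def
      proof (rule Liminf_bounded, rule eventually_mono[OF ev[OF d]])
      fix y assume "y \<noteq> x \<and> \<bar>y - x\<bar> < \<delta>'"
      then obtain p where "?P x \<delta>' p" "?sl p = q y" using sl by blast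
      with no have "\<not> q y \<le> r" by metis
      then show "ereal r \<le> ereal (q y)" by simp
     qed
     with r lL' show False by simp
    qed
    moreover have "\<exists>p. ?P x \<delta>' p \<and> ?sl p \<ge> s" if d: "\<delta>' > 0" for \<delta>'
    proof (rule ccontr)
     assume no: "\<not> ?thesis"
     have "L \<le> ereal s" unfolding L_def
      proof (rule Limsup_bounded, rule eventually_mono[OF ev[OF d]])
      fix y assume "y \<noteq> x \<and> \<bar>y - x\<bar> < \<delta>'"
      then obtain p where "?P x \<delta>' p" "?sl p = q y" using sl by blast
      with no have "\<not> q y \<ge> s" by metis
      then show "ereal (q y) \<le> ereal s" by simp
     qed
     with s lL' show False by simp
    qed
    ultimately show ?thesis using x unfolding Z1_def by blast
   qed
   then show False using x r s unfolding Z_def by blast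
  qed
  with lL have "l = L" by simp
  obtain D where D: "L = ereal D" using lc Lc lL by (cases L) auto
  have "((\<lambda>y. ereal (q y)) \<longlongrightarrow> ereal D) (at x)"
   using \<open>l = L\<close> D unfolding l_def L_def by (intro Liminf_eq_Limsup) simp_all
  then have "(q \<longlongrightarrow> D) (at x)" by simp
  then have "(f has_field_derivative D) (at x)"
   unfolding has_field_derivative_iff q_def .
  then show ?thesis using real_differentiable_def by blast
 qed
 ultimately show ?thesis using that by blast
qed

section \<open>Absolute continuity and the fundamental theorem of calculus\<close>

lemma sum_content_le_open:
 assumes "finite D" "\<And>K. K \<in> D ==> \<exists>u v. K = {u..v::real}"
  "\<And>K L. K \<in> D ==> L \<in> D ==> K \<noteq> L ==> interior K \<inter> interior L = {}"
  "\<Union>D \<subseteq> U" "U \<in> lmeasurable"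
 shows "(\<Sum>K\<in>D. measure lborel K) \<le> measure lebesgue U"
proof -
 have c: "measure lborel K = measure lebesgue (interior K)" "interior K \<in> lmeasurable" if K: "K \<in> D" for K
 proof -
  obtain u v where uv: "K = {u..v}" using assms(2)[OF K] by blast
  show "measure lborel K = measure lebesgue (interior K)" "interior K \<in> lmeasurable"
   unfolding uv interior_atLeastAtMost_real by (cases "u \<le> v"; simp)+
 qed
 have "(\<Sum>K\<in>D. measure lborel K) = (\<Sum>K\<in>D. measure lebesgue (interior K))" using c by simp
 also have "... = measure lebesgue (\<Union>K\<in>D. interior K)"
 proof (rule measure_finite_Union[symmetric])
  show "finite D" by fact
  show "interior ` D \<subseteq> sets lebesgue" using c(2) by auto
  show "disjoint_family_on interior D" using assms(3) unfolding disjoint_family_on_def by blast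
  show "\<And>i. i \<in> D ==> emeasure lebesgue (interior i) \<noteq> \<infinity>" using fmeasurableD2[OF c(2)] by simp
 qed
 also have "... \<le> measure lebesgue U"
 proof (rule measure_mono_fmeasurable)
  show "(\<Union>K\<in>D. interior K) \<subseteq> U" using assms(4) interior_subset by blast
  show "(\<Union>K\<in>D. interior K) \<in> sets lebesgue" using assms(1) c(2) by (intro sets.finite_UN) auto
 qed fact
 finally show ?thesis .
qed

text \<open>A finite family of non-overlapping intervals is coded as a division of its own union; in
  this form it matches the sets of cells of a tagged division.\<close>

definition ac_on :: "real => real => (real => 'a::real_normed_vector) => bool" where
 "ac_on a b f \<longleftrightarrow> (\<forall>\<epsilon>>0. \<exists>\<delta>>0. \<forall>d. d division_of \<Union>d \<and> \<Union>d \<subseteq> {a..b} \<and> (\<Sum>K\<in>d. measure lborel K) < \<delta> \<longrightarrow>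
   (\<Sum>K\<in>d. norm (incr f K)) < \<epsilon>)"

text \<open>Off Z the gauge comes from the derivative, as in the classical proof. On Z it is an open
  set of measure below \<delta>, so that absolute continuity makes the increments over all cells
  tagged in Z small together.\<close>

lemma ac_on_has_integral:
 fixes f :: "real => 'a::euclidean_space"
 assumes ac: "ac_on a b f" and ab: "a \<le> b" and Z: "negligible Z"
  and g: "\<And>x. x \<in> {a..b} - Z ==> (f has_vector_derivative g x) (at x within {a..b})"
 shows "(g has_integral (f b - f a)) {a..b}"
proof -
 \<comment> \<open>With integrand 0 on Z, a cell tagged in Z contributes only the increment of
   f.\<close>
 define h where "h x = (if x \<in> Z then 0 else g x)" for x
 have "(h has_integral (f b - f a)) {a..b}"
  unfolding has_integral_real
 proof (intro allI impI)
  fix e :: real assume e: "e > 0"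
  obtain \<delta> where \<delta>: "\<delta> > 0" "\<And>d. d division_of \<Union>d ==> \<Union>d \<subseteq> {a..b} ==> (\<Sum>K\<in>d. measure lborel K) < \<delta> ==>
   (\<Sum>K\<in>d. norm (incr f K)) < e / 2"
   using ac e unfolding ac_on_def by (metis half_gt_zero)
  have ZL: "Z \<in> sets lebesgue" using Z by (simp add: negligible_imp_sets)
  obtain U where U: "open U" "Z \<subseteq> U" "U - Z \<in> lmeasurable" "emeasure lebesgue (U - Z) < ennreal \<delta>"
   using sets_lebesgue_outer_open[OF ZL \<delta>(1)] by metis
  have "U = (U - Z) \<union> Z" using U(2) by blast
  moreover have Zn: "Z \<in> null_sets lebesgue" using Z by (simp add: negligible_iff_null_sets)
  ultimately have "emeasure lebesgue U = emeasure lebesgue (U - Z)"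
   using emeasure_Un_null_set[of "U - Z" lebesgue Z] U(3) by (metis fmeasurableD)
  then have Ue: "emeasure lebesgue U < ennreal \<delta>" using U(4) by simp
  have US: "U \<in> sets lebesgue" using U(1) by simp
  have UL: "U \<in> lmeasurable" using Ue US by (intro fmeasurableI) (auto intro: less_trans)
  have Um: "measure lebesgue U < \<delta>"
   using Ue UL by (simp add: emeasure_eq_measure2 \<delta>(1) ennreal_less_iff)
  define e' where "e' = e / (2 * (b - a + 1))"
  have e': "e' > 0" using e ab by (simp add: e'_def)
  have "\<exists>r>0. \<forall>y\<in>{a..b}. \<bar>y - x\<bar> < r \<longrightarrow> norm (f y - f x - (y - x) *\<^sub>R h x) \<le> e' * \<bar>y - x\<bar>"
   if x: "x \<in> {a..b} - Z" for x
  proof -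
   have "h x = g x" using x by (simp add: h_def)
   with g[OF x] show ?thesis
    unfolding has_vector_derivative_def has_derivative_within_alt
    using e' by simp
  qed
  then obtain r where r: "\<And>x. x \<in> {a..b} - Z ==> r x > 0"
   "\<And>x y. x \<in> {a..b} - Z ==> y \<in> {a..b} ==> \<bar>y - x\<bar> < r x ==>
     norm (f y - f x - (y - x) *\<^sub>R h x) \<le> e' * \<bar>y - x\<bar>" by metis
  define \<gamma> where "\<gamma> x = (if x \<in> Z then U else if x \<in> {a..b} then ball x (r x) else ball x 1)" for x
  have "gauge \<gamma>"
   unfolding gauge_def \<gamma>_def using U(1,2) r(1) by auto
  moreover have "norm (sum (\<lambda>(x,k). measure lborel k *\<^sub>R h x) p - (f b - f a)) < e"
   if p: "p tagged_division_of {a..b}" "\<gamma> fine p" for p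
  proof -
   note td = tagged_division_ofD[OF p(1)]
   have cell: "\<exists>u v. k = {u..v} \<and> u \<le> v \<and> x \<in> {u..v}" if "(x, k) \<in> p" for x k
    using td(2,4)[OF that] by auto
   define pb where "pb = {q \<in> p. fst q \<in> Z}"
   define pg where "pg = {q \<in> p. fst q \<notin> Z}"
   have split: "p = pb \<union> pg" "pb \<inter> pg = {}" "finite pb" "finite pg"
    using td(1) by (auto simp: pb_def pg_def)
   let ?D = "\<lambda>q. measure lborel (snd q) *\<^sub>R h (fst q) - incr f (snd q)"
   have eq: "sum (\<lambda>(x,k). measure lborel k *\<^sub>R h x) p - (f b - f a) = (\<Sum>q\<in>p. ?D q)"
    using additive_tagged_division_1[OF ab p(1), of f]
    by (simp add: sum_subtractf incr_def case_prod_beta)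
   have good: "norm (\<Sum>q\<in>pg. ?D q) \<le> e' * (b - a)"
   proof -
    have "norm (?D q) \<le> e' * measure lborel (snd q)" if q: "q \<in> pg" for q
    proof -
     obtain x k where qx: "q = (x, k)" by (cases q)
     have xk: "(x, k) \<in> p" "x \<notin> Z" using q qx by (auto simp: pg_def)
     obtain u v where uv: "k = {u..v}" "u \<le> v" "x \<in> {u..v}" using cell[OF xk(1)] by blast
     have kab: "{u..v} \<subseteq> {a..b}" using td(3)[OF xk(1)] uv by simp
     then have x: "x \<in> {a..b} - Z" using xk uv by blast
     have "{u..v} \<subseteq> ball x (r x)" using p(2) xk x uv unfolding fine_def \<gamma>_def by fastforce
     then have "\<bar>u - x\<bar> < r x" "\<bar>v - x\<bar> < r x"
      using uv(2) by (auto simp: subset_iff dist_real_def abs_minus_commute)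
     with r(2)[OF x] kab uv(2) have
      1: "norm (f u - f x - (u - x) *\<^sub>R h x) \<le> e' * \<bar>u - x\<bar>" and
      2: "norm (f v - f x - (v - x) *\<^sub>R h x) \<le> e' * \<bar>v - x\<bar>" by auto
     have "?D q = (f u - f x - (u - x) *\<^sub>R h x) - (f v - f x - (v - x) *\<^sub>R h x)"
      using uv by (simp add: qx algebra_simps)
     also have "norm ... \<le> e' * \<bar>u - x\<bar> + e' * \<bar>v - x\<bar>"
      using norm_triangle_ineq4[of "f u - f x - (u - x) *\<^sub>R h x" "f v - f x - (v - x) *\<^sub>R h x"] 1 2 by linarith
     also have "... = e' * measure lborel (snd q)" using uv by (simp add: qx algebra_simps)
     finally show ?thesis .
    qed
    then have "norm (\<Sum>q\<in>pg. ?D q) \<le> (\<Sum>q\<in>pg. e' * measure lborel (snd q))" by (rule sum_norm_le)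
    also have "... \<le> (\<Sum>q\<in>p. e' * measure lborel (snd q))"
     using split td(1) e' by (intro sum_mono2) auto
    also have "... = e' * (b - a)"
     using additive_content_tagged_division[of p a b] p(1) ab by (simp add: sum_distrib_left[symmetric] case_prod_beta)
    finally show ?thesis .
   qed
   have bad: "norm (\<Sum>q\<in>pb. ?D q) < e / 2"
   proof -
    have pbp: "pb tagged_partial_division_of {a..b}"
     by (rule tagged_partial_division_subset[of p]) (use p(1) split in \<open>auto simp: tagged_division_of_def\<close>)
    have dv: "snd ` pb division_of \<Union>(snd ` pb)"
     by (rule partial_division_of_tagged_division[OF pbp])
    have sub: "\<Union>(snd ` pb) \<subseteq> U" "\<Union>(snd ` pb) \<subseteq> {a..b}"
     using p(2) td(3) unfolding pb_def fine_def \<gamma>_def by fastforce+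
    have "(\<Sum>K\<in>snd ` pb. measure lborel K) \<le> measure lebesgue U"
     using division_ofD[OF dv] sub(1) UL by (intro sum_content_le_open) (auto simp: box_real)
    then have "(\<Sum>K\<in>snd ` pb. norm (incr f K)) < e / 2"
     using Um dv sub(2) by (intro \<delta>(2)) auto
    moreover have "(\<Sum>(x, k)\<in>pb. norm (incr f k)) = (\<Sum>K\<in>snd ` pb. norm (incr f K))"
    proof -
     let ?n = "\<lambda>K. if K = {} then 0 else norm (incr f K)"
     have "(\<Sum>(x, k)\<in>pb. ?n k) = (\<Sum>K\<in>snd ` pb. ?n K)"
     proof (rule sum.over_tagged_division_lemma)
      show "pb tagged_division_of \<Union>(snd ` pb)" by (rule tagged_partial_division_of_Union_self[OF pbp])
      fix u v :: real assume "box u v = {}"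
      then show "?n (cbox u v) = 0" by (cases "u = v") auto
     qed
     moreover have "k \<noteq> {}" if "(x, k) \<in> pb" for x k
      using td(2)[of x k] that by (auto simp: pb_def)
     then have "(\<Sum>(x, k)\<in>pb. ?n k) = (\<Sum>(x, k)\<in>pb. norm (incr f k))"
      "(\<Sum>K\<in>snd ` pb. ?n K) = (\<Sum>K\<in>snd ` pb. norm (incr f K))"
      by (auto intro!: sum.cong)
     ultimately show ?thesis by simp
    qed
    moreover have "norm (\<Sum>q\<in>pb. ?D q) \<le> (\<Sum>(x, k)\<in>pb. norm (incr f k))"
     by (rule sum_norm_le) (auto simp: pb_def h_def)
    ultimately show ?thesis by simp
   qed
   have "norm (\<Sum>q\<in>p. ?D q) = norm ((\<Sum>q\<in>pb. ?D q) + (\<Sum>q\<in>pg. ?D q))"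
    using sum.union_disjoint[OF split(3,4,2), of ?D] split(1) by simp
   also have "... \<le> norm (\<Sum>q\<in>pb. ?D q) + norm (\<Sum>q\<in>pg. ?D q)" by (rule norm_triangle_ineq)
   also have "... < e / 2 + e' * (b - a)" using good bad by linarith
   also have "e' * (b - a) \<le> e / 2"
    using e ab by (simp add: e'_def field_simps)
   finally show ?thesis using eq by simp
  qed
  ultimately show "\<exists>\<gamma>. gauge \<gamma> \<and> (\<forall>p. p tagged_division_of {a..b} \<and> \<gamma> fine p \<longrightarrow>
   norm (sum (\<lambda>(x,k). measure lborel k *\<^sub>R h x) p - (f b - f a)) < e)"
   by (intro exI[of _ \<gamma>]) simp
 qed
 then show ?thesis
  by (rule has_integral_spike[OF Z, rotated]) (simp add: h_def)
qed

lemma bv_imp_differentiable_ae_euclidean: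
 fixes f :: "real => 'a::euclidean_space"
 assumes bv: "\<And>d. d division_of {a..b} ==> (\<Sum>K\<in>d. norm (incr f K)) \<le> B" and ab: "a < b"
 shows "negligible {x \<in> {a<..<b}. \<not> f differentiable (at x)}"
proof -
 let ?N = "\<lambda>i. {x \<in> {a<..<b}. \<not> (\<lambda>x. f x \<bullet> i) differentiable (at x)}"
 have "negligible (?N i)" if i: "i \<in> Basis" for i
 proof (rule bv_imp_differentiable_ae[OF _ ab, of "\<lambda>x. f x \<bullet> i" B])
  fix d assume d: "d division_of {a..b}"
  have "(\<Sum>K\<in>d. \<bar>incr (\<lambda>x. f x \<bullet> i) K\<bar>) \<le> (\<Sum>K\<in>d. norm (incr f K))"
   using Basis_le_norm[OF i] by (intro sum_mono) (simp add: incr_def inner_diff_left[symmetric])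
  also have "... \<le> B" by (rule bv[OF d])
  finally show "(\<Sum>K\<in>d. \<bar>incr (\<lambda>x. f x \<bullet> i) K\<bar>) \<le> B" .
 next
  fix Z assume Z: "negligible Z" "\<And>x. x \<in> {a<..<b} - Z ==> (\<lambda>x. f x \<bullet> i) differentiable (at x)"
  show "negligible (?N i)"
  proof (rule negligible_subset[OF Z(1)], rule subsetI)
   fix x assume "x \<in> ?N i"
   then show "x \<in> Z" using Z(2)[of x] by auto
  qed
 qed
 then have "negligible (\<Union>(?N ` Basis))" by (intro negligible_Union) auto
 moreover have "{x \<in> {a<..<b}. \<not> f differentiable (at x)} \<subseteq> \<Union>(?N ` Basis)"
  by (subst differentiable_componentwise_within) blast
 ultimately show ?thesis by (rule negligible_subset)
qed

section \<open>Sampling of paths\<close>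

definition mk_path :: "(real => 'a::metric_space) => 'a cpath" where
 "mk_path f = Abs_cpath (restrict f {0..1})"

lemma path_at_mk_path:
 assumes "continuous_on {0..1} f" "t \<in> {0..1}"
 shows "path_at (mk_path f) t = f t"
proof -
 have "continuous_on {0..1} (restrict f {0..1})"
  using assms(1) continuous_on_cong[of "{0..1}" "{0..1}" "restrict f {0..1}" f] by simp
 then show ?thesis using assms(2) unfolding mk_path_def by (subst Abs_cpath_inverse) auto
qed

lemma dist_cpath_le:
 assumes "\<And>t. t \<in> {0..1} ==> dist (path_at w t) (path_at y t) \<le> c"
 shows "dist w y \<le> c"
 unfolding dist_cpath_def by (rule cSUP_least) (use assms in auto)

lemma cpath_modulus:
 fixes w :: "'a::metric_space cpath"
 assumes "e > 0"
 obtains m :: nat where "m > 0"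
  "\<And>s t. s \<in> {0..1} ==> t \<in> {0..1} ==> \<bar>s - t\<bar> \<le> 1 / m ==> dist (path_at w s) (path_at w t) < e"
proof -
 have "uniformly_continuous_on {0..1} (path_at w)"
  by (rule compact_uniformly_continuous[OF continuous_on_path_at]) simp
 then obtain d where d: "d > 0" "\<And>s t. s \<in> {0..1} ==> t \<in> {0..1} ==> dist t s < d ==> dist (path_at w t) (path_at w s) < e"
  using assms unfolding uniformly_continuous_on_def by metis
 obtain m where m: "1 / real (Suc m) < d" using d(1) nat_approx_posE by blast
 show ?thesis
 proof (rule that[of "Suc m"])
  fix s t :: real assume "s \<in> {0..1}" "t \<in> {0..1}" "\<bar>s - t\<bar> \<le> 1 / Suc m"
  then show "dist (path_at w s) (path_at w t) < e"
   using m by (intro d(2)) (auto simp: dist_real_def simp del: of_nat_Suc)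
 qed simp
qed

lemma floor_grid:
 fixes t :: real and m :: nat
 assumes "t \<in> {0..1}" "m > 0"
 shows "nat \<lfloor>t * m\<rfloor> \<le> m" "\<bar>t - real (nat \<lfloor>t * m\<rfloor>) / m\<bar> \<le> 1 / m" "real (nat \<lfloor>t * m\<rfloor>) / m \<in> {0..1}"
  "real (nat \<lfloor>t * m\<rfloor>) / m \<le> t"
proof -
 have f: "real (nat \<lfloor>t * m\<rfloor>) = of_int \<lfloor>t * m\<rfloor>" using assms by simp
 have l: "of_int \<lfloor>t * m\<rfloor> \<le> t * m" "t * m < of_int \<lfloor>t * m\<rfloor> + 1" by linarith+
 have "t * m \<le> m" using assms by (simp add: mult_left_le_one_le)
 then have "real (nat \<lfloor>t * m\<rfloor>) \<le> real m" using f l by linarith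
 then show n: "nat \<lfloor>t * m\<rfloor> \<le> m" by simp
 show "real (nat \<lfloor>t * m\<rfloor>) / m \<in> {0..1}" using n assms by simp
 show "real (nat \<lfloor>t * m\<rfloor>) / m \<le> t" using f l assms by (simp add: pos_divide_le_eq)
 then show "\<bar>t - real (nat \<lfloor>t * m\<rfloor>) / m\<bar> \<le> 1 / m"
 proof -
  have "t \<le> (real (nat \<lfloor>t * m\<rfloor>) + 1) / m" using f l assms by (simp add: pos_le_divide_eq)
  then have "t - real (nat \<lfloor>t * m\<rfloor>) / m \<le> 1 / m" by (simp add: add_divide_distrib)
  then show ?thesis using \<open>real (nat \<lfloor>t * m\<rfloor>) / m \<le> t\<close> by linarith
 qed
qed

text \<open>A metric space offers no interpolation between grid values, so the dense set cannot be
  built from polygons. For every accuracy 1/n, mesh 1/m and list of values from a dense set, one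
  path with this modulus and nearly these values is chosen whenever there is one; two such paths are
  within 4/n, by two moduli and two grid errors.\<close>

lemma cpath_countable_dense:
 obtains D :: "'a::{metric_space, second_countable_topology} cpath set"
 where "countable D" "\<And>w e. e > 0 ==> \<exists>y\<in>D. dist w y < e"
proof -
 obtain S :: "'a set" where S: "countable S" "\<And>X. open X ==> X \<noteq> {} ==> \<exists>d\<in>S. d \<in> X"
  using countable_dense_exists[where 'a = 'a] by blast
 define P where "P n m l w \<longleftrightarrow> (\<forall>s\<in>{0..1}. \<forall>t\<in>{0..1}. \<bar>s - t\<bar> \<le> 1 / real m \<longrightarrow> dist (path_at w s) (path_at w t) < 1 / real n)
  \<and> (\<forall>i\<le>m. dist (path_at w (real i / m)) (l ! i) < 1 / real n)" for n m :: nat and l :: "'a list" and w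
 define D where "D = (\<lambda>(n, m, l). SOME w. P n m l w) ` (UNIV \<times> UNIV \<times> lists S)"
 have "countable D" unfolding D_def using S(1) by (intro countable_image countable_SIGMA) auto
 moreover have "\<exists>y\<in>D. dist w y < e" if e: "e > 0" for w :: "'a cpath" and e
 proof -
  obtain n0 where "1 / real (Suc n0) < e / 8" using e nat_approx_posE[of "e / 8"] by auto
  then obtain n :: nat where n: "n > 0" "1 / real n < e / 8" by (metis zero_less_Suc)
  then have "1 / real n > 0" by simp
  then obtain m where m: "m > 0" "\<And>s t. s \<in> {0..1} ==> t \<in> {0..1} ==> \<bar>s - t\<bar> \<le> 1 / real m ==> dist (path_at w s) (path_at w t) < 1 / real n"
   by (rule cpath_modulus[of _ w]) metis
  have "\<forall>i. \<exists>d\<in>S. d \<in> ball (path_at w (real i / m)) (1 / real n)"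
   using S(2) n(1) by (intro allI S(2)) auto
  then obtain c where c: "\<And>i. c i \<in> S" "\<And>i. dist (path_at w (real i / m)) (c i) < 1 / real n"
   by (metis mem_ball)
  define l where "l = map c [0..<Suc m]"
  have l: "l \<in> lists S" using c(1) by (auto simp: l_def)
  have lc: "l ! i = c i" if "i \<le> m" for i using that unfolding l_def by (simp del: upt_Suc)
  have Pw: "P n m l w" unfolding P_def using m(2) c(2) lc by auto
  define y where "y = (SOME w. P n m l w)"
  have Py: "P n m l y" unfolding y_def using Pw by (rule someI)
  have "dist w y \<le> 4 / n"
  proof (rule dist_cpath_le)
   fix t :: real assume t: "t \<in> {0..1}"
   define i where "i = nat \<lfloor>t * m\<rfloor>"
   note g = floor_grid[OF t m(1), folded i_def]
   have "dist (path_at w t) (path_at y t) \<le> dist (path_at w t) (path_at w (real i / m))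
    + dist (path_at w (real i / m)) (l ! i) + dist (path_at y (real i / m)) (l ! i)
    + dist (path_at y t) (path_at y (real i / m))"
    by (smt (verit) dist_triangle dist_triangle2 dist_commute)
   also have "... \<le> 1 / n + 1 / n + 1 / n + 1 / n"
    using Pw Py g t unfolding P_def by (intro add_mono) (auto intro: less_imp_le)
   finally show "dist (path_at w t) (path_at y t) \<le> 4 / n" by simp
  qed
  also have "4 / real n < e" using n by (simp add: field_simps)
  finally have "dist w y < e" .
  moreover have "y \<in> D" unfolding D_def y_def
   by (rule image_eqI[of _ _ "(n, m, l)"]) (use l in auto)
  ultimately show ?thesis by blast
 qed
 ultimately show ?thesis by (rule that)
qed

lemma cpath_ball_basis:
 obtains B :: "'a::{metric_space, second_countable_topology} cpath set set"
 where "countable B" "topological_basis B" "\<And>b. b \<in> B ==> \<exists>y r. b = ball y r"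
proof -
 obtain D :: "'a cpath set" where D: "countable D" "\<And>w e. e > 0 ==> \<exists>y\<in>D. dist w y < e"
  by (rule cpath_countable_dense) blast
 let ?B = "(\<lambda>(d, n). ball d (1 / Suc n)) ` (D \<times> (UNIV :: nat set))"
 have "topological_basis ?B"
 proof (rule topological_basisI)
  fix U :: "'a cpath set" and p assume U: "open U" "p \<in> U"
  then obtain e where e: "e > 0" "ball p e \<subseteq> U" by (meson openE)
  obtain n where n: "1 / Suc n < e / 2" using e nat_approx_posE[of "e / 2"] by auto
  obtain d where d: "d \<in> D" "dist p d < 1 / Suc n" using D(2)[of "1 / Suc n" p] by auto
  have "ball d (1 / Suc n) \<subseteq> ball p e"
  proof
   fix q assume "q \<in> ball d (1 / Suc n)"
   then show "q \<in> ball p e"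
    using dist_triangle[of p q d] d n by (simp del: of_nat_Suc)
  qed
  then show "\<exists>V\<in>?B. p \<in> V \<and> V \<subseteq> U"
   using d(1) e(2) d(2) by (intro bexI[of _ "ball d (1 / Suc n)"])
    (auto simp: dist_commute simp del: of_nat_Suc)
 qed auto
 moreover have "countable ?B" using D(1) by auto
 ultimately show ?thesis by (intro that[of ?B]) auto
qed

text \<open>Separability makes the Borel sets of the uniform topology accessible through countably
  many evaluations.\<close>

instance cpath :: ("{metric_space, second_countable_topology}") second_countable_topology
proof
 obtain B :: "'a cpath set set" where "countable B" "topological_basis B"
  by (rule cpath_ball_basis) blast
 then show "\<exists>B :: 'a cpath set set. countable B \<and> open = generate_topology B"
  by (intro exI[of _ B] conjI) (auto simp: topological_basis_imp_subbasis intro!: ext)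
qed

definition samp :: "nat => 'a::metric_space cpath => nat => 'a" where
 "samp N w = restrict (\<lambda>i. path_at w (real i / real N)) {..N}"

lemma samp_space: "samp N w \<in> space (PiM {..N} (\<lambda>_. borel))"
 by (auto simp: samp_def space_PiM)

lemma grid_mem: "i \<le> N ==> N > 0 ==> real i / real N \<in> {0..1}"
 by simp

lemma dyadic_dense:
 fixes t e :: real
 assumes "t \<in> {0..1}" "e > 0"
 shows "\<exists>n k::nat. k \<le> 2 ^ n \<and> \<bar>t - real k / 2 ^ n\<bar> < e"
proof -
 obtain n where n: "(1 / 2) ^ n < e" using real_arch_pow_inv[OF assms(2), of "1 / 2"] by auto
 have "\<bar>t - real (nat \<lfloor>t * (2 ^ n :: nat)\<rfloor>) / (2 ^ n :: nat)\<bar> \<le> 1 / (2 ^ n :: nat)"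
  "nat \<lfloor>t * (2 ^ n :: nat)\<rfloor> \<le> 2 ^ n"
  using floor_grid[OF assms(1), of "2 ^ n"] by auto
 moreover have "1 / (2 ^ n :: nat) < e" using n by (simp add: power_one_over)
 ultimately show ?thesis by (intro exI[of _ n] exI[of _ "nat \<lfloor>t * (2 ^ n :: nat)\<rfloor>"]) auto
qed

lemma dist_cpath_le_dyadic:
 assumes "\<And>n k::nat. k \<le> 2 ^ n ==> dist (path_at w (real k / 2 ^ n)) (path_at y (real k / 2 ^ n)) \<le> c"
 shows "dist w y \<le> c"
proof (rule dist_cpath_le, rule field_le_epsilon)
 fix t e :: real assume t: "t \<in> {0..1}" and e: "e > 0"
 have "continuous_on {0..1} (\<lambda>t. dist (path_at w t) (path_at y t))"
  by (intro continuous_on_dist continuous_on_path_at)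
 then obtain d where d: "d > 0" "\<And>s. s \<in> {0..1} ==> dist s t < d ==>
  dist (dist (path_at w s) (path_at y s)) (dist (path_at w t) (path_at y t)) < e"
  using t e unfolding continuous_on_iff by metis
 obtain n k :: nat where nk: "k \<le> 2 ^ n" "\<bar>t - real k / 2 ^ n\<bar> < d" using dyadic_dense[OF t d(1)] by blast
 have "real k / 2 ^ n \<in> {0..1}" using grid_mem[OF nk(1)] by simp
 with d(2)[of "real k / 2 ^ n"] nk(2) have
  "dist (dist (path_at w (real k / 2 ^ n)) (path_at y (real k / 2 ^ n))) (dist (path_at w t) (path_at y t)) < e"
  by (simp add: dist_real_def abs_minus_commute)
 with assms[OF nk(1)] show "dist (path_at w t) (path_at y t) \<le> c + e"
  by (simp add: dist_real_def abs_if split: if_splits)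
qed

text \<open>A closed ball is cut out by conditions at the countably many dyadic times, an open ball
  is a countable union of closed ones, and open balls form a countable base.\<close>

lemma borel_measurable_cpathI:
 fixes f :: "'b => 'a::{metric_space, second_countable_topology} cpath"
 assumes m: "\<And>n k::nat. k \<le> 2 ^ n ==> (\<lambda>x. path_at (f x) (real k / 2 ^ n)) \<in> borel_measurable M"
 shows "f \<in> borel_measurable M"
proof -
 obtain B :: "'a cpath set set" where B: "countable B" "topological_basis B" "\<And>b. b \<in> B ==> \<exists>y r. b = ball y r"
  by (rule cpath_ball_basis) blast
 have "f -` b \<inter> space M \<in> sets M" if b: "b \<in> B" for b
 proof -
  obtain y r where br: "b = ball y r" using B(3)[OF b] by blast
  let ?C = "\<lambda>j::nat. {x \<in> space M. \<forall>n. \<forall>k\<in>{..2 ^ n}. dist (path_at (f x) (real k / 2 ^ n)) (path_at y (real k / 2 ^ n)) \<le> r - 1 / Suc j}"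
  have C: "?C j \<in> sets M" for j
   using m by (intro sets.sets_Collect_countable_All sets.sets_Collect_finite_All) (auto intro!: borel_measurable_le borel_measurable_dist measurable_const)
  have eq: "f -` b \<inter> space M = (\<Union>j. ?C j)"
  proof (intro set_eqI iffI)
   fix x assume x: "x \<in> f -` b \<inter> space M"
   then have "dist (f x) y < r" by (simp add: br dist_commute)
   then obtain j where j: "1 / Suc j < r - dist (f x) y" using nat_approx_posE[of "r - dist (f x) y"] by auto
   have "x \<in> ?C j"
   proof (intro CollectI conjI allI ballI)
    fix n k :: nat assume "k \<in> {..2 ^ n}"
    then have "real k / 2 ^ n \<in> {0..1}" using grid_mem[of k "2 ^ n"] by simp
    from dist_path_at_le[OF this, of "f x" y] j
    show "dist (path_at (f x) (real k / 2 ^ n)) (path_at y (real k / 2 ^ n)) \<le> r - 1 / Suc j" by linarith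
   qed (use x in simp)
   then show "x \<in> (\<Union>j. ?C j)" by blast
  next
   fix x assume "x \<in> (\<Union>j. ?C j)"
   then obtain j where x: "x \<in> ?C j" by blast
   have "dist (f x) y \<le> r - 1 / Suc j" by (rule dist_cpath_le_dyadic) (use x in auto)
   moreover have "1 / real (Suc j) > 0" by simp
   ultimately have "dist (f x) y < r" by linarith
   then show "x \<in> f -` b \<inter> space M" using x by (simp add: br dist_commute)
  qed
  show ?thesis unfolding eq by (intro sets.countable_UN image_subsetI C)
 qed
 then show ?thesis
  unfolding borel_eq_countable_basis[OF B(1,2)] by (intro measurable_measure_of) auto
qed

lemma measurable_samp [measurable]:
 assumes "N > 0"
 shows "samp N \<in> measurable (borel :: 'a::{metric_space, second_countable_topology} cpath measure) (PiM {..N} (\<lambda>_. borel))"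
 unfolding samp_def using assms by (intro measurable_restrict borel_measurable_eval) simp

section \<open>Dyadic cylinders\<close>

definition coarsen :: "nat => nat => (nat => 'a) => nat => 'a" where
 "coarsen N c x = restrict (\<lambda>i. x (c * i)) {..N}"

lemma coarsen_samp: "N > 0 ==> c > 0 ==> coarsen N c (samp (c * N) w) = samp N w"
 by (auto simp: coarsen_def samp_def restrict_def fun_eq_iff)

lemma measurable_coarsen [measurable]:
 "coarsen N c \<in> measurable (PiM {..c * N} (\<lambda>_. borel)) (PiM {..N} (\<lambda>_. borel))"
 unfolding coarsen_def by (intro measurable_restrict measurable_component_singleton) simp

lemma samp_refine:
 assumes "n \<le> m"
 shows "samp (2 ^ n) w = coarsen (2 ^ n) (2 ^ (m - n)) (samp (2 ^ m) w)"
proof -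
 have "(2::nat) ^ m = 2 ^ (m - n) * 2 ^ n" using assms by (simp add: power_add[symmetric])
 then show ?thesis using coarsen_samp[of "2 ^ n" "2 ^ (m - n)" w] by simp
qed

lemma measurable_coarsen_refine:
 "n \<le> m ==> coarsen (2 ^ n) (2 ^ (m - n)) \<in> measurable (PiM {..2 ^ m} (\<lambda>_. borel)) (PiM {..2 ^ n} (\<lambda>_. borel))"
 using measurable_coarsen[of "2 ^ n" "2 ^ (m - n)"] by (simp add: power_add[symmetric])

text \<open>Dyadic levels make these classes increase with n, so that finitely many cylinders always
  live on a common grid.\<close>

definition cyls :: "nat => 'a::metric_space cpath set set" where
 "cyls n = {samp (2 ^ n) -` B | B. B \<in> sets (PiM {..2 ^ n} (\<lambda>_. borel))}"

lemma cyls_mono: "n \<le> m ==> cyls n \<subseteq> cyls m"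
proof (rule subsetI)
 fix A :: "'a cpath set" assume nm: "n \<le> m" and "A \<in> cyls n"
 then obtain B where B: "A = samp (2 ^ n) -` B" "B \<in> sets (PiM {..2 ^ n} (\<lambda>_. borel :: 'a measure))"
  unfolding cyls_def by blast
 let ?c = "coarsen (2 ^ n) (2 ^ (m - n)) :: (nat => 'a) => _"
 let ?M = "PiM {..2 ^ m} (\<lambda>_. borel :: 'a measure)"
 have "A = samp (2 ^ m) -` (?c -` B \<inter> space ?M)"
  using samp_refine[OF nm] samp_space unfolding B(1) by auto
 moreover have "?c -` B \<inter> space ?M \<in> sets ?M"
  using measurable_coarsen_refine[OF nm] B(2) by (rule measurable_sets)
 ultimately show "A \<in> cyls m" unfolding cyls_def by blast
qed

lemma cyls_Compl: "A \<in> cyls n ==> - A \<in> cyls n"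
proof -
 assume "A \<in> cyls n"
 then obtain B where B: "A = samp (2 ^ n) -` B" "B \<in> sets (PiM {..2 ^ n} (\<lambda>_. borel :: 'a measure))"
  unfolding cyls_def by blast
 then have "- A = samp (2 ^ n) -` (space (PiM {..2 ^ n} (\<lambda>_. borel)) - B)" using samp_space by auto
 then show ?thesis unfolding cyls_def using B(2) by blast
qed

lemma cyls_UN:
 assumes "\<And>i. i < (k::nat) ==> C i \<in> cyls n"
 shows "(\<Union>i<k. C i) \<in> cyls n"
proof -
 have "\<forall>i\<in>{..<k}. \<exists>B. C i = samp (2 ^ n) -` B \<and> B \<in> sets (PiM {..2 ^ n} (\<lambda>_. borel :: 'a measure))"
  using assms unfolding cyls_def by auto
 then obtain B where B: "\<And>i. i < k ==> C i = samp (2 ^ n) -` B i"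
  "\<And>i. i < k ==> B i \<in> sets (PiM {..2 ^ n} (\<lambda>_. borel :: 'a measure))" by (metis lessThan_iff)
 have "(\<Union>i<k. C i) = samp (2 ^ n) -` (\<Union>i<k. B i)" using B(1) by auto
 moreover have "(\<Union>i<k. B i) \<in> sets (PiM {..2 ^ n} (\<lambda>_. borel :: 'a measure))" using B(2) by (intro sets.finite_UN) auto
 ultimately show ?thesis unfolding cyls_def by blast
qed

lemma cyls_sets: "A \<in> cyls n ==> A \<in> sets (borel :: 'a::{metric_space, second_countable_topology} cpath measure)"
 unfolding cyls_def using measurable_sets[OF measurable_samp[of "2 ^ n"]] by auto

lemma borel_cpath_cyls:
 "sets (borel :: 'a::{metric_space, second_countable_topology} cpath measure) \<subseteq> sigma_sets UNIV (\<Union>n. cyls n)"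
proof -
 let ?M = "sigma UNIV (\<Union>n. cyls n) :: 'a cpath measure"
 have sM: "sets ?M = sigma_sets UNIV (\<Union>n. cyls n)" by (intro sets_measure_of) auto
 have "(\<lambda>w. w) \<in> borel_measurable ?M"
 proof (rule borel_measurable_cpathI)
  fix n k :: nat assume k: "k \<le> 2 ^ n"
  show "(\<lambda>w. path_at w (real k / 2 ^ n)) \<in> borel_measurable ?M"
  proof (rule measurableI)
   fix U :: "'a set" assume U: "U \<in> sets borel"
   have "(\<lambda>w. path_at w (real k / 2 ^ n)) -` U = samp (2 ^ n) -` ((\<lambda>x. x k) -` U \<inter> space (PiM {..2 ^ n} (\<lambda>_. borel)))"
    using k by (auto simp: samp_def space_PiM)
   moreover have "(\<lambda>x. x k) -` U \<inter> space (PiM {..2 ^ n} (\<lambda>_. borel :: 'a measure)) \<in> sets (PiM {..2 ^ n} (\<lambda>_. borel))"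
    using k U by (intro measurable_sets[OF measurable_component_singleton]) auto
   ultimately have "(\<lambda>w. path_at w (real k / 2 ^ n)) -` U \<in> (\<Union>n. cyls n)" unfolding cyls_def by blast
   then show "(\<lambda>w. path_at w (real k / 2 ^ n)) -` U \<inter> space ?M \<in> sets ?M" unfolding sM by (simp add: sigma_sets.Basic)
  qed simp
 qed
 note id = this
 have "A \<in> sets ?M" if "A \<in> sets borel" for A
  using measurable_sets[OF id that] by (simp add: space_measure_of_conv)
 then show ?thesis unfolding sM by blast
qed

text \<open>The sets that cylinders approximate in both measures at once form a sigma-algebra. Two
  measures occur together because the same cylinder function has to serve on both sides of the
  variational formula.\<close>

lemma cyls_approx:
 fixes \<mu> \<mu>' :: "'a::{metric_space, second_countable_topology} cpath measure"
 assumes \<mu>: "finite_measure \<mu>" "sets \<mu> = sets borel" and \<mu>': "finite_measure \<mu>'" "sets \<mu>' = sets borel"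
  and A: "A \<in> sets borel" and e: "e > 0"
 shows "\<exists>n. \<exists>C\<in>cyls n. measure \<mu> ((A - C) \<union> (C - A)) + measure \<mu>' ((A - C) \<union> (C - A)) < e"
proof -
 let ?m = "\<lambda>A. measure \<mu> A + measure \<mu>' A"
 have "A \<in> sigma_sets UNIV (\<Union>n. cyls n)" using A borel_cpath_cyls by blast
 then have "\<forall>e>0. \<exists>n. \<exists>C\<in>cyls n. ?m ((A - C) \<union> (C - A)) < e"
 proof (induction rule: sigma_sets.induct)
  case (Basic a)
  then obtain n where "a \<in> cyls n" by blast
  then show ?case by (intro allI impI exI[of _ n] bexI[of _ a]) auto
 next
  case Empty
  have "{} \<in> cyls 0" unfolding cyls_def by (intro CollectI exI[of _ "{}"]) auto
  then show ?case by (intro allI impI exI[of _ 0] bexI[of _ "{}"]) auto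
 next
  case (Compl a)
  show ?case
  proof (intro allI impI)
   fix e :: real assume "e > 0"
   then obtain n C where C: "C \<in> cyls n" "?m ((a - C) \<union> (C - a)) < e" using Compl.IH by blast
   have "((UNIV - a) - (- C)) \<union> ((- C) - (UNIV - a)) = (a - C) \<union> (C - a)" by blast
   then show "\<exists>n. \<exists>C\<in>cyls n. ?m (((UNIV - a) - C) \<union> (C - (UNIV - a))) < e"
    using C cyls_Compl[OF C(1)] by (intro exI[of _ n] bexI[of _ "- C"]) auto
  qed
 next
  case (Union a)
  have ab: "a i \<in> sets borel" for i
  proof -
   have "sigma_sets (space borel) (\<Union>n. cyls n) \<subseteq> sets (borel :: 'a cpath measure)"
    using cyls_sets by (intro sets.sigma_sets_subset) auto
   then show ?thesis using Union.hyps[of i] by auto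
  qed
  have lim: "(\<lambda>k. measure \<nu> (\<Union>i<k. a i)) \<longlonglongrightarrow> measure \<nu> (\<Union>i. a i)"
   if "finite_measure \<nu>" "sets \<nu> = sets borel" for \<nu> :: "'a cpath measure"
  proof -
   interpret finite_measure \<nu> by fact
   have "incseq (\<lambda>k. \<Union>i<k. a i)" by (auto simp: incseq_def, force)
   then have "(\<lambda>k. measure \<nu> (\<Union>i<k. a i)) \<longlonglongrightarrow> measure \<nu> (\<Union>k. \<Union>i<k. a i)"
    using ab that(2) by (intro finite_Lim_measure_incseq) auto
   moreover have "(\<Union>k. \<Union>i<k. a i) = (\<Union>i. a i)" by auto
   ultimately show ?thesis by simp
  qed
  have bound: "measure \<nu> (((\<Union>i. a i) - (\<Union>i<k. C i)) \<union> ((\<Union>i<k. C i) - (\<Union>i. a i)))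
    \<le> (measure \<nu> (\<Union>i. a i) - measure \<nu> (\<Union>i<k. a i)) + (\<Sum>i<k. measure \<nu> ((a i - C i) \<union> (C i - a i)))"
   if \<nu>: "finite_measure \<nu>" "sets \<nu> = sets borel" and C: "\<And>i. C i \<in> sets borel" for \<nu> :: "'a cpath measure" and k :: nat and C
  proof -
   interpret finite_measure \<nu> by fact
   let ?D = "\<lambda>i. (a i - C i) \<union> (C i - a i)"
   have am: "a i \<in> sets \<nu>" "C i \<in> sets \<nu>" for i using ab C \<nu>(2) by auto
   have "measure \<nu> (((\<Union>i. a i) - (\<Union>i<k. C i)) \<union> ((\<Union>i<k. C i) - (\<Union>i. a i)))
    \<le> measure \<nu> (((\<Union>i. a i) - (\<Union>i<k. a i)) \<union> (\<Union>i<k. ?D i))"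
    using am by (intro finite_measure_mono) auto
   also have "... \<le> measure \<nu> ((\<Union>i. a i) - (\<Union>i<k. a i)) + measure \<nu> (\<Union>i<k. ?D i)"
    using am by (intro measure_Un_le) auto
   also have "measure \<nu> (\<Union>i<k. ?D i) \<le> (\<Sum>i<k. measure \<nu> (?D i))"
    using am by (intro measure_UNION_le) auto
   also have "measure \<nu> ((\<Union>i. a i) - (\<Union>i<k. a i)) = measure \<nu> (\<Union>i. a i) - measure \<nu> (\<Union>i<k. a i)"
    using am by (intro finite_measure_Diff) auto
   finally show ?thesis by simp
  qed
  show ?case
  proof (intro allI impI)
   fix e :: real assume e: "e > 0"
   have "(\<lambda>k. ?m (\<Union>i<k. a i)) \<longlonglongrightarrow> ?m (\<Union>i. a i)"
    using lim[OF \<mu>] lim[OF \<mu>'] by (rule tendsto_add)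
   then have "eventually (\<lambda>k. ?m (\<Union>i. a i) - e / 2 < ?m (\<Union>i<k. a i)) sequentially"
    using e by (intro order_tendstoD) auto
   then obtain k where k: "?m (\<Union>i. a i) - e / 2 < ?m (\<Union>i<k. a i)"
    by (auto simp: eventually_sequentially)
   have "\<forall>i. \<exists>n C. C \<in> cyls n \<and> ?m ((a i - C) \<union> (C - a i)) < e / (2 * (real k + 1))"
    using Union.IH e by (simp add: Bex_def)
   then obtain n C where nC: "\<And>i. C i \<in> cyls (n i)" "\<And>i. ?m ((a i - C i) \<union> (C i - a i)) < e / (2 * (real k + 1))"
    by metis
   define m where "m = Max (n ` {..k})"
   have "C i \<in> cyls m" if "i < k" for i
    using nC(1)[of i] cyls_mono[of "n i" m] that by (auto simp: m_def)
   then have Cm: "(\<Union>i<k. C i) \<in> cyls m" by (rule cyls_UN)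
   have "?m (((\<Union>i. a i) - (\<Union>i<k. C i)) \<union> ((\<Union>i<k. C i) - (\<Union>i. a i)))
    \<le> (?m (\<Union>i. a i) - ?m (\<Union>i<k. a i)) + (\<Sum>i<k. ?m ((a i - C i) \<union> (C i - a i)))"
    using bound[OF \<mu>, of C k] bound[OF \<mu>', of C k] cyls_sets[OF nC(1)] by (simp add: sum.distrib)
   also have "(\<Sum>i<k. ?m ((a i - C i) \<union> (C i - a i))) \<le> (\<Sum>i<k. e / (2 * (real k + 1)))"
    using nC(2) by (intro sum_mono less_imp_le)
   also have "... \<le> e / 2" using e by (simp add: field_simps)
   finally have "?m (((\<Union>i. a i) - (\<Union>i<k. C i)) \<union> ((\<Union>i<k. C i) - (\<Union>i. a i))) < e"
    using k by linarith
   then show "\<exists>n. \<exists>C\<in>cyls n. ?m (((\<Union>i. a i) - C) \<union> (C - (\<Union>i. a i))) < e" using Cm by blast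
  qed
 qed
 then show ?thesis using e by blast
qed

section \<open>Densities and the negative part of the entropy\<close>

lemma RN_real_density:
 assumes p: "prob_space p" and r: "prob_space r" and s: "sets p = sets r" and ac: "absolutely_continuous r p"
 defines "h \<equiv> \<lambda>x. enn2real (RN_deriv r p x)"
 shows "p = density r (\<lambda>x. ennreal (h x))" "h \<in> borel_measurable r" "AE x in p. h x > 0"
proof -
 interpret p: prob_space p by fact
 interpret r: prob_space r by fact
 show m: "h \<in> borel_measurable r" unfolding h_def by measurable
 have "AE x in r. RN_deriv r p x \<noteq> \<infinity>"
  by (rule r.RN_deriv_finite[OF p.sigma_finite_measure_axioms ac s])
 then have "AE x in r. RN_deriv r p x = ennreal (h x)"
  by eventually_elim (simp add: h_def less_top)
 then have "density r (RN_deriv r p) = density r (\<lambda>x. ennreal (h x))"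
  using m by (intro density_cong) auto
 then show d: "p = density r (\<lambda>x. ennreal (h x))"
  using r.density_RN_deriv[OF ac s] by simp
 have "AE x in density r (\<lambda>x. ennreal (h x)). h x > 0"
  using m by (subst AE_density) (auto intro!: AE_I2)
 then show "AE x in p. h x > 0" by (simp only: d[symmetric])
qed

text \<open>From - t ln t \<le> 1 - t. It is why the difference in \<open>rel_entropy\<close> never
  takes the form \<infinity> - \<infinity>.\<close>

lemma neg_log_density_finite:
 assumes r: "prob_space r" and m: "h \<in> borel_measurable r" and nn: "\<And>x. h x \<ge> 0"
 shows "(\<integral>\<^sup>+ x. ennreal (- ln (h x)) \<partial>density r (\<lambda>x. ennreal (h x))) \<le> 1"
proof -
 interpret r: prob_space r by fact
 have "ennreal t * ennreal (- ln t) \<le> 1" if "t \<ge> 0" for t :: real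
 proof (cases "0 < t \<and> t < 1")
  case True
  have "ln (1 / t) \<le> 1 / t - 1" using True by (intro ln_le_minus_one) simp
  then have "t * (- ln t) \<le> t * (1 / t - 1)" using True by (intro mult_left_mono) (auto simp: ln_div)
  also have "... \<le> 1" using True by (simp add: field_simps)
  finally have "ennreal (t * (- ln t)) \<le> 1" by (simp add: ennreal_le_1)
  then show ?thesis using True by (simp add: ennreal_mult[symmetric])
 next
  case False
  then have "t = 0 \<or> t \<ge> 1" using that by auto
  then show ?thesis by (auto simp: ennreal_neg)
 qed
 then have "(\<integral>\<^sup>+ x. ennreal (h x) * ennreal (- ln (h x)) \<partial>r) \<le> (\<integral>\<^sup>+ x. 1 \<partial>r)"
  using nn by (intro nn_integral_mono) simp
 also have "... = 1" by (simp add: r.emeasure_space_1)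
 finally show ?thesis using m by (subst nn_integral_density) auto
qed

section \<open>Variational formula for the relative entropy\<close>

lemma integrable_bounded_prob:
 fixes f :: "'a => real"
 assumes "prob_space M" "f \<in> borel_measurable M" "\<And>x. \<bar>f x\<bar> \<le> K"
 shows "integrable M f"
proof -
 interpret prob_space M by fact
 show ?thesis using assms by (intro integrable_const_bound[of _ K]) auto
qed

lemma integral_exp_bounded_pos:
 fixes f :: "'a => real"
 assumes M: "prob_space M" and f: "f \<in> borel_measurable M" "\<And>x. \<bar>f x\<bar> \<le> K"
 shows "integrable M (\<lambda>x. exp (f x))" "(\<integral>x. exp (f x) \<partial>M) \<ge> exp (- K)"
proof -
 interpret prob_space M by fact
 have fK: "f x \<le> K" for x using f(2)[of x] by linarith
 have Kf: "- K \<le> f x" for x using f(2)[of x] by linarith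
 then show i: "integrable M (\<lambda>x. exp (f x))"
  using f(1) fK by (intro integrable_bounded_prob[OF M, of _ "exp K"]) auto
 have "(\<integral>x. exp (- K) \<partial>M) \<le> (\<integral>x. exp (f x) \<partial>M)"
  using i Kf by (intro integral_mono) auto
 then show "(\<integral>x. exp (f x) \<partial>M) \<ge> exp (- K)" by (simp add: prob_space)
qed

text \<open>With Z the integral of exp f under r and h the density, f - ln h - ln Z is the logarithm
  of exp f / (h Z) and so at most this quotient minus 1; the quotient has p-integral at most 1, and
  less if r charges the zeros of h.\<close>

lemma rel_entropy_ge:
 assumes p: "prob_space p" and r: "prob_space r" and s: "sets p = sets r"
  and f: "f \<in> borel_measurable r" "\<And>x. \<bar>f x\<bar> \<le> K"
 shows "ereal ((\<integral>x. f x \<partial>p) - ln (\<integral>x. exp (f x) \<partial>r)) \<le> rel_entropy p r"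
proof (cases "absolutely_continuous r p")
 case ac: True
 interpret p: prob_space p by fact
 interpret r: prob_space r by fact
 define h where "h x = enn2real (RN_deriv r p x)" for x
 note RN = RN_real_density[OF p r s ac, folded h_def]
 have h0: "h x \<ge> 0" for x by (simp add: h_def)
 have mp: "h \<in> borel_measurable p" "f \<in> borel_measurable p"
  using RN(2) f(1) s by (simp_all cong: measurable_cong_sets)
 define Lm where "Lm = (\<integral>\<^sup>+ x. ennreal (- ln (h x)) \<partial>p)"
 define Lp where "Lp = (\<integral>\<^sup>+ x. ennreal (ln (h x)) \<partial>p)"
 have Lm: "Lm \<le> 1" unfolding Lm_def using neg_log_density_finite[OF r RN(2) h0] RN(1) by simp
 have rel: "rel_entropy p r = enn2ereal Lp - enn2ereal Lm"
  using ac by (simp add: rel_entropy_def Lp_def Lm_def h_def)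
 show ?thesis
 proof (cases "Lp = \<infinity>")
  case True
  have "Lm \<noteq> \<infinity>" using Lm by (auto simp: top_unique)
  then have "rel_entropy p r = \<infinity>" unfolding rel using True by (cases Lm) auto
  then show ?thesis by simp
 next
  case False
  have int: "integrable p (\<lambda>x. ln (h x))"
  proof (rule integrableI_bounded)
   show "(\<lambda>x. ln (h x)) \<in> borel_measurable p" using mp by measurable
   have "(\<integral>\<^sup>+ x. ennreal (norm (ln (h x))) \<partial>p) = (\<integral>\<^sup>+ x. ennreal (ln (h x)) + ennreal (- ln (h x)) \<partial>p)"
    by (intro nn_integral_cong) (auto simp: abs_if ennreal_neg)
   also have "... = Lp + Lm" unfolding Lp_def Lm_def using mp by (intro nn_integral_add) auto
   also have "Lm < \<infinity>" using Lm by (rule le_less_trans) simp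
   then have "Lp + Lm < \<infinity>" using False by (simp add: less_top)
   finally show "(\<integral>\<^sup>+ x. ennreal (norm (ln (h x))) \<partial>p) < \<infinity>" .
  qed
  have "rel_entropy p r = ereal (\<integral>x. ln (h x) \<partial>p)"
  proof -
   have "Lm \<noteq> \<infinity>" using Lm by (auto simp: top_unique)
   then have "enn2ereal Lp - enn2ereal Lm = ereal (enn2real Lp - enn2real Lm)"
    using False by (cases Lp; cases Lm) auto
   then show ?thesis unfolding rel real_lebesgue_integral_def[OF int] Lp_def Lm_def .
  qed
  moreover
  define Z where "Z = (\<integral>x. exp (f x) \<partial>r)"
  have Z: "Z > 0" using integral_exp_bounded_pos(2)[OF r f] unfolding Z_def
   by (rule less_le_trans[rotated]) simp
  have fi: "integrable p f" by (rule integrable_bounded_prob[OF p mp(2) f(2)])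
  have nnh: "(\<integral>\<^sup>+ x. ennreal (exp (f x) / (h x * Z)) \<partial>p) \<le> 1"
  proof -
   have "(\<integral>\<^sup>+ x. ennreal (exp (f x) / (h x * Z)) \<partial>p)
     = (\<integral>\<^sup>+ x. ennreal (h x) * ennreal (exp (f x) / (h x * Z)) \<partial>r)"
    using RN(2) f(1) by (subst RN(1), subst nn_integral_density) auto
   also have "... \<le> (\<integral>\<^sup>+ x. ennreal (exp (f x) / Z) \<partial>r)"
    using Z h0 by (intro nn_integral_mono) (auto simp: ennreal_mult[symmetric] intro!: ennreal_leI)
   also have "... = ennreal (\<integral>x. exp (f x) / Z \<partial>r)"
    using integral_exp_bounded_pos(1)[OF r f] Z by (intro nn_integral_eq_integral) auto
   also have "... = 1" using Z by (simp add: Z_def)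
   finally show ?thesis .
  qed
  have hi: "integrable p (\<lambda>x. exp (f x) / (h x * Z))"
   using nnh mp h0 Z by (intro integrableI_bounded) (auto simp: less_top top_unique le_less_trans)
  have h1: "(\<integral>x. exp (f x) / (h x * Z) \<partial>p) \<le> 1"
   using nnh nn_integral_eq_integral[OF hi] h0 Z by simp
  have "(\<integral>x. f x - ln (h x) - ln Z \<partial>p) \<le> (\<integral>x. exp (f x) / (h x * Z) - 1 \<partial>p)"
  proof (rule integral_mono_AE)
   show "AE x in p. f x - ln (h x) - ln Z \<le> exp (f x) / (h x * Z) - 1"
    using RN(3)
   proof eventually_elim
    case (elim x)
    then have "ln (exp (f x) / (h x * Z)) \<le> exp (f x) / (h x * Z) - 1"
     using Z by (intro ln_le_minus_one) simp
    then show ?case using elim Z by (simp add: ln_div ln_mult)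
   qed
  qed (use fi int hi in auto)
  then have "(\<integral>x. f x \<partial>p) - (\<integral>x. ln (h x) \<partial>p) - ln Z \<le> 0"
   using fi int hi h1 by (simp add: p.prob_space)
  ultimately show ?thesis by (simp add: Z_def)
 qed
qed (simp add: rel_entropy_def)

text \<open>Large multiples of indicators as test functions give absolute continuity; truncations of
  the log-density, the formal maximiser in the variational formula, then give the bound.\<close>

lemma rel_entropy_le:
 assumes p: "prob_space p" and r: "prob_space r" and s: "sets p = sets r"
  and le: "\<And>f K. f \<in> borel_measurable r ==> (\<And>x. \<bar>f x\<bar> \<le> K) ==> (\<integral>x. f x \<partial>p) \<le> ln (\<integral>x. exp (f x) \<partial>r) + c"
 shows "rel_entropy p r \<le> ereal c"
proof -
 interpret p: prob_space p by fact
 interpret r: prob_space r by fact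
 have ac: "absolutely_continuous r p"
  unfolding absolutely_continuous_def
 proof
  fix A assume A: "A \<in> null_sets r"
  then have Ap: "A \<in> sets p" "A \<in> sets r" using s by auto
  \<comment> \<open>For an r-null set A the test function n times the indicator of A is invisible to
    r, so n p(A) \<le> c for all n.\<close>
  have "real n * measure p A \<le> c" for n :: nat
  proof -
   have "(\<integral>x. real n * indicator A x \<partial>p) \<le> ln (\<integral>x. exp (real n * indicator A x) \<partial>r) + c"
    using Ap by (intro le[of _ "real n"]) (auto simp: indicator_def)
   moreover have "(\<integral>x. exp (real n * indicator A x) \<partial>r) = (\<integral>x. 1 \<partial>r)"
    using A Ap by (intro integral_cong_AE) (auto intro!: eventually_mono[OF AE_not_in[OF A]])
   ultimately show ?thesis using Ap by (simp add: r.prob_space)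
  qed
  then have "measure p A \<le> 0"
   by (metis linorder_not_le reals_Archimedean3 mult.commute)
  then show "A \<in> null_sets p" using Ap by (auto simp: null_sets_def p.emeasure_eq_measure ennreal_eq_0_iff)
 qed
 define h where "h x = enn2real (RN_deriv r p x)" for x
 note RN = RN_real_density[OF p r s ac, folded h_def]
 have h0: "h x \<ge> 0" for x by (simp add: h_def)
 have mp: "h \<in> borel_measurable p"
  using RN(2) s by (simp_all cong: measurable_cong_sets)
 define Lm where "Lm = (\<integral>\<^sup>+ x. ennreal (- ln (h x)) \<partial>p)"
 define Lp where "Lp = (\<integral>\<^sup>+ x. ennreal (ln (h x)) \<partial>p)"
 have Lm: "Lm \<le> 1" unfolding Lm_def using neg_log_density_finite[OF r RN(2) h0] RN(1) by simp
 have rel: "rel_entropy p r = enn2ereal Lp - enn2ereal Lm"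
  using ac by (simp add: rel_entropy_def Lp_def Lm_def h_def)
 obtain l where l: "Lm = ennreal l" "l \<ge> 0" using Lm by (cases Lm) (auto simp: top_unique)
 \<comment> \<open>Where h = 0 the convention ln 0 = 0 would put g = 0 and spoil exp (g n) \<le> h +
   exp (-n); the value -n is set by hand.\<close>
 define g where "g n x = (if h x = 0 then - real n else max (- real n) (min (real n) (ln (h x))))" for n x
 have gm: "g n \<in> borel_measurable r" "g n \<in> borel_measurable p" for n
  unfolding g_def using RN(2) mp by measurable
 have gb: "\<bar>g n x\<bar> \<le> real n" for n x by (auto simp: g_def)
 have part: "(\<integral>\<^sup>+ x. ennreal (min (real n) (ln (h x))) \<partial>p) \<le> ennreal (exp (- real n) + c + l)" for n
 proof -
  have "(\<integral>x. exp (g n x) \<partial>r) \<le> (\<integral>x. h x + exp (- real n) \<partial>r)"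
  proof (rule integral_mono)
   have "(\<integral>\<^sup>+ x. ennreal (h x) \<partial>r) = emeasure p (space p)"
    using RN(2) by (subst (2) RN(1)) (auto simp: emeasure_density RN(1) intro!: nn_integral_cong)
   then have "integrable r h" using RN(2) h0 p.emeasure_space_1 by (intro integrableI_bounded) auto
   then show "integrable r (\<lambda>x. h x + exp (- real n))" by simp
   show "exp (g n x) \<le> h x + exp (- real n)" for x
   proof (cases "h x = 0")
    case False
    then have "h x > 0" using h0[of x] by simp
    have "g n x \<le> max (- real n) (ln (h x))" using False by (auto simp: g_def)
    then have "exp (g n x) \<le> max (exp (- real n)) (h x)"
     using \<open>h x > 0\<close> by (metis exp_le_cancel_iff exp_ln max_def)
    also have "... \<le> h x + exp (- real n)" using h0[of x] by simp
    finally show ?thesis .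
   qed (simp add: g_def)
  qed (rule integral_exp_bounded_pos(1)[OF r gm(1) gb])
  also have "(\<integral>x. h x + exp (- real n) \<partial>r) \<le> 1 + exp (- real n)"
  proof -
   have "(\<integral>\<^sup>+ x. ennreal (h x) \<partial>r) = emeasure p (space p)"
    using RN(2) by (subst (2) RN(1)) (auto simp: emeasure_density RN(1) intro!: nn_integral_cong)
   then have n1: "(\<integral>\<^sup>+ x. ennreal (h x) \<partial>r) = 1" using p.emeasure_space_1 by simp
   then have i: "integrable r h" using RN(2) h0 by (intro integrableI_bounded) auto
   then have "(\<integral>x. h x \<partial>r) = 1" using n1 nn_integral_eq_integral[OF i] h0 by simp
   then show ?thesis using i by (simp add: r.prob_space)
  qed
  finally have "ln (\<integral>x. exp (g n x) \<partial>r) \<le> ln (1 + exp (- real n))"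
   using integral_exp_bounded_pos(2)[OF r gm(1) gb, of n]
   by (intro ln_mono) (auto intro: less_le_trans[OF exp_gt_zero])
  also have "... \<le> exp (- real n)" by (rule ln_add_one_self_le_self) simp
  finally have gp: "(\<integral>x. g n x \<partial>p) \<le> exp (- real n) + c"
   using le[OF gm(1) gb, of n] by linarith
  have i1: "integrable p (\<lambda>x. max 0 (g n x))" "integrable p (\<lambda>x. max 0 (- g n x))"
   using gm(2) gb[of n] by (auto intro!: integrable_bounded_prob[OF p, of _ "real n"] simp: abs_le_iff max_def)
  have "(\<integral>x. max 0 (- g n x) \<partial>p) \<le> l"
  proof -
   have "ennreal (\<integral>x. max 0 (- g n x) \<partial>p) = (\<integral>\<^sup>+ x. ennreal (max 0 (- g n x)) \<partial>p)"
    using i1(2) by (intro nn_integral_eq_integral[symmetric]) auto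
   also have "... \<le> Lm" unfolding Lm_def
   proof (intro nn_integral_mono_AE eventually_mono[OF RN(3)])
    fix x assume "h x > 0"
    then have "max 0 (- g n x) \<le> max 0 (- ln (h x))" by (auto simp: g_def)
    then have "ennreal (max 0 (- g n x)) \<le> ennreal (max 0 (- ln (h x)))" by (rule ennreal_leI)
    then show "ennreal (max 0 (- g n x)) \<le> ennreal (- ln (h x))" by simp
   qed
   finally show ?thesis using l by simp
  qed
  moreover have "(\<integral>x. max 0 (g n x) \<partial>p) = (\<integral>x. g n x \<partial>p) + (\<integral>x. max 0 (- g n x) \<partial>p)"
  proof -
   have "integrable p (g n)" by (rule integrable_bounded_prob[OF p gm(2) gb])
   then have "(\<integral>x. g n x \<partial>p) + (\<integral>x. max 0 (- g n x) \<partial>p) = (\<integral>x. g n x + max 0 (- g n x) \<partial>p)"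
    using i1 by simp
   also have "... = (\<integral>x. max 0 (g n x) \<partial>p)" by (intro Bochner_Integration.integral_cong) auto
   finally show ?thesis by simp
  qed
  ultimately have "(\<integral>x. max 0 (g n x) \<partial>p) \<le> exp (- real n) + c + l" using gp by linarith
  moreover have "(\<integral>\<^sup>+ x. ennreal (min (real n) (ln (h x))) \<partial>p) \<le> (\<integral>\<^sup>+ x. ennreal (max 0 (g n x)) \<partial>p)"
  proof (intro nn_integral_mono_AE eventually_mono[OF RN(3)])
   fix x assume "h x > 0"
   then have "min (real n) (ln (h x)) \<le> max 0 (g n x)" by (auto simp: g_def)
   then show "ennreal (min (real n) (ln (h x))) \<le> ennreal (max 0 (g n x))" by (rule ennreal_leI)
  qed
  moreover have "(\<integral>\<^sup>+ x. ennreal (max 0 (g n x)) \<partial>p) = ennreal (\<integral>x. max 0 (g n x) \<partial>p)"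
   using i1(1) by (intro nn_integral_eq_integral) auto
  ultimately show ?thesis by (metis ennreal_leI order_trans)
 qed
 \<comment> \<open>The truncation of the integrand is frozen at m while the error exp (-n) goes to
   zero; monotone convergence in m comes afterwards.\<close>
 have part': "(\<integral>\<^sup>+ x. ennreal (min (real m) (ln (h x))) \<partial>p) \<le> ennreal (c + l)" for m :: nat
 proof (rule tendsto_lowerbound)
  have "(\<lambda>n::nat. exp (- real n) + c + l) \<longlonglongrightarrow> 0 + c + l"
   by (intro tendsto_add tendsto_const filterlim_compose[OF exp_at_bot] filterlim_compose[OF filterlim_uminus_at_bot_at_top] filterlim_real_sequentially)
  then show "(\<lambda>n::nat. ennreal (exp (- real n) + c + l)) \<longlonglongrightarrow> ennreal (c + l)"
   by (intro tendsto_ennrealI) simp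
  show "\<forall>\<^sub>F n in sequentially. (\<integral>\<^sup>+ x. ennreal (min (real m) (ln (h x))) \<partial>p) \<le> ennreal (exp (- real n) + c + l)"
  proof (rule eventually_mono[OF eventually_ge_at_top[of m]])
   fix n assume "m \<le> n"
   then have "(\<integral>\<^sup>+ x. ennreal (min (real m) (ln (h x))) \<partial>p) \<le> (\<integral>\<^sup>+ x. ennreal (min (real n) (ln (h x))) \<partial>p)"
    by (intro nn_integral_mono ennreal_leI) auto
   then show "(\<integral>\<^sup>+ x. ennreal (min (real m) (ln (h x))) \<partial>p) \<le> ennreal (exp (- real n) + c + l)"
    using part[of n] by (rule order_trans)
  qed
 qed simp
 have "Lp \<le> ennreal (c + l)"
 proof -
  have sup: "ennreal (ln (h x)) = (SUP m::nat. ennreal (min (real m) (ln (h x))))" for x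
  proof (rule antisym)
   obtain m :: nat where "ln (h x) \<le> real m" using real_arch_simple by blast
   then have "ennreal (ln (h x)) = ennreal (min (real m) (ln (h x)))" by (simp add: min_def)
   also have "... \<le> (SUP m::nat. ennreal (min (real m) (ln (h x))))" by (rule SUP_upper) simp
   finally show "ennreal (ln (h x)) \<le> (SUP m::nat. ennreal (min (real m) (ln (h x))))" .
  qed (auto intro!: SUP_least ennreal_leI)
  have "Lp = (SUP m::nat. \<integral>\<^sup>+ x. ennreal (min (real m) (ln (h x))) \<partial>p)"
   unfolding Lp_def sup
  proof (rule nn_integral_monotone_convergence_SUP)
   show "incseq (\<lambda>m x. ennreal (min (real m) (ln (h x))))"
    by (auto simp: incseq_def le_fun_def intro!: ennreal_leI)
  qed (use mp in measurable)
  also have "... \<le> ennreal (c + l)" using part' by (intro SUP_least)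
  finally show ?thesis .
 qed
 have cl: "c + l \<ge> 0"
 proof -
  have "(\<integral>x. 0 \<partial>p) \<le> ln (\<integral>x. exp 0 \<partial>r) + c" using le[of "\<lambda>_. 0" 0] by simp
  then have "c \<ge> 0" by (simp add: r.prob_space)
  then show ?thesis using l by simp
 qed
 obtain L where L: "Lp = ennreal L" "L \<ge> 0" using \<open>Lp \<le> ennreal (c + l)\<close> by (cases Lp) (auto simp: top_unique)
 then have "L \<le> c + l" using \<open>Lp \<le> ennreal (c + l)\<close> cl by simp
 then show ?thesis unfolding rel using L l by (simp add: enn2ereal_ennreal)
qed

lemma rel_entropy_nonneg:
 assumes "prob_space p" "prob_space r" "sets p = sets r"
 shows "rel_entropy p r \<ge> 0"
proof -
 interpret r: prob_space r by fact
 show ?thesis using rel_entropy_ge[OF assms, of "\<lambda>_. 0" 0] by (simp add: r.prob_space zero_ereal_def)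
qed

text \<open>Rounding \<open>F\<close> down to multiples of \<open>1/N\<close> turns it into a sum of indicators, each of
 which is approximated by the indicator of a cylinder; the sum then has the same bound as \<open>F\<close>.\<close>

lemma cylinder_function_approx:
 fixes \<mu> \<mu>' :: "'a::{metric_space, second_countable_topology} cpath measure" and F :: "'a cpath => real"
 assumes \<mu>: "prob_space \<mu>" "sets \<mu> = sets borel" and \<mu>': "prob_space \<mu>'" "sets \<mu>' = sets borel"
  and F: "F \<in> borel_measurable borel" "\<And>w. \<bar>F w\<bar> \<le> real K" and e: "e > 0"
 obtains n g where "g \<in> borel_measurable (PiM {..2 ^ n} (\<lambda>_. borel :: 'a measure))" "\<And>x. \<bar>g x\<bar> \<le> real K"
  "\<bar>(\<integral>w. F w \<partial>\<mu>) - (\<integral>w. g (samp (2 ^ n) w) \<partial>\<mu>)\<bar> < e"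
  "(\<integral>w. \<bar>F w - g (samp (2 ^ n) w)\<bar> \<partial>\<mu>') < e"
proof -
 interpret \<mu>: prob_space \<mu> by fact
 interpret \<mu>': prob_space \<mu>' by fact
 obtain N0 where "1 / real (Suc N0) < e / 2" using e nat_approx_posE[of "e / 2"] by auto
 then obtain N :: nat where N: "N > 0" "1 / real N < e / 2" by (metis zero_less_Suc)
 \<comment> \<open>J levels of height 1/N exhaust the range [0, 2 K] of F + K, and the number of
   levels reached at w is the floor of N (F w + K).\<close>
 define J where "J = 2 * K * N"
 define A where "A j = {w. F w + K \<ge> real (Suc j) / N}" for j
 have Am: "A j \<in> sets borel" for j
  using F(1) unfolding A_def by measurable
 \<comment> \<open>J symmetric differences of measure below \<delta> add up to at most e / 2; the
   rounding takes the other half.\<close>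
 define \<delta> where "\<delta> = e / (2 * (real J + 1))"
 have \<delta>: "\<delta> > 0" using e by (simp add: \<delta>_def)
 have "\<exists>n C. C \<in> cyls n \<and> measure \<mu> ((A j - C) \<union> (C - A j)) + measure \<mu>' ((A j - C) \<union> (C - A j)) < \<delta>" for j
  using cyls_approx[OF \<mu>.finite_measure_axioms \<mu>(2) \<mu>'.finite_measure_axioms \<mu>'(2) Am \<delta>] by blast
 then obtain nn C where C: "\<And>j. C j \<in> cyls (nn j)"
  "\<And>j. measure \<mu> ((A j - C j) \<union> (C j - A j)) + measure \<mu>' ((A j - C j) \<union> (C j - A j)) < \<delta>" by metis
 define n where "n = Max (nn ` {..J})"
 have Cn: "C j \<in> cyls n" if "j < J" for j
  using C(1)[of j] cyls_mono[of "nn j" n] that by (auto simp: n_def)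
 then have "\<forall>j\<in>{..<J}. \<exists>B. C j = samp (2 ^ n) -` B \<and> B \<in> sets (PiM {..2 ^ n} (\<lambda>_. borel :: 'a measure))"
  unfolding cyls_def by auto
 then obtain B where B: "\<And>j. j < J ==> C j = samp (2 ^ n) -` B j"
  "\<And>j. j < J ==> B j \<in> sets (PiM {..2 ^ n} (\<lambda>_. borel :: 'a measure))" by (metis lessThan_iff)
 define g where "g x = (\<Sum>j<J. indicator (B j) x) / N - real K" for x :: "nat => 'a"
 have gm: "g \<in> borel_measurable (PiM {..2 ^ n} (\<lambda>_. borel :: 'a measure))"
  unfolding g_def using B(2) by (intro borel_measurable_diff borel_measurable_divide borel_measurable_sum borel_measurable_indicator borel_measurable_const) auto
 have gb: "\<bar>g x\<bar> \<le> real K" for x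
 proof -
  have "0 \<le> (\<Sum>j<J. indicator (B j) x :: real)" by (intro sum_nonneg) simp
  moreover have "(\<Sum>j<J. indicator (B j) x :: real) \<le> (\<Sum>j<J. 1)" by (intro sum_mono) (simp add: indicator_def)
  ultimately have "0 \<le> (\<Sum>j<J. indicator (B j) x :: real) / N" "(\<Sum>j<J. indicator (B j) x :: real) / N \<le> 2 * K"
   using N by (auto simp: J_def field_simps)
  then show ?thesis unfolding g_def by (simp add: abs_le_iff)
 qed
 define G where "G w = (\<Sum>j<J. indicator (A j) w) / N - real K" for w
 have FG: "\<bar>F w - G w\<bar> \<le> 1 / N" for w
 proof -
  define y where "y = (F w + K) * N"
  have y: "0 \<le> y" "y \<le> real J"
  proof -
   have "0 \<le> F w + K" "F w + K \<le> 2 * K" using F(2)[of w] by linarith+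
   then show "0 \<le> y" "y \<le> real J" unfolding y_def J_def by (auto intro!: mult_right_mono)
  qed
  have "(\<Sum>j<J. indicator (A j) w :: real) = (\<Sum>j<J. if j < nat \<lfloor>y\<rfloor> then 1 else 0)"
  proof (intro sum.cong refl)
   fix j
   have "w \<in> A j \<longleftrightarrow> real (Suc j) \<le> y" using N by (simp add: A_def y_def pos_divide_le_eq)
   also have "... \<longleftrightarrow> int j + 1 \<le> \<lfloor>y\<rfloor>" unfolding le_floor_iff by (simp add: add.commute)
   also have "... \<longleftrightarrow> j < nat \<lfloor>y\<rfloor>" by linarith
   finally show "(indicator (A j) w :: real) = (if j < nat \<lfloor>y\<rfloor> then 1 else 0)" by (simp add: indicator_def)
  qed
  also have "... = real (card ({..<J} \<inter> {j. j < nat \<lfloor>y\<rfloor>}))" by (simp add: sum.If_cases)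
  also have "{..<J} \<inter> {j. j < nat \<lfloor>y\<rfloor>} = {..<nat \<lfloor>y\<rfloor>}"
  proof -
   have "nat \<lfloor>y\<rfloor> \<le> J" using y by (simp add: nat_le_iff floor_le_iff)
   then show ?thesis by auto
  qed
  finally have "(\<Sum>j<J. indicator (A j) w :: real) = of_int \<lfloor>y\<rfloor>" using y by simp
  then have "F w - G w = (y - of_int \<lfloor>y\<rfloor>) / N" using N by (simp add: G_def y_def field_simps)
  moreover have "0 \<le> y - of_int \<lfloor>y\<rfloor>" "y - of_int \<lfloor>y\<rfloor> \<le> 1" by linarith+
  ultimately show ?thesis using N by (simp add: divide_right_mono)
 qed
 have Gg: "\<bar>G w - g (samp (2 ^ n) w)\<bar> \<le> (\<Sum>j<J. indicator ((A j - C j) \<union> (C j - A j)) w)" for w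
 proof -
  have "G w - g (samp (2 ^ n) w) = (\<Sum>j<J. indicator (A j) w - indicator (C j) w) / N"
  proof -
   have "(\<Sum>j<J. indicator (B j) (samp (2 ^ n) w) :: real) = (\<Sum>j<J. indicator (C j) w)"
    using B(1) by (intro sum.cong) (auto simp: indicator_def)
   then show ?thesis by (simp add: G_def g_def sum_subtractf diff_divide_distrib)
  qed
  also have "\<bar>...\<bar> \<le> \<bar>\<Sum>j<J. indicator (A j) w - indicator (C j) w :: real\<bar>"
  proof -
   have "\<bar>x / real N\<bar> \<le> \<bar>x\<bar>" for x :: real
    using N(1) divide_left_mono[of 1 "real N" "\<bar>x\<bar>"] by (simp add: abs_divide)
   then show ?thesis .
  qed
  also have "... \<le> (\<Sum>j<J. \<bar>indicator (A j) w - indicator (C j) w :: real\<bar>)" by (rule sum_abs)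
  also have "... = (\<Sum>j<J. indicator ((A j - C j) \<union> (C j - A j)) w)"
   by (intro sum.cong) (auto simp: indicator_def)
  finally show ?thesis .
 qed
 have main: "(\<integral>w. \<bar>F w - g (samp (2 ^ n) w)\<bar> \<partial>\<nu>) < e" "integrable \<nu> F" "integrable \<nu> (\<lambda>w. g (samp (2 ^ n) w))"
  if \<nu>: "prob_space \<nu>" "sets \<nu> = sets borel" "\<And>j. measure \<nu> ((A j - C j) \<union> (C j - A j)) < \<delta>" for \<nu>
 proof -
  interpret \<nu>: prob_space \<nu> by fact
  have Fm: "F \<in> borel_measurable \<nu>" using F(1) \<nu>(2) by (simp cong: measurable_cong_sets)
  have gsm: "(\<lambda>w. g (samp (2 ^ n) w)) \<in> borel_measurable \<nu>"
   using measurable_compose[OF measurable_samp gm] \<nu>(2) by (simp cong: measurable_cong_sets)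
  show i1: "integrable \<nu> F" by (rule integrable_bounded_prob[OF \<nu>(1) Fm F(2)])
  show i2: "integrable \<nu> (\<lambda>w. g (samp (2 ^ n) w))" by (rule integrable_bounded_prob[OF \<nu>(1) gsm gb])
  have Dm: "(A j - C j) \<union> (C j - A j) \<in> sets \<nu>" for j
   using Am cyls_sets[OF C(1)] \<nu>(2) by auto
  then have id: "integrable \<nu> (indicator ((A j - C j) \<union> (C j - A j)) :: _ => real)" for j
   by (auto simp: \<nu>.emeasure_eq_measure)
  have "(\<integral>w. \<bar>F w - g (samp (2 ^ n) w)\<bar> \<partial>\<nu>) \<le> (\<integral>w. 1 / N + (\<Sum>j<J. indicator ((A j - C j) \<union> (C j - A j)) w) \<partial>\<nu>)"
  proof (rule integral_mono)
   show "integrable \<nu> (\<lambda>w. \<bar>F w - g (samp (2 ^ n) w)\<bar>)" using i1 i2 by auto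
   show "integrable \<nu> (\<lambda>w. 1 / N + (\<Sum>j<J. indicator ((A j - C j) \<union> (C j - A j)) w))"
    using id by (intro Bochner_Integration.integrable_add Bochner_Integration.integrable_sum) auto
   fix w
   show "\<bar>F w - g (samp (2 ^ n) w)\<bar> \<le> 1 / N + (\<Sum>j<J. indicator ((A j - C j) \<union> (C j - A j)) w)"
    using FG[of w] Gg[of w] by linarith
  qed
  also have "... = (\<integral>w. 1 / N \<partial>\<nu>) + (\<integral>w. (\<Sum>j<J. indicator ((A j - C j) \<union> (C j - A j)) w :: real) \<partial>\<nu>)"
   using id by (intro Bochner_Integration.integral_add Bochner_Integration.integrable_sum) simp_all
  also have "(\<integral>w. (\<Sum>j<J. indicator ((A j - C j) \<union> (C j - A j)) w :: real) \<partial>\<nu>) = (\<Sum>j<J. \<integral>w. indicator ((A j - C j) \<union> (C j - A j)) w \<partial>\<nu>)"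
   using id by (intro Bochner_Integration.integral_sum)
  also have "... = (\<Sum>j<J. measure \<nu> ((A j - C j) \<union> (C j - A j)))"
  proof (intro sum.cong refl)
   fix j
   have "((A j - C j) \<union> (C j - A j)) \<inter> space \<nu> = (A j - C j) \<union> (C j - A j)"
    using sets.sets_into_space[OF Dm[of j]] by (rule Int_absorb2)
   then show "(\<integral>w. indicator ((A j - C j) \<union> (C j - A j)) w \<partial>\<nu>) = measure \<nu> ((A j - C j) \<union> (C j - A j))"
    by (simp only: Bochner_Integration.integral_indicator)
  qed
  also have "(\<integral>w. 1 / N \<partial>\<nu>) = 1 / real N" by (simp add: \<nu>.prob_space)
  also have "(\<Sum>j<J. measure \<nu> ((A j - C j) \<union> (C j - A j))) \<le> (\<Sum>j<J. \<delta>)"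
   using \<nu>(3) by (intro sum_mono less_imp_le)
  also have "... \<le> e / 2" using e by (simp add: \<delta>_def field_simps)
  finally show "(\<integral>w. \<bar>F w - g (samp (2 ^ n) w)\<bar> \<partial>\<nu>) < e" using N(2) by linarith
 qed
 have "measure \<mu> ((A j - C j) \<union> (C j - A j)) < \<delta>" for j
  by (rule le_less_trans[OF _ C(2)[of j]]) simp
 note m1 = main[OF \<mu> this]
 have "measure \<mu>' ((A j - C j) \<union> (C j - A j)) < \<delta>" for j
  by (rule le_less_trans[OF _ C(2)[of j]]) simp
 note m2 = main[OF \<mu>' this]
 have "\<bar>(\<integral>w. F w \<partial>\<mu>) - (\<integral>w. g (samp (2 ^ n) w) \<partial>\<mu>)\<bar> \<le> (\<integral>w. \<bar>F w - g (samp (2 ^ n) w)\<bar> \<partial>\<mu>)"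
  unfolding Bochner_Integration.integral_diff[OF m1(2,3), symmetric] by (rule integral_abs_bound)
 then show ?thesis using that[OF gm gb] m1(1) m2(1) by linarith
qed

text \<open>On uniformly bounded functions, the logarithm of the r-integral of exp f is stable under
  perturbations small in L^1(r); so cylinder functions, which approximate f in the p-mean at the
  same time, suffice as tests.\<close>

lemma rel_entropy_le_cyl:
 fixes p r :: "'a::{metric_space, second_countable_topology} cpath measure"
 assumes p: "prob_space p" "sets p = sets borel" and r: "prob_space r" "sets r = sets borel"
  and le: "\<And>n g K. g \<in> borel_measurable (PiM {..2 ^ n} (\<lambda>_. borel)) ==> (\<And>x. \<bar>g x\<bar> \<le> K) ==>
   (\<integral>w. g (samp (2 ^ n) w) \<partial>p) \<le> ln (\<integral>w. exp (g (samp (2 ^ n) w)) \<partial>r) + c"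
 shows "rel_entropy p r \<le> ereal c"
proof (rule rel_entropy_le[OF p(1) r(1)])
 show "sets p = sets r" using p r by simp
 fix f :: "'a cpath => real" and K0 assume f: "f \<in> borel_measurable r" and fK0: "\<And>x. \<bar>f x\<bar> \<le> K0"
 interpret p: prob_space p by fact
 interpret r: prob_space r by fact
 obtain K :: nat where "K0 \<le> real K" using real_arch_simple by blast
 then have fK: "\<bar>f x\<bar> \<le> real K" for x using fK0[of x] by linarith
 have fm: "f \<in> borel_measurable borel" using f r(2) by (simp cong: measurable_cong_sets)
 define X where "X = (\<integral>x. exp (f x) \<partial>r)"
 have X: "X \<ge> exp (- real K)" "X > 0"
 proof -
  show "X \<ge> exp (- real K)" unfolding X_def by (rule integral_exp_bounded_pos(2)[OF r(1) f fK])
  then show "X > 0" by (rule less_le_trans[OF exp_gt_zero])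
 qed
 \<comment> \<open>The error is e in the p-integral and (exp K / X) e in the logarithm; together
   they make e * L = d.\<close>
 define L where "L = 1 + exp (real K) / X"
 have L: "L > 0" using X by (simp add: L_def add_pos_pos)
 show "(\<integral>x. f x \<partial>p) \<le> ln (\<integral>x. exp (f x) \<partial>r) + c"
 proof (rule field_le_epsilon)
  fix d :: real assume d: "d > 0"
  define e where "e = d / L"
  have e: "e > 0" using d L by (simp add: e_def)
  obtain n g where g: "g \<in> borel_measurable (PiM {..2 ^ n} (\<lambda>_. borel :: 'a measure))" "\<And>x. \<bar>g x\<bar> \<le> real K"
   "\<bar>(\<integral>w. f w \<partial>p) - (\<integral>w. g (samp (2 ^ n) w) \<partial>p)\<bar> < e"
   "(\<integral>w. \<bar>f w - g (samp (2 ^ n) w)\<bar> \<partial>r) < e"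
    by (rule cylinder_function_approx[OF p r fm fK e], rule that)
  let ?g = "\<lambda>w. g (samp (2 ^ n) w)"
  have gm: "?g \<in> borel_measurable r"
   using measurable_compose[OF measurable_samp g(1)] r(2) by (simp cong: measurable_cong_sets)
  have exp_lip: "exp a \<le> exp b + exp (real K) * \<bar>b - a\<bar>" if "\<bar>a\<bar> \<le> real K" for a b :: real
  proof -
   have "1 + (b - a) \<le> exp (b - a)" by (rule exp_ge_add_one_self)
   then have "exp a * (1 + (b - a)) \<le> exp a * exp (b - a)" by (intro mult_left_mono) auto
   then have "exp a \<le> exp b + exp a * (a - b)" by (simp add: exp_add[symmetric] algebra_simps)
   also have "exp a * (a - b) \<le> exp a * \<bar>b - a\<bar>" by (intro mult_left_mono) auto
   also have "... \<le> exp (real K) * \<bar>b - a\<bar>" using that by (intro mult_right_mono) auto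
   finally show ?thesis by simp
  qed
  have "(\<integral>w. exp (?g w) \<partial>r) \<le> (\<integral>w. exp (f w) + exp (real K) * \<bar>f w - ?g w\<bar> \<partial>r)"
  proof (rule integral_mono)
   show "integrable r (\<lambda>w. exp (?g w))" by (rule integral_exp_bounded_pos(1)[OF r(1) gm g(2)])
   have "\<bar>\<bar>f w - ?g w\<bar>\<bar> \<le> real K + real K" for w
    using fK[of w] g(2)[of "samp (2 ^ n) w"] by linarith
   then have "integrable r (\<lambda>w. \<bar>f w - ?g w\<bar>)" using f gm by (intro integrable_bounded_prob[OF r(1)]) auto
   then show "integrable r (\<lambda>w. exp (f w) + exp (real K) * \<bar>f w - ?g w\<bar>)"
    using integral_exp_bounded_pos(1)[OF r(1) f fK] by simp
   show "exp (?g w) \<le> exp (f w) + exp (real K) * \<bar>f w - ?g w\<bar>" for w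
    by (rule exp_lip[OF g(2)])
  qed
  also have "... = X + exp (real K) * (\<integral>w. \<bar>f w - ?g w\<bar> \<partial>r)"
  proof -
   have "\<bar>\<bar>f w - ?g w\<bar>\<bar> \<le> real K + real K" for w
    using fK[of w] g(2)[of "samp (2 ^ n) w"] by linarith
   then have "integrable r (\<lambda>w. \<bar>f w - ?g w\<bar>)" using f gm by (intro integrable_bounded_prob[OF r(1)]) auto
   then show ?thesis using integral_exp_bounded_pos(1)[OF r(1) f fK] by (simp add: X_def)
  qed
  also have "... \<le> X + exp (real K) * e" using g(4) by simp
  also have "... = X * (1 + exp (real K) / X * e)" using X(2) by (simp add: algebra_simps)
  finally have 1: "(\<integral>w. exp (?g w) \<partial>r) \<le> X * (1 + exp (real K) / X * e)" .
  have "(\<integral>w. exp (?g w) \<partial>r) \<ge> exp (- real K)" by (rule integral_exp_bounded_pos(2)[OF r(1) gm g(2)])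
  then have pos: "(\<integral>w. exp (?g w) \<partial>r) > 0" by (rule less_le_trans[OF exp_gt_zero])
  have t: "exp (real K) / X * e \<ge> 0" using X e by simp
  have "ln (\<integral>w. exp (?g w) \<partial>r) \<le> ln (X * (1 + exp (real K) / X * e))"
   using 1 pos by (intro ln_mono) auto
  also have "... = ln X + ln (1 + exp (real K) / X * e)" using X t by (intro ln_mult_pos) auto
  also have "ln (1 + exp (real K) / X * e) \<le> exp (real K) / X * e" by (rule ln_add_one_self_le_self[OF t])
  finally have "ln (\<integral>w. exp (?g w) \<partial>r) \<le> ln X + exp (real K) / X * e" by simp
  moreover have "(\<integral>w. ?g w \<partial>p) \<le> ln (\<integral>w. exp (?g w) \<partial>r) + c" by (rule le[OF g(1,2)])
  moreover have "e + exp (real K) / X * e = e * L" by (simp add: L_def algebra_simps)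
  moreover have "e * L = d" using L by (simp add: e_def)
  ultimately show "(\<integral>x. f x \<partial>p) \<le> ln (\<integral>x. exp (f x) \<partial>r) + c + d" using g(3) unfolding X_def by linarith
 qed
qed

section \<open>Gaussian measures\<close>

text \<open>The centred Gaussian density with covariance v times the identity, written with the norm
  so that shifts reduce to completing the square.\<close>

definition gdens :: "real => real ^ 'n::finite => real" where
 "gdens v x = (2 * pi * v) powr (- real CARD('n) / 2) * exp (- (norm x)\<^sup>2 / (2 * v))"

lemma norm_sq_vec: "(norm (x :: real ^ 'n::finite))\<^sup>2 = (\<Sum>i\<in>UNIV. (x $ i)\<^sup>2)"
 unfolding power2_norm_eq_inner inner_vec_def by (simp add: power2_eq_square)

lemma prod_normal_density:
 fixes x :: "real ^ 'n::finite"
 assumes "v > 0"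
 shows "(\<Prod>i\<in>UNIV. normal_density 0 (sqrt v) (x $ i)) = gdens v x"
proof -
 have "(\<Prod>i\<in>UNIV. normal_density 0 (sqrt v) (x $ i)) =
  (\<Prod>i\<in>(UNIV::'n set). 1 / sqrt (2 * pi * v)) * (\<Prod>i\<in>UNIV. exp (- (x $ i)\<^sup>2 / (2 * v)))"
  unfolding normal_density_def prod.distrib[symmetric] using assms by (intro prod.cong) auto
 also have "(\<Prod>i\<in>UNIV. exp (- (x $ i)\<^sup>2 / (2 * v))) = exp (- (norm x)\<^sup>2 / (2 * v))"
  by (simp add: exp_sum[symmetric] norm_sq_vec sum_negf sum_divide_distrib)
 also have "(\<Prod>i\<in>(UNIV::'n set). 1 / sqrt (2 * pi * v)) = (2 * pi * v) powr (- real CARD('n) / 2)"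
 proof -
  have "1 / sqrt (2 * pi * v) = (2 * pi * v) powr (- 1 / 2)"
   using assms by (simp add: powr_half_sqrt[symmetric] powr_minus_divide)
  then show ?thesis using assms by (simp add: powr_realpow[symmetric] powr_powr)
 qed
 finally show ?thesis by (simp add: gdens_def)
qed

lemma gdens_nonneg [simp]: "gdens v x \<ge> 0"
 by (simp add: gdens_def)

lemma gdens_minus [simp]: "gdens v (- x) = gdens v x"
 by (simp add: gdens_def)

lemma borel_measurable_gdens [measurable]: "gdens v \<in> borel_measurable borel"
 unfolding gdens_def by measurable

definition gauss :: "real => (real ^ 'n::finite) measure" where
 "gauss v = density lborel (\<lambda>x. ennreal (gdens v x))"

lemma sets_gauss [measurable_cong, simp]: "sets (gauss v) = sets borel"
 and space_gauss [simp]: "space (gauss v) = UNIV"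
 by (simp_all add: gauss_def)

lemma wrapped_gaussian_eq: "v > 0 ==> wrapped_gaussian v = distr (gauss v) borel proj"
 unfolding wrapped_gaussian_def gauss_def by (simp add: prod_normal_density)

lemma nn_integral_gauss:
 "f \<in> borel_measurable borel ==> (\<integral>\<^sup>+ x. f x \<partial>gauss v) = (\<integral>\<^sup>+ x. ennreal (gdens v x) * f x \<partial>lborel)"
 unfolding gauss_def by (subst nn_integral_density) auto

lemma prob_space_gauss:
 assumes v: "v > 0"
 shows "prob_space (gauss v :: (real ^ 'n::finite) measure)"
proof
 interpret N: product_sigma_finite "\<lambda>_ :: real ^ 'n. lborel :: real measure"
  by standard
 have ax: "(\<Prod>b\<in>Basis. normal_density 0 (sqrt v) ((x :: real ^ 'n) \<bullet> b)) = (\<Prod>i\<in>UNIV. normal_density 0 (sqrt v) (x $ i))" for x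
 proof -
  have B: "(Basis :: (real ^ 'n) set) = (\<lambda>i. axis i 1) ` UNIV" unfolding Basis_vec_def by auto
  have "inj (\<lambda>i :: 'n. axis i (1::real))" by (auto simp: inj_on_def axis_eq_axis)
  then show ?thesis unfolding B by (subst prod.reindex) (auto simp: inner_axis o_def)
 qed
 have "emeasure (gauss v) (space (gauss v :: (real ^ 'n) measure)) = (\<integral>\<^sup>+ x. ennreal (\<Prod>b\<in>Basis. normal_density 0 (sqrt v) ((x :: real ^ 'n) \<bullet> b)) \<partial>lborel)"
  by (simp add: gauss_def emeasure_density ax prod_normal_density[OF v])
 also have "... = (\<integral>\<^sup>+ f. ennreal (\<Prod>b\<in>Basis. normal_density 0 (sqrt v) (f b)) \<partial>PiM Basis (\<lambda>_ :: real ^ 'n. lborel))"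
  unfolding lborel_def[where 'a = "real ^ 'n"] by (subst nn_integral_distr) (auto simp: lborel_eq_real)
 also have "... = (\<integral>\<^sup>+ f. (\<Prod>b\<in>Basis. ennreal (normal_density 0 (sqrt v) (f b))) \<partial>PiM Basis (\<lambda>_ :: real ^ 'n. lborel))"
  by (simp add: prod_ennreal)
 also have "... = (\<Prod>b\<in>(Basis :: (real ^ 'n) set). \<integral>\<^sup>+ x. ennreal (normal_density 0 (sqrt v) x) \<partial>lborel)"
  by (rule N.product_nn_integral_prod) auto
 also have "(\<integral>\<^sup>+ x. ennreal (normal_density 0 (sqrt v) x) \<partial>lborel) = 1"
  using v by (subst nn_integral_eq_integral) auto
 finally show "emeasure (gauss v) (space (gauss v :: (real ^ 'n) measure)) = 1" by simp
qed

lemma nn_integral_gdens: "v > 0 ==> (\<integral>\<^sup>+ x. ennreal (gdens v (x :: real ^ 'n::finite)) \<partial>lborel) = 1"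
 using prob_space.emeasure_space_1[OF prob_space_gauss[of v, where 'n = 'n]] by (simp add: gauss_def emeasure_density)

text \<open>The exponential factor is the Cameron-Martin density of the shift by b.\<close>

lemma gdens_tilt:
 assumes "v > 0"
 shows "gdens v (x - b) = gdens v x * exp ((b \<bullet> x - (norm b)\<^sup>2 / 2) / v)"
proof -
 have "(norm (x - b))\<^sup>2 = (norm x)\<^sup>2 - 2 * (b \<bullet> x) + (norm b)\<^sup>2"
  by (simp add: power2_norm_eq_inner inner_diff_left inner_diff_right inner_commute)
 then have "- (norm (x - b))\<^sup>2 / (2 * v) = - (norm x)\<^sup>2 / (2 * v) + (b \<bullet> x - (norm b)\<^sup>2 / 2) / v"
  using assms unfolding \<open>(norm (x - b))\<^sup>2 = _\<close> by (simp add: field_simps)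
 then show ?thesis unfolding gdens_def by (simp only: exp_add mult.assoc)
qed

lemma nn_integral_lborel_translate:
 fixes f :: "'a::euclidean_space => ennreal"
 assumes [measurable]: "f \<in> borel_measurable borel"
 shows "(\<integral>\<^sup>+ x. f (x + b) \<partial>lborel) = (\<integral>\<^sup>+ x. f x \<partial>lborel)"
proof -
 have "(\<integral>\<^sup>+ x. f x \<partial>lborel) = (\<integral>\<^sup>+ x. f x \<partial>distr lborel borel ((+) b))"
  by (subst lborel_distr_plus) simp
 also have "... = (\<integral>\<^sup>+ x. f (b + x) \<partial>lborel)" by (subst nn_integral_distr) auto
 finally show ?thesis by (simp add: add.commute)
qed

lemma nn_integral_gauss_translate:
 assumes v: "v > 0" and [measurable]: "f \<in> borel_measurable borel"
 shows "(\<integral>\<^sup>+ x. f (x + b) \<partial>gauss v) = (\<integral>\<^sup>+ x. f x * ennreal (exp ((b \<bullet> x - (norm b)\<^sup>2 / 2) / v)) \<partial>gauss v)"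
proof -
 have "(\<integral>\<^sup>+ x. f (x + b) \<partial>gauss v) = (\<integral>\<^sup>+ x. ennreal (gdens v ((x + b) - b)) * f (x + b) \<partial>lborel)"
  by (subst nn_integral_gauss) auto
 also have "... = (\<integral>\<^sup>+ x. ennreal (gdens v (x - b)) * f x \<partial>lborel)"
  by (rule nn_integral_lborel_translate) measurable
 also have "... = (\<integral>\<^sup>+ x. ennreal (gdens v x) * (f x * ennreal (exp ((b \<bullet> x - (norm b)\<^sup>2 / 2) / v))) \<partial>lborel)"
  by (intro nn_integral_cong) (simp add: gdens_tilt[OF v] ennreal_mult mult_ac)
 finally show ?thesis by (subst nn_integral_gauss) auto
qed

lemma distr_gauss_minus: "distr (gauss v) (gauss v) uminus = (gauss v :: (real ^ 'n::finite) measure)"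
proof (rule measure_eqI)
 fix A assume "A \<in> sets (distr (gauss v) (gauss v) (uminus :: real ^ 'n => _))"
 then have A [measurable]: "A \<in> sets borel" by simp
 have "emeasure (distr (gauss v) (gauss v) uminus) A = (\<integral>\<^sup>+ x. indicator A x \<partial>distr (gauss v) (gauss v) uminus)"
  by (subst nn_integral_indicator) auto
 also have "... = (\<integral>\<^sup>+ x. indicator A (- x) \<partial>gauss v)"
  by (subst nn_integral_distr) auto
 also have "... = (\<integral>\<^sup>+ x. ennreal (gdens v (- x)) * indicator A (- x) \<partial>lborel)"
  by (subst nn_integral_gauss) auto
 also have "... = (\<integral>\<^sup>+ x. ennreal (gdens v x) * indicator A x \<partial>distr lborel borel uminus)"
  by (subst nn_integral_distr) auto
 also have "distr lborel borel uminus = (lborel :: (real ^ 'n) measure)"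
  using lborel_affine[of "-1" "0 :: real ^ 'n"] by (simp add: density_1)
 also have "(\<integral>\<^sup>+ x. ennreal (gdens v x) * indicator A x \<partial>lborel) = emeasure (gauss v) A"
  by (simp add: gauss_def emeasure_density)
 finally show "emeasure (distr (gauss v) (gauss v) uminus) A = emeasure (gauss v) A" .
qed simp

text \<open>The exponential widens the Gaussian from variance v to v / \<epsilon>, and the value is
  the ratio of the two normalisations. It diverges as \<epsilon> tends to 0, hence the factor 1 -
  \<epsilon> throughout the lower bound.\<close>

lemma nn_integral_gauss_exp_sq:
 assumes v: "v > 0" and e: "0 < \<epsilon>"
 shows "(\<integral>\<^sup>+ x. ennreal (exp ((1 - \<epsilon>) * (norm (x :: real ^ 'n::finite))\<^sup>2 / (2 * v))) \<partial>gauss v) = ennreal (\<epsilon> powr (- real CARD('n) / 2))"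
proof -
 have "gdens v x * exp ((1 - \<epsilon>) * (norm x)\<^sup>2 / (2 * v)) = \<epsilon> powr (- real CARD('n) / 2) * gdens (v / \<epsilon>) x" for x :: "real ^ 'n"
 proof -
  have 1: "- (norm x)\<^sup>2 / (2 * v) + (1 - \<epsilon>) * (norm x)\<^sup>2 / (2 * v) = - (norm x)\<^sup>2 / (2 * (v / \<epsilon>))"
   using v e by (simp add: field_simps)
  have "(2 * pi * v) powr (- real CARD('n) / 2) = (\<epsilon> * (2 * pi * (v / \<epsilon>))) powr (- real CARD('n) / 2)"
   using e by simp
  also have "... = \<epsilon> powr (- real CARD('n) / 2) * (2 * pi * (v / \<epsilon>)) powr (- real CARD('n) / 2)"
   by (rule powr_mult)
  finally show ?thesis using 1 unfolding gdens_def by (simp add: exp_add[symmetric] mult.assoc)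
 qed
 then have "(\<integral>\<^sup>+ x. ennreal (exp ((1 - \<epsilon>) * (norm (x :: real ^ 'n))\<^sup>2 / (2 * v))) \<partial>gauss v)
   = (\<integral>\<^sup>+ x. ennreal (\<epsilon> powr (- real CARD('n) / 2)) * ennreal (gdens (v / \<epsilon>) (x :: real ^ 'n)) \<partial>lborel)"
  by (subst nn_integral_gauss) (auto intro!: nn_integral_cong simp: ennreal_mult[symmetric])
 also have "... = ennreal (\<epsilon> powr (- real CARD('n) / 2)) * 1"
  using nn_integral_gdens[of "v / \<epsilon>", where 'n = 'n] v e by (subst nn_integral_cmult) auto
 finally show ?thesis by simp
qed

section \<open>Fundamental domains\<close>

lemma nn_integral_zlat_indicator:
 assumes "\<exists>!k. k \<in> zlat \<and> x + k \<in> Q"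
 shows "(\<integral>\<^sup>+ k. indicator Q (x + k) \<partial>count_space zlat) = (1 :: ennreal)"
proof -
 obtain k0 where k0: "k0 \<in> zlat" "x + k0 \<in> Q" "\<And>k. k \<in> zlat ==> x + k \<in> Q ==> k = k0" using assms by blast
 have "(\<integral>\<^sup>+ k. indicator Q (x + k) \<partial>count_space zlat) = (\<integral>\<^sup>+ k. indicator {k0} k \<partial>count_space zlat)"
 proof (rule nn_integral_cong)
  fix k assume "k \<in> space (count_space (zlat :: (real ^ 'a) set))"
  then have kz: "k \<in> zlat" by simp
  show "indicator Q (x + k) = (indicator {k0} k :: ennreal)"
  proof (cases "k = k0")
   case False
   then have "x + k \<notin> Q" using k0(3)[OF kz] by blast
   then show ?thesis using False by simp
  qed (simp add: k0(2))
 qed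
 also have "... = emeasure (count_space zlat) {k0}" using k0(1) by (intro nn_integral_indicator) simp
 also have "... = 1" using k0(1) by simp
 finally show ?thesis .
qed

text \<open>The last hypothesis says that Q is a fundamental domain of the lattice. Inserting 1 as
  the sum over k of the indicators of x + k in Q, and translating each term by k, moves the whole
  integral into Q.\<close>

lemma nn_integral_zlat_unfold:
 fixes h :: "real ^ 'n::finite => ennreal"
 assumes [measurable]: "h \<in> borel_measurable borel" "Q \<in> sets borel"
  and Q: "\<And>x. \<exists>!k. k \<in> zlat \<and> x + k \<in> Q"
 shows "(\<integral>\<^sup>+ x. h x \<partial>lborel) = (\<integral>\<^sup>+ x\<in>Q. (\<integral>\<^sup>+ k. h (x + k) \<partial>count_space zlat) \<partial>lborel)"
proof -
 interpret c: sigma_finite_measure "count_space (zlat :: (real ^ 'n) set)"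
  by (rule sigma_finite_measure_count_space_countable[OF countable_zlat])
 interpret P: pair_sigma_finite "count_space (zlat :: (real ^ 'n) set)" lborel ..
 note one = nn_integral_zlat_indicator[OF Q]
 have m1: "(\<lambda>(k, x). h x * indicator Q (x + k)) \<in> borel_measurable (count_space zlat \<Otimes>\<^sub>M lborel)"
  by (rule measurable_pair_measure_countable1[OF countable_zlat]) (simp only: case_prod_conv, measurable)
 have m2: "(\<lambda>(k, x). h (x + k) * indicator Q x) \<in> borel_measurable (count_space zlat \<Otimes>\<^sub>M lborel)"
  by (rule measurable_pair_measure_countable1[OF countable_zlat]) (simp only: case_prod_conv, measurable)
 have "(\<integral>\<^sup>+ x. h x \<partial>lborel) = (\<integral>\<^sup>+ x. \<integral>\<^sup>+ k. h x * indicator Q (x + k) \<partial>count_space zlat \<partial>lborel)"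
  by (subst nn_integral_cmult) (auto simp: one)
 also have "... = (\<integral>\<^sup>+ k. \<integral>\<^sup>+ x. h x * indicator Q (x + k) \<partial>lborel \<partial>count_space zlat)"
  by (rule P.Fubini'[OF m1])
 also have "... = (\<integral>\<^sup>+ k. \<integral>\<^sup>+ x. h (x + - k) * indicator Q x \<partial>lborel \<partial>count_space zlat)"
 proof (rule nn_integral_cong)
  fix k :: "real ^ 'n"
  have "(\<integral>\<^sup>+ x. h ((x + k) + - k) * indicator Q (x + k) \<partial>lborel) = (\<integral>\<^sup>+ x. h (x + - k) * indicator Q x \<partial>lborel)"
   by (rule nn_integral_lborel_translate) measurable
  then show "(\<integral>\<^sup>+ x. h x * indicator Q (x + k) \<partial>lborel) = (\<integral>\<^sup>+ x. h (x + - k) * indicator Q x \<partial>lborel)" by simp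
 qed
 also have "... = (\<integral>\<^sup>+ k. \<integral>\<^sup>+ x. h (x + k) * indicator Q x \<partial>lborel \<partial>count_space zlat)"
 proof -
  have b: "bij_betw uminus zlat (zlat :: (real ^ 'n) set)"
   by (rule bij_betw_byWitness[where f' = uminus]) (auto simp: zlat_minus)
  show ?thesis
   using nn_integral_bij_count_space[OF b, of "\<lambda>k. \<integral>\<^sup>+ x. h (x + k) * indicator Q x \<partial>lborel"] by simp
 qed
 also have "... = (\<integral>\<^sup>+ x. \<integral>\<^sup>+ k. h (x + k) * indicator Q x \<partial>count_space zlat \<partial>lborel)"
  by (rule P.Fubini'[OF m2, symmetric])
 also have "... = (\<integral>\<^sup>+ x\<in>Q. (\<integral>\<^sup>+ k. h (x + k) \<partial>count_space zlat) \<partial>lborel)"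
  by (intro nn_integral_cong nn_integral_multc) simp
 finally show ?thesis .
qed

lemma cell_fundamental: "\<exists>!k. k \<in> zlat \<and> x + k \<in> cell" for x :: "real ^ 'n::finite"
proof (rule ex1I[of _ "tlog (proj x) - x"])
 show "tlog (proj x) - x \<in> zlat \<and> x + (tlog (proj x) - x) \<in> cell"
  using tlog_cell[of "proj x"] by (simp add: proj_eq_iff_zlat[symmetric])
 fix k assume k: "k \<in> zlat \<and> x + k \<in> cell"
 then have "tlog (proj x) = x + k" using tlog_proj[of "x + k"] by (simp add: proj_zlat)
 then show "k = tlog (proj x) - x" by simp
qed

lemma sets_cell [measurable]: "cell \<in> sets (borel :: (real ^ 'n::finite) measure)"
proof -
 have "cell = (\<Inter>i\<in>(UNIV :: 'n set). {x :: real ^ 'n. - 1 / 2 \<le> x $ i} \<inter> {x. x $ i < 1 / 2})"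
  by (auto simp: cell_def)
 moreover have "(\<Inter>i\<in>(UNIV :: 'n set). {x :: real ^ 'n. - 1 / 2 \<le> x $ i} \<inter> {x. x $ i < 1 / 2}) \<in> sets borel"
  by (intro sets.finite_INT sets.Int) measurable
 ultimately show ?thesis by (rule ssubst)
qed

text \<open>Unfolding over Q' the integrand restricted to Q leaves, by periodicity, a lattice sum of
  indicators of Q, which is 1.\<close>

lemma fundamental_domain_change:
 fixes g :: "'n::finite torus => ennreal"
 assumes [measurable]: "g \<in> borel_measurable borel" "Q \<in> sets borel" "Q' \<in> sets borel"
  and Q: "\<And>x. \<exists>!k. k \<in> zlat \<and> x + k \<in> Q" and Q': "\<And>x. \<exists>!k. k \<in> zlat \<and> x + k \<in> Q'"
 shows "(\<integral>\<^sup>+ x\<in>Q. g (proj x) \<partial>lborel) = (\<integral>\<^sup>+ x\<in>Q'. g (proj x) \<partial>lborel)"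
proof -
 note one = nn_integral_zlat_indicator[OF Q]
 have "(\<integral>\<^sup>+ x\<in>Q. g (proj x) \<partial>lborel) = (\<integral>\<^sup>+ x\<in>Q'. (\<integral>\<^sup>+ k. g (proj (x + k)) * indicator Q (x + k) \<partial>count_space zlat) \<partial>lborel)"
  by (rule nn_integral_zlat_unfold[OF _ _ Q']) measurable
 also have "... = (\<integral>\<^sup>+ x\<in>Q'. (\<integral>\<^sup>+ k. g (proj x) * indicator Q (x + k) \<partial>count_space zlat) \<partial>lborel)"
 proof (intro nn_integral_cong arg_cong2[of _ _ _ _ "(*)"] refl)
  fix x and k :: "real ^ 'n" assume "k \<in> space (count_space zlat)"
  then show "g (proj (x + k)) = g (proj x)" by (simp add: proj_zlat)
 qed
 also have "... = (\<integral>\<^sup>+ x\<in>Q'. g (proj x) \<partial>lborel)"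
  by (subst nn_integral_cmult) (auto simp: one)
 finally show ?thesis .
qed

lemma sets_leb_torus [measurable_cong, simp]: "sets leb_torus = sets borel"
 and space_leb_torus [simp]: "space leb_torus = UNIV"
 by (simp_all add: leb_torus_def)

lemma nn_integral_leb_torus:
 fixes g :: "'n::finite torus => ennreal"
 assumes [measurable]: "g \<in> borel_measurable borel"
 shows "(\<integral>\<^sup>+ q. g q \<partial>leb_torus) = (\<integral>\<^sup>+ x\<in>cell. g (proj x) \<partial>lborel)"
proof -
 let ?B = "cbox 0 1 :: (real ^ 'n) set"
 have BU: "emeasure lborel ?B = 1"
 proof -
  have "(1 :: real ^ 'n) \<bullet> b = 1" if "b \<in> Basis" for b using that by (auto simp: Basis_vec_def inner_axis)
  then show ?thesis by (simp add: emeasure_lborel_cbox_eq)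
 qed
 \<comment> \<open>The closed cube of the definition is not a fundamental domain; the half-open one
   is, and the two differ by a null set.\<close>
 let ?H = "{x :: real ^ 'n. \<forall>i. 0 \<le> x $ i \<and> x $ i < 1}"
 have H: "\<exists>!k. k \<in> zlat \<and> x + k \<in> ?H" for x :: "real ^ 'n"
 proof -
  let ?h = "(\<chi> i. 1 / 2) :: real ^ 'n"
  have "y \<in> ?H \<longleftrightarrow> y - ?h \<in> cell" for y by (auto simp: cell_def)
  then show ?thesis using cell_fundamental[of "x - ?h"] by (simp add: algebra_simps)
 qed
 have Hs [measurable]: "?H \<in> sets borel"
 proof -
  have "?H = (\<Inter>i\<in>(UNIV :: 'n set). {x :: real ^ 'n. 0 \<le> x $ i} \<inter> {x. x $ i < 1})" by auto
  moreover have "(\<Inter>i\<in>(UNIV :: 'n set). {x :: real ^ 'n. 0 \<le> x $ i} \<inter> {x. x $ i < 1}) \<in> sets borel"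
   by (intro sets.finite_INT sets.Int) measurable
  ultimately show ?thesis by (rule ssubst)
 qed
 have "(\<integral>\<^sup>+ q. g q \<partial>leb_torus) = (\<integral>\<^sup>+ x\<in>?B. g (proj x) \<partial>lborel)"
  unfolding leb_torus_def using BU
  by (subst nn_integral_distr) (auto simp: nn_integral_uniform_measure divide_ennreal_def)
 also have "... = (\<integral>\<^sup>+ x\<in>?H. g (proj x) \<partial>lborel)"
 proof (rule nn_integral_cong_AE)
  have "AE x in lborel. x \<notin> ?B - box 0 1"
   using negligible_frontier_interval[of 0 "1 :: real ^ 'n"]
   by (intro AE_not_in) (simp add: negligible_iff_null_sets null_sets_completion_iff)
  then show "AE x in lborel. g (proj x) * indicator ?B x = g (proj x) * indicator ?H x"
   by eventually_elim (auto simp: indicator_def mem_box_cart less_imp_le)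
 qed
 also have "... = (\<integral>\<^sup>+ x\<in>cell. g (proj x) \<partial>lborel)"
  by (rule fundamental_domain_change[OF _ _ _ H cell_fundamental]) measurable
 finally show ?thesis .
qed

lemma prob_space_leb_torus: "prob_space (leb_torus :: 'n::finite torus measure)"
proof -
 let ?B = "cbox 0 1 :: (real ^ 'n) set"
 have "(1 :: real ^ 'n) \<bullet> b = 1" if "b \<in> Basis" for b using that by (auto simp: Basis_vec_def inner_axis)
 then have "emeasure lborel ?B = 1" by (simp add: emeasure_lborel_cbox_eq)
 then have "prob_space (uniform_measure lborel ?B)" by (intro prob_space_uniform_measure) auto
 then show ?thesis unfolding leb_torus_def by (rule prob_space.prob_space_distr) simp
qed

text \<open>The translated cell is another fundamental domain.\<close>

lemma nn_integral_leb_torus_translate: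
 fixes g :: "'n::finite torus => ennreal"
 assumes [measurable]: "g \<in> borel_measurable borel"
 shows "(\<integral>\<^sup>+ q. g (q + a) \<partial>leb_torus) = (\<integral>\<^sup>+ q. g q \<partial>leb_torus)"
proof -
 obtain \<alpha> where \<alpha>: "a = proj \<alpha>" using proj_surj by blast
 let ?Q = "{y :: real ^ 'n. y + - \<alpha> \<in> cell}"
 have Q: "\<exists>!k. k \<in> zlat \<and> x + k \<in> ?Q" for x :: "real ^ 'n"
  using cell_fundamental[of "x - \<alpha>"] by (simp add: algebra_simps)
 have Qs [measurable]: "?Q \<in> sets borel" by measurable
 have "(\<integral>\<^sup>+ q. g (q + a) \<partial>leb_torus) = (\<integral>\<^sup>+ x. g (proj x + a) * indicator cell x \<partial>lborel)"
  by (rule nn_integral_leb_torus) measurable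
 also have "... = (\<integral>\<^sup>+ x. (\<lambda>y. g (proj y) * indicator ?Q y) (x + \<alpha>) \<partial>lborel)"
  by (intro nn_integral_cong) (simp add: \<alpha> proj_add indicator_def)
 also have "... = (\<integral>\<^sup>+ y\<in>?Q. g (proj y) \<partial>lborel)"
  by (rule nn_integral_lborel_translate) measurable
 also have "... = (\<integral>\<^sup>+ y\<in>cell. g (proj y) \<partial>lborel)"
  by (rule fundamental_domain_change[OF _ _ _ Q cell_fundamental]) measurable
 also have "... = (\<integral>\<^sup>+ q. g q \<partial>leb_torus)" by (rule nn_integral_leb_torus[symmetric]) measurable
 finally show ?thesis .
qed

lemma distr_leb_torus_translate: "distr leb_torus borel (\<lambda>q. q + a) = (leb_torus :: 'n::finite torus measure)"
proof (rule measure_eqI)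
 fix A assume "A \<in> sets (distr leb_torus borel (\<lambda>q. q + a :: 'n torus))"
 then have A [measurable]: "A \<in> sets borel" by simp
 have "emeasure (distr leb_torus borel (\<lambda>q. q + a)) A = (\<integral>\<^sup>+ q. indicator A q \<partial>distr leb_torus borel (\<lambda>q. q + a))"
  by (subst nn_integral_indicator) auto
 also have "... = (\<integral>\<^sup>+ q. indicator A (q + a) \<partial>leb_torus)" by (subst nn_integral_distr) auto
 also have "... = (\<integral>\<^sup>+ q. indicator A q \<partial>leb_torus)" by (rule nn_integral_leb_torus_translate) measurable
 also have "... = emeasure leb_torus A" by (subst nn_integral_indicator) auto
 finally show "emeasure (distr leb_torus borel (\<lambda>q. q + a)) A = emeasure leb_torus A" .
qed simp

lemma measurable_nn_integral_zlat:
 assumes "\<And>k. k \<in> zlat ==> (\<lambda>x. f x k) \<in> borel_measurable M"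
 shows "(\<lambda>x. \<integral>\<^sup>+ k. f x k \<partial>count_space (zlat :: (real ^ 'n::finite) set)) \<in> borel_measurable M"
proof -
 interpret c: sigma_finite_measure "count_space (zlat :: (real ^ 'n) set)"
  by (rule sigma_finite_measure_count_space_countable[OF countable_zlat])
 have "(\<lambda>(k, x). f x k) \<in> borel_measurable (count_space zlat \<Otimes>\<^sub>M M)"
  by (rule measurable_pair_measure_countable1[OF countable_zlat]) (simp add: assms)
 from measurable_compose[OF measurable_pair_swap' this] have "(\<lambda>(x, k). f x k) \<in> borel_measurable (M \<Otimes>\<^sub>M count_space zlat)"
  by (simp add: case_prod_beta)
 then show ?thesis by (rule c.borel_measurable_nn_integral)
qed

lemma nn_integral_unfold_torus:
 fixes h :: "real ^ 'n::finite => ennreal"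
 assumes [measurable]: "h \<in> borel_measurable borel"
 shows "(\<integral>\<^sup>+ x. h x \<partial>lborel) = (\<integral>\<^sup>+ q. (\<integral>\<^sup>+ k. h (tlog q + k) \<partial>count_space zlat) \<partial>leb_torus)"
proof -
 have m: "(\<lambda>q. \<integral>\<^sup>+ k. h (tlog q + k) \<partial>count_space zlat) \<in> borel_measurable borel"
  by (rule measurable_nn_integral_zlat) measurable
 have "(\<integral>\<^sup>+ x. h x \<partial>lborel) = (\<integral>\<^sup>+ x\<in>cell. (\<integral>\<^sup>+ k. h (x + k) \<partial>count_space zlat) \<partial>lborel)"
  by (rule nn_integral_zlat_unfold[OF _ _ cell_fundamental]) measurable
 also have "... = (\<integral>\<^sup>+ x\<in>cell. (\<integral>\<^sup>+ k. h (tlog (proj x) + k) \<partial>count_space zlat) \<partial>lborel)"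
 proof (rule nn_integral_cong)
  fix x :: "real ^ 'n"
  show "(\<integral>\<^sup>+ k. h (x + k) \<partial>count_space zlat) * indicator cell x = (\<integral>\<^sup>+ k. h (tlog (proj x) + k) \<partial>count_space zlat) * indicator cell x"
   by (cases "x \<in> cell") (simp_all add: tlog_proj)
 qed
 also have "... = (\<integral>\<^sup>+ q. (\<integral>\<^sup>+ k. h (tlog q + k) \<partial>count_space zlat) \<partial>leb_torus)"
  by (rule nn_integral_leb_torus[OF m, symmetric])
 finally show ?thesis .
qed

text \<open>A theta-type lattice sum; it enters only through the cost of wrapping Gaussian
  increments around the torus.\<close>

definition lat_const :: "'n::finite itself => ennreal" where
 "lat_const _ = (\<integral>\<^sup>+ k. ennreal (exp (- (norm k)\<^sup>2 / 8)) \<partial>count_space (zlat :: (real ^ 'n) set))"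

text \<open>Comparing the lattice sum with the integral of a wider Gaussian over the unit cell.\<close>

lemma lat_const_finite: "lat_const TYPE('n::finite) < \<infinity>"
proof -
 let ?c = "(2 * pi * 8) powr (- real CARD('n) / 2) :: real"
 have c: "?c > 0" by simp
 have "(\<integral>\<^sup>+ q. ennreal (?c * exp (- (real CARD('n))\<^sup>2 / 8)) * lat_const TYPE('n) \<partial>(leb_torus :: 'n torus measure))
  \<le> (\<integral>\<^sup>+ q. (\<integral>\<^sup>+ k. ennreal (gdens 8 (tlog q + k)) \<partial>count_space zlat) \<partial>(leb_torus :: 'n torus measure))"
 proof (rule nn_integral_mono)
  fix q :: "'n torus"
  have "ennreal (?c * exp (- (real CARD('n))\<^sup>2 / 8)) * lat_const TYPE('n)
   = (\<integral>\<^sup>+ k. ennreal (?c * exp (- (real CARD('n))\<^sup>2 / 8)) * ennreal (exp (- (norm k)\<^sup>2 / 8)) \<partial>count_space (zlat :: (real ^ 'n) set))"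
   unfolding lat_const_def by (rule nn_integral_cmult[symmetric]) simp
  also have "... \<le> (\<integral>\<^sup>+ k. ennreal (gdens 8 (tlog q + k)) \<partial>count_space zlat)"
  proof (rule nn_integral_mono)
   fix k :: "real ^ 'n"
   have "norm (tlog q + k) \<le> real CARD('n) + norm k"
    using norm_triangle_ineq[of "tlog q" k] norm_tlog_bound[of q] by linarith
   then have "(norm (tlog q + k))\<^sup>2 \<le> (real CARD('n) + norm k)\<^sup>2" by (rule power_mono) simp
   also have "... \<le> 2 * (real CARD('n))\<^sup>2 + 2 * (norm k)\<^sup>2"
    using zero_le_power2[of "real CARD('n) - norm k"] by (simp add: power2_eq_square algebra_simps)
   finally have "- (real CARD('n))\<^sup>2 / 8 + - (norm k)\<^sup>2 / 8 \<le> - (norm (tlog q + k))\<^sup>2 / (2 * 8)" by simp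
   then have "exp (- (real CARD('n))\<^sup>2 / 8) * exp (- (norm k)\<^sup>2 / 8) \<le> exp (- (norm (tlog q + k))\<^sup>2 / (2 * 8))"
    by (simp add: exp_add[symmetric])
   then have "?c * (exp (- (real CARD('n))\<^sup>2 / 8) * exp (- (norm k)\<^sup>2 / 8)) \<le> gdens 8 (tlog q + k)"
    unfolding gdens_def by (intro mult_left_mono) auto
   then show "ennreal (?c * exp (- (real CARD('n))\<^sup>2 / 8)) * ennreal (exp (- (norm k)\<^sup>2 / 8)) \<le> ennreal (gdens 8 (tlog q + k))"
    by (simp add: ennreal_mult[symmetric] mult.assoc ennreal_leI)
  qed
  finally show "ennreal (?c * exp (- (real CARD('n))\<^sup>2 / 8)) * lat_const TYPE('n) \<le> (\<integral>\<^sup>+ k. ennreal (gdens 8 (tlog q + k)) \<partial>count_space zlat)" .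
 qed
 also have "... = (\<integral>\<^sup>+ x. ennreal (gdens 8 (x :: real ^ 'n)) \<partial>lborel)"
  by (rule nn_integral_unfold_torus[symmetric]) measurable
 also have "... = 1" by (rule nn_integral_gdens) simp
 finally have "ennreal (?c * exp (- (real CARD('n))\<^sup>2 / 8)) * lat_const TYPE('n) \<le> 1"
  using prob_space.emeasure_space_1[OF prob_space_leb_torus[where 'n = 'n]] by simp
 then show ?thesis using c by (cases "lat_const TYPE('n)") (auto simp: ennreal_mult_top top_unique)
qed

text \<open>The exponent is split into halves: by |k| \<ge> 1 one half gives exp (-1 / (8 v)) \<le>
  8 v, and by v \<le> 1 the other leaves the terms of \<open>lat_const\<close>. The correction has
  to be linear in v, because N factors with v = \<nu> / N will be multiplied.\<close>

lemma lattice_sum_bound: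
 assumes v: "0 < v" "v \<le> 1"
 shows "(\<integral>\<^sup>+ k. ennreal (exp (- (norm k)\<^sup>2 / (4 * v))) \<partial>count_space (zlat :: (real ^ 'n::finite) set))
  \<le> 1 + ennreal (8 * v) * lat_const TYPE('n)"
proof -
 have pt: "exp (- (norm k)\<^sup>2 / (4 * v)) \<le> (if k = 0 then 1 else 0) + 8 * v * exp (- (norm k)\<^sup>2 / 8)"
  if k: "k \<in> zlat" for k :: "real ^ 'n"
 proof (cases "k = 0")
  case False
  then have n1: "(norm k)\<^sup>2 \<ge> 1" using zlat_norm_ge_1[OF k] by simp
  have "- (norm k)\<^sup>2 / (4 * v) \<le> - 1 / (8 * v) + - (norm k)\<^sup>2 / 8"
  proof -
   have "(norm k)\<^sup>2 / (8 * v) \<ge> 1 / (8 * v)" using n1 v by (intro divide_right_mono) auto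
   moreover have "(norm k)\<^sup>2 / (8 * v) \<ge> (norm k)\<^sup>2 / 8" using v by (intro divide_left_mono) auto
   moreover have "(norm k)\<^sup>2 / (4 * v) = (norm k)\<^sup>2 / (8 * v) + (norm k)\<^sup>2 / (8 * v)" using v by (simp add: field_simps)
   ultimately show ?thesis by simp
  qed
  then have "exp (- (norm k)\<^sup>2 / (4 * v)) \<le> exp (- 1 / (8 * v)) * exp (- (norm k)\<^sup>2 / 8)"
   by (simp add: exp_add[symmetric])
  also have "exp (- 1 / (8 * v)) \<le> 8 * v"
  proof -
   have "1 / (8 * v) \<le> exp (1 / (8 * v))" using exp_ge_add_one_self[of "1 / (8 * v)"] by linarith
   then have "inverse (exp (1 / (8 * v))) \<le> inverse (1 / (8 * v))" using v by (intro le_imp_inverse_le) auto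
   then show ?thesis by (simp add: exp_minus)
  qed
  finally show ?thesis using False by simp
 qed (use v in simp)
 have "(\<integral>\<^sup>+ k. ennreal (exp (- (norm k)\<^sup>2 / (4 * v))) \<partial>count_space (zlat :: (real ^ 'n) set))
  \<le> (\<integral>\<^sup>+ k. indicator {0} k + ennreal (8 * v) * ennreal (exp (- (norm k)\<^sup>2 / 8)) \<partial>count_space (zlat :: (real ^ 'n) set))"
 proof (rule nn_integral_mono)
  fix k :: "real ^ 'n" assume "k \<in> space (count_space zlat)"
  then have "ennreal (exp (- (norm k)\<^sup>2 / (4 * v))) \<le> ennreal ((if k = 0 then 1 else 0) + 8 * v * exp (- (norm k)\<^sup>2 / 8))"
   using pt[of k] by (intro ennreal_leI) simp
  also have "... = indicator {0} k + ennreal (8 * v) * ennreal (exp (- (norm k)\<^sup>2 / 8))"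
   using v by (subst ennreal_plus) (auto simp: ennreal_mult indicator_def)
  finally show "ennreal (exp (- (norm k)\<^sup>2 / (4 * v))) \<le> indicator {0} k + ennreal (8 * v) * ennreal (exp (- (norm k)\<^sup>2 / 8))" .
 qed
 also have "... = (\<integral>\<^sup>+ k. indicator {0} k \<partial>count_space (zlat :: (real ^ 'n) set)) + ennreal (8 * v) * lat_const TYPE('n)"
  unfolding lat_const_def by (subst nn_integral_add) (auto simp: nn_integral_cmult)
 also have "(\<integral>\<^sup>+ k. indicator {0} k \<partial>count_space (zlat :: (real ^ 'n) set)) = 1"
  by (subst nn_integral_indicator) auto
 finally show ?thesis .
qed

text \<open>For |k| \<ge> 1 and |x| \<le> 1/4 the cross term 2 (x . k) costs at most half of
  |k|^2.\<close>

lemma gdens_lattice_le: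
 fixes x :: "real ^ 'n::finite"
 assumes v: "0 < v" and x: "norm x \<le> 1 / 4" and k: "k \<in> zlat"
 shows "gdens v (x + k) \<le> gdens v x * exp (- (norm k)\<^sup>2 / (4 * v))"
proof -
 have "(norm (x + k))\<^sup>2 = (norm x)\<^sup>2 + 2 * (x \<bullet> k) + (norm k)\<^sup>2"
  by (simp add: power2_norm_eq_inner inner_add_left inner_add_right inner_commute)
 moreover have "2 * (x \<bullet> k) \<ge> - ((norm k)\<^sup>2 / 2)"
 proof (cases "k = 0")
  case False
  then have "norm k \<ge> 1" using zlat_norm_ge_1 k by blast
  have "\<bar>x \<bullet> k\<bar> \<le> norm x * norm k" by (rule Cauchy_Schwarz_ineq2)
  also have "... \<le> (1 / 4) * norm k" using x by (intro mult_right_mono) auto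
  also have "... \<le> (1 / 4) * (norm k * norm k)" using mult_left_mono[of 1 "norm k" "norm k"] \<open>norm k \<ge> 1\<close> by simp
  finally show ?thesis by (simp add: power2_eq_square)
 qed simp
 ultimately have "(norm (x + k))\<^sup>2 \<ge> (norm x)\<^sup>2 + (norm k)\<^sup>2 / 2" by linarith
 then have "(norm (x + k))\<^sup>2 / (2 * v) \<ge> ((norm x)\<^sup>2 + (norm k)\<^sup>2 / 2) / (2 * v)"
  using v by (intro divide_right_mono) auto
 then have "- (norm (x + k))\<^sup>2 / (2 * v) \<le> - (norm x)\<^sup>2 / (2 * v) + - (norm k)\<^sup>2 / (4 * v)"
  by (simp add: add_divide_distrib)
 then have "exp (- (norm (x + k))\<^sup>2 / (2 * v)) \<le> exp (- (norm x)\<^sup>2 / (2 * v)) * exp (- (norm k)\<^sup>2 / (4 * v))"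
  by (simp add: exp_add[symmetric])
 then show ?thesis unfolding gdens_def mult.assoc by (rule mult_left_mono) simp
qed

text \<open>Folding the Gaussian back onto the cell adds the mass of its lattice translates; near
  the origin each translate is exponentially smaller than the central term, so the folded density is
  at most 1 + O(v) times the original one.\<close>

lemma tlog_gauss_dominated:
 fixes g :: "real ^ 'n::finite => ennreal"
 assumes v: "0 < v" "v \<le> 1" and [measurable]: "g \<in> borel_measurable borel"
 shows "(\<integral>\<^sup>+ x. indicator {x. norm (tlog (proj x)) < 1 / 4} x * g (tlog (proj x)) \<partial>gauss v)
  \<le> (1 + ennreal (8 * v) * lat_const TYPE('n)) * (\<integral>\<^sup>+ x. g x \<partial>gauss v)"
proof -
 let ?I = "{x :: real ^ 'n. norm (tlog (proj x)) < 1 / 4}"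
 have [measurable]: "?I \<in> sets borel" by measurable
 let ?c = "1 + ennreal (8 * v) * lat_const TYPE('n)"
 have "(\<integral>\<^sup>+ x. indicator ?I x * g (tlog (proj x)) \<partial>gauss v) = (\<integral>\<^sup>+ x. ennreal (gdens v x) * (indicator ?I x * g (tlog (proj x))) \<partial>lborel)"
  by (rule nn_integral_gauss) measurable
 also have "... = (\<integral>\<^sup>+ x\<in>cell. (\<integral>\<^sup>+ k. ennreal (gdens v (x + k)) * (indicator ?I (x + k) * g (tlog (proj (x + k)))) \<partial>count_space zlat) \<partial>lborel)"
  by (rule nn_integral_zlat_unfold[OF _ _ cell_fundamental]) measurable
 also have "... \<le> (\<integral>\<^sup>+ x. ?c * (ennreal (gdens v x) * g x) \<partial>lborel)"
 proof (rule nn_integral_mono)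
  fix x :: "real ^ 'n"
  show "(\<integral>\<^sup>+ k. ennreal (gdens v (x + k)) * (indicator ?I (x + k) * g (tlog (proj (x + k)))) \<partial>count_space zlat) * indicator cell x
   \<le> ?c * (ennreal (gdens v x) * g x)"
  proof (cases "x \<in> cell")
   case True
   have "(\<integral>\<^sup>+ k. ennreal (gdens v (x + k)) * (indicator ?I (x + k) * g (tlog (proj (x + k)))) \<partial>count_space zlat)
    = (\<integral>\<^sup>+ k. ennreal (gdens v (x + k)) * (indicator ?I x * g x) \<partial>count_space zlat)"
    by (intro nn_integral_cong) (simp add: proj_zlat tlog_proj[OF True] indicator_def)
   also have "... \<le> ?c * (ennreal (gdens v x) * g x)"
   proof (cases "x \<in> ?I")
    case I: True
    then have nx: "norm x \<le> 1 / 4" using tlog_proj[OF True] by simp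
    have "(\<integral>\<^sup>+ k. ennreal (gdens v (x + k)) * (indicator ?I x * g x) \<partial>count_space zlat)
     \<le> (\<integral>\<^sup>+ k. ennreal (exp (- (norm k)\<^sup>2 / (4 * v))) * (ennreal (gdens v x) * g x) \<partial>count_space (zlat :: (real ^ 'n) set))"
    proof (rule nn_integral_mono)
     fix k :: "real ^ 'n" assume "k \<in> space (count_space zlat)"
     then have "ennreal (gdens v (x + k)) \<le> ennreal (gdens v x * exp (- (norm k)\<^sup>2 / (4 * v)))"
      using gdens_lattice_le[OF v(1) nx, of k] by (intro ennreal_leI) simp
     also have "... = ennreal (exp (- (norm k)\<^sup>2 / (4 * v))) * ennreal (gdens v x)"
      by (simp add: ennreal_mult[symmetric] mult.commute)
     finally show "ennreal (gdens v (x + k)) * (indicator ?I x * g x) \<le> ennreal (exp (- (norm k)\<^sup>2 / (4 * v))) * (ennreal (gdens v x) * g x)"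
      using I by (simp add: mult.assoc[symmetric] mult_right_mono)
    qed
    also have "... = (\<integral>\<^sup>+ k. ennreal (exp (- (norm k)\<^sup>2 / (4 * v))) \<partial>count_space (zlat :: (real ^ 'n) set)) * (ennreal (gdens v x) * g x)"
     by (rule nn_integral_multc) simp
    also have "... \<le> ?c * (ennreal (gdens v x) * g x)"
     by (intro mult_right_mono lattice_sum_bound v) simp
    finally show ?thesis .
   qed simp
   finally show ?thesis using True by simp
  qed simp
 qed
 also have "... = ?c * (\<integral>\<^sup>+ x. g x \<partial>gauss v)"
  by (subst nn_integral_gauss) (auto simp: nn_integral_cmult)
 finally show ?thesis .
qed

text \<open>Tensorises, by induction on the index set, a domination in one coordinate: the image
  under T of the measure weighted by k is at most c times the target. It is used with c = 1 for
  shifts and with c = 1 + O(v) for wrapping.\<close>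

lemma PiM_dominated:
 fixes k :: "'i => 'a => ennreal" and T :: "'i => 'a => 'b"
 assumes J: "finite J" and M: "sigma_finite_measure M" and M': "sigma_finite_measure M'"
  and k: "\<And>j. k j \<in> borel_measurable M" and T: "\<And>j. T j \<in> measurable M M'"
  and le: "\<And>j g. g \<in> borel_measurable M' ==> (\<integral>\<^sup>+ x. k j x * g (T j x) \<partial>M) \<le> c * (\<integral>\<^sup>+ x. g x \<partial>M')"
  and f: "f \<in> borel_measurable (PiM J (\<lambda>_. M'))"
 shows "(\<integral>\<^sup>+ z. (\<Prod>j\<in>J. k j (z j)) * f (\<lambda>j\<in>J. T j (z j)) \<partial>PiM J (\<lambda>_. M)) \<le> c ^ card J * (\<integral>\<^sup>+ z. f z \<partial>PiM J (\<lambda>_. M'))"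
 using J f
proof (induction J arbitrary: f rule: finite_induct)
 case empty
 interpret product_sigma_finite "\<lambda>_ :: 'i. M" using M by (simp add: product_sigma_finite_def)
 interpret M': product_sigma_finite "\<lambda>_ :: 'i. M'" using M' by (simp add: product_sigma_finite_def)
 have "restrict (\<lambda>j. T j undefined) {} = (\<lambda>_. undefined)" by (auto simp: restrict_def)
 then show ?case by (simp add: PiM_empty restrict_def nn_integral_count_space_finite)
next
 case (insert i J)
 interpret product_sigma_finite "\<lambda>_ :: 'i. M" using M by (simp add: product_sigma_finite_def)
 interpret M': product_sigma_finite "\<lambda>_ :: 'i. M'" using M' by (simp add: product_sigma_finite_def)
 have Tm [measurable]: "(\<lambda>z. \<lambda>j\<in>insert i J. T j (z j)) \<in> measurable (PiM (insert i J) (\<lambda>_. M)) (PiM (insert i J) (\<lambda>_. M'))"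
  using T by (intro measurable_restrict measurable_compose[OF measurable_component_singleton]) auto
 have km [measurable]: "(\<lambda>z. \<Prod>j\<in>insert i J. k j (z j)) \<in> borel_measurable (PiM (insert i J) (\<lambda>_. M))"
  using k by (intro borel_measurable_prod_ennreal measurable_compose[OF measurable_component_singleton]) auto
 have TmJ: "(\<lambda>z. \<lambda>j\<in>J. T j (z j)) \<in> measurable (PiM J (\<lambda>_. M)) (PiM J (\<lambda>_. M'))"
  using T by (intro measurable_restrict measurable_compose[OF measurable_component_singleton]) auto
 define F where "F z = (\<integral>\<^sup>+ y. f (z(i := y)) \<partial>M')" for z
 have fup: "(\<lambda>(z, y). f (z(i := y))) \<in> borel_measurable (PiM J (\<lambda>_. M') \<Otimes>\<^sub>M M')"
  using measurable_compose[OF measurable_add_dim insert.prems] by (simp add: split_beta' del: fun_upd_apply)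
 have Fm: "F \<in> borel_measurable (PiM J (\<lambda>_. M'))"
  unfolding F_def by (rule sigma_finite_measure.borel_measurable_nn_integral[OF M' fup])
 have "(\<integral>\<^sup>+ z. (\<Prod>j\<in>insert i J. k j (z j)) * f (\<lambda>j\<in>insert i J. T j (z j)) \<partial>PiM (insert i J) (\<lambda>_. M))
  = (\<integral>\<^sup>+ z. \<integral>\<^sup>+ y. (\<Prod>j\<in>insert i J. k j ((z(i := y)) j)) * f (\<lambda>j\<in>insert i J. T j ((z(i := y)) j)) \<partial>M \<partial>PiM J (\<lambda>_. M))"
  by (rule product_nn_integral_insert[OF insert.hyps]) (use insert.prems in measurable)
 also have "... \<le> (\<integral>\<^sup>+ z. c * ((\<Prod>j\<in>J. k j (z j)) * F (\<lambda>j\<in>J. T j (z j))) \<partial>PiM J (\<lambda>_. M))"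
 proof (rule nn_integral_mono)
  fix z assume z: "z \<in> space (PiM J (\<lambda>_. M))"
  have Tz: "(\<lambda>j\<in>J. T j (z j)) \<in> space (PiM J (\<lambda>_. M'))"
   using measurable_space[OF TmJ z] .
  have gm: "(\<lambda>y. f ((\<lambda>j\<in>J. T j (z j))(i := y))) \<in> borel_measurable M'"
   using measurable_compose[OF measurable_Pair1'[OF Tz] fup] by simp
  have upd: "(\<lambda>j\<in>insert i J. T j ((z(i := y)) j)) = (\<lambda>j\<in>J. T j (z j))(i := T i y)" for y
   using insert.hyps(2) by (auto simp: restrict_def fun_eq_iff)
  have "(\<integral>\<^sup>+ y. (\<Prod>j\<in>insert i J. k j ((z(i := y)) j)) * f (\<lambda>j\<in>insert i J. T j ((z(i := y)) j)) \<partial>M)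
   = (\<integral>\<^sup>+ y. (\<Prod>j\<in>J. k j (z j)) * (k i y * f ((\<lambda>j\<in>J. T j (z j))(i := T i y))) \<partial>M)"
  proof (rule nn_integral_cong)
   fix y
   have "(\<Prod>j\<in>insert i J. k j ((z(i := y)) j)) = k i y * (\<Prod>j\<in>J. k j ((z(i := y)) j))"
    using insert.hyps by simp
   also have "(\<Prod>j\<in>J. k j ((z(i := y)) j)) = (\<Prod>j\<in>J. k j (z j))"
    using insert.hyps(2) by (intro prod.cong) auto
   finally show "(\<Prod>j\<in>insert i J. k j ((z(i := y)) j)) * f (\<lambda>j\<in>insert i J. T j ((z(i := y)) j))
    = (\<Prod>j\<in>J. k j (z j)) * (k i y * f ((\<lambda>j\<in>J. T j (z j))(i := T i y)))"
    unfolding upd by (simp only: mult_ac)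
  qed
  also have "... = (\<Prod>j\<in>J. k j (z j)) * (\<integral>\<^sup>+ y. k i y * f ((\<lambda>j\<in>J. T j (z j))(i := T i y)) \<partial>M)"
   by (intro nn_integral_cmult borel_measurable_times_ennreal k measurable_compose[OF T gm])
  also have "... \<le> (\<Prod>j\<in>J. k j (z j)) * (c * F (\<lambda>j\<in>J. T j (z j)))"
   unfolding F_def by (intro mult_left_mono le[OF gm]) simp
  finally show "(\<integral>\<^sup>+ y. (\<Prod>j\<in>insert i J. k j ((z(i := y)) j)) * f (\<lambda>j\<in>insert i J. T j ((z(i := y)) j)) \<partial>M)
   \<le> c * ((\<Prod>j\<in>J. k j (z j)) * F (\<lambda>j\<in>J. T j (z j)))" by (simp only: mult_ac)
 qed
 also have "... = c * (\<integral>\<^sup>+ z. (\<Prod>j\<in>J. k j (z j)) * F (\<lambda>j\<in>J. T j (z j)) \<partial>PiM J (\<lambda>_. M))"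
 proof (rule nn_integral_cmult)
  show "(\<lambda>z. (\<Prod>j\<in>J. k j (z j)) * F (\<lambda>j\<in>J. T j (z j))) \<in> borel_measurable (PiM J (\<lambda>_. M))"
   using k by (intro borel_measurable_times_ennreal borel_measurable_prod_ennreal measurable_compose[OF TmJ Fm]
     measurable_compose[OF measurable_component_singleton]) auto
 qed
 also have "... \<le> c * (c ^ card J * (\<integral>\<^sup>+ z. F z \<partial>PiM J (\<lambda>_. M')))"
  by (intro mult_left_mono insert.IH Fm) simp
 also have "(\<integral>\<^sup>+ z. F z \<partial>PiM J (\<lambda>_. M')) = (\<integral>\<^sup>+ z. f z \<partial>PiM (insert i J) (\<lambda>_. M'))"
  unfolding F_def by (rule M'.product_nn_integral_insert[OF insert.hyps insert.prems, symmetric])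
 finally show ?case using insert.hyps by (simp add: mult.assoc)
qed

lemma PiM_distr_component:
 fixes J :: "'i set"
 assumes J: "finite J" and M: "prob_space M" and T: "T \<in> measurable M M'"
 shows "distr (PiM J (\<lambda>_. M)) (PiM J (\<lambda>_. M')) (\<lambda>z. \<lambda>j\<in>J. T (z j)) = PiM J (\<lambda>_. distr M M' T)"
proof -
 interpret M: product_prob_space "\<lambda>_ :: 'i. M" using M by (intro product_prob_spaceI)
 interpret D: product_prob_space "\<lambda>_ :: 'i. distr M M' T"
  using prob_space.prob_space_distr[OF M T] by (intro product_prob_spaceI)
 have TmJ: "(\<lambda>z. \<lambda>j\<in>J. T (z j)) \<in> measurable (PiM J (\<lambda>_. M)) (PiM J (\<lambda>_. M'))"
  using T by (intro measurable_restrict measurable_compose[OF measurable_component_singleton]) auto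
 show ?thesis
 proof (rule D.PiM_eqI[OF J])
  show "sets (distr (PiM J (\<lambda>_. M)) (PiM J (\<lambda>_. M')) (\<lambda>z. \<lambda>j\<in>J. T (z j))) = sets (PiM J (\<lambda>_. distr M M' T))"
   by (simp cong: sets_PiM_cong)
  fix A assume A: "\<And>i. i \<in> J ==> A i \<in> sets (distr M M' T)"
  then have A': "Pi\<^sub>E J A \<in> sets (PiM J (\<lambda>_. M'))" by (intro sets_PiM_I_finite J) auto
  have "(\<lambda>z. \<lambda>j\<in>J. T (z j)) -` (Pi\<^sub>E J A) \<inter> space (PiM J (\<lambda>_. M)) = Pi\<^sub>E J (\<lambda>j. T -` A j \<inter> space M)"
   by (auto simp: space_PiM PiE_iff extensional_def)
  then have "emeasure (distr (PiM J (\<lambda>_. M)) (PiM J (\<lambda>_. M')) (\<lambda>z. \<lambda>j\<in>J. T (z j))) (Pi\<^sub>E J A)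
   = emeasure (PiM J (\<lambda>_. M)) (Pi\<^sub>E J (\<lambda>j. T -` A j \<inter> space M))"
   using A' TmJ by (subst emeasure_distr) auto
  also have "... = (\<Prod>j\<in>J. emeasure M (T -` A j \<inter> space M))"
   using A T by (intro M.emeasure_PiM J) auto
  also have "... = (\<Prod>j\<in>J. emeasure (distr M M' T) (A j))"
   using A T by (intro prod.cong refl) (simp add: emeasure_distr)
  finally show "emeasure (distr (PiM J (\<lambda>_. M)) (PiM J (\<lambda>_. M')) (\<lambda>z. \<lambda>j\<in>J. T (z j))) (Pi\<^sub>E J A)
   = (\<Prod>j\<in>J. emeasure (distr M M' T) (A j))" .
 qed
qed

section \<open>Gaussian increments\<close>

abbreviation gaussN :: "real => nat => (nat => real ^ 'n::finite) measure" where
 "gaussN v N \<equiv> PiM {1..N} (\<lambda>_. gauss v)"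

lemma sets_gaussN [measurable_cong]: "sets (gaussN v N) = sets (PiM {1..N} (\<lambda>_. borel))"
 by (intro sets_PiM_cong) auto

lemma prob_space_gaussN: "v > 0 ==> prob_space (gaussN v N)"
 by (intro prob_space_PiM prob_space_gauss)

lemma gaussN_reflect:
 assumes v: "v > 0"
 shows "distr (gaussN v N) (gaussN v N) (\<lambda>z. \<lambda>j\<in>{1..N}. - z j) = (gaussN v N :: (nat => real ^ 'n::finite) measure)"
 using PiM_distr_component[OF _ prob_space_gauss[OF v], of "{1..N}" uminus "gauss v"]
 by (simp add: distr_gauss_minus)

lemma gaussN_odd_integral:
 fixes g :: "(nat => real ^ 'n::finite) => real"
 assumes v: "v > 0" and gm: "g \<in> borel_measurable (gaussN v N)"
  and odd: "\<And>z. z \<in> space (gaussN v N) ==> g (\<lambda>j\<in>{1..N}. - z j) = - g z"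
 shows "(\<integral>z. g z \<partial>gaussN v N) = 0"
proof -
 have m: "(\<lambda>z. \<lambda>j\<in>{1..N}. - z j) \<in> measurable (gaussN v N) (gaussN v N :: (nat => real ^ 'n) measure)"
  by (intro measurable_restrict measurable_compose[OF measurable_component_singleton]) auto
 have "(\<integral>z. g z \<partial>gaussN v N) = (\<integral>z. g z \<partial>distr (gaussN v N) (gaussN v N) (\<lambda>z. \<lambda>j\<in>{1..N}. - z j))"
  unfolding gaussN_reflect[OF v] ..
 also have "... = (\<integral>z. g (\<lambda>j\<in>{1..N}. - z j) \<partial>gaussN v N)"
  by (rule integral_distr[OF m gm])
 also have "... = (\<integral>z. - g z \<partial>gaussN v N)" by (intro Bochner_Integration.integral_cong refl odd)
 also have "... = - (\<integral>z. g z \<partial>gaussN v N)" by simp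
 finally show ?thesis by simp
qed

text \<open>The weight cancels the density of the shift exactly; the inequality with an explicit
  factor 1 fits the pattern of \<open>PiM_dominated\<close>.\<close>

lemma gauss_shift_dominated:
 fixes b :: "real ^ 'n::finite"
 assumes v: "v > 0" and g: "g \<in> borel_measurable (gauss v)"
 shows "(\<integral>\<^sup>+ x. ennreal (exp (- (2 * (b \<bullet> x) + (norm b)\<^sup>2) / (2 * v))) * g (x + b) \<partial>gauss v) \<le> 1 * (\<integral>\<^sup>+ x. g x \<partial>gauss v)"
proof -
 have gb [measurable]: "g \<in> borel_measurable borel" using g by (simp cong: measurable_cong_sets)
 let ?h = "\<lambda>y. ennreal (exp (- (2 * (b \<bullet> (y - b)) + (norm b)\<^sup>2) / (2 * v))) * g y"
 have "(\<integral>\<^sup>+ x. ennreal (exp (- (2 * (b \<bullet> x) + (norm b)\<^sup>2) / (2 * v))) * g (x + b) \<partial>gauss v) = (\<integral>\<^sup>+ x. ?h (x + b) \<partial>gauss v)"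
  by simp
 also have "... = (\<integral>\<^sup>+ x. ?h x * ennreal (exp ((b \<bullet> x - (norm b)\<^sup>2 / 2) / v)) \<partial>gauss v)"
  by (rule nn_integral_gauss_translate[OF v]) measurable
 also have "... = (\<integral>\<^sup>+ x. g x \<partial>gauss v)"
 proof (rule nn_integral_cong)
  fix x :: "real ^ 'n"
  have "- (2 * (b \<bullet> (x - b)) + (norm b)\<^sup>2) / (2 * v) + (b \<bullet> x - (norm b)\<^sup>2 / 2) / v = 0"
   using v by (simp add: inner_diff_right power2_norm_eq_inner field_simps)
  then have "ennreal (exp (- (2 * (b \<bullet> (x - b)) + (norm b)\<^sup>2) / (2 * v))) * ennreal (exp ((b \<bullet> x - (norm b)\<^sup>2 / 2) / v)) = 1"
   by (simp add: ennreal_mult[symmetric] exp_add[symmetric])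
  moreover have "?h x * ennreal (exp ((b \<bullet> x - (norm b)\<^sup>2 / 2) / v)) =
   (ennreal (exp (- (2 * (b \<bullet> (x - b)) + (norm b)\<^sup>2) / (2 * v))) * ennreal (exp ((b \<bullet> x - (norm b)\<^sup>2 / 2) / v))) * g x"
   by (simp only: mult_ac)
  ultimately show "?h x * ennreal (exp ((b \<bullet> x - (norm b)\<^sup>2 / 2) / v)) = g x"
   by (simp only: mult_1)
 qed
 finally show ?thesis by simp
qed

lemma gaussN_shift_dominated:
 fixes b :: "nat => real ^ 'n::finite"
 assumes v: "v > 0" and f: "f \<in> borel_measurable (gaussN v N)"
 shows "(\<integral>\<^sup>+ z. ennreal (exp (- (\<Sum>j\<in>{1..N}. 2 * (b j \<bullet> z j) + (norm (b j))\<^sup>2) / (2 * v))) * f (\<lambda>j\<in>{1..N}. z j + b j) \<partial>gaussN v N)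
  \<le> (\<integral>\<^sup>+ z. f z \<partial>gaussN v N)"
proof -
 have sf: "sigma_finite_measure (gauss v :: (real ^ 'n) measure)"
  using prob_space_gauss[OF v] by (rule prob_space_imp_sigma_finite)
 have "(\<Prod>j\<in>{1..N}. ennreal (exp (- (2 * (b j \<bullet> z j) + (norm (b j))\<^sup>2) / (2 * v))))
  = ennreal (exp (- (\<Sum>j\<in>{1..N}. 2 * (b j \<bullet> z j) + (norm (b j))\<^sup>2) / (2 * v)))" for z
  by (simp add: prod_ennreal exp_sum[symmetric] sum_divide_distrib sum_negf[symmetric] del: sum_negf)
 moreover have "(\<integral>\<^sup>+ z. (\<Prod>j\<in>{1..N}. ennreal (exp (- (2 * (b j \<bullet> z j) + (norm (b j))\<^sup>2) / (2 * v)))) * f (\<lambda>j\<in>{1..N}. z j + b j) \<partial>gaussN v N)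
  \<le> 1 ^ card {1..N} * (\<integral>\<^sup>+ z. f z \<partial>gaussN v N)"
  by (rule PiM_dominated[OF _ sf sf _ _ gauss_shift_dominated[OF v] f]) (auto simp: measurable_cong_sets[OF sets_gauss refl])
 ultimately show ?thesis by simp
qed

text \<open>The variational inequality behind the recovery sequence: Jensen's inequality for the weight
 \<open>h\<close>, the finite-dimensional Cameron--Martin shift by \<open>b\<close>, and the cancellation of the linear
 term because \<open>h\<close> weights \<open>u\<close> symmetrically.\<close>

lemma gaussian_shift_jensen:
 fixes b :: "nat => real ^ 'n::finite" and h f :: "(nat => real ^ 'n) => real"
 assumes v: "v > 0"
  and h: "h \<in> borel_measurable (gaussN v N)" "\<And>z. h z \<ge> 0" "integrable (gaussN v N) h" "(\<integral>z. h z \<partial>gaussN v N) = 1"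
  and u: "u \<in> measurable (gaussN v N) (gaussN v N)"
  and cross: "integrable (gaussN v N) (\<lambda>z. h z * (\<Sum>j\<in>{1..N}. b j \<bullet> u z j))"
   "(\<integral>z. h z * (\<Sum>j\<in>{1..N}. b j \<bullet> u z j) \<partial>gaussN v N) = 0"
  and dom: "\<And>g. g \<in> borel_measurable (gaussN v N) ==> (\<integral>\<^sup>+ z. ennreal (h z) * g (u z) \<partial>gaussN v N) \<le> ennreal C * (\<integral>\<^sup>+ z. g z \<partial>gaussN v N)"
  and C: "C > 0"
  and f: "f \<in> borel_measurable (gaussN v N)" "\<And>z. \<bar>f z\<bar> \<le> K"
 shows "(\<integral>z. h z * f (\<lambda>j\<in>{1..N}. u z j + b j) \<partial>gaussN v N)
  \<le> (\<Sum>j\<in>{1..N}. (norm (b j))\<^sup>2) / (2 * v) + ln (C * (\<integral>z. exp (f z) \<partial>gaussN v N))"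
proof -
 let ?G = "gaussN v N :: (nat => real ^ 'n) measure"
 interpret G: prob_space ?G by (rule prob_space_gaussN[OF v])
 let ?B = "\<Sum>j\<in>{1..N}. (norm (b j))\<^sup>2"
 \<comment> \<open>The logarithm of the Cameron-Martin weight: integrating exp (L z) times a
   nonnegative function of z + b does not exceed the integral of that function.\<close>
 define L where "L z = - (\<Sum>j\<in>{1..N}. 2 * (b j \<bullet> z j) + (norm (b j))\<^sup>2) / (2 * v)" for z :: "nat => real ^ 'n"
 have Le: "L z = - ?B / (2 * v) - (\<Sum>j\<in>{1..N}. b j \<bullet> z j) / v" for z
  using v by (simp add: L_def sum.distrib sum_distrib_left[symmetric] field_simps)
 have Lm: "L \<in> borel_measurable ?G" unfolding L_def by measurable
 have sm: "(\<lambda>z. \<lambda>j\<in>{1..N}. z j + b j) \<in> measurable ?G ?G"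
  by (intro measurable_restrict) (simp cong: measurable_cong_sets)
 let ?s = "\<lambda>z. \<lambda>j\<in>{1..N}. u z j + b j"
 have fs: "(\<lambda>z. f (?s z)) \<in> borel_measurable ?G"
  using measurable_compose[OF u measurable_compose[OF sm f(1)]] by simp
 have Lu: "(\<lambda>z. L (u z)) \<in> borel_measurable ?G" by (rule measurable_compose[OF u Lm])
 define Z where "Z = C * (\<integral>z. exp (f z) \<partial>?G)"
 have Z: "Z > 0" unfolding Z_def
  using C less_le_trans[OF exp_gt_zero integral_exp_bounded_pos(2)[OF G.prob_space_axioms f]] by simp
 have ub: "(\<integral>\<^sup>+ z. ennreal (h z) * ennreal (exp (f (?s z) + L (u z))) \<partial>?G) \<le> ennreal Z"
 proof -
  let ?g = "\<lambda>z. ennreal (exp (L z)) * ennreal (exp (f (\<lambda>j\<in>{1..N}. z j + b j)))"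
  have gm: "?g \<in> borel_measurable ?G"
   using Lm measurable_compose[OF sm f(1)] by simp
  have "(\<integral>\<^sup>+ z. ennreal (h z) * ennreal (exp (f (?s z) + L (u z))) \<partial>?G) = (\<integral>\<^sup>+ z. ennreal (h z) * ?g (u z) \<partial>?G)"
   by (simp add: exp_add ennreal_mult mult.commute)
  also have "... \<le> ennreal C * (\<integral>\<^sup>+ z. ?g z \<partial>?G)" by (rule dom[OF gm])
  finally have A: "(\<integral>\<^sup>+ z. ennreal (h z) * ennreal (exp (f (?s z) + L (u z))) \<partial>?G) \<le> ennreal C * (\<integral>\<^sup>+ z. ?g z \<partial>?G)" .
  have "(\<integral>\<^sup>+ z. ?g z \<partial>?G) \<le> (\<integral>\<^sup>+ z. ennreal (exp (f z)) \<partial>?G)"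
   unfolding L_def by (rule gaussN_shift_dominated[OF v]) (use f(1) in simp)
  also have "... = ennreal (\<integral>z. exp (f z) \<partial>?G)"
   using integral_exp_bounded_pos(1)[OF G.prob_space_axioms f] by (intro nn_integral_eq_integral) auto
  finally have "ennreal C * (\<integral>\<^sup>+ z. ?g z \<partial>?G) \<le> ennreal C * ennreal (\<integral>z. exp (f z) \<partial>?G)"
   by (rule mult_left_mono) simp
  from order_trans[OF A this] have "(\<integral>\<^sup>+ z. ennreal (h z) * ennreal (exp (f (?s z) + L (u z))) \<partial>?G) \<le> ennreal C * ennreal (\<integral>z. exp (f z) \<partial>?G)" .
  moreover have "ennreal Z = ennreal C * ennreal (\<integral>z. exp (f z) \<partial>?G)"
   unfolding Z_def using C by (intro ennreal_mult) auto
  ultimately show ?thesis by (rule ord_le_eq_trans[OF _ sym])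
 qed
 have ih: "integrable ?G (\<lambda>z. h z * exp (f (?s z) + L (u z)))"
  using ub h(1,2) fs Lu by (intro integrableI_bounded) (auto simp: ennreal_mult abs_mult le_less_trans)
 have "ennreal (\<integral>z. h z * exp (f (?s z) + L (u z)) \<partial>?G) \<le> ennreal Z"
  using ub h(2) by (subst nn_integral_eq_integral[OF ih, symmetric]) (auto simp: ennreal_mult)
 then have iZ: "(\<integral>z. h z * exp (f (?s z) + L (u z)) \<partial>?G) \<le> Z" using Z by (simp add: ennreal_le_iff)
 have hf: "integrable ?G (\<lambda>z. h z * f (?s z))"
 proof (rule Bochner_Integration.integrable_bound)
  show "integrable ?G (\<lambda>z. K * h z)" using h(3) by simp
  show "AE z in ?G. norm (h z * f (?s z)) \<le> norm (K * h z)"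
   using f(2) h(2) by (intro AE_I2) (auto simp: abs_mult mult.commute[of K] intro!: mult_left_mono order_trans[OF f(2)])
 qed (use h(1) fs in measurable)
 have hL: "h z * L (u z) = (- ?B / (2 * v)) * h z - (h z * (\<Sum>j\<in>{1..N}. b j \<bullet> u z j)) / v" for z
  by (simp add: Le algebra_simps)
 have hLi: "integrable ?G (\<lambda>z. h z * L (u z))" unfolding hL using h(3) cross(1) by simp
 have hL0: "(\<integral>z. h z * L (u z) \<partial>?G) = - ?B / (2 * v)"
  unfolding hL using h(3,4) cross by (simp add: Bochner_Integration.integral_diff)
 \<comment> \<open>Jensen's inequality in tangent form, t \<le> exp t / Z - 1 + ln Z, integrated
   against h; Z bounds the integral of h times exp t.\<close>
 have "(\<integral>z. h z * f (?s z) + h z * L (u z) \<partial>?G) \<le> (\<integral>z. (h z * exp (f (?s z) + L (u z))) / Z - h z + h z * ln Z \<partial>?G)"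
 proof (rule integral_mono)
  fix z :: "nat => real ^ 'n"
  let ?x = "f (?s z) + L (u z)"
  have "ln (exp ?x / Z) \<le> exp ?x / Z - 1" using Z by (intro ln_le_minus_one) simp
  then have "?x \<le> exp ?x / Z - 1 + ln Z" using Z by (simp add: ln_div)
  then have "h z * ?x \<le> h z * (exp ?x / Z - 1 + ln Z)" using h(2) by (rule mult_left_mono)
  then show "h z * f (?s z) + h z * L (u z) \<le> (h z * exp ?x) / Z - h z + h z * ln Z"
   by (simp add: algebra_simps)
 qed (use hf hLi ih h(3) in auto)
 also have "... = (\<integral>z. h z * exp (f (?s z) + L (u z)) \<partial>?G) / Z - 1 + ln Z"
  using ih h(3,4) by simp
 also have "... \<le> ln Z" using iZ Z by (simp add: field_simps)
 finally show ?thesis using hf hLi hL0 by (simp add: Z_def)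
qed

section \<open>Random walks and the finite-dimensional laws of Brownian motion\<close>

lemma proj_sum: "finite J ==> proj (\<Sum>j\<in>J. f j) = (\<Sum>j\<in>J. proj (f j))"
 by (induction J rule: finite_induct) (simp_all add: proj_add)

definition walk :: "nat => 'n::finite torus => (nat => real ^ 'n) => nat => 'n torus" where
 "walk N x z = restrict (\<lambda>i. x + proj (\<Sum>j\<in>{1..i}. z j)) {..N}"

lemma measurable_partial_sum:
 "i \<le> N ==> (\<lambda>z. \<Sum>j\<in>{1..i}. z j) \<in> borel_measurable (gaussN v N :: (nat => real ^ 'n::finite) measure)"
 by (intro borel_measurable_sum) (simp cong: measurable_cong_sets)

text \<open>The grid ends at time T: T = 1 with diffusivity \<nu> describes the reference process, T
  = \<nu> with diffusivity 1 the noise, and both give walks with steps of variance \<nu> / N. The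
  start is integrated innermost, so that it can be treated for fixed increments.\<close>

lemma brownian_fd:
 fixes R :: "'n::finite torus cpath measure"
 assumes R: "is_reversible_brownian \<nu> R" and \<nu>: "\<nu> > 0" and T: "0 < T" "T \<le> 1" and N: "N > 0"
  and f: "f \<in> borel_measurable (PiM {..N} (\<lambda>_. borel))"
 shows "(\<integral>\<^sup>+ w. f (\<lambda>i\<in>{..N}. path_at w (T * real i / real N)) \<partial>R)
  = (\<integral>\<^sup>+ z. \<integral>\<^sup>+ x. f (walk N x z) \<partial>leb_torus \<partial>gaussN (\<nu> * T / N) N)"
proof -
 let ?v = "\<nu> * T / N"
 have v: "?v > 0" using \<nu> T N by simp
 define u where "u k = T * real k / real N" for k
 have u1: "u k \<in> {0..1}" if "k \<le> N" for k
 proof -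
  have "real k / real N \<le> 1" using that N by simp
  then have "T * (real k / real N) \<le> 1 * 1" using T by (intro mult_mono) auto
  then show ?thesis using T N by (simp add: u_def)
 qed
 have us: "u k < u (Suc k)" "u (Suc k) - u k = T / N" for k
  using T N by (simp_all add: u_def field_simps)
 define X where "X k w = (case k of 0 => path_at w 0 | Suc j => path_at w (u (Suc j)) - path_at w (u j))" for k and w :: "'n torus cpath"
 have RP: "R \<in> space (prob_algebra borel)" and R0: "distr R borel (\<lambda>w. path_at w 0) = leb_torus"
  and Rinc: "\<And>s t. 0 \<le> s ==> s < t ==> t \<le> 1 ==> distr R borel (\<lambda>w. path_at w t - path_at w s) = wrapped_gaussian (\<nu> * (t - s))"
  using R unfolding is_reversible_brownian_def by blast+
 have setsR: "sets R = sets borel" and prR: "prob_space R" using RP by (auto simp: space_prob_algebra)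
 interpret R: prob_space R by fact
 have ev: "(\<lambda>w. path_at w t) \<in> borel_measurable R" if "t \<in> {0..1}" for t
  using borel_measurable_eval[OF that] setsR by (simp cong: measurable_cong_sets)
 have Xm: "X k \<in> borel_measurable R" if "k \<in> {..N}" for k
  using that u1 unfolding X_def by (cases k) (auto intro!: borel_measurable_diff_torus ev)
 have "R.indep_vars (\<lambda>_. borel) X {..N}"
 proof -
  have "u 0 = 0" "\<forall>k<N. u k < u (Suc k)" "u N \<le> 1" using us u1[of N] by (simp_all add: u_def)
  then show ?thesis using R unfolding is_reversible_brownian_def X_def by blast
 qed
 then have joint: "distr R (PiM {..N} (\<lambda>_. borel)) (\<lambda>w. \<lambda>i\<in>{..N}. X i w) = PiM {..N} (\<lambda>i. distr R borel (X i))"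
  by (subst (asm) R.indep_vars_iff_distr_eq_PiM') (use Xm in auto)
 define L where "L i = (if i = 0 then leb_torus else wrapped_gaussian ?v :: 'n torus measure)" for i :: nat
 have wg: "wrapped_gaussian ?v = distr (gauss ?v :: (real ^ 'n) measure) borel proj" by (rule wrapped_gaussian_eq[OF v])
 have prw: "prob_space (wrapped_gaussian ?v :: 'n torus measure)"
  unfolding wg by (rule prob_space.prob_space_distr[OF prob_space_gauss[OF v]]) (simp cong: measurable_cong_sets)
 have Lp: "prob_space (L i)" for i unfolding L_def using prob_space_leb_torus[where 'n = 'n] prw by simp
 have XL: "distr R borel (X i) = L i" if "i \<in> {..N}" for i
 proof (cases i)
  case 0
  then show ?thesis using R0 by (simp add: X_def[abs_def] L_def)
 next
  case (Suc j)
  then have "u j \<in> {0..1}" "u (Suc j) \<in> {0..1}" using u1 that by auto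
  then have "distr R borel (X i) = wrapped_gaussian (\<nu> * (u (Suc j) - u j))"
   unfolding Suc X_def[abs_def] using Rinc[of "u j" "u (Suc j)"] us(1) by simp
  then show ?thesis using Suc us(2) by (simp add: L_def)
 qed
 have jointL: "distr R (PiM {..N} (\<lambda>_. borel)) (\<lambda>w. \<lambda>i\<in>{..N}. X i w) = PiM {..N} L"
  unfolding joint by (rule PiM_cong) (use XL in auto)
 \<comment> \<open>Cumulative sums undo the passage to start and increments, whose joint law is a
   product by independence.\<close>
 define cum where "cum x = (\<lambda>i\<in>{..N}. \<Sum>k\<in>{..i}. x k)" for x :: "nat => 'n torus"
 have sum_m: "(\<lambda>x. \<Sum>k\<in>{..i}. x k) \<in> borel_measurable (PiM {..N} (\<lambda>_. borel :: 'n torus measure))" if "i \<le> N" for i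
  using that
 proof (induction i)
  case 0
  then show ?case by (simp add: measurable_component_singleton)
 next
  case (Suc i)
  then have "(\<lambda>x. (\<Sum>k\<in>{..i}. x k) + x (Suc i)) \<in> borel_measurable (PiM {..N} (\<lambda>_. borel :: 'n torus measure))"
   by (intro borel_measurable_add_torus measurable_component_singleton) auto
  then show ?case by (simp add: atMost_Suc add.commute)
 qed
 have cum_m: "cum \<in> measurable (PiM {..N} (\<lambda>_. borel)) (PiM {..N} (\<lambda>_. borel))"
  unfolding cum_def using sum_m by (intro measurable_restrict) auto
 have sL: "sets (PiM {..N} L) = sets (PiM {..N} (\<lambda>_. borel))"
  by (intro sets_PiM_cong) (auto simp: L_def wrapped_gaussian_def)
 have cumX: "cum (\<lambda>i\<in>{..N}. X i w) = (\<lambda>i\<in>{..N}. path_at w (T * real i / real N))" for w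
 proof -
  have "(\<Sum>k\<in>{..i}. X k w) = path_at w (u i)" for i
   by (induction i) (simp_all add: X_def u_def atMost_Suc)
  then show ?thesis by (auto simp: cum_def u_def restrict_def fun_eq_iff intro!: sum.cong)
 qed
 have XR: "(\<lambda>w. \<lambda>i\<in>{..N}. X i w) \<in> measurable R (PiM {..N} (\<lambda>_. borel))"
  using Xm by (intro measurable_restrict) auto
 have "(\<integral>\<^sup>+ w. f (\<lambda>i\<in>{..N}. path_at w (T * real i / real N)) \<partial>R) = (\<integral>\<^sup>+ w. f (cum (\<lambda>i\<in>{..N}. X i w)) \<partial>R)"
  unfolding cumX ..
 also have "... = (\<integral>\<^sup>+ x. f (cum x) \<partial>PiM {..N} L)"
  unfolding jointL[symmetric] by (rule nn_integral_distr[symmetric, OF XR]) (use measurable_compose[OF cum_m f] in simp)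
 also have "... = (\<integral>\<^sup>+ y. \<integral>\<^sup>+ x. f (cum (y(0 := x))) \<partial>L 0 \<partial>PiM {1..N} L)"
 proof -
  interpret L: product_sigma_finite L
   using Lp by (simp add: product_sigma_finite_def prob_space_imp_sigma_finite)
  have ins: "{..N} = insert 0 {1..N}" by auto
  have "(\<lambda>x. f (cum x)) \<in> borel_measurable (PiM {..N} L)"
   using measurable_compose[OF cum_m f] sL by (simp cong: measurable_cong_sets)
  then show ?thesis unfolding ins by (intro L.product_nn_integral_insert) auto
 qed
 also have "PiM {1..N} L = PiM {1..N} (\<lambda>_. distr (gauss ?v) borel proj)"
  by (rule PiM_cong) (auto simp: L_def wg)
 also have "... = distr (gaussN ?v N) (PiM {1..N} (\<lambda>_. borel)) (\<lambda>z. \<lambda>j\<in>{1..N}. proj (z j))"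
  by (rule PiM_distr_component[symmetric, OF _ prob_space_gauss[OF v]]) (simp_all cong: measurable_cong_sets)
 also have "(\<integral>\<^sup>+ y. \<integral>\<^sup>+ x. f (cum (y(0 := x))) \<partial>L 0 \<partial>distr (gaussN ?v N) (PiM {1..N} (\<lambda>_. borel)) (\<lambda>z. \<lambda>j\<in>{1..N}. proj (z j)))
  = (\<integral>\<^sup>+ z. \<integral>\<^sup>+ x. f (cum ((\<lambda>j\<in>{1..N}. proj (z j))(0 := x))) \<partial>L 0 \<partial>gaussN ?v N)"
 proof (rule nn_integral_distr)
  show "(\<lambda>z. \<lambda>j\<in>{1..N}. proj (z j)) \<in> measurable (gaussN ?v N) (PiM {1..N} (\<lambda>_. borel :: 'n torus measure))"
   by (intro measurable_restrict measurable_compose[OF measurable_component_singleton]) (auto cong: measurable_cong_sets)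
  interpret L0: sigma_finite_measure "L 0" using Lp by (rule prob_space_imp_sigma_finite)
  have ins: "{..N} = insert 0 {1..N}" by auto
  have "(\<lambda>(y, x). y(0 := x)) \<in> measurable (PiM {1..N} (\<lambda>_. borel) \<Otimes>\<^sub>M borel) (PiM {..N} (\<lambda>_. borel :: 'n torus measure))"
   unfolding ins by (rule measurable_add_dim)
  from measurable_compose[OF this measurable_compose[OF cum_m f]]
  have "(\<lambda>(y, x). f (cum (y(0 := x)))) \<in> borel_measurable (PiM {1..N} (\<lambda>_. borel) \<Otimes>\<^sub>M L 0)"
   by (simp add: split_beta' L_def del: fun_upd_apply cong: measurable_cong_sets sets_pair_measure_cong)
  then have "(\<lambda>y. \<integral>\<^sup>+ x. f (cum (y(0 := x))) \<partial>L 0) \<in> borel_measurable (PiM {1..N} (\<lambda>_. borel))"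
   by (rule L0.borel_measurable_nn_integral)
  then show "(\<lambda>y. \<integral>\<^sup>+ x. f (cum (y(0 := x))) \<partial>L 0) \<in> borel_measurable
    (distr (gaussN ?v N) (PiM {1..N} (\<lambda>_. borel)) (\<lambda>z. \<lambda>j\<in>{1..N}. proj (z j)))"
   by simp
 qed
 also have "... = (\<integral>\<^sup>+ z. \<integral>\<^sup>+ x. f (walk N x z) \<partial>leb_torus \<partial>gaussN ?v N)"
 proof -
  have "cum ((\<lambda>j\<in>{1..N}. proj (z j))(0 := x)) = walk N x z" for x and z :: "nat => real ^ 'n"
   unfolding cum_def walk_def
  proof (rule restrict_ext)
   fix i assume i: "i \<in> {..N}"
   have "{..i} = insert 0 {1..i}" by auto
   then have "(\<Sum>k\<in>{..i}. ((\<lambda>j\<in>{1..N}. proj (z j))(0 := x)) k) = x + (\<Sum>k\<in>{1..i}. ((\<lambda>j\<in>{1..N}. proj (z j))(0 := x)) k)"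
    by simp
   also have "(\<Sum>k\<in>{1..i}. ((\<lambda>j\<in>{1..N}. proj (z j))(0 := x)) k) = (\<Sum>k\<in>{1..i}. proj (z k))"
    using i by (intro sum.cong) auto
   also have "... = proj (\<Sum>j\<in>{1..i}. z j)" by (rule proj_sum[symmetric]) simp
   finally show "(\<Sum>k\<in>{..i}. ((\<lambda>j\<in>{1..N}. proj (z j))(0 := x)) k) = x + proj (\<Sum>j\<in>{1..i}. z j)" .
  qed
  then show ?thesis by (simp add: L_def)
 qed
 finally show ?thesis .
qed

section \<open>Velocities of torus curves and their Euclidean lifts\<close>

lemma has_velocity_altdef:
 assumes "has_velocity \<omega> v t" "e > 0"
 obtains d where "d > 0" "\<And>s. s \<in> {0..1} ==> \<bar>s - t\<bar> < d ==> dist (\<omega> s) (\<omega> t + proj ((s - t) *\<^sub>R v)) \<le> e * \<bar>s - t\<bar>"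
proof -
 have "\<forall>\<^sub>F s in at t within {0..1}. dist (dist (\<omega> s) (\<omega> t + proj ((s - t) *\<^sub>R v)) / \<bar>s - t\<bar>) 0 < e"
  using assms unfolding has_velocity_def by (rule tendstoD)
 then obtain d where d: "d > 0" "\<And>s. s \<in> {0..1} ==> s \<noteq> t ==> dist s t < d ==>
   dist (dist (\<omega> s) (\<omega> t + proj ((s - t) *\<^sub>R v)) / \<bar>s - t\<bar>) 0 < e"
  unfolding eventually_at by blast
 show ?thesis
 proof (rule that[OF d(1)])
  fix s assume s: "s \<in> {0..1}" "\<bar>s - t\<bar> < d"
  show "dist (\<omega> s) (\<omega> t + proj ((s - t) *\<^sub>R v)) \<le> e * \<bar>s - t\<bar>"
  proof (cases "s = t")
   case False
   then have "dist (\<omega> s) (\<omega> t + proj ((s - t) *\<^sub>R v)) / \<bar>s - t\<bar> < e"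
    using d(2)[of s] s by (simp add: dist_real_def)
   then show ?thesis using False by (simp add: pos_divide_less_eq less_imp_le)
  qed simp
 qed
qed

lemma dist_proj_small: "norm (x - y) < 1 / 2 ==> dist (p + proj x) (p + proj y) = norm (x - y)"
 by (simp add: dist_torus_diff_left dist_torus_eq proj_diff[symmetric] tlog_proj_small)

text \<open>The intervals straddle t instead of starting there, because the grid cell of t contains
  it somewhere inside.\<close>

lemma has_velocity_increment_ge:
 assumes "has_velocity \<omega> v t" "e > 0"
 obtains d where "d > 0" "\<And>s s'. s \<in> {0..1} ==> s' \<in> {0..1} ==> s \<le> t ==> t \<le> s' ==> s' - s < d ==>
  dist (\<omega> s) (\<omega> s') \<ge> (norm v - e) * (s' - s)"
proof -
 obtain d where d: "d > 0" "\<And>s. s \<in> {0..1} ==> \<bar>s - t\<bar> < d ==> dist (\<omega> s) (\<omega> t + proj ((s - t) *\<^sub>R v)) \<le> e * \<bar>s - t\<bar>"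
  by (rule has_velocity_altdef[OF assms], rule that)
 show ?thesis
 \<comment> \<open>The second bound keeps (s' - s) |v| below 1/2, where torus distance and norm
   agree.\<close>
 proof (rule that[of "min d (1 / (2 * (norm v + 1)))"])
  show "0 < min d (1 / (2 * (norm v + 1)))" using d(1) by (simp add: add_nonneg_pos)
  fix s s' assume s: "s \<in> {0..1}" "s' \<in> {0..1}" "s \<le> t" "t \<le> s'" "s' - s < min d (1 / (2 * (norm v + 1)))"
  have "(s' - s) * (2 * (norm v + 1)) < 1" using s(5) by (simp add: pos_less_divide_eq add_nonneg_pos)
  moreover have "(s' - s) * norm v \<le> (s' - s) * (norm v + 1)" using s by (intro mult_left_mono) auto
  ultimately have "(s' - s) * norm v < 1 / 2" by (simp add: algebra_simps)
  moreover have "(s - t) *\<^sub>R v - (s' - t) *\<^sub>R v = (s - s') *\<^sub>R v" by (simp add: algebra_simps)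
  ultimately have "dist (\<omega> t + proj ((s - t) *\<^sub>R v)) (\<omega> t + proj ((s' - t) *\<^sub>R v)) = (s' - s) * norm v"
   using dist_proj_small[of "(s - t) *\<^sub>R v" "(s' - t) *\<^sub>R v" "\<omega> t"] s by simp
  moreover have "dist (\<omega> t + proj ((s - t) *\<^sub>R v)) (\<omega> t + proj ((s' - t) *\<^sub>R v)) \<le>
   dist (\<omega> s) (\<omega> t + proj ((s - t) *\<^sub>R v)) + dist (\<omega> s) (\<omega> s') + dist (\<omega> s') (\<omega> t + proj ((s' - t) *\<^sub>R v))"
   by (smt (verit) dist_triangle dist_commute)
  moreover have "dist (\<omega> s) (\<omega> t + proj ((s - t) *\<^sub>R v)) \<le> e * (t - s)" using d(2)[of s] s by simp
  moreover have "dist (\<omega> s') (\<omega> t + proj ((s' - t) *\<^sub>R v)) \<le> e * (s' - t)" using d(2)[of s'] s by simp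
  ultimately have "(s' - s) * norm v \<le> e * (t - s) + dist (\<omega> s) (\<omega> s') + e * (s' - t)" by linarith
  then show "dist (\<omega> s) (\<omega> s') \<ge> (norm v - e) * (s' - s)" by (simp add: algebra_simps)
 qed
qed

lemma has_velocity_unique:
 assumes v: "has_velocity \<omega> v t" and w: "has_velocity \<omega> w t" and t: "t \<in> {0<..<1}"
 shows "v = w"
proof (rule ccontr)
 assume "v \<noteq> w"
 define e where "e = norm (v - w) / 4"
 have e: "e > 0" using \<open>v \<noteq> w\<close> by (simp add: e_def)
 obtain d where d: "d > 0" "\<And>s. s \<in> {0..1} ==> \<bar>s - t\<bar> < d ==> dist (\<omega> s) (\<omega> t + proj ((s - t) *\<^sub>R v)) \<le> e * \<bar>s - t\<bar>"
  by (rule has_velocity_altdef[OF v e], rule that)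
 obtain d' where d': "d' > 0" "\<And>s. s \<in> {0..1} ==> \<bar>s - t\<bar> < d' ==> dist (\<omega> s) (\<omega> t + proj ((s - t) *\<^sub>R w)) \<le> e * \<bar>s - t\<bar>"
  by (rule has_velocity_altdef[OF w e], rule that)
 define m where "m = min (min d d') (min (1 - t) (1 / (2 * norm (v - w))))"
 have m: "m > 0" using d(1) d'(1) t \<open>v \<noteq> w\<close> by (simp add: m_def)
 define h where "h = m / 2"
 have "h < m" using m by (simp add: h_def)
 then have h: "h > 0" "h < d" "h < d'" "h < 1 - t" "h < 1 / (2 * norm (v - w))"
  using m by (simp_all add: h_def m_def)
 have n: "norm (h *\<^sub>R v - h *\<^sub>R w) = h * norm (v - w)"
  using h(1) by (simp add: scaleR_diff_right[symmetric])
 have "h * norm (v - w) < 1 / 2"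
  using h(5) \<open>v \<noteq> w\<close> by (simp add: pos_less_divide_eq field_simps)
 then have "h * norm (v - w) = dist (\<omega> t + proj (h *\<^sub>R v)) (\<omega> t + proj (h *\<^sub>R w))"
  using dist_proj_small[of "h *\<^sub>R v" "h *\<^sub>R w" "\<omega> t"] n by simp
 also have "... \<le> dist (\<omega> (t + h)) (\<omega> t + proj (h *\<^sub>R v)) + dist (\<omega> (t + h)) (\<omega> t + proj (h *\<^sub>R w))"
  by (metis dist_commute dist_triangle)
 also have "... \<le> e * h + e * h"
  using d(2)[of "t + h"] d'(2)[of "t + h"] h t by (intro add_mono) auto
 finally have "h * (4 * e) \<le> h * (2 * e)" by (simp add: e_def algebra_simps)
 then show False using h(1) e by simp
qed

lemma velocity_eqI: "has_velocity \<omega> v t ==> t \<in> {0<..<1} ==> velocity \<omega> t = v"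
 unfolding velocity_def using has_velocity_unique by (intro the_equality) auto

text \<open>A piece on which the curve stays within 1/4 of its starting point: there the logarithm
  of the increment from the start is an isometric lift, and Euclidean calculus applies.\<close>

locale short_path =
 fixes \<omega> :: "real => 'n::finite torus" and a b :: real
 assumes ab: "0 \<le> a" "a < b" "b \<le> 1"
  and short: "\<And>t. t \<in> {a..b} ==> dist (\<omega> t) (\<omega> a) < 1 / 4"
begin

definition lift :: "real => real ^ 'n" where
 "lift t = tlog (\<omega> t - \<omega> a)"

lemma lift_norm: "t \<in> {a..b} ==> norm (lift t) < 1 / 4"
 using short[of t] by (simp add: lift_def dist_torus_eq)

lemma lift_diff: "s \<in> {a..b} ==> t \<in> {a..b} ==> lift t - lift s = tlog (\<omega> t - \<omega> s)"
 using tlog_small_diff[of "\<omega> t - \<omega> a" "\<omega> s - \<omega> a"] lift_norm unfolding lift_def by simp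

lemma lift_dist: "s \<in> {a..b} ==> t \<in> {a..b} ==> norm (lift t - lift s) = dist (\<omega> t) (\<omega> s)"
 by (simp add: lift_diff dist_torus_eq)

lemma lift_velocity:
 assumes t: "t \<in> {a<..<b}" and d: "(lift has_vector_derivative v) (at t)"
 shows "has_velocity \<omega> v t"
 unfolding has_velocity_def
proof (rule tendstoI)
 fix e :: real assume e: "e > 0"
 have "(lift has_derivative (\<lambda>h. h *\<^sub>R v)) (at t)" using d by (simp add: has_vector_derivative_def)
 then obtain r where r: "r > 0" "\<And>s. \<bar>s - t\<bar> < r ==> norm (lift s - lift t - (s - t) *\<^sub>R v) \<le> e / 2 * \<bar>s - t\<bar>"
  unfolding has_derivative_at_alt using e by (metis half_gt_zero real_norm_def)
 have m: "min r (min (t - a) (b - t)) > 0" using r(1) t by simp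
 show "\<forall>\<^sub>F s in at t within {0..1}. dist (dist (\<omega> s) (\<omega> t + proj ((s - t) *\<^sub>R v)) / \<bar>s - t\<bar>) 0 < e"
  unfolding eventually_at
 proof (rule exI[of _ "min r (min (t - a) (b - t))"], intro conjI ballI impI m)
  fix s assume s: "s \<in> {0..1}" "s \<noteq> t \<and> dist s t < min r (min (t - a) (b - t))"
  then have sab: "s \<in> {a..b}" "t \<in> {a..b}" "\<bar>s - t\<bar> < r" using t by (auto simp: dist_real_def)
  have "proj (lift s - lift t - (s - t) *\<^sub>R v) = \<omega> s - (\<omega> t + proj ((s - t) *\<^sub>R v))"
   by (simp only: lift_diff[OF sab(2,1)] proj_diff proj_tlog diff_diff_eq)
  then have "dist (\<omega> s) (\<omega> t + proj ((s - t) *\<^sub>R v)) \<le> norm (lift s - lift t - (s - t) *\<^sub>R v)"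
   using norm_tlog_le[of "lift s - lift t - (s - t) *\<^sub>R v"] by (simp add: dist_torus_eq)
  also have "... \<le> e / 2 * \<bar>s - t\<bar>" using r(2) sab by blast
  finally have "dist (\<omega> s) (\<omega> t + proj ((s - t) *\<^sub>R v)) / \<bar>s - t\<bar> \<le> e / 2"
   using s by (simp add: pos_divide_le_eq)
  also have "e / 2 < e" using e by simp
  finally show "dist (dist (\<omega> s) (\<omega> t + proj ((s - t) *\<^sub>R v)) / \<bar>s - t\<bar>) 0 < e"
   by simp
 qed
qed

text \<open>Transfers one instance of the \<epsilon>-\<delta> condition from indexed families of
  open intervals to divisions; degenerate cells, which such families exclude, have zero increment
  and are dropped. It serves with \<epsilon> = 1 to bound the variation, and with every \<epsilon>
  for absolute continuity of the lift.\<close>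

lemma sum_incr_lift_less:
 assumes ac: "\<And>n c d. (\<forall>i<n. 0 \<le> c i \<and> c i < d i \<and> d i \<le> 1) ==>
   disjoint_family_on (\<lambda>i. {c i<..<d i}) {..<n::nat} ==> (\<Sum>i<n. d i - c i) < \<delta> ==>
   (\<Sum>i<n. dist (\<omega> (c i)) (\<omega> (d i))) < \<epsilon>"
  and D: "D division_of \<Union>D" "\<Union>D \<subseteq> {a..b}" "(\<Sum>K\<in>D. measure lborel K) < \<delta>"
 shows "(\<Sum>K\<in>D. norm (incr lift K)) < \<epsilon>"
proof -
 have cell: "\<exists>u v. K = {u..v} \<and> u \<le> v" if "K \<in> D" for K
  using division_ofD(3,4)[OF D(1) that] by (metis atLeastatMost_empty_iff interval_cbox)
 have fin: "finite D" using D(1) by blast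
 define D' where "D' = {K \<in> D. Inf K < Sup K}"
 have finD': "finite D'" using fin by (simp add: D'_def)
 obtain h n where h: "bij_betw h {..<n::nat} D'"
  using ex_bij_betw_nat_finite[OF finD'] by (auto simp: atLeast0LessThan)
 let ?c = "\<lambda>i. Inf (h i)" and ?d = "\<lambda>i. Sup (h i)"
 have hi: "h i \<in> D" "?c i < ?d i" "h i = {?c i..?d i}" "0 \<le> ?c i" "?d i \<le> 1" "?c i \<in> {a..b}" "?d i \<in> {a..b}" if "i < n" for i
 proof -
  have "h i \<in> D'" using h that by (auto simp: bij_betw_def)
  then show 1: "h i \<in> D" "?c i < ?d i" by (auto simp: D'_def)
  obtain u v where uv: "h i = {u..v}" "u \<le> v" using cell[OF 1(1)] by blast
  then show 2: "h i = {?c i..?d i}" by simp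
  have "h i \<subseteq> {a..b}" using D(2) 1(1) by blast
  then show "?c i \<in> {a..b}" "?d i \<in> {a..b}" using uv by auto
  then show "0 \<le> ?c i" "?d i \<le> 1" using ab by auto
 qed
 have "(\<Sum>i<n. dist (\<omega> (?c i)) (\<omega> (?d i))) < \<epsilon>"
 proof (rule ac)
  show "\<forall>i<n. 0 \<le> ?c i \<and> ?c i < ?d i \<and> ?d i \<le> 1" using hi by blast
  show "disjoint_family_on (\<lambda>i. {?c i<..<?d i}) {..<n}"
   unfolding disjoint_family_on_def
  proof (intro ballI impI)
   fix i j assume ij: "i \<in> {..<n}" "j \<in> {..<n}" "i \<noteq> j"
   then have "h i \<noteq> h j" using h by (auto simp: bij_betw_def inj_on_def)
   then have "interior (h i) \<inter> interior (h j) = {}" using division_ofD(5)[OF D(1)] hi(1) ij by blast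
   moreover have "interior (h i) = {?c i<..<?d i}" "interior (h j) = {?c j<..<?d j}"
    using hi(3)[of i] hi(3)[of j] ij interior_atLeastAtMost_real by (metis lessThan_iff)+
   ultimately show "{?c i<..<?d i} \<inter> {?c j<..<?d j} = {}" by simp
  qed
  have "(\<Sum>i<n. ?d i - ?c i) = (\<Sum>i<n. measure lborel (h i))"
  proof (intro sum.cong refl)
   fix i assume "i \<in> {..<n}"
   then have "h i = {?c i..?d i}" "?c i \<le> ?d i" using hi(2,3)[of i] by auto
   then show "?d i - ?c i = measure lborel (h i)" by (metis measure_lborel_Icc)
  qed
  also have "... = (\<Sum>K\<in>D'. measure lborel K)" by (rule sum.reindex_bij_betw[OF h])
  also have "... \<le> (\<Sum>K\<in>D. measure lborel K)" using fin by (intro sum_mono2) (auto simp: D'_def)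
  finally show "(\<Sum>i<n. ?d i - ?c i) < \<delta>" using D(3) by simp
 qed
 also have "(\<Sum>i<n. dist (\<omega> (?c i)) (\<omega> (?d i))) = (\<Sum>i<n. norm (incr lift (h i)))"
  using hi(6,7) by (intro sum.cong refl) (simp add: incr_def lift_dist dist_commute)
 also have "... = (\<Sum>K\<in>D'. norm (incr lift K))" by (rule sum.reindex_bij_betw[OF h])
 also have "... = (\<Sum>K\<in>D. norm (incr lift K))"
 proof (rule sum.mono_neutral_left[OF fin])
  show "\<forall>K\<in>D - D'. norm (incr lift K) = 0"
  proof
   fix K assume K: "K \<in> D - D'"
   then obtain u v where "K = {u..v}" "u \<le> v" using cell by blast
   then show "norm (incr lift K) = 0" using K by (cases "u = v") (auto simp: D'_def incr_def)
  qed
 qed (auto simp: D'_def)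
 finally show ?thesis .
qed

end

text \<open>A piece shorter than the \<delta> that belongs to \<epsilon> = 1 has variation at most
  1; this is how the second assumption is met.\<close>

locale short_ac_path = short_path +
 assumes ac: "abs_continuous_path \<omega>"
  and bv: "\<And>D. D division_of {a..b} ==> (\<Sum>K\<in>D. norm (incr lift K)) \<le> 1"
begin

lemma ac_lift: "ac_on a b lift"
 unfolding ac_on_def
proof (intro allI impI)
 fix \<epsilon> :: real assume "\<epsilon> > 0"
 then obtain \<delta> where \<delta>: "\<delta> > 0" "\<And>n c d. (\<forall>i<n. 0 \<le> c i \<and> c i < d i \<and> d i \<le> 1) \<and>
   disjoint_family_on (\<lambda>i. {c i<..<d i}) {..<n::nat} \<and> (\<Sum>i<n. d i - c i) < \<delta> ==>
   (\<Sum>i<n. dist (\<omega> (c i)) (\<omega> (d i))) < \<epsilon>"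
  using ac unfolding abs_continuous_path_def by blast
 show "\<exists>\<delta>>0. \<forall>D. D division_of \<Union>D \<and> \<Union>D \<subseteq> {a..b} \<and> (\<Sum>K\<in>D. measure lborel K) < \<delta> \<longrightarrow>
   (\<Sum>K\<in>D. norm (incr lift K)) < \<epsilon>"
 proof (intro exI[of _ \<delta>] conjI allI impI \<delta>(1))
  fix D assume D: "D division_of \<Union>D \<and> \<Union>D \<subseteq> {a..b} \<and> (\<Sum>K\<in>D. measure lborel K) < \<delta>"
  show "(\<Sum>K\<in>D. norm (incr lift K)) < \<epsilon>"
   by (rule sum_incr_lift_less[of \<delta>]) (use D \<delta>(2) in auto)
 qed
qed

definition bad :: "real set" where
 "bad = {x \<in> {a<..<b}. \<not> lift differentiable (at x)} \<union> {a, b}"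

lemma negligible_bad: "negligible bad"
proof -
 have "negligible {x \<in> {a<..<b}. \<not> lift differentiable (at x)}"
  by (rule bv_imp_differentiable_ae_euclidean[OF _ ab(2), of lift 1]) (rule bv)
 moreover have "negligible {a, b}" by simp
 ultimately show ?thesis unfolding bad_def by (rule negligible_Un)
qed

lemma lift_derivative:
 assumes t: "t \<in> {a..b} - bad"
 shows "has_velocity \<omega> (velocity \<omega> t) t" "(lift has_vector_derivative velocity \<omega> t) (at t)"
proof -
 have t': "t \<in> {a<..<b}" "lift differentiable (at t)" using t by (auto simp: bad_def)
 then have d: "(lift has_vector_derivative (vector_derivative lift (at t))) (at t)"
  using vector_derivative_works by blast
 then have v: "has_velocity \<omega> (vector_derivative lift (at t)) t" by (rule lift_velocity[OF t'(1)])
 have "t \<in> {0<..<1}" using t' ab by auto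
 then have "velocity \<omega> t = vector_derivative lift (at t)" by (rule velocity_eqI[OF v])
 then show "has_velocity \<omega> (velocity \<omega> t) t" "(lift has_vector_derivative velocity \<omega> t) (at t)"
  using v d by simp_all
qed

lemma velocity_has_integral: "(velocity \<omega> has_integral (lift b - lift a)) {a..b}"
 by (rule ac_on_has_integral[OF ac_lift _ negligible_bad])
  (use ab lift_derivative(2) in \<open>auto intro: has_vector_derivative_at_within\<close>)

text \<open>\<open>velocity\<close> is a definite description and has no measurability of its own;
  off a null set it is the derivative of the lift, so Lebesgue measurability comes with its
  integral.\<close>

lemma velocity_measurable: "(\<lambda>t. indicator {a..b} t *\<^sub>R velocity \<omega> t) \<in> borel_measurable lebesgue"
proof -
 have "velocity \<omega> integrable_on cbox a b" using velocity_has_integral by (auto simp: integrable_on_def)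
 then have "velocity \<omega> \<in> borel_measurable (lebesgue_on {a..b})" by (simp add: integrable_imp_measurable)
 then show ?thesis by (subst (asm) borel_measurable_restrict_space_iff) auto
qed

text \<open>Cauchy-Schwarz for the displacement w over time h, in the form 2 h (w . v) \<le> |w|^2 +
  h^2 |v|^2 integrated over the piece, so that no product of integrals occurs.\<close>

lemma action_density_ge:
 "ennreal ((dist (\<omega> a) (\<omega> b))\<^sup>2 / (b - a)) \<le> (\<integral>\<^sup>+ t\<in>{a..b}. ennreal ((norm (velocity \<omega> t))\<^sup>2) \<partial>lborel)"
proof (cases "(\<integral>\<^sup>+ t\<in>{a..b}. ennreal ((norm (velocity \<omega> t))\<^sup>2) \<partial>lborel) = \<infinity>")
 case False
 let ?q = "\<lambda>t. indicator {a..b} t * (norm (velocity \<omega> t))\<^sup>2 :: real"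
 have q: "?q t = (norm (indicator {a..b} t *\<^sub>R velocity \<omega> t))\<^sup>2" for t by (simp add: indicator_def)
 have qm: "?q \<in> borel_measurable lebesgue" unfolding q using velocity_measurable by measurable
 \<comment> \<open>\<open>action\<close> integrates over \<open>lborel\<close>, whereas the velocity
   is only Lebesgue measurable; passing to the completion leaves the integral unchanged.\<close>
 have nn: "(\<integral>\<^sup>+ t. ennreal (?q t) \<partial>lebesgue) = (\<integral>\<^sup>+ t\<in>{a..b}. ennreal ((norm (velocity \<omega> t))\<^sup>2) \<partial>lborel)"
  unfolding nn_integral_completion by (intro nn_integral_cong) (simp add: indicator_def)
 have qi: "integrable lebesgue ?q"
  using qm nn False by (intro integrableI_bounded) (auto simp: less_top abs_mult)
 define J where "J = integral\<^sup>L lebesgue ?q"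
 have J: "(\<integral>\<^sup>+ t\<in>{a..b}. ennreal ((norm (velocity \<omega> t))\<^sup>2) \<partial>lborel) = ennreal J"
  unfolding J_def nn[symmetric] by (rule nn_integral_eq_integral[OF qi]) simp
 have "(?q has_integral J) UNIV" unfolding J_def by (rule has_integral_integral_lebesgue[OF qi])
 then have "((\<lambda>t. if t \<in> {a..b} then (norm (velocity \<omega> t))\<^sup>2 else 0) has_integral J) UNIV"
  by (rule has_integral_eq[rotated]) (simp add: indicator_def)
 then have hJ: "((\<lambda>t. (norm (velocity \<omega> t))\<^sup>2) has_integral J) {a..b}"
  using has_integral_restrict_UNIV by blast
 define w where "w = lift b - lift a"
 define h where "h = b - a"
 have h: "h > 0" using ab by (simp add: h_def)
 have hw: "((\<lambda>t. w \<bullet> velocity \<omega> t) has_integral w \<bullet> w) {a..b}"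
  using has_integral_linear[OF velocity_has_integral bounded_linear_inner_right[of w]] by (simp add: w_def o_def)
 have hr: "((\<lambda>t. (w \<bullet> w) / (2 * h) + h / 2 * (norm (velocity \<omega> t))\<^sup>2) has_integral (b - a) *\<^sub>R ((w \<bullet> w) / (2 * h)) + h / 2 * J) {a..b}"
  using ab has_integral_const_real[of "(w \<bullet> w) / (2 * h)" a b]
  by (intro has_integral_add has_integral_mult_right hJ) auto
 have "w \<bullet> w \<le> (b - a) *\<^sub>R ((w \<bullet> w) / (2 * h)) + h / 2 * J"
 proof (rule has_integral_le[OF hw hr])
  fix t
  let ?v = "velocity \<omega> t"
  have "0 \<le> (norm (w - h *\<^sub>R ?v))\<^sup>2" by simp
  also have "... = w \<bullet> w - 2 * h * (w \<bullet> ?v) + h * h * (norm ?v)\<^sup>2"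
   by (simp add: power2_norm_eq_inner inner_diff_left inner_diff_right inner_commute algebra_simps)
  finally have "h * (2 * (w \<bullet> ?v)) \<le> w \<bullet> w + h * h * (norm ?v)\<^sup>2" by simp
  then show "w \<bullet> ?v \<le> (w \<bullet> w) / (2 * h) + h / 2 * (norm ?v)\<^sup>2" using h by (simp add: field_simps power2_eq_square)
 qed
 also have "(b - a) *\<^sub>R ((w \<bullet> w) / (2 * h)) = (w \<bullet> w) / 2" using h unfolding h_def[symmetric] by simp
 finally have "w \<bullet> w \<le> h * J" by simp
 moreover have "w \<bullet> w = (dist (\<omega> a) (\<omega> b))\<^sup>2"
  using lift_dist[of a b] ab by (simp add: w_def power2_norm_eq_inner[symmetric] dist_commute)
 ultimately have "(dist (\<omega> a) (\<omega> b))\<^sup>2 / (b - a) \<le> J" using h by (simp add: h_def pos_divide_le_eq mult.commute)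
 then show ?thesis unfolding J by (rule ennreal_leI)
qed simp

end

section \<open>Energy and action\<close>

text \<open>The action of the piecewise geodesic curve through the grid values.\<close>

definition energy :: "nat => 'n::finite torus cpath => real" where
 "energy N w = real N / 2 * (\<Sum>i<N. (dist (path_at w (real i / N)) (path_at w (real (Suc i) / N)))\<^sup>2)"

lemma ennreal_half: "ennreal (1 / 2) = 1 / 2"
proof -
 have "ennreal 1 / ennreal 2 = ennreal (1 / 2)" by (rule divide_ennreal) auto
 then show ?thesis by (simp only: ennreal_1 ennreal_numeral)
qed

lemma energy_nonneg: "energy N w \<ge> 0"
 by (simp add: energy_def sum_nonneg)

lemma dist_chain: "k \<le> l ==> dist (x k) (x l) \<le> (\<Sum>j\<in>{k..<l}. dist (x j) (x (Suc j)))"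
proof (induction l)
 case (Suc l)
 show ?case
 proof (cases "k = Suc l")
  case False
  then have "k \<le> l" using Suc.prems by simp
  then show ?thesis using Suc.IH dist_triangle[of "x k" "x (Suc l)" "x l"] by simp
 qed simp
qed simp

text \<open>Triangle inequality and Cauchy-Schwarz on each block of m steps.\<close>

lemma energy_refine:
 assumes N: "N > 0" and m: "m > 0"
 shows "energy N w \<le> energy (N * m) w"
proof -
 let ?M = "N * m"
 define x where "x j = path_at w (real j / ?M)" for j
 define g where "g j = (dist (x j) (x (Suc j)))\<^sup>2" for j
 have xi: "path_at w (real i / N) = x (i * m)" for i using m by (simp add: x_def)
 have "(dist (path_at w (real i / N)) (path_at w (real (Suc i) / N)))\<^sup>2 \<le> m * sum g {i * m..<i * m + m}" for i
 proof -
  have "dist (x (i * m)) (x (Suc i * m)) \<le> (\<Sum>j\<in>{i * m..<i * m + m}. dist (x j) (x (Suc j)))"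
   using dist_chain[of "i * m" "Suc i * m" x] by (simp add: add.commute)
  then have "(dist (x (i * m)) (x (Suc i * m)))\<^sup>2 \<le> (\<Sum>j\<in>{i * m..<i * m + m}. dist (x j) (x (Suc j)))\<^sup>2"
   by (rule power_mono) simp
  also have "... \<le> real (card {i * m..<i * m + m}) * (\<Sum>j\<in>{i * m..<i * m + m}. (dist (x j) (x (Suc j)))\<^sup>2)"
   by (subst mult.commute) (rule sum_squared_le_sum_of_squares)
  finally show ?thesis unfolding xi g_def by simp
 qed
 then have "(\<Sum>i<N. (dist (path_at w (real i / N)) (path_at w (real (Suc i) / N)))\<^sup>2) \<le> (\<Sum>i<N. m * sum g {i * m..<i * m + m})"
  by (intro sum_mono)
 also have "... = m * sum g {..<?M}"
  by (simp only: sum_distrib_left[symmetric] sum.nat_group)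
 finally have "real N / 2 * (\<Sum>i<N. (dist (path_at w (real i / N)) (path_at w (real (Suc i) / N)))\<^sup>2) \<le> real N / 2 * (m * sum g {..<?M})"
  by (intro mult_left_mono) auto
 also have "... = energy ?M w" unfolding energy_def g_def x_def by simp
 finally show ?thesis unfolding energy_def .
qed

text \<open>The grid is refined until every cell is shorter than the modulus for 1/4 and than the
  \<delta> for \<epsilon> = 1; it stays a refinement of the given grid, so that
  \<open>energy_refine\<close> applies.\<close>

lemma ac_short_partition:
 fixes w :: "'n::finite torus cpath"
 assumes ac: "abs_continuous_path (path_at w)" and N: "N > 0"
 obtains m where "m > 0" "\<And>i. i < N * m ==> short_ac_path (path_at w) (real i / (N * m)) (real (Suc i) / (N * m))"
proof -
 obtain \<delta> where \<delta>: "\<delta> > 0" "\<And>n c d. (\<forall>i<n. 0 \<le> c i \<and> c i < d i \<and> d i \<le> 1) \<and>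
   disjoint_family_on (\<lambda>i. {c i<..<d i}) {..<n::nat} \<and> (\<Sum>i<n. d i - c i) < \<delta> ==>
   (\<Sum>i<n. dist (path_at w (c i)) (path_at w (d i))) < 1"
  using ac[unfolded abs_continuous_path_def, rule_format, OF zero_less_one] by blast
 obtain m0 :: nat where m0: "m0 > 0" "\<And>s t. s \<in> {0..1} ==> t \<in> {0..1} ==> \<bar>s - t\<bar> \<le> 1 / m0 ==> dist (path_at w s) (path_at w t) < 1 / 4"
  by (rule cpath_modulus[of "1 / 4" w], simp, rule that)
 obtain m1 where m1: "1 / real (Suc m1) < \<delta>" using \<delta>(1) nat_approx_posE by blast
 define m where "m = max m0 (Suc m1)"
 have m: "m > 0" by (simp add: m_def)
 let ?M = "N * m"
 have "real m0 \<le> real ?M" "real (Suc m1) \<le> real ?M"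
 proof -
  have "m \<le> ?M" using N by simp
  then show "real m0 \<le> real ?M" "real (Suc m1) \<le> real ?M" unfolding m_def of_nat_le_iff by linarith+
 qed
 then have M1: "1 / real ?M \<le> 1 / m0" and M2: "1 / real ?M < \<delta>"
 proof -
  show "1 / real ?M \<le> 1 / m0" using m0(1) \<open>real m0 \<le> real ?M\<close> by (intro divide_left_mono) auto
  have "1 / real ?M \<le> 1 / real (Suc m1)" using \<open>real (Suc m1) \<le> real ?M\<close> by (intro divide_left_mono) auto
  then show "1 / real ?M < \<delta>" using m1 by linarith
 qed
 show ?thesis
 proof (rule that[OF m])
  fix i assume i: "i < ?M"
  let ?a = "real i / ?M" and ?b = "real (Suc i) / ?M"
  have Mp: "real ?M > 0" using N m by simp
  have abM: "0 \<le> ?a" "?a < ?b" "?b \<le> 1" "?b - ?a = 1 / ?M"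
   using Mp i by (simp_all add: field_simps diff_divide_distrib[symmetric] del: of_nat_mult) 
  interpret short_path "path_at w" ?a ?b
  proof
   fix t assume t: "t \<in> {?a..?b}"
   then have "\<bar>t - ?a\<bar> \<le> 1 / m0" using abM(4) M1 by auto
   moreover have "0 \<le> t" "t \<le> 1"
    using order_trans[OF abM(1), of t] order_trans[of t ?b 1] abM(3) t by simp_all
   then have "t \<in> {0..1}" "?a \<in> {0..1}" using abM(1,2,3) by auto
   ultimately show "dist (path_at w t) (path_at w ?a) < 1 / 4" using m0(2) by blast
  qed (use abM in auto)
  show "short_ac_path (path_at w) ?a ?b"
  proof
   show "abs_continuous_path (path_at w)" by fact
   fix D assume D: "D division_of {?a..?b}"
   have UD: "\<Union>D = {?a..?b}" using D by blast
   have "(\<Sum>K\<in>D. measure lborel K) = ?b - ?a"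
    using additive_content_division[of D ?a ?b] D abM(2) by simp
   then have "(\<Sum>K\<in>D. measure lborel K) < \<delta>" using abM(4) M2 by simp
   then have "(\<Sum>K\<in>D. norm (incr lift K)) < 1"
    using \<delta>(2) D UD by (intro sum_incr_lift_less[of \<delta>]) auto
   then show "(\<Sum>K\<in>D. norm (incr lift K)) \<le> 1" by simp
  qed
 qed
qed

lemma ac_velocity_ae:
 assumes ac: "abs_continuous_path (path_at w)"
 shows "AE t in lborel. t \<in> {0..1} \<longrightarrow> has_velocity (path_at w) (velocity (path_at w) t) t"
proof -
 obtain m where m: "m > 0" "\<And>i. i < 1 * m ==> short_ac_path (path_at w) (real i / (1 * m)) (real (Suc i) / (1 * m))"
  by (rule ac_short_partition[OF ac, of 1]) auto
 define Z where "Z = (\<Union>i<m. short_ac_path.bad (path_at w) (real i / m) (real (Suc i) / m)) \<union> {1}"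
 have "negligible (\<Union>i<m. short_ac_path.bad (path_at w) (real i / m) (real (Suc i) / m))"
  using short_ac_path.negligible_bad[OF m(2)] by (intro negligible_Union) auto
 then have "negligible Z" unfolding Z_def by (intro negligible_Un) auto
 then have "AE t in lebesgue. t \<notin> Z" by (intro AE_not_in) (simp add: negligible_iff_null_sets)
 then have "AE t in lborel. t \<notin> Z" by (simp add: AE_completion_iff)
 then show ?thesis
 proof eventually_elim
  case (elim t)
  show ?case
  proof
   assume t: "t \<in> {0..1}"
   define i where "i = nat \<lfloor>t * m\<rfloor>"
   have t1: "t \<noteq> 1" using elim by (auto simp: Z_def)
   have fl: "real i = of_int \<lfloor>t * m\<rfloor>" using t by (simp add: i_def)
   have "t * m < m" using t t1 m(1) by simp
   then have im: "i < m" using fl by linarith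
   have "real i \<le> t * m" "t * m \<le> real (Suc i)" using fl by linarith+
   then have "t \<in> {real i / m..real (Suc i) / m}" using m(1) by (simp add: pos_divide_le_eq pos_le_divide_eq)
   moreover have "t \<notin> short_ac_path.bad (path_at w) (real i / m) (real (Suc i) / m)"
    using elim im by (auto simp: Z_def)
   ultimately show "has_velocity (path_at w) (velocity (path_at w) t) t"
    using short_ac_path.lift_derivative(1)[OF m(2)[of i]] im by simp
  qed
 qed
qed

lemma energy_le_action:
 assumes N: "N > 0"
 shows "ennreal (energy N w) \<le> action w"
proof (cases "abs_continuous_path (path_at w)")
 case ac: True
 obtain m where m: "m > 0" "\<And>i. i < N * m ==> short_ac_path (path_at w) (real i / (N * m)) (real (Suc i) / (N * m))"
  by (rule ac_short_partition[OF ac N], rule that)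
 let ?M = "N * m"
 let ?I = "\<lambda>i. {real i / ?M..real (Suc i) / ?M}"
 let ?v = "velocity (path_at w)"
 have Mp: "real ?M > 0" using N m by simp
 have qm: "(\<lambda>t. ennreal ((norm (?v t))\<^sup>2) * indicator (?I i) t) \<in> borel_measurable lebesgue" if "i < ?M" for i
 proof -
  have "(\<lambda>t. ennreal ((norm (indicator (?I i) t *\<^sub>R ?v t))\<^sup>2)) \<in> borel_measurable lebesgue"
   using short_ac_path.velocity_measurable[OF m(2)[OF that]] by measurable
  moreover have "ennreal ((norm (indicator (?I i) t *\<^sub>R ?v t))\<^sup>2) = ennreal ((norm (?v t))\<^sup>2) * indicator (?I i) t" for t
   by (simp add: indicator_def)
  ultimately show ?thesis by (simp only:)
 qed
 have piece: "ennreal (real ?M * (dist (path_at w (real i / ?M)) (path_at w (real (Suc i) / ?M)))\<^sup>2)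
  \<le> (\<integral>\<^sup>+ t. ennreal ((norm (?v t))\<^sup>2) * indicator (?I i) t \<partial>lebesgue)" if "i < ?M" for i
 proof -
  have "real (Suc i) / ?M - real i / ?M = 1 / ?M" by (simp add: diff_divide_distrib[symmetric])
  then show ?thesis using short_ac_path.action_density_ge[OF m(2)[OF that]]
   by (simp add: mult.commute nn_integral_completion del: of_nat_Suc of_nat_mult)
 qed
 have "ennreal (energy N w) \<le> ennreal (energy ?M w)" by (intro ennreal_leI energy_refine N m(1))
 also have "ennreal (energy ?M w) = (1 / 2) * (\<Sum>i<?M. ennreal (real ?M * (dist (path_at w (real i / ?M)) (path_at w (real (Suc i) / ?M)))\<^sup>2))"
 proof -
  have "energy ?M w = 1 / 2 * (\<Sum>i<?M. real ?M * (dist (path_at w (real i / ?M)) (path_at w (real (Suc i) / ?M)))\<^sup>2)"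
   by (simp add: energy_def sum_distrib_left)
  then have "ennreal (energy ?M w) = ennreal (1 / 2) * ennreal (\<Sum>i<?M. real ?M * (dist (path_at w (real i / ?M)) (path_at w (real (Suc i) / ?M)))\<^sup>2)"
   by (simp only:) (intro ennreal_mult sum_nonneg, auto)
  also note ennreal_half
  finally show ?thesis by (subst sum_ennreal) auto
 qed
 also have "... \<le> (1 / 2) * (\<Sum>i<?M. \<integral>\<^sup>+ t. ennreal ((norm (?v t))\<^sup>2) * indicator (?I i) t \<partial>lebesgue)"
  by (intro mult_left_mono sum_mono piece) auto
 also have "... = (1 / 2) * (\<integral>\<^sup>+ t. (\<Sum>i<?M. ennreal ((norm (?v t))\<^sup>2) * indicator (?I i) t) \<partial>lebesgue)"
  using qm by (subst nn_integral_sum) auto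
 \<comment> \<open>The closed cells overlap only at grid points, a null set.\<close>
 also have "... \<le> (1 / 2) * (\<integral>\<^sup>+ t. ennreal ((norm (?v t))\<^sup>2) * indicator {0..1} t \<partial>lebesgue)"
 proof (intro mult_left_mono nn_integral_mono_AE)
  have "negligible ((\<lambda>i. real i / ?M) ` {..?M})" by (intro negligible_finite) auto
  then have "AE t in lebesgue. t \<notin> (\<lambda>i. real i / ?M) ` {..?M}" by (intro AE_not_in) (simp add: negligible_iff_null_sets)
  then show "AE t in lebesgue. (\<Sum>i<?M. ennreal ((norm (?v t))\<^sup>2) * indicator (?I i) t) \<le> ennreal ((norm (?v t))\<^sup>2) * indicator {0..1} t"
  proof eventually_elim
   case (elim t)
   have below: "real u < t * ?M" if "real u / ?M \<le> t" "real u / ?M \<noteq> t" for u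
   proof -
    have "real u / ?M < t" using that by simp
    then show ?thesis using pos_divide_less_eq[OF Mp] by blast
   qed
   have above: "t * ?M < real u" if "t \<le> real u / ?M" "real u / ?M \<noteq> t" for u
   proof -
    have "t < real u / ?M" using that by simp
    then show ?thesis using pos_less_divide_eq[OF Mp] by blast
   qed
   have "(\<Sum>i<?M. indicator (?I i) t) \<le> (indicator {0..1} t :: ennreal)"
   proof (cases "\<exists>i<?M. t \<in> ?I i")
    case True
    then obtain i where i: "i < ?M" "t \<in> ?I i" by blast
    have "real (Suc i) / ?M \<le> 1" using i(1) Mp by (simp add: divide_le_eq del: of_nat_mult)
    then have t01: "t \<in> {0..1}" using i(2) by (auto intro: order_trans[of 0 "real i / ?M"])
    have "t \<notin> ?I j" if j: "j < ?M" "j \<noteq> i" for j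
    proof
     assume tj: "t \<in> ?I j"
     have "real i / ?M \<noteq> t" "real j / ?M \<noteq> t" "real (Suc i) / ?M \<noteq> t" "real (Suc j) / ?M \<noteq> t"
      using elim i(1) j(1) by (metis Suc_leI atMost_iff imageI less_imp_le)+
     then have "real i < t * ?M" "t * ?M < real (Suc i)" "real j < t * ?M" "t * ?M < real (Suc j)"
      using i(2) tj below above by (simp_all del: of_nat_mult of_nat_Suc)
     then have "real i < real (Suc j)" "real j < real (Suc i)" by linarith+
     then show False using j(2) by linarith
    qed
    then have "(\<Sum>i<?M. indicator (?I i) t) = (\<Sum>j<?M. if j = i then 1 else 0 :: ennreal)"
     using i by (intro sum.cong) (auto simp: indicator_def)
    then show ?thesis using i(1) t01 by simp
   next
    case False
    then have "(\<Sum>i<?M. indicator (?I i) t) = (0 :: ennreal)" by (intro sum.neutral) (auto simp: indicator_def)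
    then show ?thesis by simp
   qed
   then have "ennreal ((norm (?v t))\<^sup>2) * (\<Sum>i<?M. indicator (?I i) t) \<le> ennreal ((norm (?v t))\<^sup>2) * indicator {0..1} t"
    by (intro mult_left_mono) auto
   then show ?case by (simp only: sum_distrib_left)
  qed
 qed auto
 also have "... = action w" using ac by (simp add: action_def nn_integral_completion)
 finally show ?thesis .
qed (simp add: action_def)

text \<open>Intervals are rounded inwards to a fine grid; each grid step d is split by d \<le> l /
  (2 N) + (N / (2 l)) d^2 into a part controlled by the total length and a part controlled by the
  energy.\<close>

lemma energy_bounded_imp_ac:
 fixes w :: "'n::finite torus cpath"
 assumes E: "\<And>n. energy (2 ^ n) w \<le> E"
 shows "abs_continuous_path (path_at w)"
 unfolding abs_continuous_path_def
proof (intro allI impI)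
 fix \<epsilon> :: real assume \<epsilon>: "\<epsilon> > 0"
 have E0: "E \<ge> 0" using E[of 0] energy_nonneg[of "2 ^ 0" w] by linarith
 \<comment> \<open>l makes E / l at most \<epsilon> / 4, \<delta> makes \<delta> l / 2 equal to
   \<epsilon> / 4, and the rounding costs another \<epsilon> / 4 through y below.\<close>
 define l where "l = 4 * (E + 1) / \<epsilon>"
 have l: "l > 0" using E0 \<epsilon> by (simp add: l_def)
 define \<delta> where "\<delta> = \<epsilon> / (2 * l)"
 have \<delta>: "\<delta> > 0" using \<epsilon> l by (simp add: \<delta>_def)
 show "\<exists>\<delta>>0. \<forall>(n::nat) a b. (\<forall>i<n. 0 \<le> a i \<and> a i < b i \<and> b i \<le> 1) \<and>
   disjoint_family_on (\<lambda>i. {a i<..<b i}) {..<n} \<and> (\<Sum>i<n. b i - a i) < \<delta> \<longrightarrow>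
   (\<Sum>i<n. dist (path_at w (a i)) (path_at w (b i))) < \<epsilon>"
 proof (intro exI[of _ \<delta>] conjI allI impI \<delta>)
  fix n :: nat and a b :: "nat => real"
  assume H: "(\<forall>i<n. 0 \<le> a i \<and> a i < b i \<and> b i \<le> 1) \<and>
   disjoint_family_on (\<lambda>i. {a i<..<b i}) {..<n} \<and> (\<Sum>i<n. b i - a i) < \<delta>"
  then have ab: "\<And>i. i < n ==> 0 \<le> a i \<and> a i < b i \<and> b i \<le> 1"
   and dj: "\<And>i j. i < n ==> j < n ==> i \<noteq> j ==> {a i<..<b i} \<inter> {a j<..<b j} = {}"
   and sm: "(\<Sum>i<n. b i - a i) < \<delta>" unfolding disjoint_family_on_def by auto
  define y where "y = \<epsilon> / (8 * (real n + 1))"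
  have y: "y > 0" using \<epsilon> by (simp add: y_def)
  obtain m0 :: nat where m0: "m0 > 0" "\<And>s t. s \<in> {0..1} ==> t \<in> {0..1} ==> \<bar>s - t\<bar> \<le> 1 / m0 ==> dist (path_at w s) (path_at w t) < y"
   by (rule cpath_modulus[OF y, of w], rule that)
  define r where "r = Min (insert (1 / m0) ((\<lambda>i. (b i - a i) / 2) ` {..<n}))"
  have r: "r > 0" unfolding r_def using ab m0(1) by (subst Min_gr_iff) auto
  obtain p where p: "(1 / 2) ^ p < r" using real_arch_pow_inv[OF r, of "1 / 2"] by auto
  define N :: nat where "N = 2 ^ p"
  have N: "N > 0" "1 / real N < r" using p by (simp_all add: N_def power_one_over)
  have Nm0: "1 / real N \<le> 1 / m0"
  proof -
   have "r \<le> 1 / m0" unfolding r_def by (rule Min_le) auto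
   then show ?thesis using N by linarith
  qed
  have Nab: "2 / real N < b i - a i" if "i < n" for i
  proof -
   have "r \<le> (b i - a i) / 2" unfolding r_def using that by (intro Min_le) auto
   define h where "h = 1 / real N"
   have "2 / real N = 2 * h" "h < r" using N(2) by (simp_all add: h_def)
   moreover from this(2) \<open>r \<le> (b i - a i) / 2\<close> have "2 * h < b i - a i" by argo
   ultimately show ?thesis by simp
  qed
  define x where "x j = path_at w (real j / N)" for j
  define k where "k i = nat \<lceil>a i * N\<rceil>" for i
  define q where "q i = nat \<lfloor>b i * N\<rfloor>" for i
  have kq: "a i * N \<le> real (k i)" "real (k i) < a i * N + 1" "real (q i) \<le> b i * N" "b i * N < real (q i) + 1" "k i \<le> q i" "q i \<le> N"
   if i: "i < n" for i
  proof -
   have a0: "a i * N \<ge> 0" "b i * N \<ge> 0" using ab[OF i] by auto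
   have fk: "real (k i) = of_int \<lceil>a i * N\<rceil>" using a0 unfolding k_def by (simp add: le_ceiling_iff)
   have fq: "real (q i) = of_int \<lfloor>b i * N\<rfloor>" using a0 unfolding q_def by simp
   show 1: "a i * N \<le> real (k i)" "real (k i) < a i * N + 1" using fk by linarith+
   show 2: "real (q i) \<le> b i * N" "b i * N < real (q i) + 1" using fq by linarith+
   have "2 < (b i - a i) * N" using Nab[OF i] N(1) by (simp add: pos_divide_less_eq)
   then have "real (k i) \<le> real (q i)" using 1 2 by (simp add: left_diff_distrib)
   then show "k i \<le> q i" by simp
   have "b i * N \<le> N" using ab[OF i] by (simp add: mult_left_le_one_le)
   then have "real (q i) \<le> real N" using 2 by linarith
   then show "q i \<le> N" by simp
  qed
  let ?d = "\<lambda>j. dist (x j) (x (Suc j))"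
  have each: "dist (path_at w (a i)) (path_at w (b i)) \<le> 2 * y + (\<Sum>j\<in>{k i..<q i}. ?d j)" if i: "i < n" for i
  proof -
   note kq = kq[OF i] and abi = ab[OF i]
   have Np: "real N > 0" using N(1) by simp
   have k01: "real (k i) / N \<in> {0..1}" "real (q i) / N \<in> {0..1}" using kq(5,6) N(1) by auto
   have "a i \<le> real (k i) / N" "real (k i) / N \<le> a i + 1 / N"
    using kq(1,2) Np by (simp_all add: pos_le_divide_eq pos_divide_le_eq distrib_right)
   moreover have "real (q i) / N \<le> b i" "b i \<le> real (q i) / N + 1 / N"
    using kq(3,4) Np by (simp_all add: add_divide_distrib[symmetric] pos_le_divide_eq pos_divide_le_eq)
   ultimately have "\<bar>a i - real (k i) / N\<bar> \<le> 1 / N" "\<bar>real (q i) / N - b i\<bar> \<le> 1 / N" by auto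
   then have 1: "dist (path_at w (a i)) (x (k i)) < y" "dist (x (q i)) (path_at w (b i)) < y"
    unfolding x_def using k01 abi Nm0 by (auto intro!: m0(2))
   have "dist (path_at w (a i)) (path_at w (b i)) \<le> dist (path_at w (a i)) (x (k i)) + dist (x (k i)) (x (q i)) + dist (x (q i)) (path_at w (b i))"
    using dist_triangle[of "path_at w (a i)" "path_at w (b i)" "x (k i)"] dist_triangle[of "x (k i)" "path_at w (b i)" "x (q i)"] by linarith
   moreover have "dist (x (k i)) (x (q i)) \<le> (\<Sum>j\<in>{k i..<q i}. ?d j)" by (rule dist_chain[OF kq(5)])
   ultimately show ?thesis using 1 by linarith
  qed
  define U where "U = (\<Union>i<n. {k i..<q i})"
  \<comment> \<open>A common grid step from c / N to (c + 1) / N would put its midpoint into both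
    intervals.\<close>
  have disj: "{k i..<q i} \<inter> {k j..<q j} = {}" if ij: "i < n" "j < n" "i \<noteq> j" for i j
  proof (rule ccontr)
   assume "{k i..<q i} \<inter> {k j..<q j} \<noteq> {}"
   then obtain c where "c \<in> {k i..<q i}" "c \<in> {k j..<q j}" by blast
   then have c: "k i \<le> c" "c < q i" "k j \<le> c" "c < q j" by auto
   have Np: "real N > 0" using N(1) by simp
   have "real (k i) \<le> real c" "real c + 1 \<le> real (q i)" "real (k j) \<le> real c" "real c + 1 \<le> real (q j)" using c by linarith+
   then have "a i * N \<le> c" "c + 1 \<le> b i * N" "a j * N \<le> c" "c + 1 \<le> b j * N"
    using kq(1,3)[OF ij(1)] kq(1,3)[OF ij(2)] by linarith+
   then have "a i * N < real c + 1 / 2" "real c + 1 / 2 < b i * N" "a j * N < real c + 1 / 2" "real c + 1 / 2 < b j * N" by linarith+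
   then have "(real c + 1 / 2) / N \<in> {a i<..<b i} \<inter> {a j<..<b j}"
    using Np by (simp add: pos_less_divide_eq pos_divide_less_eq)
   then show False using dj[OF ij] by blast
  qed
  have UN: "U \<subseteq> {..<N}" unfolding U_def using kq(6) by fastforce
  have finU: "finite U" unfolding U_def by auto
  have sumU: "(\<Sum>j\<in>U. g j) = (\<Sum>i<n. \<Sum>j\<in>{k i..<q i}. g j)" for g :: "nat => real"
   unfolding U_def using disj by (intro sum.UNION_disjoint) auto
  have cardU: "real (card U) \<le> \<delta> * N"
  proof -
   have "real (card U) = (\<Sum>j\<in>U. 1)" by simp
   also have "... = (\<Sum>i<n. real (q i - k i))" unfolding sumU by simp
   also have "... \<le> (\<Sum>i<n. (b i - a i) * N)"
   proof (intro sum_mono)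
    fix i assume "i \<in> {..<n}"
    then have i: "i < n" by simp
    have "real (q i - k i) = real (q i) - real (k i)" using kq(5)[OF i] by simp
    also have "... \<le> (b i - a i) * N" using kq(1,3)[OF i] by (simp add: left_diff_distrib)
    finally show "real (q i - k i) \<le> (b i - a i) * N" .
   qed
   also have "... = (\<Sum>i<n. b i - a i) * N" by (simp add: sum_distrib_right)
   also have "... \<le> \<delta> * N" using sm by (intro mult_right_mono) auto
   finally show ?thesis .
  qed
  have dle: "?d j \<le> l / (2 * N) + N / (2 * l) * (?d j)\<^sup>2" for j
  proof -
   have "0 \<le> (l - N * ?d j)\<^sup>2" by simp
   then have "2 * l * N * ?d j \<le> l\<^sup>2 + N\<^sup>2 * (?d j)\<^sup>2" by (simp add: power2_eq_square algebra_simps)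
   then have "(2 * l * N * ?d j) / (2 * l * N) \<le> (l\<^sup>2 + N\<^sup>2 * (?d j)\<^sup>2) / (2 * l * N)"
    using l N(1) by (intro divide_right_mono) auto
   then show ?thesis using l N(1) by (simp add: add_divide_distrib power2_eq_square)
  qed
  have "(\<Sum>i<n. dist (path_at w (a i)) (path_at w (b i))) \<le> (\<Sum>i<n. 2 * y + (\<Sum>j\<in>{k i..<q i}. ?d j))"
   using each by (intro sum_mono) auto
  also have "... = n * (2 * y) + (\<Sum>j\<in>U. ?d j)" by (simp add: sum.distrib sumU)
  also have "(\<Sum>j\<in>U. ?d j) \<le> (\<Sum>j\<in>U. l / (2 * N) + N / (2 * l) * (?d j)\<^sup>2)" by (intro sum_mono dle)
  also have "... = card U * (l / (2 * N)) + N / (2 * l) * (\<Sum>j\<in>U. (?d j)\<^sup>2)" by (simp add: sum.distrib sum_distrib_left)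
  also have "card U * (l / (2 * N)) \<le> \<delta> * N * (l / (2 * N))" using cardU l by (intro mult_right_mono) auto
  also have "... = \<epsilon> / 4" using N(1) l by (simp add: \<delta>_def)
  also have "N / (2 * l) * (\<Sum>j\<in>U. (?d j)\<^sup>2) \<le> \<epsilon> / 4"
  proof -
   have "(\<Sum>j\<in>U. (?d j)\<^sup>2) \<le> (\<Sum>j<N. (?d j)\<^sup>2)" using UN by (intro sum_mono2) auto
   then have "N / 2 * (\<Sum>j\<in>U. (?d j)\<^sup>2) \<le> energy N w"
    unfolding energy_def x_def by (intro mult_left_mono) auto
   also have "... \<le> E" unfolding N_def by (rule E)
   finally have "N / 2 * (\<Sum>j\<in>U. (?d j)\<^sup>2) / l \<le> E / l" using l by (intro divide_right_mono) auto
   also have "E / l \<le> \<epsilon> / 4" using E0 \<epsilon> by (simp add: l_def field_simps)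
   finally show ?thesis by simp
  qed
  also have "real n * (2 * y) \<le> \<epsilon> / 4" using \<epsilon> by (simp add: y_def field_simps)
  finally show "(\<Sum>i<n. dist (path_at w (a i)) (path_at w (b i))) < \<epsilon>" using \<epsilon> by simp
 qed
qed

text \<open>Fatou's lemma for the piecewise constant squared difference quotients
  \<open>Q n\<close>: almost everywhere on [0, 1] their lower limit is at least the squared speed,
  by the straddling estimate, and each has integral at most 2 E.\<close>

lemma action_le_energy_bound:
 fixes w :: "'n::finite torus cpath"
 assumes E: "\<And>n. energy (2 ^ n) w \<le> E"
 shows "action w \<le> ennreal E"
proof -
 have ac: "abs_continuous_path (path_at w)" by (rule energy_bounded_imp_ac[OF E])
 let ?v = "velocity (path_at w)"
 define D where "D n i = dist (path_at w (real i / 2 ^ n)) (path_at w (real (Suc i) / 2 ^ n))" for n i :: nat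
 define J where "J n i = {real i / 2 ^ n..<real (Suc i) / 2 ^ n}" for n i :: nat
 define Q where "Q n t = (\<Sum>i<2 ^ n. (2 ^ n * D n i)\<^sup>2 * indicator (J n i) t)" for n and t :: real
 have Qm: "(\<lambda>t. ennreal (Q n t)) \<in> borel_measurable lborel" for n unfolding Q_def J_def by measurable
 have Qint: "(\<integral>\<^sup>+ t. ennreal (Q n t) \<partial>lborel) \<le> ennreal (2 * E)" for n
 proof -
  have "(\<integral>\<^sup>+ t. ennreal (Q n t) \<partial>lborel) = (\<integral>\<^sup>+ t. (\<Sum>i<2 ^ n. ennreal ((2 ^ n * D n i)\<^sup>2) * indicator (J n i) t) \<partial>lborel)"
  proof (rule nn_integral_cong)
   fix t
   have "ennreal (Q n t) = (\<Sum>i<2 ^ n. ennreal ((2 ^ n * D n i)\<^sup>2 * indicator (J n i) t))"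
    unfolding Q_def by (rule sum_ennreal[symmetric]) simp
   then show "ennreal (Q n t) = (\<Sum>i<2 ^ n. ennreal ((2 ^ n * D n i)\<^sup>2) * indicator (J n i) t)"
    by (simp add: indicator_def if_distrib cong: if_cong)
  qed
  also have "... = (\<Sum>i<2 ^ n. ennreal ((2 ^ n * D n i)\<^sup>2) * emeasure lborel (J n i))"
   unfolding J_def by (subst nn_integral_sum) (auto simp: nn_integral_cmult_indicator)
  also have "... = (\<Sum>i<2 ^ n. ennreal (2 ^ n * (D n i)\<^sup>2))"
  proof (intro sum.cong refl)
   fix i :: nat
   have "emeasure lborel (J n i) = ennreal (real (Suc i) / 2 ^ n - real i / 2 ^ n)"
    unfolding J_def by (rule emeasure_lborel_Ico) (simp add: divide_right_mono)
   also have "real (Suc i) / 2 ^ n - real i / 2 ^ n = 1 / 2 ^ n" by (simp add: diff_divide_distrib[symmetric])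
   finally have eJ: "emeasure lborel (J n i) = ennreal (1 / 2 ^ n)" .
   have "ennreal ((2 ^ n * D n i)\<^sup>2) * ennreal (1 / 2 ^ n) = ennreal ((2 ^ n * D n i)\<^sup>2 * (1 / 2 ^ n))"
    by (rule ennreal_mult[symmetric]) auto
   also have "(2 ^ n * D n i)\<^sup>2 * (1 / 2 ^ n) = 2 ^ n * (D n i)\<^sup>2" by (simp add: power2_eq_square)
   finally show "ennreal ((2 ^ n * D n i)\<^sup>2) * emeasure lborel (J n i) = ennreal (2 ^ n * (D n i)\<^sup>2)"
    unfolding eJ .
  qed
  also have "... = ennreal (2 * energy (2 ^ n) w)"
   by (subst sum_ennreal) (auto simp: energy_def D_def sum_distrib_left[symmetric])
  also have "... \<le> ennreal (2 * E)" using E[of n] by (intro ennreal_leI) simp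
  finally show ?thesis .
 qed
 have "(\<integral>\<^sup>+ t\<in>{0..1}. ennreal ((norm (?v t))\<^sup>2) \<partial>lborel) \<le> (\<integral>\<^sup>+ t. liminf (\<lambda>n. ennreal (Q n t)) \<partial>lborel)"
 proof (rule nn_integral_mono_AE)
  have "AE t in lborel. t \<noteq> (1::real)" by (rule AE_lborel_singleton)
  with ac_velocity_ae[OF ac] show "AE t in lborel. ennreal ((norm (?v t))\<^sup>2) * indicator {0..1} t \<le> liminf (\<lambda>n. ennreal (Q n t))"
  proof eventually_elim
   case (elim t)
   show ?case
   proof (cases "t \<in> {0..1}")
    case t: True
    then have t1: "0 \<le> t" "t < 1" using elim by auto
    have hv: "has_velocity (path_at w) (?v t) t" using elim t by blast
    \<comment> \<open>e below the speed keeps \<open>norm (?v t) - e\<close> nonnegative, so that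
      squaring preserves the estimate.\<close>
    have ev: "eventually (\<lambda>n. (norm (?v t) - e)\<^sup>2 \<le> Q n t) sequentially" if e: "0 < e" "e < norm (?v t)" for e
    proof -
     obtain d where d: "d > 0" "\<And>s s'. s \<in> {0..1} ==> s' \<in> {0..1} ==> s \<le> t ==> t \<le> s' ==> s' - s < d ==>
      dist (path_at w s) (path_at w s') \<ge> (norm (?v t) - e) * (s' - s)"
      by (rule has_velocity_increment_ge[OF hv e(1)], rule that)
     obtain n0 where n0: "(1 / 2) ^ n0 < d" using real_arch_pow_inv[OF d(1), of "1 / 2"] by auto
     show ?thesis
     proof (rule eventually_mono[OF eventually_ge_at_top[of n0]])
      fix n assume n: "n0 \<le> n"
      have hd: "1 / 2 ^ n < d"
      proof -
       have "(1 / 2 :: real) ^ n \<le> (1 / 2) ^ n0" using n by (intro power_decreasing) auto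
       then show ?thesis using n0 by (simp add: power_one_over)
      qed
      define i where "i = nat \<lfloor>t * 2 ^ n\<rfloor>"
      have fl: "real i = of_int \<lfloor>t * 2 ^ n\<rfloor>" using t1 by (simp add: i_def)
      then have il: "real i \<le> t * 2 ^ n" "t * 2 ^ n < real (Suc i)" by linarith+
      have "t * 2 ^ n < 2 ^ n" using t1 by simp
      then have "real i < 2 ^ n" using il by linarith
      then have "real i < real (2 ^ n)" by (simp only: of_nat_power of_nat_numeral)
      then have i: "i < 2 ^ n" by (simp only: of_nat_less_iff)
      let ?s = "real i / 2 ^ n" and ?s' = "real (Suc i) / 2 ^ n"
      have s: "?s \<le> t" "t < ?s'" using il by (simp_all add: pos_divide_le_eq pos_less_divide_eq)
      have s01: "?s \<in> {0..1}" "?s' \<in> {0..1}" using grid_mem[of i "2 ^ n"] grid_mem[of "Suc i" "2 ^ n"] i by simp_all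
      have dif: "?s' - ?s = 1 / 2 ^ n" by (simp add: diff_divide_distrib[symmetric])
      have "D n i \<ge> (norm (?v t) - e) * (1 / 2 ^ n)"
       unfolding D_def using d(2)[OF s01] s hd dif by simp
      then have "norm (?v t) - e \<le> 2 ^ n * D n i" by (simp add: pos_divide_le_eq mult.commute)
      then have "(norm (?v t) - e)\<^sup>2 \<le> (2 ^ n * D n i)\<^sup>2" using e by (intro power_mono) auto
      also have "... = (2 ^ n * D n i)\<^sup>2 * indicator (J n i) t" using s by (simp add: J_def)
      also have "... \<le> Q n t" unfolding Q_def using i by (intro member_le_sum) auto
      finally show "(norm (?v t) - e)\<^sup>2 \<le> Q n t" .
     qed
    qed
    have Qlow: "ennreal ((norm (?v t) - e)\<^sup>2) \<le> liminf (\<lambda>n. ennreal (Q n t))" if "0 < e" "e < norm (?v t)" for e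
     by (rule Liminf_bounded, rule eventually_mono[OF ev[OF that]]) (rule ennreal_leI)
    have "ennreal ((norm (?v t))\<^sup>2) \<le> liminf (\<lambda>n. ennreal (Q n t))"
    proof (cases "?v t = 0")
     case False
     have "((\<lambda>e. ennreal ((norm (?v t) - e)\<^sup>2)) \<longlongrightarrow> ennreal ((norm (?v t) - 0)\<^sup>2)) (at_right 0)"
      by (intro tendsto_intros tendsto_ennrealI)
     moreover have "eventually (\<lambda>e. ennreal ((norm (?v t) - e)\<^sup>2) \<le> liminf (\<lambda>n. ennreal (Q n t))) (at_right 0)"
      using eventually_at_right_real[of 0 "norm (?v t)"] False Qlow by (auto elim: eventually_mono)
     ultimately have "ennreal ((norm (?v t) - 0)\<^sup>2) \<le> liminf (\<lambda>n. ennreal (Q n t))"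
      by (rule tendsto_upperbound) simp
     then show ?thesis by simp
    qed simp
    then show ?thesis using t by simp
   qed simp
  qed
 qed
 also have "... \<le> liminf (\<lambda>n. \<integral>\<^sup>+ t. ennreal (Q n t) \<partial>lborel)" by (rule nn_integral_liminf[OF Qm])
 also have "... \<le> ennreal (2 * E)"
  using Qint by (intro Liminf_le) auto
 finally have "(\<integral>\<^sup>+ t\<in>{0..1}. ennreal ((norm (?v t))\<^sup>2) \<partial>lborel) \<le> ennreal (2 * E)" .
 then have "(1 / 2) * (\<integral>\<^sup>+ t\<in>{0..1}. ennreal ((norm (?v t))\<^sup>2) \<partial>lborel) \<le> (1 / 2) * ennreal (2 * E)"
  by (rule mult_left_mono) simp
 also have "... = ennreal E"
 proof -
  have "ennreal (1 / 2) * ennreal (2 * E) = ennreal (1 / 2 * (2 * E))" by (rule ennreal_mult'[symmetric]) simp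
  then show ?thesis unfolding ennreal_half by simp
 qed
 finally show ?thesis using ac by (simp add: action_def)
qed

section \<open>Lower bound\<close>

lemma narrow_limit_integral:
 fixes P :: "real => 'a::topological_space measure"
 assumes P: "\<And>\<nu>. \<nu> > 0 ==> P \<nu> \<in> space (prob_algebra borel)"
  and lim: "limitin narrow_topology P p (at_right 0)" and f: "(f :: 'a => real) \<in> bcontfun"
 shows "((\<lambda>\<nu>. \<integral>x. f x \<partial>P \<nu>) \<longlongrightarrow> (\<integral>x. f x \<partial>p)) (at_right 0)"
proof -
 have p: "p \<in> space (prob_algebra borel)" using lim by (simp add: limitin_def)
 \<comment> \<open>\<open>limitin_narrow_topology\<close> asks for probability measures at every
   index, but nothing is known of P at \<nu> \<le> 0.\<close>
 define P' where "P' \<nu> = (if \<nu> > 0 then P \<nu> else p)" for \<nu>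
 have P': "P' \<nu> \<in> space (prob_algebra borel)" for \<nu> using P p by (simp add: P'_def)
 have eq: "\<forall>\<^sub>F \<nu> in at_right 0. P \<nu> = P' \<nu>"
  using eventually_at_right_less[of "0::real"] by eventually_elim (simp add: P'_def)
 then have "limitin narrow_topology P' p (at_right 0)" using lim by (rule limitin_transform_eventually)
 then have "((\<lambda>\<nu>. \<integral>x. f x \<partial>P' \<nu>) \<longlongrightarrow> (\<integral>x. f x \<partial>p)) (at_right 0)"
  using f unfolding limitin_narrow_topology[OF P' p] by blast
 then show ?thesis
  by (rule Lim_transform_eventually) (use eq in \<open>auto elim: eventually_mono\<close>)
qed

lemma measure_eqI_bcontfun:
 fixes \<mu> \<nu> :: "'a::metric_space measure"
 assumes \<mu>: "finite_measure \<mu>" "sets \<mu> = sets borel" and \<nu>: "finite_measure \<nu>" "sets \<nu> = sets borel"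
  and eq: "\<And>f :: 'a => real. f \<in> bcontfun ==> (\<integral>x. f x \<partial>\<mu>) = (\<integral>x. f x \<partial>\<nu>)"
 shows "\<mu> = \<nu>"
proof -
 have closed_eq: "measure \<mu> F = measure \<nu> F" if F: "closed F" for F :: "'a set"
 proof (cases "F = {}")
  case ne: False
  define g where "g n x = max 0 (1 - real n * infdist x F)" for n x
  have gc: "continuous_on UNIV (g n)" for n unfolding g_def by (intro continuous_intros)
  have gb: "0 \<le> g n x" "g n x \<le> 1" for n x by (auto simp: g_def infdist_nonneg)
  have gbc: "g n \<in> bcontfun" for n
   unfolding bcontfun_def using gc gb by (auto intro!: boundedI[of _ 1])
  have glim: "(\<lambda>n. g n x) \<longlonglongrightarrow> indicator F x" for x
  proof (cases "x \<in> F")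
   case True
   then show ?thesis by (simp add: g_def)
  next
   case False
   then have d: "infdist x F > 0" using in_closed_iff_infdist_zero[OF F ne, of x] infdist_nonneg[of x F] by linarith
   obtain n0 :: nat where n0: "1 / infdist x F < real n0" using reals_Archimedean2 by blast
   have "g n x = 0" if "n \<ge> n0" for n
   proof -
    have "1 / infdist x F < real n" using n0 that by linarith
    then have "1 < real n * infdist x F" using d by (simp add: pos_divide_less_eq)
    then show ?thesis by (simp add: g_def)
   qed
   then have "\<forall>\<^sub>F n in sequentially. g n x = 0" unfolding eventually_sequentially by blast
   then show ?thesis using False by (simp add: tendsto_eventually)
  qed
  have "(\<lambda>n. \<integral>x. g n x \<partial>h) \<longlonglongrightarrow> measure h F" if h: "finite_measure h" "sets h = sets borel" for h :: "'a measure"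
  proof -
   interpret finite_measure h by fact
   have "(\<lambda>n. \<integral>x. g n x \<partial>h) \<longlonglongrightarrow> (\<integral>x. indicator F x \<partial>h)"
   proof (rule integral_dominated_convergence[where w = "\<lambda>_. 1"])
    show "\<And>n. g n \<in> borel_measurable h"
     using borel_measurable_continuous_onI[OF gc] h(2) by (simp cong: measurable_cong_sets)
    show "(indicator F :: 'a => real) \<in> borel_measurable h"
     by (rule borel_measurable_indicator) (simp add: F h(2))
   qed (use glim gb in auto)
   moreover have "(\<integral>x. indicator F x \<partial>h) = measure h F"
    using sets_eq_imp_space_eq[OF h(2)] by simp
   ultimately show ?thesis by simp
  qed
  from this[OF \<mu>] this[OF \<nu>] eq[OF gbc] show ?thesis using LIMSEQ_unique by auto
 qed simp
 show ?thesis
 proof (rule measure_eqI_generator_eq[where E = "{F. closed F}" and \<Omega> = UNIV and A = "\<lambda>_. UNIV"])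
  show "Int_stable {F :: 'a set. closed F}" by (auto simp: Int_stable_def)
  show "sets \<mu> = sigma_sets UNIV {F. closed F}" "sets \<nu> = sigma_sets UNIV {F. closed F}"
   using \<mu>(2) \<nu>(2) by (simp_all add: borel_eq_closed)
  show "emeasure \<mu> X = emeasure \<nu> X" if "X \<in> {F. closed F}" for X
   using that closed_eq \<mu>(1) \<nu>(1) by (simp add: finite_measure.emeasure_eq_measure)
  show "emeasure \<mu> UNIV \<noteq> \<infinity>" using \<mu>(1) by (simp add: finite_measure.emeasure_eq_measure)
 qed auto
qed

lemma prob_algebra_borel_iff: "P \<in> space (prob_algebra borel) \<longleftrightarrow> prob_space P \<and> sets P = sets borel"
 by (auto simp: space_prob_algebra)

text \<open>Frequently instead of eventually: if the constraint holds only along a sequence of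
  \<nu>, the functionals may still be finite there. This suffices, since a limit of values that
  frequently equal a constant is that constant.\<close>

lemma distr_narrow_limit:
 fixes P :: "real => 'a::topological_space measure" and \<phi> :: "'a => 'b::metric_space"
 assumes P: "\<And>\<nu>. \<nu> > 0 ==> P \<nu> \<in> space (prob_algebra borel)"
  and lim: "limitin narrow_topology P p (at_right 0)" and \<phi>: "continuous_on UNIV \<phi>"
  and fr: "\<exists>\<^sub>F \<nu> in at_right 0. distr (P \<nu>) borel \<phi> = m"
 shows "distr p borel \<phi> = m"
proof -
 have p: "p \<in> space (prob_algebra borel)" using lim by (simp add: limitin_def)
 have \<phi>m: "\<phi> \<in> borel_measurable borel" by (rule borel_measurable_continuous_onI[OF \<phi>])
 have \<phi>P: "\<phi> \<in> measurable Q borel" if "Q \<in> space (prob_algebra borel)" for Q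
  using \<phi>m that by (simp add: prob_algebra_borel_iff cong: measurable_cong_sets)
 have "\<exists>\<^sub>F \<nu> in at_right 0. \<nu> > 0 \<and> distr (P \<nu>) borel \<phi> = m"
  using frequently_eventually_conj[OF fr eventually_at_right_less[of "0::real"]] by (simp add: conj_commute)
 then obtain \<nu>0 where \<nu>0: "\<nu>0 > 0" "distr (P \<nu>0) borel \<phi> = m" by (auto dest: frequently_ex)
 have mp: "prob_space m" "sets m = sets borel"
  using \<nu>0(2) prob_space.prob_space_distr[of "P \<nu>0" \<phi> borel] P[OF \<nu>0(1)] \<phi>P by (auto simp: prob_algebra_borel_iff)
 show ?thesis
 proof (rule measure_eqI_bcontfun)
  show "finite_measure (distr p borel \<phi>)"
   using p \<phi>P[OF p] by (simp add: prob_algebra_borel_iff prob_space.prob_space_distr prob_space.finite_measure)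
  show "finite_measure m" using mp by (simp add: prob_space.finite_measure)
  fix f :: "'b => real" assume f: "f \<in> bcontfun"
  then have fc: "continuous_on UNIV f" "bounded (range f)" by (auto simp: bcontfun_def)
  have fm: "f \<in> borel_measurable borel" by (rule borel_measurable_continuous_onI[OF fc(1)])
  have "continuous_on UNIV (\<lambda>x. f (\<phi> x))" by (rule continuous_on_compose2[OF fc(1) \<phi>]) simp
  moreover have "bounded (range (\<lambda>x. f (\<phi> x)))" by (rule bounded_subset[OF fc(2)]) auto
  ultimately have "(\<lambda>x. f (\<phi> x)) \<in> bcontfun" by (simp add: bcontfun_def)
  from narrow_limit_integral[OF P lim this]
  have L: "((\<lambda>\<nu>. \<integral>x. f (\<phi> x) \<partial>P \<nu>) \<longlongrightarrow> (\<integral>x. f (\<phi> x) \<partial>p)) (at_right 0)" by blast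
  have "\<exists>\<^sub>F \<nu> in at_right 0. (\<integral>x. f (\<phi> x) \<partial>P \<nu>) = (\<integral>x. f x \<partial>m)"
  proof (rule frequently_mono[OF _ \<open>\<exists>\<^sub>F \<nu> in at_right 0. \<nu> > 0 \<and> distr (P \<nu>) borel \<phi> = m\<close>], intro allI impI)
   fix \<nu> :: real assume "0 < \<nu> \<and> distr (P \<nu>) borel \<phi> = m"
   then show "(\<integral>x. f (\<phi> x) \<partial>P \<nu>) = (\<integral>x. f x \<partial>m)"
    using integral_distr[OF \<phi>P[OF P] fm, of \<nu>] by auto
  qed
  then have "(\<integral>x. f (\<phi> x) \<partial>p) = (\<integral>x. f x \<partial>m)"
   using tendsto_imp_eventually_ne[OF L] unfolding frequently_def by blast
  then show "(\<integral>x. f x \<partial>distr p borel \<phi>) = (\<integral>x. f x \<partial>m)"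
   using integral_distr[OF \<phi>P[OF p] fm] by simp
 qed (use mp in simp_all)
qed

section \<open>Exponential moments of the discrete energy\<close>

definition energy_fd :: "nat => (nat => 'n::finite torus) => real" where
 "energy_fd N x = real N / 2 * (\<Sum>i<N. (dist (x i) (x (Suc i)))\<^sup>2)"

lemma energy_samp: "energy N w = energy_fd N (samp N w)"
 by (simp add: energy_def energy_fd_def samp_def)

lemma measurable_energy_fd: "energy_fd N \<in> borel_measurable (PiM {..N} (\<lambda>_. borel))"
proof -
 have "(\<lambda>x. (dist (x i) (x (Suc i) :: 'n::finite torus))\<^sup>2) \<in> borel_measurable (PiM {..N} (\<lambda>_. borel))" if "i < N" for i
  using that by (intro borel_measurable_power borel_measurable_dist measurable_component_singleton) auto
 then show ?thesis unfolding energy_fd_def[abs_def]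
  by (intro borel_measurable_times borel_measurable_sum borel_measurable_const) auto
qed

lemma continuous_energy: "N > 0 ==> continuous_on UNIV (energy N)"
 unfolding energy_def[abs_def] by (intro continuous_intros continuous_on_eval) (auto simp: divide_le_eq)

lemma energy_bounded: "energy N (w :: 'n::finite torus cpath) \<le> real N / 2 * (N * (real CARD('n))\<^sup>2)"
proof -
 have "(\<Sum>i<N. (dist (path_at w (real i / N)) (path_at w (real (Suc i) / N)))\<^sup>2) \<le> (\<Sum>i<N. (real CARD('n))\<^sup>2)"
  by (intro sum_mono power_mono dist_torus_le) auto
 then show ?thesis unfolding energy_def by (intro mult_left_mono) auto
qed

lemma energy_bcontfun: "N > 0 ==> (energy N :: 'n::finite torus cpath => real) \<in> bcontfun"
proof -
 assume N: "N > 0"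
 have "norm (energy N w) \<le> real N / 2 * (N * (real CARD('n))\<^sup>2)" for w :: "'n torus cpath"
  using energy_bounded[of N w] energy_nonneg[of N w] by simp
 then have "bounded (range (energy N :: 'n torus cpath => real))"
  by (intro boundedI[of _ "real N / 2 * (N * (real CARD('n))\<^sup>2)"]) blast
 then show ?thesis using continuous_energy[OF N] by (simp add: bcontfun_def)
qed

lemma energy_fd_walk:
 "energy_fd N (walk N x z) \<le> real N / 2 * (\<Sum>j\<in>{1..N}. (norm (z j))\<^sup>2)"
proof -
 have "dist (walk N x z i) (walk N x z (Suc i)) \<le> norm (z (Suc i))" if "i < N" for i
 proof -
  have "dist (walk N x z i) (walk N x z (Suc i)) = dist (proj (\<Sum>j\<in>{1..i}. z j)) (proj (\<Sum>j\<in>{1..Suc i}. z j))"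
   using that by (simp add: walk_def dist_torus_diff_left)
  also have "... \<le> dist (\<Sum>j\<in>{1..i}. z j) (\<Sum>j\<in>{1..Suc i}. z j)" by (rule dist_proj_le)
  also have "... = norm (z (Suc i))" by (simp add: dist_norm)
  finally show ?thesis .
 qed
 then have "(\<Sum>i<N. (dist (walk N x z i) (walk N x z (Suc i)))\<^sup>2) \<le> (\<Sum>i<N. (norm (z (Suc i)))\<^sup>2)"
  by (intro sum_mono power_mono) auto
 also have "... = (\<Sum>j\<in>{1..N}. (norm (z j))\<^sup>2)"
  by (rule sum.reindex_bij_witness[of _ "\<lambda>j. j - 1" Suc]) auto
 finally show ?thesis unfolding energy_fd_def by (intro mult_left_mono) auto
qed

text \<open>Torus distances are at most the norms of the steps, so the exponent is at most a sum
  over independent Gaussian steps of variance \<nu> / N, and the bound factorises.\<close>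

lemma brownian_exp_energy:
 fixes R :: "'n::finite torus cpath measure"
 assumes R: "is_reversible_brownian \<nu> R" and \<nu>: "\<nu> > 0" and N: "N > 0" and \<epsilon>: "0 < \<epsilon>" "\<epsilon> < 1"
 shows "(\<integral>\<^sup>+ w. ennreal (exp ((1 - \<epsilon>) * energy N w / \<nu>)) \<partial>R) \<le> ennreal ((\<epsilon> powr (- real CARD('n) / 2)) ^ N)"
proof -
 define v where "v = \<nu> * 1 / real N"
 have v: "v > 0" using \<nu> N by (simp add: v_def)
 let ?f = "\<lambda>x :: nat => 'n torus. ennreal (exp ((1 - \<epsilon>) * energy_fd N x / \<nu>))"
 have fm: "?f \<in> borel_measurable (PiM {..N} (\<lambda>_. borel))"
  using measurable_energy_fd by measurable
 have "(\<integral>\<^sup>+ w. ennreal (exp ((1 - \<epsilon>) * energy N w / \<nu>)) \<partial>R) = (\<integral>\<^sup>+ w. ?f (\<lambda>i\<in>{..N}. path_at w (1 * real i / real N)) \<partial>R)"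
  by (simp add: energy_samp samp_def)
 also have "... = (\<integral>\<^sup>+ z. \<integral>\<^sup>+ x. ?f (walk N x z) \<partial>leb_torus \<partial>gaussN v N)"
  unfolding v_def by (rule brownian_fd[OF R \<nu> _ _ N fm]) auto
 also have "... \<le> (\<integral>\<^sup>+ z. (\<Prod>j\<in>{1..N}. ennreal (exp ((1 - \<epsilon>) * (norm (z j))\<^sup>2 / (2 * v)))) \<partial>(gaussN v N :: (nat => real ^ 'n) measure))"
 proof (rule nn_integral_mono)
  fix z :: "nat => real ^ 'n"
  have le: "?f (walk N x z) \<le> (\<Prod>j\<in>{1..N}. ennreal (exp ((1 - \<epsilon>) * (norm (z j))\<^sup>2 / (2 * v))))" for x
  proof -
   have "(1 - \<epsilon>) * energy_fd N (walk N x z) / \<nu> \<le> (1 - \<epsilon>) * (real N / 2 * (\<Sum>j\<in>{1..N}. (norm (z j))\<^sup>2)) / \<nu>"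
    using \<epsilon> \<nu> by (intro divide_right_mono mult_left_mono energy_fd_walk) auto
   also have "... = (\<Sum>j\<in>{1..N}. (1 - \<epsilon>) * (norm (z j))\<^sup>2 / (2 * v))"
    using \<nu> N by (simp add: v_def sum_distrib_left sum_divide_distrib mult_ac)
   finally show ?thesis by (simp add: prod_ennreal exp_sum[symmetric] ennreal_leI)
  qed
  have "(\<integral>\<^sup>+ x. ?f (walk N x z) \<partial>leb_torus) \<le> (\<integral>\<^sup>+ x. (\<Prod>j\<in>{1..N}. ennreal (exp ((1 - \<epsilon>) * (norm (z j))\<^sup>2 / (2 * v)))) \<partial>(leb_torus :: 'n torus measure))"
   by (intro nn_integral_mono le)
  then show "(\<integral>\<^sup>+ x. ?f (walk N x z) \<partial>leb_torus) \<le> (\<Prod>j\<in>{1..N}. ennreal (exp ((1 - \<epsilon>) * (norm (z j))\<^sup>2 / (2 * v))))"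
   using prob_space.emeasure_space_1[OF prob_space_leb_torus[where 'n = 'n]] by simp
 qed
 also have "... = (\<Prod>j\<in>{1..N}. \<integral>\<^sup>+ x. ennreal (exp ((1 - \<epsilon>) * (norm x)\<^sup>2 / (2 * v))) \<partial>(gauss v :: (real ^ 'n) measure))"
 proof -
  interpret product_sigma_finite "\<lambda>_ :: nat. gauss v :: (real ^ 'n) measure"
   using prob_space_gauss[OF v, where 'n = 'n] by (simp add: product_sigma_finite_def prob_space_imp_sigma_finite)
  show ?thesis by (rule product_nn_integral_prod) (auto simp: measurable_cong_sets[OF sets_gauss refl])
 qed
 also have "... = ennreal ((\<epsilon> powr (- real CARD('n) / 2)) ^ N)"
  unfolding nn_integral_gauss_exp_sq[OF v \<epsilon>(1)] by (simp add: ennreal_power)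
 finally show ?thesis .
qed

text \<open>The variational formula with test function (1 - \<epsilon>) energy / \<nu>, multiplied
  by \<nu>: for fixed N and \<epsilon> the error is \<nu> times a constant.\<close>

lemma energy_le_entropy:
 fixes P R :: "'n::finite torus cpath measure"
 assumes R: "is_reversible_brownian \<nu> R" and P: "P \<in> space (prob_algebra borel)"
  and \<nu>: "\<nu> > 0" and N: "N > 0" and \<epsilon>: "0 < \<epsilon>" "\<epsilon> < 1"
 shows "ereal ((1 - \<epsilon>) * (\<integral>w. energy N w \<partial>P) - \<nu> * ln ((\<epsilon> powr (- real CARD('n) / 2)) ^ N)) \<le> ereal \<nu> * rel_entropy P R"
proof -
 have R': "R \<in> space (prob_algebra borel)" using R by (simp add: is_reversible_brownian_def)
 have pP: "prob_space P" "sets P = sets borel" and pR: "prob_space R" "sets R = sets borel"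
  using P R' by (auto simp: prob_algebra_borel_iff)
 define K where "K = (1 - \<epsilon>) * (real N / 2 * (N * (real CARD('n))\<^sup>2)) / \<nu>"
 define f where "f w = (1 - \<epsilon>) * energy N w / \<nu>" for w :: "'n torus cpath"
 have fb: "\<bar>f w\<bar> \<le> K" for w
 proof -
  have "0 \<le> f w" unfolding f_def using \<epsilon> \<nu> energy_nonneg[of N w] by simp
  moreover have "f w \<le> K" unfolding f_def K_def using \<epsilon> \<nu> by (intro divide_right_mono mult_left_mono energy_bounded) auto
  ultimately show ?thesis by simp
 qed
 have fm: "f \<in> borel_measurable R"
  unfolding f_def[abs_def] using borel_measurable_continuous_onI[OF continuous_energy[OF N]] pR(2)
  by (intro borel_measurable_divide borel_measurable_times) (auto cong: measurable_cong_sets)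
 have "(\<integral>w. exp (f w) \<partial>R) \<le> (\<epsilon> powr (- real CARD('n) / 2)) ^ N"
 proof -
  have "ennreal (\<integral>w. exp (f w) \<partial>R) = (\<integral>\<^sup>+ w. ennreal (exp (f w)) \<partial>R)"
   using integral_exp_bounded_pos(1)[OF pR(1) fm fb] by (intro nn_integral_eq_integral[symmetric]) auto
  also have "... \<le> ennreal ((\<epsilon> powr (- real CARD('n) / 2)) ^ N)"
   unfolding f_def by (rule brownian_exp_energy[OF R \<nu> N \<epsilon>])
  finally show ?thesis by (simp add: ennreal_le_iff)
 qed
 then have "ln (\<integral>w. exp (f w) \<partial>R) \<le> ln ((\<epsilon> powr (- real CARD('n) / 2)) ^ N)"
  using less_le_trans[OF exp_gt_zero integral_exp_bounded_pos(2)[OF pR(1) fm fb]] by (intro ln_mono) auto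
 moreover have "ereal ((\<integral>w. f w \<partial>P) - ln (\<integral>w. exp (f w) \<partial>R)) \<le> rel_entropy P R"
  using pP pR by (intro rel_entropy_ge[OF _ _ _ fm fb]) auto
 ultimately have "ereal ((\<integral>w. f w \<partial>P) - ln ((\<epsilon> powr (- real CARD('n) / 2)) ^ N)) \<le> rel_entropy P R"
  by (elim order_trans[rotated]) simp
 then have "ereal \<nu> * ereal ((\<integral>w. f w \<partial>P) - ln ((\<epsilon> powr (- real CARD('n) / 2)) ^ N)) \<le> ereal \<nu> * rel_entropy P R"
  using \<nu> by (intro ereal_mult_left_mono) auto
 moreover have "\<nu> * (\<integral>w. f w \<partial>P) = (1 - \<epsilon>) * (\<integral>w. energy N w \<partial>P)"
  using \<nu> by (simp add: f_def)
 ultimately show ?thesis by (simp add: right_diff_distrib)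
qed

text \<open>Monotone convergence along the dyadic grids, where the supremum of the energies
  dominates the action.\<close>

lemma nn_integral_action_eq_SUP:
 fixes p :: "'n::finite torus cpath measure"
 assumes p: "p \<in> space (prob_algebra borel)"
 shows "(\<integral>\<^sup>+ w. action w \<partial>p) \<le> (SUP n. ennreal (\<integral>w. energy (2 ^ n) w \<partial>p))"
proof -
 have pp: "prob_space p" "sets p = sets borel" using p by (auto simp: prob_algebra_borel_iff)
 have em: "(energy (2 ^ n) :: 'n torus cpath => real) \<in> borel_measurable p" for n
  using borel_measurable_continuous_onI[OF continuous_energy[of "2 ^ n"]] pp(2) by (simp cong: measurable_cong_sets)
 have "action w \<le> (SUP n. ennreal (energy (2 ^ n) w))" for w :: "'n torus cpath"
 proof (cases "(SUP n. ennreal (energy (2 ^ n) w))")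
  case (real E)
  have "ennreal (energy (2 ^ n) w) \<le> ennreal E" for n unfolding real(2)[symmetric] by (rule SUP_upper) simp
  then have "energy (2 ^ n) w \<le> E" for n using real(1) by (simp add: ennreal_le_iff)
  then show ?thesis using action_le_energy_bound real(2) by metis
 next
  case top
  show ?thesis unfolding top by (rule top_greatest)
 qed
 then have "(\<integral>\<^sup>+ w. action w \<partial>p) \<le> (\<integral>\<^sup>+ w. (SUP n. ennreal (energy (2 ^ n) w)) \<partial>p)"
  by (intro nn_integral_mono)
 also have "... = (SUP n. \<integral>\<^sup>+ w. ennreal (energy (2 ^ n) w) \<partial>p)"
 proof (rule nn_integral_monotone_convergence_SUP)
  show "incseq (\<lambda>n w. ennreal (energy (2 ^ n) (w :: 'n torus cpath)))"
   by (rule incseq_SucI) (auto simp: le_fun_def mult.commute[of 2] intro!: ennreal_leI energy_refine)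
 qed (use em in simp)
 also have "... = (SUP n. ennreal (\<integral>w. energy (2 ^ n) w \<partial>p))"
 proof (intro SUP_cong refl nn_integral_eq_integral)
  fix n :: nat
  show "integrable p (energy (2 ^ n))"
   by (rule integrable_bounded_prob[OF pp(1) em, of _ "real (2 ^ n) / 2 * (real (2 ^ n) * (real CARD('n))\<^sup>2)"])
    (use energy_bounded[where 'n = 'n and N = "2 ^ n"] in \<open>simp add: abs_of_nonneg energy_nonneg\<close>)
 qed (simp add: energy_nonneg)
 finally show ?thesis .
qed

text \<open>The order of limits matters: \<nu> to 0 for fixed N and \<epsilon>, which kills the
  logarithm, then \<epsilon> to 0, then refinement of the grid. Each discrete energy is bounded and
  continuous for the uniform topology, which the action is not.\<close>

lemma Gamma_liminf:
 fixes P R :: "real => 'n::finite torus cpath measure"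
 assumes R: "\<And>\<nu>. \<nu> > 0 ==> is_reversible_brownian \<nu> (R \<nu>)"
  and P: "\<And>\<nu>. \<nu> > 0 ==> P \<nu> \<in> space (prob_algebra borel)"
  and lim: "limitin narrow_topology P p (at_right 0)"
 shows "mean_action p \<le> Liminf (at_right 0) (\<lambda>\<nu>. ereal \<nu> * rel_entropy (P \<nu>) (R \<nu>))"
proof -
 let ?L = "Liminf (at_right 0) (\<lambda>\<nu>. ereal \<nu> * rel_entropy (P \<nu>) (R \<nu>))"
 have p: "p \<in> space (prob_algebra borel)" using lim by (simp add: limitin_def)
 have nb: "at_right (0::real) \<noteq> bot" by simp
 have step: "ereal ((1 - \<epsilon>) * (\<integral>w. energy N w \<partial>p)) \<le> ?L" if N: "N > 0" and \<epsilon>: "0 < \<epsilon>" "\<epsilon> < 1" for N \<epsilon>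
 proof -
  let ?l = "\<lambda>\<nu>. (1 - \<epsilon>) * (\<integral>w. energy N w \<partial>P \<nu>) - \<nu> * ln ((\<epsilon> powr (- real CARD('n) / 2)) ^ N)"
  have "((\<lambda>\<nu>. \<integral>w. energy N w \<partial>P \<nu>) \<longlongrightarrow> (\<integral>w. energy N w \<partial>p)) (at_right 0)"
   by (rule narrow_limit_integral[OF P lim energy_bcontfun[OF N]])
  then have "(?l \<longlongrightarrow> (1 - \<epsilon>) * (\<integral>w. energy N w \<partial>p) - 0 * ln ((\<epsilon> powr (- real CARD('n) / 2)) ^ N)) (at_right 0)"
   by (intro tendsto_intros)
  then have "((\<lambda>\<nu>. ereal (?l \<nu>)) \<longlongrightarrow> ereal ((1 - \<epsilon>) * (\<integral>w. energy N w \<partial>p))) (at_right 0)" by simp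
  then have "ereal ((1 - \<epsilon>) * (\<integral>w. energy N w \<partial>p)) = Liminf (at_right 0) (\<lambda>\<nu>. ereal (?l \<nu>))"
   by (rule sym[OF lim_imp_Liminf[OF nb]])
  also have "... \<le> ?L"
  proof (rule Liminf_mono, rule eventually_mono[OF eventually_at_right_less[of 0]])
   fix \<nu> :: real assume "0 < \<nu>"
   then show "ereal (?l \<nu>) \<le> ereal \<nu> * rel_entropy (P \<nu>) (R \<nu>)"
    by (intro energy_le_entropy R P N \<epsilon>)
  qed
  finally show ?thesis .
 qed
 have e: "ereal (\<integral>w. energy N w \<partial>p) \<le> ?L" if N: "N > 0" for N
 proof (rule tendsto_upperbound)
  have "((\<lambda>\<epsilon>. (1 - \<epsilon>) * (\<integral>w. energy N w \<partial>p)) \<longlongrightarrow> (1 - 0) * (\<integral>w. energy N w \<partial>p)) (at_right 0)"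
   by (intro tendsto_intros)
  then show "((\<lambda>\<epsilon>. ereal ((1 - \<epsilon>) * (\<integral>w. energy N w \<partial>p))) \<longlongrightarrow> ereal (\<integral>w. energy N w \<partial>p)) (at_right 0)" by simp
  show "\<forall>\<^sub>F \<epsilon> in at_right 0. ereal ((1 - \<epsilon>) * (\<integral>w. energy N w \<partial>p)) \<le> ?L"
   using eventually_at_right_real[of "0::real" 1] step[OF N] by (auto elim: eventually_mono)
 qed simp
 have "0 \<le> (\<integral>w. energy 1 w \<partial>p)" by (rule Bochner_Integration.integral_nonneg) (rule energy_nonneg)
 then have "ereal 0 \<le> ereal (\<integral>w. energy 1 w \<partial>p)" by (simp only: ereal_less_eq)
 then have "ereal 0 \<le> ?L" by (rule order_trans) (rule e, simp)
 then have L0: "?L \<ge> 0" by (simp only: zero_ereal_def)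
 have "(\<integral>\<^sup>+ w. action w \<partial>p) \<le> e2ennreal ?L"
 proof (rule order_trans[OF nn_integral_action_eq_SUP[OF p]], rule SUP_least)
  fix n :: nat
  have "e2ennreal (ereal (\<integral>w. energy (2 ^ n) w \<partial>p)) \<le> e2ennreal ?L" by (intro e2ennreal_mono e) simp
  then show "ennreal (\<integral>w. energy (2 ^ n) w \<partial>p) \<le> e2ennreal ?L" by (simp add: e2ennreal_ereal)
 qed
 then have "mean_action p \<le> enn2ereal (e2ennreal ?L)" unfolding mean_action_def by (simp add: less_eq_ennreal.rep_eq)
 then show ?thesis using L0 by (simp add: enn2ereal_e2ennreal)
qed

text \<open>Either the constraint fails eventually and the lower limit is infinite, or it holds
  frequently and passes to the limit flow.\<close>

lemma Gamma_liminf_constraint: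
 fixes P R :: "real => 'n::finite torus cpath measure"
 assumes R: "\<And>\<nu>. \<nu> > 0 ==> is_reversible_brownian \<nu> (R \<nu>)"
  and P: "\<And>\<nu>. \<nu> > 0 ==> P \<nu> \<in> space (prob_algebra borel)"
  and lim: "limitin narrow_topology P p (at_right 0)"
  and J: "\<And>q. J q = 0 \<or> J q = \<infinity>"
  and closed: "\<exists>\<^sub>F \<nu> in at_right 0. J (P \<nu>) = 0 ==> J p = 0"
 shows "mean_action p + J p \<le> Liminf (at_right 0) (\<lambda>\<nu>. ereal \<nu> * rel_entropy (P \<nu>) (R \<nu>) + J (P \<nu>))"
proof (cases "J p = 0")
 case True
 have "mean_action p + J p \<le> Liminf (at_right 0) (\<lambda>\<nu>. ereal \<nu> * rel_entropy (P \<nu>) (R \<nu>))"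
  using Gamma_liminf[OF R P lim] True by simp
 also have "... \<le> Liminf (at_right 0) (\<lambda>\<nu>. ereal \<nu> * rel_entropy (P \<nu>) (R \<nu>) + J (P \<nu>))"
 proof (rule Liminf_mono, rule always_eventually, rule allI)
  fix \<nu>
  have "J (P \<nu>) \<ge> 0" using J[of "P \<nu>"] by auto
  then show "ereal \<nu> * rel_entropy (P \<nu>) (R \<nu>) \<le> ereal \<nu> * rel_entropy (P \<nu>) (R \<nu>) + J (P \<nu>)"
   using add_left_mono[of 0 "J (P \<nu>)" "ereal \<nu> * rel_entropy (P \<nu>) (R \<nu>)"] by simp
 qed
 finally show ?thesis .
next
 case False
 then have "\<forall>\<^sub>F \<nu> in at_right 0. J (P \<nu>) \<noteq> 0" using closed by (auto simp: frequently_def)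
 then have "\<forall>\<^sub>F \<nu> in at_right 0. \<infinity> \<le> ereal \<nu> * rel_entropy (P \<nu>) (R \<nu>) + J (P \<nu>)"
 proof eventually_elim
  case (elim \<nu>)
  then have "J (P \<nu>) = \<infinity>" using J[of "P \<nu>"] by blast
  then show ?case by simp
 qed
 then have "\<infinity> \<le> Liminf (at_right 0) (\<lambda>\<nu>. ereal \<nu> * rel_entropy (P \<nu>) (R \<nu>) + J (P \<nu>))"
  by (rule Liminf_bounded)
 then have "Liminf (at_right 0) (\<lambda>\<nu>. ereal \<nu> * rel_entropy (P \<nu>) (R \<nu>) + J (P \<nu>)) = \<infinity>"
  by (simp only: ereal_infty_less_eq)
 then show ?thesis by (simp only: ereal_less_eq)
qed

section \<open>Perturbed flows\<close>

definition add_path :: "'n::finite torus cpath => 'n torus cpath => 'n torus cpath" where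
 "add_path w z = mk_path (\<lambda>t. path_at w t + path_at z t)"

lemma path_at_add_path: "t \<in> {0..1} ==> path_at (add_path w z) t = path_at w t + path_at z t"
 unfolding add_path_def by (intro path_at_mk_path continuous_on_add_torus continuous_on_path_at)

definition zero_path :: "'n::finite torus cpath" where
 "zero_path = mk_path (\<lambda>_. 0)"

lemma path_at_zero_path: "t \<in> {0..1} ==> path_at zero_path t = 0"
 unfolding zero_path_def by (intro path_at_mk_path continuous_on_const)

lemma dist_add_path: "dist (add_path w z) w \<le> dist z zero_path"
proof (rule dist_cpath_le)
 fix t :: real assume t: "t \<in> {0..1}"
 have "dist (path_at (add_path w z) t) (path_at w t) = dist (path_at w t + path_at z t) (path_at w t + 0)"
  by (simp only: path_at_add_path[OF t] add_0_right)
 also have "... = dist (path_at z t) (path_at zero_path t)" by (simp only: dist_torus_diff_left path_at_zero_path[OF t])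
 also have "... \<le> dist z zero_path" by (rule dist_path_at_le[OF t])
 finally show "dist (path_at (add_path w z) t) (path_at w t) \<le> dist z zero_path" .
qed

lemma measurable_add_path:
 "(\<lambda>(w, z). add_path w z) \<in> borel_measurable (borel \<Otimes>\<^sub>M borel :: ('n::finite torus cpath \<times> 'n torus cpath) measure)"
proof (rule borel_measurable_cpathI)
 fix n k :: nat assume "k \<le> 2 ^ n"
 then have k: "real k / 2 ^ n \<in> {0..1}" by simp
 have e: "(\<lambda>w. path_at w (real k / 2 ^ n)) \<in> borel_measurable (borel :: 'n torus cpath measure)"
  by (rule borel_measurable_eval[OF k])
 have "(\<lambda>x. path_at (fst x) (real k / 2 ^ n) + path_at (snd x) (real k / 2 ^ n))
  \<in> borel_measurable (borel \<Otimes>\<^sub>M borel :: ('n torus cpath \<times> 'n torus cpath) measure)"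
  by (intro borel_measurable_add_torus measurable_compose[OF measurable_fst e] measurable_compose[OF measurable_snd e])
 then show "(\<lambda>x. path_at (case x of (w, z) => add_path w z) (real k / 2 ^ n))
  \<in> borel_measurable (borel \<Otimes>\<^sub>M borel :: ('n torus cpath \<times> 'n torus cpath) measure)"
  using k by (simp add: path_at_add_path split_beta')
qed

text \<open>Convolution in the group of paths.\<close>

definition perturb :: "'n::finite torus cpath measure => 'n torus cpath measure => 'n torus cpath measure" where
 "perturb p Q = distr (p \<Otimes>\<^sub>M Q) borel (\<lambda>(w, z). add_path w z)"

context
 fixes p Q :: "'n::finite torus cpath measure"
 assumes p: "p \<in> space (prob_algebra borel)" and Q: "Q \<in> space (prob_algebra borel)"
begin

lemma p_space: "prob_space p" "sets p = sets borel" and Q_space: "prob_space Q" "sets Q = sets borel"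
 using p Q by (auto simp: prob_algebra_borel_iff)

lemma sets_pair: "sets (p \<Otimes>\<^sub>M Q) = sets (borel \<Otimes>\<^sub>M borel)"
 by (intro sets_pair_measure_cong p_space Q_space)

lemma prob_space_pair: "prob_space (p \<Otimes>\<^sub>M Q)"
proof -
 interpret A: prob_space p by (rule p_space)
 interpret Q: prob_space Q by (rule Q_space)
 interpret pair_prob_space p Q ..
 show ?thesis by (rule prob_space_axioms)
qed

lemma measurable_add_path_pair: "(\<lambda>(w, z). add_path w z) \<in> borel_measurable (p \<Otimes>\<^sub>M Q)"
 using measurable_add_path measurable_cong_sets[OF sets_pair refl] by blast

lemma perturb_prob: "perturb p Q \<in> space (prob_algebra borel)"
 using prob_space.prob_space_distr[OF prob_space_pair measurable_add_path_pair]
 by (simp add: prob_algebra_borel_iff perturb_def)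

lemma integral_perturb:
 fixes f :: "'n torus cpath => real"
 assumes f: "f \<in> borel_measurable borel" "\<And>x. \<bar>f x\<bar> \<le> K"
 shows "(\<integral>y. f y \<partial>perturb p Q) = (\<integral>w. (\<integral>z. f (add_path w z) \<partial>Q) \<partial>p)"
proof -
 interpret A: prob_space p by (rule p_space)
 interpret Q: prob_space Q by (rule Q_space)
 interpret pair_prob_space p Q ..
 have "(\<integral>y. f y \<partial>perturb p Q) = (\<integral>x. f (case x of (w, z) => add_path w z) \<partial>(p \<Otimes>\<^sub>M Q))"
  unfolding perturb_def by (rule integral_distr[OF measurable_add_path_pair f(1)])
 also have "... = (\<integral>w. (\<integral>z. f (case (w, z) of (w, z) => add_path w z) \<partial>Q) \<partial>p)"
  by (rule integral_fst'[symmetric], rule integrable_bounded_prob[OF prob_space_pair])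
   (use measurable_compose[OF measurable_add_path_pair f(1)] f(2) in auto)
 finally show ?thesis by simp
qed

lemma integral_add_path_measurable:
 fixes f :: "'n torus cpath => real"
 assumes f: "f \<in> borel_measurable borel"
 shows "(\<lambda>w. \<integral>z. f (add_path w z) \<partial>Q) \<in> borel_measurable borel"
  and "(\<lambda>z. f (add_path w z)) \<in> borel_measurable borel"
proof -
 interpret Q: prob_space Q by (rule Q_space)
 have m: "(\<lambda>(w, z). f (add_path w z)) \<in> borel_measurable (borel \<Otimes>\<^sub>M borel)"
  using measurable_compose[OF measurable_add_path f] by (simp add: split_beta')
 moreover have "sets (borel \<Otimes>\<^sub>M Q) = sets (borel \<Otimes>\<^sub>M borel :: ('n torus cpath \<times> 'n torus cpath) measure)"
  by (intro sets_pair_measure_cong Q_space refl)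
 ultimately have "(\<lambda>(w, z). f (add_path w z)) \<in> borel_measurable (borel \<Otimes>\<^sub>M Q)"
  using measurable_cong_sets by blast
 then show "(\<lambda>w. \<integral>z. f (add_path w z) \<partial>Q) \<in> borel_measurable borel"
  by (rule Q.borel_measurable_lebesgue_integral)
 show "(\<lambda>z. f (add_path w z)) \<in> borel_measurable borel"
  using measurable_compose[OF measurable_Pair1' m, of w] by simp
qed

lemma perturb_marginal:
 assumes t: "t \<in> {0..1}" and inc: "distr p borel (\<lambda>w. path_at w t) = leb_torus"
 shows "distr (perturb p Q) borel (\<lambda>w. path_at w t) = leb_torus"
proof (rule measure_eqI_bcontfun)
 interpret L: prob_space "leb_torus :: 'n torus measure" by (rule prob_space_leb_torus)
 interpret PQ: prob_space "perturb p Q" using perturb_prob by (simp add: prob_algebra_borel_iff)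
 interpret A: prob_space p by (rule p_space)
 interpret Q: prob_space Q by (rule Q_space)
 have ev: "(\<lambda>w. path_at w t) \<in> borel_measurable (borel :: 'n torus cpath measure)" by (rule borel_measurable_eval[OF t])
 have evPQ: "(\<lambda>w. path_at w t) \<in> borel_measurable (perturb p Q)" using ev by (simp add: perturb_def)
 have evp: "(\<lambda>w. path_at w t) \<in> borel_measurable p" using ev measurable_cong_sets[OF p_space(2) refl] by blast
 show "finite_measure (distr (perturb p Q) borel (\<lambda>w. path_at w t))"
  using PQ.prob_space_distr[OF evPQ] by (simp add: prob_space_def)
 show "finite_measure (leb_torus :: 'n torus measure)" by (rule L.finite_measure_axioms)
 fix f :: "'n torus => real" assume f: "f \<in> bcontfun"
 then have fm: "f \<in> borel_measurable borel" by (intro borel_measurable_continuous_onI) (auto simp: bcontfun_def)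
 obtain K where K: "\<And>x. \<bar>f x\<bar> \<le> K" using f unfolding bcontfun_def bounded_iff by auto
 have "(\<integral>x. f x \<partial>distr (perturb p Q) borel (\<lambda>w. path_at w t)) = (\<integral>y. f (path_at y t) \<partial>perturb p Q)"
  by (rule integral_distr[OF evPQ fm])
 also have "... = (\<integral>w. (\<integral>z. f (path_at (add_path w z) t) \<partial>Q) \<partial>p)"
  by (rule integral_perturb[where K = K]) (use measurable_compose[OF ev fm] K in auto)
 \<comment> \<open>With z outermost, each inner integral sees only a translate of the marginal of p
   at time t.\<close>
 also have "... = (\<integral>z. (\<integral>w. f (path_at (add_path w z) t) \<partial>p) \<partial>Q)"
 proof -
  interpret pair_prob_space p Q ..
  have "(\<lambda>x. f (path_at (case x of (w, z) => add_path w z) t)) \<in> borel_measurable (p \<Otimes>\<^sub>M Q)"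
   by (rule measurable_compose[OF measurable_add_path_pair measurable_compose[OF ev fm]])
  then show ?thesis
   by (intro Fubini_integral[symmetric] integrable_bounded_prob[OF prob_space_pair, where K = K])
    (use K in \<open>auto simp: split_beta'\<close>)
 qed
 also have "... = (\<integral>z. (\<integral>q. f q \<partial>leb_torus) \<partial>Q)"
 proof (rule Bochner_Integration.integral_cong[OF refl])
  fix z :: "'n torus cpath"
  have tr: "(\<lambda>q. q + path_at z t) \<in> borel_measurable (leb_torus :: 'n torus measure)"
   by (intro borel_measurable_add_torus) (simp_all cong: measurable_cong_sets)
  have "(\<integral>w. f (path_at (add_path w z) t) \<partial>p) = (\<integral>q. f (q + path_at z t) \<partial>distr p borel (\<lambda>w. path_at w t))"
   unfolding path_at_add_path[OF t]
   by (rule integral_distr[symmetric, OF evp], rule measurable_compose[OF _ fm], intro borel_measurable_add_torus) simp_all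
  also have "... = (\<integral>q. f q \<partial>distr leb_torus borel (\<lambda>q. q + path_at z t))"
   unfolding inc by (rule integral_distr[symmetric, OF tr fm])
  finally show "(\<integral>w. f (path_at (add_path w z) t) \<partial>p) = (\<integral>q. f q \<partial>leb_torus)" by (simp add: distr_leb_torus_translate)
 qed
 also have "... = (\<integral>q. f q \<partial>leb_torus)" by (simp add: Q.prob_space)
 finally show "(\<integral>x. f x \<partial>distr (perturb p Q) borel (\<lambda>w. path_at w t)) = (\<integral>q. f q \<partial>leb_torus)" .
qed simp_all

lemma perturb_endpoints:
 assumes 0: "AE z in Q. path_at z 0 = 0 \<and> path_at z 1 = 0"
 shows "distr (perturb p Q) borel (\<lambda>w. (path_at w 0, path_at w 1)) = distr p borel (\<lambda>w. (path_at w 0, path_at w 1))"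
proof (rule measure_eqI_bcontfun)
 let ?e = "\<lambda>w :: 'n torus cpath. (path_at w 0, path_at w 1)"
 interpret PQ: prob_space "perturb p Q" using perturb_prob by (simp add: prob_algebra_borel_iff)
 interpret A: prob_space p by (rule p_space)
 interpret Q: prob_space Q by (rule Q_space)
 have ev: "?e \<in> borel_measurable (borel :: 'n torus cpath measure)"
  by (intro borel_measurable_continuous_onI continuous_on_Pair continuous_on_eval) auto
 have evPQ: "?e \<in> borel_measurable (perturb p Q)" using ev by (simp add: perturb_def)
 have evp: "?e \<in> borel_measurable p" using ev measurable_cong_sets[OF p_space(2) refl] by blast
 show "finite_measure (distr (perturb p Q) borel ?e)"
  using PQ.prob_space_distr[OF evPQ] by (simp add: prob_space_def)
 show "finite_measure (distr p borel ?e)"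
  using A.prob_space_distr[OF evp] by (simp add: prob_space_def)
 fix f :: "'n torus \<times> 'n torus => real" assume f: "f \<in> bcontfun"
 then have fm: "f \<in> borel_measurable borel" by (intro borel_measurable_continuous_onI) (auto simp: bcontfun_def)
 obtain K where K: "\<And>x. \<bar>f x\<bar> \<le> K" using f unfolding bcontfun_def bounded_iff by auto
 have "(\<integral>x. f x \<partial>distr (perturb p Q) borel ?e) = (\<integral>y. f (?e y) \<partial>perturb p Q)"
  by (rule integral_distr[OF evPQ fm])
 also have "... = (\<integral>w. (\<integral>z. f (?e (add_path w z)) \<partial>Q) \<partial>p)"
  by (rule integral_perturb[where K = K]) (use measurable_compose[OF ev fm] K in auto)
 also have "... = (\<integral>w. (\<integral>z. f (?e w) \<partial>Q) \<partial>p)"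
 proof (rule Bochner_Integration.integral_cong[OF refl], rule integral_cong_AE)
  fix w :: "'n torus cpath"
  show "(\<lambda>z. f (?e (add_path w z))) \<in> borel_measurable Q"
   using integral_add_path_measurable(2)[OF measurable_compose[OF ev fm]] measurable_cong_sets[OF Q_space(2) refl] by blast
  show "AE z in Q. f (?e (add_path w z)) = f (?e w)"
   using 0 by eventually_elim (simp add: path_at_add_path)
 qed simp
 also have "... = (\<integral>w. f (?e w) \<partial>p)" by (simp add: Q.prob_space)
 also have "... = (\<integral>x. f x \<partial>distr p borel ?e)" by (rule integral_distr[symmetric, OF evp fm])
 finally show "(\<integral>x. f x \<partial>distr (perturb p Q) borel ?e) = (\<integral>x. f x \<partial>distr p borel ?e)" .
qed simp_all

end

section \<open>Noise concentrating at the zero path\<close>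

lemma tendsto_integral_concentrating:
 fixes Q :: "real => 'a::metric_space measure" and g :: "'a => real"
 assumes Q: "\<And>\<nu>. 0 < \<nu> ==> Q \<nu> \<in> space (prob_algebra borel)"
  and conc: "\<And>\<epsilon>. \<epsilon> > 0 ==> ((\<lambda>\<nu>. measure (Q \<nu>) {z. dist z a \<ge> \<epsilon>}) \<longlongrightarrow> 0) (at_right 0)"
  and g: "g \<in> borel_measurable borel" "\<And>x. \<bar>g x\<bar> \<le> K" and cont: "isCont g a"
 shows "((\<lambda>\<nu>. \<integral>z. g z \<partial>Q \<nu>) \<longlongrightarrow> g a) (at_right 0)"
proof (rule tendstoI)
 fix e :: real assume e: "e > 0"
 obtain d where d: "d > 0" "\<And>z. dist z a < d ==> dist (g z) (g a) < e / 2"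
  using cont e unfolding continuous_at_eps_delta by (meson half_gt_zero)
 have K0: "K \<ge> 0" using g(2)[of a] by simp
 have "\<forall>\<^sub>F \<nu> in at_right 0. measure (Q \<nu>) {z. dist z a \<ge> d} < e / (2 * (2 * K + 1))"
  using tendstoD[OF conc[OF d(1)], of "e / (2 * (2 * K + 1))"] e K0 by (simp add: dist_real_def)
 then show "\<forall>\<^sub>F \<nu> in at_right 0. dist (\<integral>z. g z \<partial>Q \<nu>) (g a) < e"
  using eventually_at_right_less[of "0 :: real"]
 proof eventually_elim
  case (elim \<nu>)
  have Qp: "prob_space (Q \<nu>)" "sets (Q \<nu>) = sets borel" using Q[OF elim(2)] by (auto simp: prob_algebra_borel_iff)
  interpret prob_space "Q \<nu>" by (rule Qp)
  have gm: "g \<in> borel_measurable (Q \<nu>)" using g(1) measurable_cong_sets[OF Qp(2) refl] by blast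
  have Am: "{z. dist z a \<ge> d} \<in> sets (Q \<nu>)" unfolding Qp(2) by (intro borel_closed closed_Collect_le continuous_intros)
  have gi: "integrable (Q \<nu>) g" by (rule integrable_bounded_prob[OF Qp(1) gm g(2)])
  have i1: "integrable (Q \<nu>) (\<lambda>z. e / 2 + 2 * K * indicator {z. dist z a \<ge> d} z)"
   using Am by (intro Bochner_Integration.integrable_add integrable_mult_right integrable_real_indicator) (auto simp: emeasure_eq_measure)
  have "\<bar>(\<integral>z. g z \<partial>Q \<nu>) - g a\<bar> = \<bar>\<integral>z. g z - g a \<partial>Q \<nu>\<bar>" using gi by (simp add: prob_space)
  also have "... \<le> (\<integral>z. \<bar>g z - g a\<bar> \<partial>Q \<nu>)" by (rule integral_abs_bound)
  also have "... \<le> (\<integral>z. e / 2 + 2 * K * indicator {z. dist z a \<ge> d} z \<partial>Q \<nu>)"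
  proof (rule integral_mono[OF _ i1])
   show "integrable (Q \<nu>) (\<lambda>z. \<bar>g z - g a\<bar>)" using gi by simp
   fix z
   show "\<bar>g z - g a\<bar> \<le> e / 2 + 2 * K * indicator {z. dist z a \<ge> d} z"
   proof (cases "dist z a < d")
    case True
    then show ?thesis using d(2)[OF True] K0 by (simp add: dist_real_def)
   next
    case False
    then show ?thesis using g(2)[of z] g(2)[of a] e by simp
   qed
  qed
  also have "... = e / 2 + 2 * K * measure (Q \<nu>) {z. dist z a \<ge> d}"
   using Am by (simp add: prob_space emeasure_eq_measure Int_absorb2 sets.sets_into_space)
  also have "... \<le> e / 2 + (2 * K + 1) * measure (Q \<nu>) {z. dist z a \<ge> d}" by (simp add: algebra_simps)
  also have "... < e"
   using elim(1) K0 by (simp add: field_simps)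
  finally show ?case by (simp add: dist_real_def)
 qed
qed

lemma perturb_tendsto:
 fixes Q :: "real => 'n::finite torus cpath measure"
 assumes p: "p \<in> space (prob_algebra borel)" and Q: "\<And>\<nu>. 0 < \<nu> ==> Q \<nu> \<in> space (prob_algebra borel)"
  and conc: "\<And>\<epsilon>. \<epsilon> > 0 ==> ((\<lambda>\<nu>. measure (Q \<nu>) {z. dist z zero_path \<ge> \<epsilon>}) \<longlongrightarrow> 0) (at_right 0)"
  and f: "(f :: 'n torus cpath => real) \<in> bcontfun"
 shows "((\<lambda>\<nu>. \<integral>y. f y \<partial>perturb p (Q \<nu>)) \<longlongrightarrow> (\<integral>w. f w \<partial>p)) (at_right (0::real))"
\<comment> \<open>Dominated convergence over w works along sequences, so the filter is first reduced
  to them.\<close>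
proof (rule tendsto_at_right_sequentially[of 0 1])
 fix S :: "nat => real" assume S: "\<And>n. 0 < S n" "S \<longlonglongrightarrow> 0"
 have fc: "continuous_on UNIV f" using f by (simp add: bcontfun_def)
 have fm: "f \<in> borel_measurable borel" by (rule borel_measurable_continuous_onI[OF fc])
 obtain K where K: "\<And>x. \<bar>f x\<bar> \<le> K" using f unfolding bcontfun_def bounded_iff by auto
 have pp: "prob_space p" "sets p = sets borel" using p by (auto simp: prob_algebra_borel_iff)
 interpret p: prob_space p by (rule pp)
 have Sr: "filterlim S (at_right 0) sequentially"
  unfolding filterlim_at using S(2) less_imp_neq[OF S(1)] by (auto simp: S(1))
 have "(\<lambda>n. \<integral>w. (\<integral>z. f (add_path w z) \<partial>Q (S n)) \<partial>p) \<longlonglongrightarrow> (\<integral>w. f w \<partial>p)"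
 proof (rule integral_dominated_convergence[where w = "\<lambda>_. K"])
  show "f \<in> borel_measurable p" using fm measurable_cong_sets[OF pp(2) refl] by blast
  show "(\<lambda>w. \<integral>z. f (add_path w z) \<partial>Q (S n)) \<in> borel_measurable p" for n
   using integral_add_path_measurable(1)[OF p Q[OF S(1)] fm] measurable_cong_sets[OF pp(2) refl] by blast
  show "AE w in p. (\<lambda>n. \<integral>z. f (add_path w z) \<partial>Q (S n)) \<longlonglongrightarrow> f w"
  proof (rule AE_I2)
   fix w :: "'n torus cpath"
   have az: "add_path w zero_path = w"
    by (rule cpath_eqI) (simp add: path_at_add_path path_at_zero_path)
   have "isCont (\<lambda>z. f (add_path w z)) zero_path"
   proof (rule isCont_o2[where g = f])
    show "isCont (add_path w) zero_path"
     unfolding continuous_at_eps_delta using dist_add_path[of w] by (auto simp: az intro: le_less_trans)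
    show "isCont f (add_path w zero_path)" using fc by (simp add: continuous_on_eq_continuous_at)
   qed
   then have "((\<lambda>\<nu>. \<integral>z. f (add_path w z) \<partial>Q \<nu>) \<longlongrightarrow> f (add_path w zero_path)) (at_right 0)"
    by (intro tendsto_integral_concentrating[where Q = Q and a = zero_path and K = K] Q conc K
      integral_add_path_measurable(2)[OF p Q[OF zero_less_one] fm])
   then show "(\<lambda>n. \<integral>z. f (add_path w z) \<partial>Q (S n)) \<longlonglongrightarrow> f w"
    unfolding az by (rule filterlim_compose[OF _ Sr])
  qed
  show "AE w in p. norm (\<integral>z. f (add_path w z) \<partial>Q (S n)) \<le> K" for n
  proof (rule AE_I2)
   fix w :: "'n torus cpath"
   have Qp: "prob_space (Q (S n))" "sets (Q (S n)) = sets borel" using Q[OF S(1)] by (auto simp: prob_algebra_borel_iff)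
   interpret Q: prob_space "Q (S n)" by (rule Qp)
   have "integrable (Q (S n)) (\<lambda>z. f (add_path w z))"
    using integral_add_path_measurable(2)[OF p Q[OF S(1)] fm] measurable_cong_sets[OF Qp(2) refl] K
    by (intro integrable_bounded_prob[OF Qp(1), where K = K]) blast+
   then have "(\<integral>z. \<bar>f (add_path w z)\<bar> \<partial>Q (S n)) \<le> (\<integral>z. K \<partial>Q (S n))"
    using K by (intro integral_mono integrable_abs) auto
   then have "norm (\<integral>z. f (add_path w z) \<partial>Q (S n)) \<le> (\<integral>z. K \<partial>Q (S n))"
    unfolding real_norm_def by (rule order_trans[OF integral_abs_bound])
   then show "norm (\<integral>z. f (add_path w z) \<partial>Q (S n)) \<le> K" by (simp add: Q.prob_space)
  qed
 qed simp
 then show "(\<lambda>n. \<integral>y. f y \<partial>perturb p (Q (S n))) \<longlonglongrightarrow> (\<integral>w. f w \<partial>p)"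
  using integral_perturb[OF p Q[OF S(1)] fm K] by simp
qed simp

lemma limitin_perturb:
 fixes Q :: "real => 'n::finite torus cpath measure"
 assumes p: "p \<in> space (prob_algebra borel)" and Q: "\<And>\<nu>. 0 < \<nu> ==> Q \<nu> \<in> space (prob_algebra borel)"
  and conc: "\<And>\<epsilon>. \<epsilon> > 0 ==> ((\<lambda>\<nu>. measure (Q \<nu>) {z. dist z zero_path \<ge> \<epsilon>}) \<longlongrightarrow> 0) (at_right 0)"
  and P: "\<And>\<nu>. P \<nu> \<in> space (prob_algebra borel)" "\<forall>\<^sub>F \<nu> in at_right 0. P \<nu> = perturb p (Q \<nu>)"
 shows "limitin narrow_topology P p (at_right 0)"
 unfolding limitin_narrow_topology[OF P(1) p]
proof (intro allI impI)
 fix f :: "'n torus cpath => real" assume f: "f \<in> bcontfun"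
 have "\<forall>\<^sub>F \<nu> in at_right 0. (\<integral>y. f y \<partial>perturb p (Q \<nu>)) = (\<integral>y. f y \<partial>P \<nu>)"
  using P(2) by eventually_elim simp
 moreover have "((\<lambda>\<nu>. \<integral>y. f y \<partial>perturb p (Q \<nu>)) \<longlongrightarrow> (\<integral>w. f w \<partial>p)) (at_right (0::real))"
  by (rule perturb_tendsto[OF p Q conc f])
 ultimately show "((\<lambda>\<nu>. \<integral>y. f y \<partial>P \<nu>) \<longlongrightarrow> (\<integral>w. f w \<partial>p)) (at_right 0)"
  by (rule Lim_transform_eventually[rotated])
qed

section \<open>Gaussian bridges and shifted walks\<close>

lemma nn_integral_lborel_affine:
 fixes f :: "real ^ 'n::finite => ennreal"
 assumes c: "c \<noteq> 0" and [measurable]: "f \<in> borel_measurable borel"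
 shows "(\<integral>\<^sup>+ y. f y \<partial>lborel) = ennreal (\<bar>c\<bar> ^ CARD('n)) * (\<integral>\<^sup>+ w. f (t + c *\<^sub>R w) \<partial>lborel)"
proof -
 have "(\<integral>\<^sup>+ y. f y \<partial>lborel) = (\<integral>\<^sup>+ y. f y \<partial>density (distr lborel borel (\<lambda>x. t + c *\<^sub>R x)) (\<lambda>_. \<bar>c\<bar> ^ DIM(real ^ 'n)))"
  by (subst lborel_affine[OF c, of t]) simp
 also have "... = (\<integral>\<^sup>+ w. ennreal (\<bar>c\<bar> ^ CARD('n)) * f (t + c *\<^sub>R w) \<partial>lborel)"
  by (simp add: nn_integral_density nn_integral_distr)
 also have "... = ennreal (\<bar>c\<bar> ^ CARD('n)) * (\<integral>\<^sup>+ w. f (t + c *\<^sub>R w) \<partial>lborel)"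
  by (rule nn_integral_cmult) measurable
 finally show ?thesis .
qed

lemma measurable_gaussN_shift:
 fixes h :: "'b \<times> (nat => real ^ 'n::finite) => real ^ 'n"
 assumes h: "h \<in> borel_measurable (M \<Otimes>\<^sub>M gaussN v N)"
 shows "(\<lambda>x. \<lambda>j\<in>{1..N}. snd x j + h x) \<in> measurable (M \<Otimes>\<^sub>M gaussN v N) (gaussN v N)"
proof (rule measurable_restrict)
 fix j assume j: "j \<in> {1..N}"
 have "(\<lambda>z. z j) \<in> measurable (gaussN v N) (gauss v :: (real ^ 'n) measure)"
  by (rule measurable_component_singleton[OF j])
 then have c: "(\<lambda>z. z j) \<in> borel_measurable (gaussN v N :: (nat => real ^ 'n) measure)"
  by (simp cong: measurable_cong_sets)
 have "(\<lambda>x. snd x j + h x) \<in> borel_measurable (M \<Otimes>\<^sub>M gaussN v N)"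
  by (intro borel_measurable_add h measurable_compose[OF measurable_snd c])
 then show "(\<lambda>x. snd x j + h x) \<in> measurable (M \<Otimes>\<^sub>M gaussN v N) (gauss v)"
  by (simp cong: measurable_cong_sets)
qed

text \<open>Shifting every increment by w shifts the sum, of variance \<nu>, by N w; its density
  changes by exactly the weight that appears in \<open>gaussN_shift_dominated\<close>.\<close>

lemma gdens_shift:
 fixes z :: "nat => real ^ 'n::finite" and w :: "real ^ 'n"
 assumes \<nu>: "\<nu> > 0" and N: "N > 0"
 shows "gdens \<nu> ((\<Sum>j\<in>{1..N}. z j) + real N *\<^sub>R w)
  = exp (- (\<Sum>j\<in>{1..N}. 2 * (w \<bullet> z j) + (norm w)\<^sup>2) / (2 * (\<nu> / N))) * gdens \<nu> (\<Sum>j\<in>{1..N}. z j)"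
proof -
 let ?S = "\<Sum>j\<in>{1..N}. z j"
 have "(\<Sum>j\<in>{1..N}. 2 * (w \<bullet> z j) + (norm w)\<^sup>2) = 2 * (w \<bullet> ?S) + N * (norm w)\<^sup>2"
  by (simp add: sum.distrib inner_sum_right sum_distrib_left)
 moreover have "(norm (?S + real N *\<^sub>R w))\<^sup>2 = (norm ?S)\<^sup>2 + 2 * N * (w \<bullet> ?S) + (real N)\<^sup>2 * (norm w)\<^sup>2"
  unfolding power2_norm_eq_inner
  by (simp only: inner_add_left inner_add_right inner_scaleR_left inner_scaleR_right inner_commute[of ?S w] power2_eq_square ring_distribs mult.commute mult.left_commute)
 ultimately have "- (norm (?S + real N *\<^sub>R w))\<^sup>2 / (2 * \<nu>)
  = - (\<Sum>j\<in>{1..N}. 2 * (w \<bullet> z j) + (norm w)\<^sup>2) / (2 * (\<nu> / N)) + - (norm ?S)\<^sup>2 / (2 * \<nu>)"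
  using \<nu> N by (simp add: field_simps power2_eq_square)
 then have e: "exp (- (norm (?S + real N *\<^sub>R w))\<^sup>2 / (2 * \<nu>))
  = exp (- (\<Sum>j\<in>{1..N}. 2 * (w \<bullet> z j) + (norm w)\<^sup>2) / (2 * (\<nu> / N))) * exp (- (norm ?S)\<^sup>2 / (2 * \<nu>))"
  by (simp only: exp_add)
 show ?thesis unfolding gdens_def e by (simp only: mult_ac)
qed

text \<open>Replacing the sum of the increments by an independent Gaussian of the same law does not
 change the law of the increments.\<close>

lemma gaussian_bridge_dominated:
 fixes g :: "(nat => real ^ 'n::finite) => ennreal"
 assumes \<nu>: "\<nu> > 0" and N: "N > 0" and g: "g \<in> borel_measurable (gaussN (\<nu> / N) N)"
 shows "(\<integral>\<^sup>+ y. \<integral>\<^sup>+ z. g (\<lambda>j\<in>{1..N}. z j + (1 / real N) *\<^sub>R (y - (\<Sum>j\<in>{1..N}. z j))) \<partial>gaussN (\<nu> / N) N \<partial>gauss \<nu>)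
  \<le> (\<integral>\<^sup>+ z. g z \<partial>gaussN (\<nu> / N) N)"
proof -
 let ?G = "gaussN (\<nu> / N) N :: (nat => real ^ 'n) measure"
 let ?L = "lborel :: (real ^ 'n) measure"
 let ?S = "\<lambda>z :: nat => real ^ 'n. \<Sum>j\<in>{1..N}. z j"
 let ?k = "ennreal (real N ^ CARD('n))"
 have v: "\<nu> / N > 0" using \<nu> N by simp
 interpret G: prob_space ?G by (rule prob_space_gaussN[OF v])
 interpret pair_sigma_finite ?L ?G ..
 have Sm [measurable]: "?S \<in> borel_measurable ?G" by (rule measurable_partial_sum) simp
 have gd [measurable]: "gdens \<nu> \<in> borel_measurable (borel :: (real ^ 'n) measure)" unfolding gdens_def[abs_def] by measurable
 have sh: "(\<lambda>x. g (\<lambda>j\<in>{1..N}. snd x j + h x)) \<in> borel_measurable (?L \<Otimes>\<^sub>M ?G)"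
  if "h \<in> borel_measurable (?L \<Otimes>\<^sub>M ?G)" for h
  by (rule measurable_compose[OF measurable_gaussN_shift[OF that] g])
 have m1 [measurable]: "(\<lambda>x. g (\<lambda>j\<in>{1..N}. snd x j + (1 / real N) *\<^sub>R (fst x - ?S (snd x)))) \<in> borel_measurable (?L \<Otimes>\<^sub>M ?G)"
  by (rule sh) measurable
 have m2 [measurable]: "(\<lambda>x. g (\<lambda>j\<in>{1..N}. snd x j + fst x)) \<in> borel_measurable (?L \<Otimes>\<^sub>M ?G)"
  by (rule sh) measurable
 have gm [measurable]: "g \<in> borel_measurable ?G" by (rule g)
 have in1: "(\<lambda>y. \<integral>\<^sup>+ z. g (\<lambda>j\<in>{1..N}. z j + (1 / real N) *\<^sub>R (y - ?S z)) \<partial>?G) \<in> borel_measurable borel"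
  using G.borel_measurable_nn_integral_fst[OF m1] by simp
 have "(\<integral>\<^sup>+ y. \<integral>\<^sup>+ z. g (\<lambda>j\<in>{1..N}. z j + (1 / real N) *\<^sub>R (y - ?S z)) \<partial>?G \<partial>gauss \<nu>)
  = (\<integral>\<^sup>+ y. ennreal (gdens \<nu> y) * (\<integral>\<^sup>+ z. g (\<lambda>j\<in>{1..N}. z j + (1 / real N) *\<^sub>R (y - ?S z)) \<partial>?G) \<partial>?L)"
  by (rule nn_integral_gauss[OF in1])
 also have "... = (\<integral>\<^sup>+ y. \<integral>\<^sup>+ z. ennreal (gdens \<nu> y) * g (\<lambda>j\<in>{1..N}. z j + (1 / real N) *\<^sub>R (y - ?S z)) \<partial>?G \<partial>?L)"
 proof (rule nn_integral_cong, rule nn_integral_cmult[symmetric])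
  fix y :: "real ^ 'n"
  show "(\<lambda>z. g (\<lambda>j\<in>{1..N}. z j + (1 / real N) *\<^sub>R (y - ?S z))) \<in> borel_measurable ?G"
   using measurable_compose[OF measurable_Pair1' m1, of y] by simp
 qed
 also have "... = (\<integral>\<^sup>+ z. \<integral>\<^sup>+ y. ennreal (gdens \<nu> y) * g (\<lambda>j\<in>{1..N}. z j + (1 / real N) *\<^sub>R (y - ?S z)) \<partial>?L \<partial>?G)"
  by (rule Fubini'[symmetric]) (unfold split_beta', measurable)
 \<comment> \<open>Substituting y = S + N w, with S the sum of the increments, turns the correction
   into a common shift w of all increments.\<close>
 also have "... = (\<integral>\<^sup>+ z. \<integral>\<^sup>+ w. ?k * (ennreal (gdens \<nu> (?S z + real N *\<^sub>R w)) * g (\<lambda>j\<in>{1..N}. z j + w)) \<partial>?L \<partial>?G)"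
 proof (rule nn_integral_cong)
  fix z assume z: "z \<in> space ?G"
  have a1: "(\<lambda>y. g (\<lambda>j\<in>{1..N}. z j + (1 / real N) *\<^sub>R (y - ?S z))) \<in> borel_measurable borel"
   using measurable_compose[OF measurable_Pair2'[OF z] m1] by simp
  have a2: "(\<lambda>w. g (\<lambda>j\<in>{1..N}. z j + w)) \<in> borel_measurable borel"
   using measurable_compose[OF measurable_Pair2'[OF z] m2] by simp
  have "(\<integral>\<^sup>+ y. ennreal (gdens \<nu> y) * g (\<lambda>j\<in>{1..N}. z j + (1 / real N) *\<^sub>R (y - ?S z)) \<partial>?L)
   = ennreal (\<bar>real N\<bar> ^ CARD('n)) * (\<integral>\<^sup>+ w. ennreal (gdens \<nu> (?S z + real N *\<^sub>R w)) *
     g (\<lambda>j\<in>{1..N}. z j + (1 / real N) *\<^sub>R ((?S z + real N *\<^sub>R w) - ?S z)) \<partial>?L)"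
  proof (rule nn_integral_lborel_affine)
   show "real N \<noteq> 0" using N by simp
   show "(\<lambda>y. ennreal (gdens \<nu> y) * g (\<lambda>j\<in>{1..N}. z j + (1 / real N) *\<^sub>R (y - ?S z))) \<in> borel_measurable borel"
    by (intro borel_measurable_times_ennreal a1) measurable
  qed
  also have "... = ?k * (\<integral>\<^sup>+ w. ennreal (gdens \<nu> (?S z + real N *\<^sub>R w)) * g (\<lambda>j\<in>{1..N}. z j + w) \<partial>?L)"
   using N by simp
  also have "... = (\<integral>\<^sup>+ w. ?k * (ennreal (gdens \<nu> (?S z + real N *\<^sub>R w)) * g (\<lambda>j\<in>{1..N}. z j + w)) \<partial>?L)"
   by (rule nn_integral_cmult[symmetric]) (use a2 in measurable)
  finally show "(\<integral>\<^sup>+ y. ennreal (gdens \<nu> y) * g (\<lambda>j\<in>{1..N}. z j + (1 / real N) *\<^sub>R (y - ?S z)) \<partial>?L)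
   = (\<integral>\<^sup>+ w. ?k * (ennreal (gdens \<nu> (?S z + real N *\<^sub>R w)) * g (\<lambda>j\<in>{1..N}. z j + w)) \<partial>?L)" .
 qed
 also have "... = (\<integral>\<^sup>+ w. \<integral>\<^sup>+ z. ?k * (ennreal (gdens \<nu> (?S z + real N *\<^sub>R w)) * g (\<lambda>j\<in>{1..N}. z j + w)) \<partial>?G \<partial>?L)"
  by (rule Fubini') (unfold split_beta', measurable)
 \<comment> \<open>For fixed w the weight from \<open>gdens_shift\<close> is absorbed by the shift;
   what is left of w is a density of mass 1, integrated out next.\<close>
 also have "... \<le> (\<integral>\<^sup>+ w. \<integral>\<^sup>+ z. ?k * (ennreal (gdens \<nu> (?S z - real N *\<^sub>R w)) * g z) \<partial>?G \<partial>?L)"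
 proof (rule nn_integral_mono)
  fix w :: "real ^ 'n"
  have Ssh: "?S (\<lambda>j\<in>{1..N}. z j + w) = ?S z + real N *\<^sub>R w" for z
   by (simp add: sum.distrib scaleR_conv_of_real flip: scaleR_scaleR) 
  have "?k * (ennreal (gdens \<nu> (?S z + real N *\<^sub>R w)) * g (\<lambda>j\<in>{1..N}. z j + w))
   = ennreal (exp (- (\<Sum>j\<in>{1..N}. 2 * (w \<bullet> z j) + (norm w)\<^sup>2) / (2 * (\<nu> / N)))) *
    (?k * (ennreal (gdens \<nu> (?S (\<lambda>j\<in>{1..N}. z j + w) - real N *\<^sub>R w)) * g (\<lambda>j\<in>{1..N}. z j + w)))" for z
   unfolding Ssh gdens_shift[OF \<nu> N] by (simp add: ennreal_mult gdens_nonneg mult_ac)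
  then show "(\<integral>\<^sup>+ z. ?k * (ennreal (gdens \<nu> (?S z + real N *\<^sub>R w)) * g (\<lambda>j\<in>{1..N}. z j + w)) \<partial>?G)
   \<le> (\<integral>\<^sup>+ z. ?k * (ennreal (gdens \<nu> (?S z - real N *\<^sub>R w)) * g z) \<partial>?G)"
   by (simp only:) (rule gaussN_shift_dominated[OF v, where b = "\<lambda>_. w"], measurable)
 qed
 also have "... = (\<integral>\<^sup>+ z. \<integral>\<^sup>+ w. ?k * (ennreal (gdens \<nu> (?S z - real N *\<^sub>R w)) * g z) \<partial>?L \<partial>?G)"
  by (rule Fubini'[symmetric]) (unfold split_beta', measurable)
 also have "... = (\<integral>\<^sup>+ z. g z \<partial>?G)"
 proof (rule nn_integral_cong)
  fix z :: "nat => real ^ 'n"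
  have "(\<integral>\<^sup>+ w. ?k * (ennreal (gdens \<nu> (?S z - real N *\<^sub>R w)) * g z) \<partial>?L)
   = (?k * (\<integral>\<^sup>+ w. ennreal (gdens \<nu> (?S z + (- real N) *\<^sub>R w)) \<partial>?L)) * g z"
   by (simp add: nn_integral_cmult nn_integral_multc mult.assoc)
  also have "?k * (\<integral>\<^sup>+ w. ennreal (gdens \<nu> (?S z + (- real N) *\<^sub>R w)) \<partial>?L) = (\<integral>\<^sup>+ y. ennreal (gdens \<nu> y) \<partial>?L)"
   using nn_integral_lborel_affine[of "- real N" "\<lambda>y :: real ^ 'n. ennreal (gdens \<nu> y)" "?S z"] N by simp
  also have "... = 1" by (rule nn_integral_gdens[OF \<nu>])
  finally show "(\<integral>\<^sup>+ w. ?k * (ennreal (gdens \<nu> (?S z - real N *\<^sub>R w)) * g z) \<partial>?L) = g z" by simp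
 qed
 finally show ?thesis .
qed

text \<open>The shortest lifts of the grid increments, whatever their size. Their sum lifts the
  displacement from time 0 to time 1, but it depends on the grid and is in general not the shortest
  lift.\<close>

definition path_incr :: "nat => 'n::finite torus cpath => nat => real ^ 'n" where
 "path_incr N \<omega> j = tlog (path_at \<omega> (real j / real N) - path_at \<omega> (real (j - 1) / real N))"

lemma path_at_incr: "path_at \<omega> (real i / real N) = path_at \<omega> 0 + proj (\<Sum>j\<in>{1..i}. path_incr N \<omega> j)"
proof (induction i)
 case (Suc i)
 have "path_at \<omega> 0 + proj (\<Sum>j\<in>{1..Suc i}. path_incr N \<omega> j)
  = (path_at \<omega> 0 + proj (\<Sum>j\<in>{1..i}. path_incr N \<omega> j)) + proj (path_incr N \<omega> (Suc i))"
  by (simp add: proj_add add.assoc)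
 also have "... = path_at \<omega> (real (Suc i) / real N)" unfolding Suc.IH[symmetric] by (simp add: path_incr_def)
 finally show ?case by simp
qed simp

lemma energy_path_incr: "energy N \<omega> = real N / 2 * (\<Sum>j\<in>{1..N}. (norm (path_incr N \<omega> j))\<^sup>2)"
proof -
 have "(\<Sum>j\<in>{1..N}. (norm (path_incr N \<omega> j))\<^sup>2) = (\<Sum>i<N. (norm (path_incr N \<omega> (Suc i)))\<^sup>2)"
  by (simp add: sum.atLeast1_atMost_eq)
 also have "... = (\<Sum>i<N. (dist (path_at \<omega> (real i / N)) (path_at \<omega> (real (Suc i) / N)))\<^sup>2)"
  by (intro sum.cong refl arg_cong[where f = "\<lambda>x :: real. x\<^sup>2"]) (simp add: path_incr_def dist_torus_eq[symmetric] dist_commute)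
 finally show ?thesis by (simp add: energy_def)
qed

text \<open>The bound 1/8 on positions leaves the logarithms of the steps below 1/4.\<close>

definition small_walk :: "nat => (nat => real ^ 'n::finite) => bool" where
 "small_walk N z \<longleftrightarrow> (\<forall>i\<le>N. norm (tlog (proj (\<Sum>j\<in>{1..i}. z j))) < 1 / 8)"

text \<open>Logarithms of consecutive positions may be subtracted by \<open>tlog_small_diff\<close>,
  and the logarithms of the steps telescope.\<close>

lemma small_walk_incr:
 assumes s: "small_walk N z"
 shows "j \<in> {1..N} ==> norm (tlog (proj (z j))) < 1 / 4"
  and "i \<le> N ==> (\<Sum>j\<in>{1..i}. tlog (proj (z j))) = tlog (proj (\<Sum>j\<in>{1..i}. z j))"
proof -
 let ?t = "\<lambda>i. tlog (proj (\<Sum>j\<in>{1..i}. z j))"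
 have t: "norm (?t i) < 1 / 8" if "i \<le> N" for i using s that by (simp add: small_walk_def)
 have st: "tlog (proj (z (Suc i))) = ?t (Suc i) - ?t i" if "Suc i \<le> N" for i
 proof -
  have "proj (z (Suc i)) = proj (\<Sum>j\<in>{1..Suc i}. z j) - proj (\<Sum>j\<in>{1..i}. z j)"
   by (simp add: proj_add)
  moreover have "norm (?t i) < 1 / 4" "norm (?t (Suc i)) < 1 / 4" using t[of i] t[of "Suc i"] that by simp_all
  ultimately show ?thesis using tlog_small_diff by metis
 qed
 show "norm (tlog (proj (z j))) < 1 / 4" if "j \<in> {1..N}"
 proof -
  have i: "j = Suc (j - 1)" "Suc (j - 1) \<le> N" using \<open>j \<in> {1..N}\<close> by auto
  let ?i = "j - 1"
  have "norm (?t (Suc ?i) - ?t ?i) \<le> norm (?t (Suc ?i)) + norm (?t ?i)" by (rule norm_triangle_ineq4)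
  then show ?thesis using st[OF i(2)] t[of ?i] t[of "Suc ?i"] i by simp
 qed
 show "(\<Sum>j\<in>{1..i}. tlog (proj (z j))) = ?t i" if "i \<le> N"
  using that
 proof (induction i)
  case 0
  show ?case using tlog_proj_small[of 0] by simp
 next
  case (Suc i)
  have "(\<Sum>j\<in>{1..Suc i}. tlog (proj (z j))) = ?t i + (?t (Suc i) - ?t i)"
   using Suc.IH Suc.prems st[OF Suc.prems] by simp
  then show ?case by simp
 qed
qed

lemma small_walk_minus: "small_walk N (\<lambda>j\<in>{1..N}. - z j) \<longleftrightarrow> small_walk N z"
proof -
 have "(\<Sum>j\<in>{1..i}. (\<lambda>j\<in>{1..N}. - z j) j) = - (\<Sum>j\<in>{1..i}. z j)" if "i \<le> N" for i
  using that by (simp add: sum_negf[symmetric] del: sum_negf)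
 then show ?thesis by (simp add: small_walk_def proj_minus)
qed

lemma small_walk_sets: "{z \<in> space (gaussN v N). small_walk N z} \<in> sets (gaussN v N :: (nat => real ^ 'n::finite) measure)"
proof -
 have [measurable]: "(\<lambda>z. \<Sum>j\<in>{1..i}. z j) \<in> borel_measurable (gaussN v N :: (nat => real ^ 'n) measure)" if "i \<le> N" for i
  by (rule measurable_partial_sum[OF that])
 have "{z \<in> space (gaussN v N). norm (tlog (proj (\<Sum>j\<in>{1..i}. z j))) < 1 / 8} \<in> sets (gaussN v N :: (nat => real ^ 'n) measure)" if "i \<le> N" for i
  using that by measurable
 then have "(\<Inter>i\<in>{..N}. {z \<in> space (gaussN v N). norm (tlog (proj (\<Sum>j\<in>{1..i}. z j))) < 1 / 8}) \<in> sets (gaussN v N :: (nat => real ^ 'n) measure)"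
  by (intro sets.finite_INT) auto
 also have "(\<Inter>i\<in>{..N}. {z \<in> space (gaussN v N). norm (tlog (proj (\<Sum>j\<in>{1..i}. z j))) < 1 / 8}) = {z \<in> space (gaussN v N :: (nat => real ^ 'n) measure). small_walk N z}"
  by (auto simp: small_walk_def)
 finally show ?thesis .
qed

text \<open>For \<theta> = 0 the free walk from x, for \<theta> = 1 the discrete bridge from x whose
  total displacement lifts to y.\<close>

definition bridge_walk :: "real => nat => 'n::finite torus => real ^ 'n => (nat => real ^ 'n) => nat => 'n torus" where
 "bridge_walk \<theta> N x y \<xi> = (\<lambda>i\<in>{..N}. x + proj ((\<theta> * (real i / real N)) *\<^sub>R y + (\<Sum>j\<in>{1..i}. \<xi> j)
  - (\<theta> * (real i / real N)) *\<^sub>R (\<Sum>j\<in>{1..N}. \<xi> j)))"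

text \<open>The grid values of w plus pinned noise, as a function of the grid values of the noise
  alone.\<close>

definition pinned_walk :: "real => nat => 'n::finite torus cpath => (nat => 'n torus) => nat => 'n torus" where
 "pinned_walk \<theta> N w y = (\<lambda>i\<in>{..N}. path_at w (real i / real N) + (y i - proj ((\<theta> * (real i / real N)) *\<^sub>R tlog (y N))))"

lemma measurable_bridge_walk:
 "(\<lambda>(y, \<xi>). bridge_walk \<theta> N x y \<xi>) \<in> measurable (borel \<Otimes>\<^sub>M gaussN v N) (PiM {..N} (\<lambda>_. borel :: 'n::finite torus measure))"
 unfolding bridge_walk_def split_beta'
proof (rule measurable_restrict)
 fix i assume "i \<in> {..N}"
 then have [measurable]: "(\<lambda>\<xi>. \<Sum>j\<in>{1..i}. \<xi> j) \<in> borel_measurable (gaussN v N :: (nat => real ^ 'n) measure)"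
  by (intro measurable_partial_sum) simp
 have [measurable]: "(\<lambda>\<xi>. \<Sum>j\<in>{1..N}. \<xi> j) \<in> borel_measurable (gaussN v N :: (nat => real ^ 'n) measure)"
  by (intro measurable_partial_sum) simp
 show "(\<lambda>z. x + proj ((\<theta> * (real i / real N)) *\<^sub>R fst z + (\<Sum>j\<in>{1..i}. snd z j)
  - (\<theta> * (real i / real N)) *\<^sub>R (\<Sum>j\<in>{1..N}. snd z j))) \<in> borel_measurable (borel \<Otimes>\<^sub>M gaussN v N)"
  by measurable
qed

lemma measurable_bridge_walk1:
 "bridge_walk \<theta> N x y \<in> measurable (gaussN v N) (PiM {..N} (\<lambda>_. borel :: 'n::finite torus measure))"
 using measurable_compose[OF measurable_Pair1' measurable_bridge_walk, of y] by simp

text \<open>On the small event the perturbed path is the bridge built from the lifted noise shifted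
  by the centred increments of w. For \<theta> = 1 the bridge does not see a common shift of all
  increments, so the mean A / N may be removed from the drift, which makes the shift
  cheapest.\<close>

lemma bridge_walk_shift:
 fixes w :: "'n::finite torus cpath" and \<xi> :: "nat => real ^ 'n" and N :: nat
 defines "A \<equiv> \<Sum>j\<in>{1..N}. path_incr N w j"
 assumes s: "small_walk N \<xi>" and \<theta>: "\<theta> * \<theta> = \<theta>" and N: "N > 0"
 shows "bridge_walk \<theta> N (path_at w 0) A (\<lambda>j\<in>{1..N}. (\<lambda>j\<in>{1..N}. tlog (proj (\<xi> j))) j + (path_incr N w j - (\<theta> / real N) *\<^sub>R A))
  = pinned_walk \<theta> N w (walk N 0 \<xi>)"
 unfolding bridge_walk_def pinned_walk_def
proof (rule restrict_ext)
 fix i assume "i \<in> {..N}"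
 then have i: "i \<le> N" by simp
 let ?\<eta> = "\<lambda>j\<in>{1..N}. (\<lambda>j\<in>{1..N}. tlog (proj (\<xi> j))) j + (path_incr N w j - (\<theta> / real N) *\<^sub>R A)"
 let ?t = "\<lambda>i. tlog (proj (\<Sum>j\<in>{1..i}. \<xi> j))" and ?A = "\<lambda>i. \<Sum>j\<in>{1..i}. path_incr N w j"
 have S: "(\<Sum>j\<in>{1..i}. ?\<eta> j) = ?t i + (?A i - (\<theta> * (real i / real N)) *\<^sub>R A)" if "i \<le> N" for i
 proof -
  have "(\<Sum>j\<in>{1..i}. ?\<eta> j) = (\<Sum>j\<in>{1..i}. tlog (proj (\<xi> j)) + (path_incr N w j - (\<theta> / real N) *\<^sub>R A))"
   using that by (intro sum.cong) auto
  also have "... = (\<Sum>j\<in>{1..i}. tlog (proj (\<xi> j))) + (?A i - real i *\<^sub>R (\<theta> / real N) *\<^sub>R A)"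
   by (simp only: sum.distrib sum_subtractf sum_constant_scaleR card_atLeastAtMost) simp
  finally show ?thesis using small_walk_incr(2)[OF s that] by (simp add: mult.commute)
 qed
 have SN: "(\<Sum>j\<in>{1..N}. ?\<eta> j) = ?t N + (A - \<theta> *\<^sub>R A)" using S[of N] N by (simp add: A_def)
 let ?r = "\<theta> * (real i / real N)"
 \<comment> \<open>Idempotence of \<theta> lets the free and the pinned case go through
   together.\<close>
 have "?r * \<theta> = (\<theta> * \<theta>) * (real i / real N)" by (simp only: mult_ac)
 then have r\<theta>: "?r * \<theta> = ?r" by (simp only: \<theta>)
 have "?r *\<^sub>R A + (\<Sum>j\<in>{1..i}. ?\<eta> j) - ?r *\<^sub>R (\<Sum>j\<in>{1..N}. ?\<eta> j) = ?A i + ?t i - ?r *\<^sub>R ?t N"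
  unfolding S[OF i] SN using r\<theta> by (simp add: scaleR_add_right scaleR_diff_right)
 then have "path_at w 0 + proj (?r *\<^sub>R A + (\<Sum>j\<in>{1..i}. ?\<eta> j) - ?r *\<^sub>R (\<Sum>j\<in>{1..N}. ?\<eta> j))
  = (path_at w 0 + proj (?A i)) + (proj (?t i) - proj (?r *\<^sub>R ?t N))"
  by (simp only: proj_add proj_diff add.assoc add_diff_eq)
 also have "... = path_at w (real i / real N) + (walk N 0 \<xi> i - proj (?r *\<^sub>R tlog (walk N 0 \<xi> N)))"
  unfolding path_at_incr[of w i N] using i by (simp add: walk_def)
 finally show "path_at w 0 + proj (?r *\<^sub>R A + (\<Sum>j\<in>{1..i}. ?\<eta> j) - ?r *\<^sub>R (\<Sum>j\<in>{1..N}. ?\<eta> j))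
  = path_at w (real i / real N) + (walk N 0 \<xi> i - proj (?r *\<^sub>R tlog (walk N 0 \<xi> N)))" .
qed

text \<open>The variance identity. The saving \<theta> |A|^2 / N, divided by 2 \<nu> / N, is the
  Gaussian exponent that later compares the endpoints with the heat kernel.\<close>

lemma sum_norm_sq_centred:
 fixes a :: "nat => 'a::real_inner" and N :: nat
 defines "A \<equiv> \<Sum>j\<in>{1..N}. a j"
 assumes \<theta>: "\<theta> * \<theta> = \<theta>" and N: "N > 0"
 shows "(\<Sum>j\<in>{1..N}. (norm (a j - (\<theta> / real N) *\<^sub>R A))\<^sup>2) = (\<Sum>j\<in>{1..N}. (norm (a j))\<^sup>2) - \<theta> / N * (norm A)\<^sup>2"
proof -
 have "(norm (a j - (\<theta> / real N) *\<^sub>R A))\<^sup>2 = (norm (a j))\<^sup>2 - 2 * (\<theta> / N) * (a j \<bullet> A) + (\<theta> / N)\<^sup>2 * (norm A)\<^sup>2" for j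
  unfolding power2_norm_eq_inner
  by (simp add: inner_diff_left inner_diff_right inner_commute[of A "a j"] power2_eq_square right_diff_distrib diff_divide_distrib mult.assoc)
 then have "(\<Sum>j\<in>{1..N}. (norm (a j - (\<theta> / real N) *\<^sub>R A))\<^sup>2)
  = (\<Sum>j\<in>{1..N}. (norm (a j))\<^sup>2 - r * (a j \<bullet> A) + z)"
  if "r = 2 * (\<theta> / N)" "z = (\<theta> / N)\<^sup>2 * (norm A)\<^sup>2" for r z
  by (simp only: that)
 moreover have "(\<Sum>j\<in>{1..N}. (norm (a j))\<^sup>2 - r * (a j \<bullet> A) + z)
  = (\<Sum>j\<in>{1..N}. (norm (a j))\<^sup>2) - r * (A \<bullet> A) + real N * z" for r z :: real
 proof -
  have "(\<Sum>j\<in>{1..N}. r * (a j \<bullet> A)) = r * (A \<bullet> A)"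
   by (subst (2) A_def) (simp only: inner_sum_left sum_distrib_left)
  then show ?thesis by (simp add: sum.distrib sum_subtractf)
 qed
 ultimately have "(\<Sum>j\<in>{1..N}. (norm (a j - (\<theta> / real N) *\<^sub>R A))\<^sup>2)
  = (\<Sum>j\<in>{1..N}. (norm (a j))\<^sup>2) - 2 * (\<theta> / N) * (A \<bullet> A) + real N * ((\<theta> / N)\<^sup>2 * (norm A)\<^sup>2)"
  by metis
 also have "real N * ((\<theta> / N)\<^sup>2 * (norm A)\<^sup>2) = \<theta> / N * (norm A)\<^sup>2"
 proof -
  have "real N * (\<theta> / N)\<^sup>2 = (\<theta> * \<theta>) / N" using N by (simp add: power2_eq_square)
  then show ?thesis by (simp only: \<theta> mult.assoc[symmetric])
 qed
 finally show ?thesis by (simp add: power2_norm_eq_inner)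
qed

text \<open>An instance of \<open>gaussian_shift_jensen\<close>: h is the normalised indicator of
  the small event, u the lift of the wrapped steps, b the centred increments of w.\<close>

lemma conditioned_walk_jensen:
 fixes w :: "'n::finite torus cpath" and F :: "(nat => 'n torus) => real" and N :: nat
 defines "A \<equiv> \<Sum>j\<in>{1..N}. path_incr N w j" and "l \<equiv> enn2real (lat_const TYPE('n))"
 assumes \<nu>: "0 < \<nu>" "\<nu> \<le> 1" and N: "N > 0" and \<theta>: "\<theta> * \<theta> = \<theta>"
  and F: "F \<in> borel_measurable (PiM {..N} (\<lambda>_. borel))" "\<And>x. \<bar>F x\<bar> \<le> K"
  and c: "c = measure (gaussN (\<nu> / N) N) {\<xi> \<in> space (gaussN (\<nu> / N) N :: (nat => real ^ 'n) measure). small_walk N \<xi>}" "c > 0"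
 shows "(\<integral>\<xi>. indicator {\<xi>. small_walk N \<xi>} \<xi> / c * F (pinned_walk \<theta> N w (walk N 0 \<xi>)) \<partial>gaussN (\<nu> / N) N)
  \<le> energy N w / \<nu> - \<theta> * (norm A)\<^sup>2 / (2 * \<nu>)
   + ln ((1 + 8 * (\<nu> / N) * l) ^ N / c * (\<integral>\<xi>. exp (F (bridge_walk \<theta> N (path_at w 0) A \<xi>)) \<partial>gaussN (\<nu> / N) N))"
proof -
 let ?v = "\<nu> / real N"
 let ?G = "gaussN ?v N :: (nat => real ^ 'n) measure"
 have v: "0 < ?v" "?v \<le> 1" using \<nu> N by (auto simp: divide_le_eq)
 interpret G: prob_space ?G by (rule prob_space_gaussN[OF v(1)])
 have l: "lat_const TYPE('n) = ennreal l" "l \<ge> 0"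
  unfolding l_def using lat_const_finite[where 'n = 'n] by (simp_all add: ennreal_enn2real)
 let ?I = "indicator {\<xi>. small_walk N \<xi>} :: (nat => real ^ 'n) => real"
 define h where "h \<xi> = ?I \<xi> / c" for \<xi>
 define u where "u \<xi> = (\<lambda>j\<in>{1..N}. tlog (proj (\<xi> j)))" for \<xi> :: "nat => real ^ 'n"
 define b where "b j = path_incr N w j - (\<theta> / real N) *\<^sub>R A" for j
 define f where "f \<xi> = F (bridge_walk \<theta> N (path_at w 0) A \<xi>)" for \<xi>
 \<comment> \<open>One factor per step from wrapping, and 1 / c from conditioning.\<close>
 define C where "C = (1 + 8 * ?v * l) ^ N / c"
 have comp: "(\<lambda>\<xi>. \<xi> j) \<in> borel_measurable ?G" if "j \<in> {1..N}" for j
  using measurable_component_singleton[OF that, of "\<lambda>_. gauss ?v :: (real ^ 'n) measure"] by (simp cong: measurable_cong_sets)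
 have sm: "{\<xi>. small_walk N \<xi>} \<inter> space ?G \<in> sets ?G" using small_walk_sets[of N ?v, where 'n = 'n] by (simp add: Int_def conj_commute)
 have Im: "?I \<in> borel_measurable ?G" using sm by (simp add: borel_measurable_indicator_iff)
 have hm: "h \<in> borel_measurable ?G" unfolding h_def by (intro borel_measurable_divide Im borel_measurable_const)
 have h0: "h \<xi> \<ge> 0" for \<xi> using c(2) by (simp add: h_def)
 have hle: "\<bar>h \<xi>\<bar> \<le> 1 / c" for \<xi> using c(2) by (simp add: h_def indicator_def)
 have hi: "integrable ?G h" by (rule integrable_bounded_prob[OF G.prob_space_axioms hm hle])
 have h1: "(\<integral>\<xi>. h \<xi> \<partial>?G) = 1"
  unfolding h_def using c sm by (simp add: Int_def conj_commute)
 have um: "u \<in> measurable ?G ?G"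
  unfolding u_def by (rule measurable_restrict) (use measurable_compose[OF comp measurable_compose[OF borel_measurable_proj borel_measurable_tlog]] in \<open>simp cong: measurable_cong_sets\<close>)
 have ucomp: "(\<lambda>\<xi>. u \<xi> j) \<in> borel_measurable ?G" if "j \<in> {1..N}" for j
  by (rule measurable_compose[OF um comp[OF that]])
 let ?X = "\<lambda>\<xi>. h \<xi> * (\<Sum>j\<in>{1..N}. b j \<bullet> u \<xi> j)"
 have Xm: "?X \<in> borel_measurable ?G"
  by (intro borel_measurable_times hm borel_measurable_sum borel_measurable_inner borel_measurable_const ucomp)
 have usm: "norm (u \<xi> j) < 1 / 4" if "small_walk N \<xi>" "j \<in> {1..N}" for \<xi> j
  using small_walk_incr(1)[OF that] that(2) by (simp add: u_def)
 have Xb: "\<bar>?X \<xi>\<bar> \<le> 1 / c * (\<Sum>j\<in>{1..N}. norm (b j))" for \<xi>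
 proof (cases "small_walk N \<xi>")
  case True
  have "\<bar>\<Sum>j\<in>{1..N}. b j \<bullet> u \<xi> j\<bar> \<le> (\<Sum>j\<in>{1..N}. \<bar>b j \<bullet> u \<xi> j\<bar>)" by (rule sum_abs)
  also have "... \<le> (\<Sum>j\<in>{1..N}. norm (b j))"
  proof (rule sum_mono)
   fix j assume j: "j \<in> {1..N}"
   have "\<bar>b j \<bullet> u \<xi> j\<bar> \<le> norm (b j) * norm (u \<xi> j)" by (rule Cauchy_Schwarz_ineq2)
   also have "... \<le> norm (b j) * 1" using usm[OF True j] by (intro mult_left_mono) auto
   finally show "\<bar>b j \<bullet> u \<xi> j\<bar> \<le> norm (b j)" by simp
  qed
  finally show ?thesis unfolding abs_mult using hle[of \<xi>] c(2) by (intro mult_mono) auto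
 qed (use c(2) in \<open>simp add: h_def sum_nonneg\<close>)
 have Xi: "integrable ?G ?X" by (rule integrable_bounded_prob[OF G.prob_space_axioms Xm Xb])
 \<comment> \<open>The small event is invariant under reflection, and \<open>tlog\<close> is odd on
   steps below 1/2; this is the symmetry that kills the linear term.\<close>
 have X0: "(\<integral>\<xi>. ?X \<xi> \<partial>?G) = 0"
 proof (rule gaussN_odd_integral[OF v(1) Xm])
  fix \<xi> :: "nat => real ^ 'n"
  show "?X (\<lambda>j\<in>{1..N}. - \<xi> j) = - ?X \<xi>"
  proof (cases "small_walk N \<xi>")
   case True
   have "u (\<lambda>j\<in>{1..N}. - \<xi> j) j = - u \<xi> j" if j: "j \<in> {1..N}" for j
    using j tlog_minus[of "proj (\<xi> j)"] small_walk_incr(1)[OF True j] by (simp add: u_def proj_minus)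
   then have "(\<Sum>j\<in>{1..N}. b j \<bullet> u (\<lambda>j\<in>{1..N}. - \<xi> j) j) = - (\<Sum>j\<in>{1..N}. b j \<bullet> u \<xi> j)"
    unfolding sum_negf[symmetric] by (intro sum.cong refl) (simp only: inner_minus_right)
   moreover have "h (\<lambda>j\<in>{1..N}. - \<xi> j) = h \<xi>" unfolding h_def indicator_def mem_Collect_eq small_walk_minus ..
   ultimately show ?thesis by simp
  next
   case False
   then have "h (\<lambda>j\<in>{1..N}. - \<xi> j) = 0" "h \<xi> = 0" using small_walk_minus[of N \<xi>] by (auto simp: h_def)
   then show ?thesis by simp
  qed
 qed
 have vl: "0 \<le> 8 * ?v * l" using l(2) v(1) by (intro mult_nonneg_nonneg) auto
 have C: "C > 0" unfolding C_def by (intro divide_pos_pos zero_less_power add_pos_nonneg vl c(2) zero_less_one)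
 have dom: "(\<integral>\<^sup>+ \<xi>. ennreal (h \<xi>) * g (u \<xi>) \<partial>?G) \<le> ennreal C * (\<integral>\<^sup>+ \<xi>. g \<xi> \<partial>?G)" if g: "g \<in> borel_measurable ?G" for g
 proof -
  let ?k = "indicator {x :: real ^ 'n. norm (tlog (proj x)) < 1 / 4} :: real ^ 'n => ennreal"
  have km: "?k \<in> borel_measurable borel" by measurable
  have sf: "sigma_finite_measure (gauss ?v :: (real ^ 'n) measure)"
   using prob_space_gauss[OF v(1)] by (rule prob_space_imp_sigma_finite)
  \<comment> \<open>Smallness of the walk implies smallness of every single step, so the event,
    which does not factorise, is enlarged to a product.\<close>
  have hk: "ennreal (h \<xi>) \<le> ennreal (1 / c) * (\<Prod>j\<in>{1..N}. ?k (\<xi> j))" for \<xi>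
  proof (cases "small_walk N \<xi>")
   case True
   then have "(\<Prod>j\<in>{1..N}. ?k (\<xi> j)) = 1" using small_walk_incr(1)[OF True] by (intro prod.neutral) auto
   then show ?thesis using True by (simp add: h_def)
  qed (simp add: h_def)
  have m: "(\<lambda>\<xi>. (\<Prod>j\<in>{1..N}. ?k (\<xi> j)) * g (u \<xi>)) \<in> borel_measurable ?G"
   by (intro borel_measurable_times_ennreal borel_measurable_prod_ennreal measurable_compose[OF comp km] measurable_compose[OF um g])
  have "(\<integral>\<^sup>+ \<xi>. ennreal (h \<xi>) * g (u \<xi>) \<partial>?G) \<le> (\<integral>\<^sup>+ \<xi>. ennreal (1 / c) * ((\<Prod>j\<in>{1..N}. ?k (\<xi> j)) * g (u \<xi>)) \<partial>?G)"
   by (rule nn_integral_mono) (unfold mult.assoc[symmetric], rule mult_right_mono[OF hk], simp)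
  also have "... = ennreal (1 / c) * (\<integral>\<^sup>+ \<xi>. (\<Prod>j\<in>{1..N}. ?k (\<xi> j)) * g (u \<xi>) \<partial>?G)"
   by (rule nn_integral_cmult[OF m])
  also have "... \<le> ennreal (1 / c) * ((1 + ennreal (8 * ?v) * lat_const TYPE('n)) ^ card {1..N} * (\<integral>\<^sup>+ \<xi>. g \<xi> \<partial>?G))"
  proof (rule mult_left_mono)
   show "(\<integral>\<^sup>+ \<xi>. (\<Prod>j\<in>{1..N}. ?k (\<xi> j)) * g (u \<xi>) \<partial>?G) \<le> (1 + ennreal (8 * ?v) * lat_const TYPE('n)) ^ card {1..N} * (\<integral>\<^sup>+ \<xi>. g \<xi> \<partial>?G)"
    unfolding u_def
   proof (rule PiM_dominated[OF _ sf sf _ _ _ g])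
    fix g :: "real ^ 'n => ennreal" assume "g \<in> borel_measurable (gauss ?v)"
    then have "g \<in> borel_measurable borel" by (simp cong: measurable_cong_sets)
    then show "(\<integral>\<^sup>+ x. ?k x * g (tlog (proj x)) \<partial>gauss ?v) \<le> (1 + ennreal (8 * ?v) * lat_const TYPE('n)) * (\<integral>\<^sup>+ x. g x \<partial>gauss ?v)"
     by (rule tlog_gauss_dominated[OF v])
   next
    show "?k \<in> borel_measurable (gauss ?v)" using km by (simp cong: measurable_cong_sets)
    show "(\<lambda>x. tlog (proj x)) \<in> measurable (gauss ?v) (gauss ?v :: (real ^ 'n) measure)" by (simp cong: measurable_cong_sets)
   qed simp
  qed simp
  also have "1 + ennreal (8 * ?v) * lat_const TYPE('n) = ennreal (1 + 8 * ?v * l)"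
   unfolding l(1) using l(2) v(1) ennreal_plus[OF zero_le_one vl] by (simp add: ennreal_mult[symmetric])
  also have "ennreal (1 / c) * (ennreal (1 + 8 * ?v * l) ^ card {1..N} * (\<integral>\<^sup>+ \<xi>. g \<xi> \<partial>?G)) = ennreal C * (\<integral>\<^sup>+ \<xi>. g \<xi> \<partial>?G)"
  proof -
   have "ennreal (1 / c) * ennreal (1 + 8 * ?v * l) ^ card {1..N} = ennreal C"
    unfolding C_def using vl c(2) by (subst ennreal_power) (simp_all only: card_atLeastAtMost ennreal_mult[symmetric] zero_le_power add_nonneg_nonneg zero_le_one zero_le_divide_1_iff less_imp_le, simp)
   then show ?thesis by (simp only: mult.assoc[symmetric])
  qed
  finally show ?thesis .
 qed
 have fm: "f \<in> borel_measurable ?G" unfolding f_def by (rule measurable_compose[OF measurable_bridge_walk1 F(1)])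
 have main: "(\<integral>\<xi>. h \<xi> * f (\<lambda>j\<in>{1..N}. u \<xi> j + b j) \<partial>?G)
  \<le> (\<Sum>j\<in>{1..N}. (norm (b j))\<^sup>2) / (2 * ?v) + ln (C * (\<integral>\<xi>. exp (f \<xi>) \<partial>?G))"
  by (rule gaussian_shift_jensen[OF v(1) hm h0 hi h1 um Xi X0 dom C fm, where K = K]) (simp_all add: f_def F(2))
 have lhs: "(\<integral>\<xi>. h \<xi> * f (\<lambda>j\<in>{1..N}. u \<xi> j + b j) \<partial>?G) = (\<integral>\<xi>. ?I \<xi> / c * F (pinned_walk \<theta> N w (walk N 0 \<xi>)) \<partial>?G)"
 proof (rule Bochner_Integration.integral_cong[OF refl])
  fix \<xi> :: "nat => real ^ 'n"
  show "h \<xi> * f (\<lambda>j\<in>{1..N}. u \<xi> j + b j) = ?I \<xi> / c * F (pinned_walk \<theta> N w (walk N 0 \<xi>))"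
  proof (cases "small_walk N \<xi>")
   case True
   show ?thesis unfolding h_def f_def u_def b_def A_def bridge_walk_shift[OF True \<theta> N] ..
  qed (simp add: h_def)
 qed
 have "(\<Sum>j\<in>{1..N}. (norm (b j))\<^sup>2) / (2 * ?v) = energy N w / \<nu> - \<theta> * (norm A)\<^sup>2 / (2 * \<nu>)"
  unfolding b_def A_def sum_norm_sq_centred[OF \<theta> N] energy_path_incr using \<nu> N by (simp add: field_simps)
 then show ?thesis using main unfolding lhs unfolding f_def C_def by (simp only:)
qed

section \<open>Conditioned noise\<close>

text \<open>Brownian motion of diffusivity 1 on the time interval [0, \<nu>], rescaled to [0, 1]:
  its increments have the law of diffusivity \<nu>, and one probability space carries the noise for
  all \<nu>.\<close>

definition noise :: "real => 'n::finite torus cpath => 'n torus cpath" where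
 "noise \<nu> B = mk_path (\<lambda>t. path_at B (\<nu> * t) - path_at B 0)"

text \<open>\<theta> = 1 makes the path end at 0, \<theta> = 0 leaves it unchanged.\<close>

definition pin :: "real => 'n::finite torus cpath => 'n torus cpath" where
 "pin \<theta> z = mk_path (\<lambda>t. path_at z t - proj ((\<theta> * t) *\<^sub>R tlog (path_at z 1)))"

lemma path_at_noise:
 assumes \<nu>: "0 \<le> \<nu>" "\<nu> \<le> 1" and t: "t \<in> {0..1}"
 shows "path_at (noise \<nu> B) t = path_at B (\<nu> * t) - path_at B 0"
 unfolding noise_def
proof (rule path_at_mk_path[OF _ t], rule continuous_on_diff_torus)
 show "continuous_on {0..1} (\<lambda>t. path_at B (\<nu> * t))"
  by (rule continuous_on_compose2[OF continuous_on_path_at]) (use \<nu> in \<open>auto intro!: continuous_intros mult_le_one\<close>)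
qed (rule continuous_on_const)

lemma path_at_pin:
 assumes t: "t \<in> {0..1}"
 shows "path_at (pin \<theta> z) t = path_at z t - proj ((\<theta> * t) *\<^sub>R tlog (path_at z 1))"
 unfolding pin_def
proof (rule path_at_mk_path[OF _ t], rule continuous_on_diff_torus[OF continuous_on_path_at])
 show "continuous_on {0..1} (\<lambda>t. proj ((\<theta> * t) *\<^sub>R tlog (path_at z 1)))"
  by (rule continuous_on_compose2[OF continuous_on_proj[of UNIV]]) (auto intro!: continuous_intros)
qed

lemma measurable_noise:
 assumes \<nu>: "0 \<le> \<nu>" "\<nu> \<le> 1"
 shows "noise \<nu> \<in> borel_measurable (borel :: 'n::finite torus cpath measure)"
proof (rule borel_measurable_cpathI)
 fix n k :: nat assume "k \<le> 2 ^ n"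
 then have k: "real k / 2 ^ n \<in> {0..1}" by simp
 have "0 \<le> \<nu> * (real k / 2 ^ n)" "\<nu> * (real k / 2 ^ n) \<le> 1"
  using \<nu> k by (auto intro!: mult_nonneg_nonneg mult_le_one simp del: times_divide_eq_right)
 then have k': "\<nu> * (real k / 2 ^ n) \<in> {0..1}" unfolding atLeastAtMost_iff by (rule conjI)
 show "(\<lambda>B. path_at (noise \<nu> B :: 'n torus cpath) (real k / 2 ^ n)) \<in> borel_measurable borel"
  unfolding path_at_noise[OF \<nu> k] by (intro borel_measurable_diff_torus borel_measurable_eval k') simp
qed

lemma measurable_pin: "pin \<theta> \<in> borel_measurable (borel :: 'n::finite torus cpath measure)"
proof (rule borel_measurable_cpathI)
 fix n k :: nat assume "k \<le> 2 ^ n"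
 then have k: "real k / 2 ^ n \<in> {0..1}" by simp
 have [measurable]: "(\<lambda>z. path_at z 1) \<in> borel_measurable (borel :: 'n torus cpath measure)" by (rule borel_measurable_eval) simp
 show "(\<lambda>z. path_at (pin \<theta> z :: 'n torus cpath) (real k / 2 ^ n)) \<in> borel_measurable borel"
  unfolding path_at_pin[OF k] by (intro borel_measurable_diff_torus borel_measurable_eval k) measurable
qed

lemma samp_add_pin:
 assumes N: "N > 0"
 shows "samp N (add_path w (pin \<theta> z)) = pinned_walk \<theta> N w (samp N z)"
 unfolding samp_def[of N "add_path w (pin \<theta> z)"] pinned_walk_def
proof (rule restrict_ext)
 fix i assume i: "i \<in> {..N}"
 then have g: "real i / real N \<in> {0..1}" using N by (intro grid_mem) auto
 show "path_at (add_path w (pin \<theta> z)) (real i / real N) = path_at w (real i / real N) + (samp N z i - proj ((\<theta> * (real i / real N)) *\<^sub>R tlog (samp N z N)))"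
  unfolding path_at_add_path[OF g] path_at_pin[OF g] using i N by (simp add: samp_def)
qed

lemma dist_pin:
 assumes \<theta>: "\<bar>\<theta>\<bar> \<le> 1"
 shows "dist (pin \<theta> z) zero_path \<le> 2 * dist z zero_path"
proof (rule dist_cpath_le)
 fix t :: real assume t: "t \<in> {0..1}"
 have d: "norm (tlog (path_at z s)) \<le> dist z zero_path" if "s \<in> {0..1}" for s
  using dist_path_at_le[OF that, of z zero_path] by (simp add: path_at_zero_path[OF that] dist_torus_0)
 have "dist (path_at z t + - proj ((\<theta> * t) *\<^sub>R tlog (path_at z 1))) (0 + 0)
  \<le> dist (path_at z t) 0 + dist (- proj ((\<theta> * t) *\<^sub>R tlog (path_at z 1))) 0"
  by (rule uniformly_continuous_add_torus)
 also have "dist (- proj ((\<theta> * t) *\<^sub>R tlog (path_at z 1))) 0 = norm (tlog (proj ((\<theta> * t) *\<^sub>R tlog (path_at z 1))))"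
  by (simp only: dist_torus_0 norm_tlog_minus)
 also have "... \<le> \<bar>\<theta> * t\<bar> * norm (tlog (path_at z 1))" using norm_tlog_le[of "(\<theta> * t) *\<^sub>R tlog (path_at z 1)"] by simp
 also have "... \<le> 1 * norm (tlog (path_at z 1))"
  using \<theta> t by (intro mult_right_mono) (auto simp: abs_mult intro!: mult_le_one)
 finally show "dist (path_at (pin \<theta> z) t) (path_at zero_path t) \<le> 2 * dist z zero_path"
  using d[OF t] d[of 1] by (simp add: path_at_pin[OF t] path_at_zero_path[OF t] dist_torus_0)
qed

definition small_samp :: "nat => (nat => 'n::finite torus) => bool" where
 "small_samp N y \<longleftrightarrow> (\<forall>i\<le>N. norm (tlog (y i)) < 1 / 8)"

lemma small_walk_samp: "small_walk N \<xi> \<longleftrightarrow> small_samp N (walk N 0 \<xi>)"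
 by (simp add: small_walk_def small_samp_def walk_def)

lemma small_samp_sets: "{y \<in> space (PiM {..N} (\<lambda>_. borel)). small_samp N y} \<in> sets (PiM {..N} (\<lambda>_. borel :: 'n::finite torus measure))"
proof -
 let ?M = "PiM {..N} (\<lambda>_. borel :: 'n torus measure)"
 have "{y \<in> space ?M. norm (tlog (y i)) < 1 / 8} \<in> sets ?M" if "i \<le> N" for i
 proof -
  have [measurable]: "(\<lambda>y. y i) \<in> borel_measurable ?M" using that by (intro measurable_component_singleton) simp
  show ?thesis by measurable
 qed
 then have "(\<Inter>i\<in>{..N}. {y \<in> space ?M. norm (tlog (y i)) < 1 / 8}) \<in> sets ?M" by (intro sets.finite_INT) auto
 also have "(\<Inter>i\<in>{..N}. {y \<in> space ?M. norm (tlog (y i)) < 1 / 8}) = {y \<in> space ?M. small_samp N y}"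
  by (auto simp: small_samp_def)
 finally show ?thesis .
qed

definition small_grid :: "nat => 'n::finite torus cpath set" where
 "small_grid n = {z. small_samp (2 ^ n) (samp (2 ^ n) z)}"

lemma small_grid_sets: "small_grid n \<in> sets (borel :: 'n::finite torus cpath measure)"
proof -
 have "samp (2 ^ n) -` {y \<in> space (PiM {..2 ^ n} (\<lambda>_. borel)). small_samp (2 ^ n) y} \<inter> space borel \<in> sets (borel :: 'n torus cpath measure)"
  by (rule measurable_sets[OF measurable_samp small_samp_sets]) simp
 also have "samp (2 ^ n) -` {y \<in> space (PiM {..2 ^ n} (\<lambda>_. borel)). small_samp (2 ^ n) y} \<inter> space borel = (small_grid n :: 'n torus cpath set)"
  using samp_space by (auto simp: small_grid_def)
 finally show ?thesis .
qed

lemma small_grid_antimono: "n \<le> m ==> small_grid m \<subseteq> (small_grid n :: 'n::finite torus cpath set)"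
proof
 fix z :: "'n torus cpath" assume nm: "n \<le> m" and z: "z \<in> small_grid m"
 have "norm (tlog (samp (2 ^ n) z i)) < 1 / 8" if "i \<le> 2 ^ n" for i
 proof -
  have "2 ^ (m - n) * i \<le> 2 ^ (m - n) * (2 ^ n :: nat)" using that by simp
  also have "... = 2 ^ m" using nm by (simp add: power_add[symmetric])
  finally have "norm (tlog (samp (2 ^ m) z (2 ^ (m - n) * i))) < 1 / 8" using z by (simp add: small_grid_def small_samp_def)
  then show ?thesis unfolding samp_refine[OF nm] using that by (simp add: coarsen_def)
 qed
 then show "z \<in> small_grid n" by (simp add: small_grid_def small_samp_def)
qed

text \<open>On small paths the increments are recovered additively by \<open>tlog\<close>, so that the noise is handled in
 Euclidean space; the dyadic grid makes the event measurable and a decreasing limit of grid events.\<close>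

definition small_paths :: "'n::finite torus cpath set" where
 "small_paths = (\<Inter>n. small_grid n)"

lemma small_paths_sets: "small_paths \<in> sets (borel :: 'n::finite torus cpath measure)"
 unfolding small_paths_def using small_grid_sets by (intro sets.countable_INT) auto

lemma ball_small_paths: "dist z zero_path < 1 / 8 ==> z \<in> small_paths"
proof -
 assume d: "dist z zero_path < 1 / 8"
 have "norm (tlog (samp (2 ^ n) z i)) < 1 / 8" if "i \<le> 2 ^ n" for n i
 proof -
  have g: "real i / real (2 ^ n) \<in> {0..1}" using that by (intro grid_mem) auto
  have "norm (tlog (samp (2 ^ n) z i)) = dist (path_at z (real i / real (2 ^ n))) (path_at zero_path (real i / real (2 ^ n)))"
   unfolding path_at_zero_path[OF g] dist_torus_0 using that by (simp add: samp_def)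
  also have "... \<le> dist z zero_path" by (rule dist_path_at_le[OF g])
  finally show ?thesis using d by simp
 qed
 then show ?thesis by (simp add: small_paths_def small_grid_def small_samp_def)
qed

context
 fixes R1 :: "'n::finite torus cpath measure"
 assumes R1: "is_reversible_brownian 1 R1"
begin

lemma R1_space: "prob_space R1" "sets R1 = sets borel"
 using R1 by (auto simp: is_reversible_brownian_def prob_algebra_borel_iff)

definition "noise_law \<nu> = distr R1 borel (noise \<nu>)"

lemma noise_meas_R1: "0 \<le> \<nu> ==> \<nu> \<le> 1 ==> noise \<nu> \<in> borel_measurable R1"
 using measurable_noise measurable_cong_sets[OF R1_space(2) refl] by blast

lemma noise_law_space:
 assumes "0 \<le> \<nu>" "\<nu> \<le> 1"
 shows "prob_space (noise_law \<nu>)" "sets (noise_law \<nu>) = sets borel"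
 using prob_space.prob_space_distr[OF R1_space(1) noise_meas_R1[OF assms]] by (simp_all add: noise_law_def)

lemma measurable_walk0: "walk N 0 \<in> measurable (gaussN v N) (PiM {..N} (\<lambda>_. borel :: 'n torus measure))"
 unfolding walk_def[abs_def]
proof (rule measurable_restrict)
 fix i assume "i \<in> {..N}"
 then have [measurable]: "(\<lambda>\<xi>. \<Sum>j\<in>{1..i}. \<xi> j) \<in> borel_measurable (gaussN v N :: (nat => real ^ 'n) measure)"
  by (intro measurable_partial_sum) simp
 show "(\<lambda>\<xi>. 0 + proj (\<Sum>j\<in>{1..i}. \<xi> j)) \<in> borel_measurable (gaussN v N :: (nat => real ^ 'n) measure)" by measurable
qed

text \<open>Brownian scaling, read off \<open>brownian_fd\<close> with horizon \<nu>; taking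
  differences from the starting point makes the uniform initial law drop out.\<close>

lemma noise_law_samp:
 assumes \<nu>: "0 < \<nu>" "\<nu> \<le> 1" and N: "N > 0"
 shows "distr (noise_law \<nu>) (PiM {..N} (\<lambda>_. borel)) (samp N) = distr (gaussN (\<nu> / N) N) (PiM {..N} (\<lambda>_. borel)) (walk N 0)"
proof (rule measure_eqI)
 let ?M = "PiM {..N} (\<lambda>_. borel :: 'n torus measure)"
 have v: "\<nu> / N > 0" using \<nu> N by simp
 interpret G: prob_space "gaussN (\<nu> / N) N :: (nat => real ^ 'n) measure" by (rule prob_space_gaussN[OF v])
 interpret L: prob_space "leb_torus :: 'n torus measure" by (rule prob_space_leb_torus)
 have nm: "noise \<nu> \<in> borel_measurable R1" using \<nu> by (intro noise_meas_R1) auto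
 have sm: "samp N \<in> measurable borel ?M" by (rule measurable_samp[OF N])
 define s0 where "s0 x = (\<lambda>i\<in>{..N}. x i - x 0)" for x :: "nat => 'n torus"
 have s0m: "s0 \<in> measurable ?M ?M"
  unfolding s0_def by (intro measurable_restrict borel_measurable_diff_torus measurable_component_singleton) auto
 have sn: "samp N (noise \<nu> B) = s0 (\<lambda>i\<in>{..N}. path_at B (\<nu> * real i / real N))" for B :: "'n torus cpath"
  unfolding samp_def s0_def
 proof (rule restrict_ext)
  fix i assume i: "i \<in> {..N}"
  then have "real i / real N \<in> {0..1}" using N by (intro grid_mem) auto
  from path_at_noise[OF _ \<nu>(2) this] show "path_at (noise \<nu> B) (real i / real N)
   = (\<lambda>i\<in>{..N}. path_at B (\<nu> * real i / real N)) i - (\<lambda>i\<in>{..N}. path_at B (\<nu> * real i / real N)) 0"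
   using i \<nu>(1) by simp
 qed
 have sw: "s0 (walk N x \<xi>) = walk N 0 \<xi>" for x \<xi>
  unfolding walk_def s0_def by (rule restrict_ext) auto
 fix A assume "A \<in> sets (distr (noise_law \<nu>) ?M (samp N))"
 then have A: "A \<in> sets ?M" by simp
 have iA: "(indicator A :: _ => ennreal) \<in> borel_measurable ?M" using A by simp
 have "emeasure (distr (noise_law \<nu>) ?M (samp N)) A = (\<integral>\<^sup>+ x. indicator A x \<partial>distr R1 ?M (\<lambda>B. samp N (noise \<nu> B)))"
  unfolding noise_law_def using A nm sm by (simp add: distr_distr comp_def)
 also have "... = (\<integral>\<^sup>+ B. indicator A (samp N (noise \<nu> B)) \<partial>R1)"
  by (rule nn_integral_distr[OF measurable_compose[OF nm sm]]) (use iA in simp)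
 also have "... = (\<integral>\<^sup>+ B. indicator A (s0 (\<lambda>i\<in>{..N}. path_at B (\<nu> * real i / real N))) \<partial>R1)" unfolding sn ..
 also have "... = (\<integral>\<^sup>+ \<xi>. \<integral>\<^sup>+ x. indicator A (s0 (walk N x \<xi>)) \<partial>leb_torus \<partial>gaussN (1 * \<nu> / N) N)"
  by (rule brownian_fd[OF R1 zero_less_one \<nu> N measurable_compose[OF s0m iA]])
 also have "... = (\<integral>\<^sup>+ \<xi>. indicator A (walk N 0 \<xi>) \<partial>gaussN (\<nu> / N) N)"
  unfolding sw using L.emeasure_space_1 by (simp add: space_leb_torus)
 also have "... = (\<integral>\<^sup>+ x. indicator A x \<partial>distr (gaussN (\<nu> / N) N) ?M (walk N 0))"
  by (rule nn_integral_distr[symmetric, OF measurable_walk0]) (use iA in simp)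
 also have "... = emeasure (distr (gaussN (\<nu> / N) N) ?M (walk N 0)) A" using A by simp
 finally show "emeasure (distr (noise_law \<nu>) ?M (samp N)) A = emeasure (distr (gaussN (\<nu> / N) N) ?M (walk N 0)) A" .
qed simp

text \<open>Pointwise in B by continuity of B at time 0, then dominated convergence; no Gaussian
  estimate enters.\<close>

lemma noise_law_concentrates:
 assumes e: "e > 0"
 shows "((\<lambda>\<nu>. measure (noise_law \<nu>) {z. dist z zero_path \<ge> e}) \<longlongrightarrow> 0) (at_right 0)"
proof (rule tendsto_at_right_sequentially[of 0 1])
 fix S :: "nat => real" assume S: "\<And>n. 0 < S n" "\<And>n. S n < 1" "S \<longlonglongrightarrow> 0"
 interpret R: prob_space R1 by (rule R1_space)
 let ?D = "{z :: 'n torus cpath. dist z zero_path \<ge> e}"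
 have D: "?D \<in> sets borel" by (intro borel_closed closed_Collect_le continuous_intros)
 have nm: "noise (S n) \<in> borel_measurable R1" for n using S(1,2)[of n] by (intro noise_meas_R1) auto
 have m: "measure (noise_law (S n)) ?D = (\<integral>B. indicator ?D (noise (S n) B) \<partial>R1)" for n
 proof -
  have "measure (noise_law (S n)) ?D = (\<integral>z. indicator ?D z \<partial>noise_law (S n))" using D by (simp add: noise_law_def)
  also have "... = (\<integral>B. indicator ?D (noise (S n) B) \<partial>R1)"
   unfolding noise_law_def by (rule integral_distr[OF nm]) (use D in simp)
  finally show ?thesis .
 qed
 have "(\<lambda>n. \<integral>B. indicator ?D (noise (S n) B) \<partial>R1) \<longlonglongrightarrow> (\<integral>B. (0 :: real) \<partial>R1)"
 proof (rule integral_dominated_convergence[where w = "\<lambda>_. 1"])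
  show "(\<lambda>B. indicator ?D (noise (S n) B) :: real) \<in> borel_measurable R1" for n
   by (rule measurable_compose[OF nm]) (use D in simp)
  show "AE B in R1. (\<lambda>n. indicator ?D (noise (S n) B) :: real) \<longlonglongrightarrow> 0"
  proof (rule AE_I2)
   fix B :: "'n torus cpath"
   have "continuous_on {0..1} (path_at B)" by (rule continuous_on_path_at)
   then obtain d where d: "d > 0" "\<And>s. s \<in> {0..1} ==> dist s 0 < d ==> dist (path_at B s) (path_at B 0) < e / 2"
    using e unfolding continuous_on_iff by (metis atLeastAtMost_iff half_gt_zero order_refl zero_le_one)
   have "\<forall>\<^sub>F n in sequentially. S n < d" using S(3) d(1) by (rule order_tendstoD)
   then have "\<forall>\<^sub>F n in sequentially. indicator ?D (noise (S n) B) = (0 :: real)"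
   proof eventually_elim
    case (elim n)
    have "dist (noise (S n) B) zero_path \<le> e / 2"
    proof (rule dist_cpath_le)
     fix t :: real assume t: "t \<in> {0..1}"
     have le: "S n * t \<le> S n * 1" using S(1)[of n] t by (intro mult_left_mono) auto
     moreover have "0 \<le> S n * t" using S(1)[of n] t by (intro mult_nonneg_nonneg) auto
     ultimately have s: "S n * t \<in> {0..1}" using S(2)[of n] by simp
     have "dist (path_at B (S n * t)) (path_at B 0) < e / 2" using elim s le by (intro d(2)) (auto simp: dist_real_def)
     then show "dist (path_at (noise (S n) B) t) (path_at zero_path t) \<le> e / 2"
      using S(1,2)[of n] t by (simp add: path_at_noise path_at_zero_path dist_torus_diff_0[symmetric])
    qed
    then show ?case using e by simp
   qed
   then show "(\<lambda>n. indicator ?D (noise (S n) B) :: real) \<longlonglongrightarrow> 0" by (rule tendsto_eventually)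
  qed
 qed (auto simp: indicator_def)
 then show "(\<lambda>n. measure (noise_law (S n)) ?D) \<longlonglongrightarrow> 0" unfolding m by simp
qed simp

text \<open>The level 1/2 is arbitrary; it becomes the term ln 2 in the entropy bound.\<close>

lemma small_paths_likely: "\<forall>\<^sub>F \<nu> in at_right 0. \<nu> \<le> 1 \<and> measure (noise_law \<nu>) small_paths \<ge> 1 / 2"
proof -
 have "\<forall>\<^sub>F \<nu> in at_right 0. measure (noise_law \<nu>) {z. dist z zero_path \<ge> 1 / 8} < 1 / 2"
  by (rule order_tendstoD(2)[OF noise_law_concentrates]) simp_all
 moreover have "\<forall>\<^sub>F \<nu> in at_right (0::real). 0 < \<nu> \<and> \<nu> < 1"
  using eventually_at_right_real[of "0::real" 1] by (auto elim: eventually_mono)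
 ultimately show ?thesis
 proof eventually_elim
  case (elim \<nu>)
  have sp: "prob_space (noise_law \<nu>)" "sets (noise_law \<nu>) = sets borel" using elim noise_law_space[of \<nu>] by auto
  interpret prob_space "noise_law \<nu>" by (rule sp)
  let ?D = "{z :: 'n torus cpath. dist z zero_path \<ge> 1 / 8}"
  have D: "?D \<in> events" unfolding sp(2) by (intro borel_closed closed_Collect_le continuous_intros)
  have "1 - measure (noise_law \<nu>) ?D = measure (noise_law \<nu>) (space (noise_law \<nu>) - ?D)" using D by (simp add: prob_compl)
  also have "... \<le> measure (noise_law \<nu>) small_paths"
  proof (rule finite_measure_mono)
   show "space (noise_law \<nu>) - ?D \<subseteq> small_paths"
   proof
    fix x assume "x \<in> space (noise_law \<nu>) - ?D"
    then have "dist x zero_path < 1 / 8" by (simp add: not_le)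
    then show "x \<in> small_paths" by (rule ball_small_paths)
   qed
  qed (use small_paths_sets sp(2) in simp)
  finally show ?case using elim by simp
 qed
qed

end

lemma integral_energy_le:
 fixes p :: "'n::finite torus cpath measure"
 assumes p: "p \<in> space (prob_algebra borel)" and N: "N > 0" and a: "mean_action p \<le> ereal a"
 shows "integrable p (energy N)" "(\<integral>w. energy N w \<partial>p) \<le> a"
proof -
 have pp: "prob_space p" "sets p = sets borel" using p by (auto simp: prob_algebra_borel_iff)
 have "energy N \<in> borel_measurable (borel :: 'n torus cpath measure)"
  by (rule borel_measurable_continuous_onI[OF continuous_energy[OF N]])
 then have em: "energy N \<in> borel_measurable p" using measurable_cong_sets[OF pp(2) refl] by blast
 show i: "integrable p (energy N)"
  by (rule integrable_bounded_prob[OF pp(1) em, of "real N / 2 * (real N * (real CARD('n))\<^sup>2)"])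
   (use energy_bounded[where 'n = 'n and N = N] in \<open>simp only: abs_of_nonneg[OF energy_nonneg]\<close>)
 have e0: "(\<integral>w. energy N w \<partial>p) \<ge> 0" by (rule Bochner_Integration.integral_nonneg) (rule energy_nonneg)
 have "ennreal (\<integral>w. energy N w \<partial>p) = (\<integral>\<^sup>+ w. ennreal (energy N w) \<partial>p)"
  by (rule nn_integral_eq_integral[symmetric, OF i]) (simp add: energy_nonneg)
 also have "... \<le> (\<integral>\<^sup>+ w. action w \<partial>p)" by (intro nn_integral_mono energy_le_action N)
 finally have "enn2ereal (ennreal (\<integral>w. energy N w \<partial>p)) \<le> mean_action p"
  unfolding mean_action_def by (simp add: less_eq_ennreal.rep_eq)
 then have "ereal (\<integral>w. energy N w \<partial>p) \<le> mean_action p" using e0 by (simp only: enn2ereal_ennreal)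
 then have "ereal (\<integral>w. energy N w \<partial>p) \<le> ereal a" using a by (rule order_trans)
 then show "(\<integral>w. energy N w \<partial>p) \<le> a" by simp
qed

section \<open>Conditioned and pinned noise\<close>

lemma integral_uniform_measure:
 fixes f :: "'a => real"
 assumes M: "prob_space M" and A: "A \<in> sets M" "measure M A > 0" and f: "f \<in> borel_measurable M"
 shows "(\<integral>x. f x \<partial>uniform_measure M A) = (\<integral>x. indicator A x / measure M A * f x \<partial>M)"
proof -
 interpret prob_space M by fact
 have "indicator A x / emeasure M A = ennreal (indicator A x / measure M A)" for x
  using A(2) by (simp add: emeasure_eq_measure indicator_def divide_ennreal[symmetric])
 then have "uniform_measure M A = density M (\<lambda>x. ennreal (indicator A x / measure M A))"
  by (simp add: uniform_measure_def)
 moreover have "(\<integral>x. f x \<partial>density M (\<lambda>x. ennreal (indicator A x / measure M A))) = (\<integral>x. (indicator A x / measure M A) *\<^sub>R f x \<partial>M)"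
  by (rule integral_density) (use f A in auto)
 ultimately show ?thesis by simp
qed

definition pinned_noise :: "real => 'n::finite torus cpath measure => real => 'n torus cpath measure" where
 "pinned_noise \<theta> R1 \<nu> = distr (uniform_measure (noise_law R1 \<nu>) small_paths) borel (pin \<theta>)"

context
 fixes R1 :: "'n::finite torus cpath measure" and \<nu> :: real
 assumes R1: "is_reversible_brownian 1 R1" and \<nu>: "0 < \<nu>" "\<nu> \<le> 1"
  and likely: "measure (noise_law R1 \<nu>) small_paths \<ge> 1 / 2"
begin

lemma W_space: "prob_space (noise_law R1 \<nu>)" "sets (noise_law R1 \<nu>) = sets borel"
 using noise_law_space[OF R1, of \<nu>] \<nu> by auto

lemma uniform_noise_space:
 "prob_space (uniform_measure (noise_law R1 \<nu>) small_paths)" "sets (uniform_measure (noise_law R1 \<nu>) small_paths) = sets borel"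
proof -
 interpret prob_space "noise_law R1 \<nu>" by (rule W_space)
 show "prob_space (uniform_measure (noise_law R1 \<nu>) small_paths)"
  using likely by (intro prob_space_uniform_measure) (auto simp: emeasure_eq_measure)
 show "sets (uniform_measure (noise_law R1 \<nu>) small_paths) = sets borel" using W_space(2) by simp
qed

lemma pin_measurable_uniform: "pin \<theta> \<in> borel_measurable (uniform_measure (noise_law R1 \<nu>) small_paths)"
 using measurable_pin measurable_cong_sets[OF uniform_noise_space(2) refl] by blast

lemma pinned_noise_space: "pinned_noise \<theta> R1 \<nu> \<in> space (prob_algebra borel)"
 using prob_space.prob_space_distr[OF uniform_noise_space(1) pin_measurable_uniform]
 by (simp add: prob_algebra_borel_iff pinned_noise_def)

lemma integral_pinned_noise:
 fixes f :: "'n torus cpath => real"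
 assumes f: "f \<in> borel_measurable borel"
 shows "(\<integral>z. f z \<partial>pinned_noise \<theta> R1 \<nu>)
  = (\<integral>z. indicator small_paths z / measure (noise_law R1 \<nu>) small_paths * f (pin \<theta> z) \<partial>noise_law R1 \<nu>)"
proof -
 have "(\<integral>z. f z \<partial>pinned_noise \<theta> R1 \<nu>) = (\<integral>z. f (pin \<theta> z) \<partial>uniform_measure (noise_law R1 \<nu>) small_paths)"
  unfolding pinned_noise_def by (rule integral_distr[OF pin_measurable_uniform f])
 also have "... = (\<integral>z. indicator small_paths z / measure (noise_law R1 \<nu>) small_paths * f (pin \<theta> z) \<partial>noise_law R1 \<nu>)"
 proof (rule integral_uniform_measure[OF W_space(1)])
  show "(\<lambda>z. f (pin \<theta> z)) \<in> borel_measurable (noise_law R1 \<nu>)"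
   using measurable_compose[OF measurable_pin f] measurable_cong_sets[OF W_space(2) refl] by blast
 qed (use small_paths_sets W_space(2) likely in auto)
 finally show ?thesis .
qed

text \<open>Conditioning on an event of probability at least 1/2 at most doubles probabilities, and
  pinning at most doubles the distance to the zero path.\<close>

lemma pinned_noise_tail:
 assumes \<theta>: "\<bar>\<theta>\<bar> \<le> 1"
 shows "measure (pinned_noise \<theta> R1 \<nu>) {z. dist z zero_path \<ge> e} \<le> 2 * measure (noise_law R1 \<nu>) {z. dist z zero_path \<ge> e / 2}"
proof -
 interpret prob_space "noise_law R1 \<nu>" by (rule W_space)
 let ?c = "measure (noise_law R1 \<nu>) small_paths"
 let ?D = "\<lambda>e. {z :: 'n torus cpath. dist z zero_path \<ge> e}"
 have D: "?D e \<in> sets borel" for e by (intro borel_closed closed_Collect_le continuous_intros)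
 then have Dm: "(indicator (?D e) :: _ => real) \<in> borel_measurable borel" for e by simp
 have iD: "integrable (noise_law R1 \<nu>) (indicator (?D (e / 2)) :: _ => real)"
  using D[of "e / 2"] W_space(2) by (intro integrable_real_indicator) (auto simp: emeasure_eq_measure)
 have pD: "(\<lambda>z. indicator small_paths z / ?c * indicator (?D e) (pin \<theta> z) :: real) \<in> borel_measurable (noise_law R1 \<nu>)"
 proof -
  have "(\<lambda>z. indicator small_paths z / ?c * indicator (?D e) (pin \<theta> z) :: real) \<in> borel_measurable borel"
   by (intro borel_measurable_times borel_measurable_divide measurable_compose[OF measurable_pin Dm]
     borel_measurable_indicator small_paths_sets borel_measurable_const)
  then show ?thesis using measurable_cong_sets[OF W_space(2) refl] by blast
 qed
 have le: "indicator small_paths z / ?c * indicator (?D e) (pin \<theta> z) \<le> 2 * (indicator (?D (e / 2)) z :: real)" for z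
 proof (cases "z \<in> small_paths \<and> e \<le> dist (pin \<theta> z) zero_path")
  case True
  then have "e / 2 \<le> dist z zero_path" using dist_pin[OF \<theta>, of z] by simp
  moreover have "1 / ?c \<le> 2" using likely by (simp add: divide_le_eq)
  ultimately show ?thesis using True by simp
 qed (auto simp: indicator_def)
 have "measure (pinned_noise \<theta> R1 \<nu>) (?D e) = (\<integral>z. indicator (?D e) z \<partial>pinned_noise \<theta> R1 \<nu>)"
  using D by (simp add: pinned_noise_def)
 also have "... = (\<integral>z. indicator small_paths z / ?c * indicator (?D e) (pin \<theta> z) \<partial>noise_law R1 \<nu>)"
  by (rule integral_pinned_noise[OF Dm])
 also have "... \<le> (\<integral>z. 2 * indicator (?D (e / 2)) z \<partial>noise_law R1 \<nu>)"
 proof (rule integral_mono[OF _ _ le])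
  show "integrable (noise_law R1 \<nu>) (\<lambda>z. indicator small_paths z / ?c * indicator (?D e) (pin \<theta> z) :: real)"
   by (rule integrable_bounded_prob[OF prob_space_axioms pD, of 2], rule order_trans[OF _ order_trans[OF le]])
    (use likely in \<open>auto simp: indicator_def\<close>)
 qed (use iD in simp)
 also have "... = 2 * measure (noise_law R1 \<nu>) (?D (e / 2))"
  using D[of "e / 2"] W_space(2) by simp
 finally show ?thesis .
qed

lemma pinned_noise_endpoints: "AE z in pinned_noise 1 R1 \<nu>. path_at z 0 = 0 \<and> path_at z 1 = 0"
proof -
 have m: "{z :: 'n torus cpath. path_at z 0 = 0 \<and> path_at z 1 = 0} \<in> sets borel"
  by (intro borel_closed closed_Collect_conj closed_Collect_eq continuous_on_eval continuous_on_const) auto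
 have m0: "{z :: 'n torus cpath. path_at z 0 = 0} \<in> sets borel"
  by (intro borel_closed closed_Collect_eq continuous_on_eval continuous_on_const) auto
 have nm: "noise \<nu> \<in> borel_measurable R1" using noise_meas_R1[OF R1] \<nu> by simp
 have "AE z in noise_law R1 \<nu>. path_at z 0 = 0"
  unfolding noise_law_def[OF R1] using m0 \<nu> by (subst AE_distr_iff[OF nm]) (simp_all add: path_at_noise)
 then have "AE z in uniform_measure (noise_law R1 \<nu>) small_paths. path_at z 0 = 0"
  using small_paths_sets W_space(2) by (intro AE_uniform_measureI) auto
 then have "AE z in uniform_measure (noise_law R1 \<nu>) small_paths. path_at (pin 1 z) 0 = 0 \<and> path_at (pin 1 z) 1 = 0"
  by eventually_elim (simp add: path_at_pin)
 then show ?thesis unfolding pinned_noise_def using m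
  by (subst AE_distr_iff[OF pin_measurable_uniform]) simp_all
qed

end

section \<open>Entropy of the perturbed flow\<close>

lemma measurable_pinned_walk:
 "pinned_walk \<theta> N w \<in> measurable (PiM {..N} (\<lambda>_. borel)) (PiM {..N} (\<lambda>_. borel :: 'n::finite torus measure))"
 unfolding pinned_walk_def
proof (rule measurable_restrict)
 fix i assume "i \<in> {..N}"
 then have 1: "(\<lambda>y. y i) \<in> borel_measurable (PiM {..N} (\<lambda>_. borel :: 'n torus measure))" by (rule measurable_component_singleton)
 have [measurable]: "(\<lambda>y. y N) \<in> borel_measurable (PiM {..N} (\<lambda>_. borel :: 'n torus measure))" by (intro measurable_component_singleton) simp
 have 2: "(\<lambda>y. proj ((\<theta> * (real i / real N)) *\<^sub>R tlog (y N))) \<in> borel_measurable (PiM {..N} (\<lambda>_. borel :: 'n torus measure))" by measurable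
 show "(\<lambda>y. path_at w (real i / real N) + (y i - proj ((\<theta> * (real i / real N)) *\<^sub>R tlog (y N)))) \<in> borel_measurable (PiM {..N} (\<lambda>_. borel))"
  by (intro borel_measurable_add_torus borel_measurable_diff_torus 1 2) simp
qed

lemma small_samp_indicator_measurable:
 "(indicator {y. small_samp N y} :: _ => real) \<in> borel_measurable (PiM {..N} (\<lambda>_. borel :: 'n::finite torus measure))"
 using small_samp_sets[of N, where 'n = 'n] by (simp add: borel_measurable_indicator_iff Int_def conj_commute)

lemma power_le_exp:
 assumes "x \<ge> 0" "N > 0"
 shows "(1 + x / real N) ^ N \<le> exp x"
proof -
 have "(1 + x / real N) ^ N \<le> exp (x / N) ^ N" using assms by (intro power_mono exp_ge_add_one_self) (simp add: add_nonneg_nonneg)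
 also have "... = exp x" using assms(2) by (simp add: exp_of_nat_mult[symmetric])
 finally show ?thesis .
qed

text \<open>The estimate for one fixed path w. The number G bounds the logarithm of the saved
  exponent times the bridge integral, both of which depend on the grid through the lift; the
  wrapping factor (1 + 8 (\<nu> / N) l)^N is bounded independently of N.\<close>

lemma pinned_noise_pointwise:
 fixes R1 :: "'n::finite torus cpath measure" and F :: "(nat => 'n torus) => real"
 defines "l \<equiv> enn2real (lat_const TYPE('n))"
 assumes R1: "is_reversible_brownian 1 R1" and \<nu>: "0 < \<nu>" "\<nu> \<le> 1" and \<theta>: "\<theta> * \<theta> = \<theta>"
  and likely: "measure (noise_law R1 \<nu>) (small_grid m) \<ge> 1 / 2" and N: "N = 2 ^ m"
  and F: "F \<in> borel_measurable (PiM {..N} (\<lambda>_. borel))" "\<And>x. \<bar>F x\<bar> \<le> K"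
  and G: "exp (- \<theta> * (norm (\<Sum>j\<in>{1..N}. path_incr N w j))\<^sup>2 / (2 * \<nu>)) *
   (\<integral>\<xi>. exp (F (bridge_walk \<theta> N (path_at w 0) (\<Sum>j\<in>{1..N}. path_incr N w j) \<xi>)) \<partial>gaussN (\<nu> / N) N) \<le> exp G"
 shows "(\<integral>z. indicator (small_grid m) z / measure (noise_law R1 \<nu>) (small_grid m) * F (samp N (add_path w (pin \<theta> z))) \<partial>noise_law R1 \<nu>)
  \<le> energy N w / \<nu> + (8 * \<nu> * l + ln 2) + G"
proof -
 let ?G = "gaussN (\<nu> / N) N :: (nat => real ^ 'n) measure" and ?M = "PiM {..N} (\<lambda>_. borel :: 'n torus measure)"
 let ?W = "noise_law R1 \<nu>"
 let ?A = "\<Sum>j\<in>{1..N}. path_incr N w j"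
 have N0: "N > 0" unfolding N by simp
 have v: "\<nu> / N > 0" using \<nu> N0 by simp
 interpret G: prob_space ?G by (rule prob_space_gaussN[OF v])
 have W: "prob_space ?W" "sets ?W = sets borel" using noise_law_space[OF R1, of \<nu>] \<nu> by auto
 have sW: "samp N \<in> measurable ?W ?M" using measurable_samp[OF N0] measurable_cong_sets[OF W(2) refl] by blast
 define c where "c = measure ?W (small_grid m)"
 define q where "q y = indicator {y. small_samp N y} y / c * F (pinned_walk \<theta> N w y)" for y
 have qm: "q \<in> borel_measurable ?M"
  unfolding q_def by (intro borel_measurable_times borel_measurable_divide small_samp_indicator_measurable borel_measurable_const
    measurable_compose[OF measurable_pinned_walk F(1)])
 have eq: "(\<integral>z. f (samp N z) \<partial>?W) = (\<integral>\<xi>. f (walk N 0 \<xi>) \<partial>?G)" if f: "f \<in> borel_measurable ?M" for f :: "_ => real"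
  unfolding integral_distr[OF sW f, symmetric] integral_distr[OF measurable_walk0[OF R1] f, symmetric]
   noise_law_samp[OF R1 \<nu> N0] ..
 have c: "c = measure ?G {\<xi> \<in> space ?G. small_walk N \<xi>}"
 proof -
  have "c = (\<integral>z. indicator {y. small_samp N y} (samp N z) \<partial>?W)"
  proof -
   have e: "indicator {y. small_samp N y} (samp N z) = (indicator (small_grid m) z :: real)" for z
    by (simp add: small_grid_def N indicator_def)
   have "(\<integral>z. indicator {y. small_samp N y} (samp N z) \<partial>?W) = (\<integral>z. (indicator (small_grid m) z :: real) \<partial>?W)"
    by (intro Bochner_Integration.integral_cong refl) (rule e)
   then show ?thesis using small_grid_sets[of m] W(2) sets_eq_imp_space_eq[OF W(2)] by (simp add: c_def)
  qed
  also have "... = (\<integral>\<xi>. indicator {y. small_samp N y} (walk N 0 \<xi>) \<partial>?G)"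
   by (rule eq[OF small_samp_indicator_measurable])
  also have "... = (\<integral>\<xi>. indicator {\<xi> \<in> space ?G. small_walk N \<xi>} \<xi> \<partial>?G)"
   by (intro Bochner_Integration.integral_cong refl) (simp add: small_walk_samp indicator_def)
  also have "... = measure ?G {\<xi> \<in> space ?G. small_walk N \<xi>}"
   using small_walk_sets[of N "\<nu> / N", where 'n = 'n] by simp
  finally show ?thesis .
 qed
 have c2: "c \<ge> 1 / 2" using likely by (simp add: c_def)
 then have c0: "c > 0" by linarith
 have "(\<integral>z. indicator (small_grid m) z / c * F (samp N (add_path w (pin \<theta> z))) \<partial>?W) = (\<integral>z. q (samp N z) \<partial>?W)"
  unfolding q_def samp_add_pin[OF N0] by (intro Bochner_Integration.integral_cong refl) (simp add: small_grid_def N indicator_def)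
 also have "... = (\<integral>\<xi>. q (walk N 0 \<xi>) \<partial>?G)" by (rule eq[OF qm])
 also have "... = (\<integral>\<xi>. indicator {\<xi>. small_walk N \<xi>} \<xi> / c * F (pinned_walk \<theta> N w (walk N 0 \<xi>)) \<partial>?G)"
  by (intro Bochner_Integration.integral_cong refl) (simp add: q_def small_walk_samp indicator_def)
 also have "... \<le> energy N w / \<nu> - \<theta> * (norm ?A)\<^sup>2 / (2 * \<nu>)
   + ln ((1 + 8 * (\<nu> / N) * l) ^ N / c * (\<integral>\<xi>. exp (F (bridge_walk \<theta> N (path_at w 0) ?A \<xi>)) \<partial>?G))"
  unfolding l_def by (rule conditioned_walk_jensen[OF \<nu> N0 \<theta> F c c0])
 also have "... \<le> energy N w / \<nu> + (8 * \<nu> * l + ln 2) + G"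
 proof -
  let ?I = "\<integral>\<xi>. exp (F (bridge_walk \<theta> N (path_at w 0) ?A \<xi>)) \<partial>?G"
  have I: "?I > 0"
   using integral_exp_bounded_pos(2)[OF G.prob_space_axioms measurable_compose[OF measurable_bridge_walk1 F(1)] F(2)]
   by (rule less_le_trans[OF exp_gt_zero])
  have l0: "l \<ge> 0" by (simp add: l_def)
  have "(1 + 8 * (\<nu> / N) * l) ^ N = (1 + (8 * \<nu> * l) / N) ^ N" by (simp add: mult_ac)
  also have "... \<le> exp (8 * \<nu> * l)" using l0 \<nu> N0 by (intro power_le_exp) auto
  finally have p: "(1 + 8 * (\<nu> / N) * l) ^ N \<le> exp (8 * \<nu> * l)" .
  have nn: "0 \<le> 8 * (\<nu> / N) * l" using l0 v by (intro mult_nonneg_nonneg) auto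
  have "0 < 1 + 8 * (\<nu> / N) * l" by (rule add_pos_nonneg[OF zero_less_one nn])
  then have p0: "(1 + 8 * (\<nu> / N) * l) ^ N > 0" by (rule zero_less_power)
  have "(1 + 8 * (\<nu> / N) * l) ^ N / c \<le> exp (8 * \<nu> * l) / (1 / 2)"
   using p c2 by (intro frac_le) auto
  then have "ln ((1 + 8 * (\<nu> / N) * l) ^ N / c) \<le> ln (exp (8 * \<nu> * l) * 2)"
   using p0 c0 by (subst ln_le_cancel_iff) auto
  then have A: "ln ((1 + 8 * (\<nu> / N) * l) ^ N / c) \<le> 8 * \<nu> * l + ln 2" by (simp add: ln_mult)
  have "ln (exp (- \<theta> * (norm ?A)\<^sup>2 / (2 * \<nu>)) * ?I) \<le> ln (exp G)"
   using G I by (subst ln_le_cancel_iff) auto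
  then have B: "- \<theta> * (norm ?A)\<^sup>2 / (2 * \<nu>) + ln ?I \<le> G" using I by (simp add: ln_mult)
  have "ln ((1 + 8 * (\<nu> / N) * l) ^ N / c * ?I) = ln ((1 + 8 * (\<nu> / N) * l) ^ N / c) + ln ?I"
   by (rule ln_mult_pos[OF divide_pos_pos[OF p0 c0] I])
  then show ?thesis using A B by simp
 qed
 finally show ?thesis unfolding c_def .
qed

text \<open>A test function on the grid of level n is examined on all finer grids of level m, with
  the noise conditioned on \<open>small_grid m\<close>; then m tends to infinity for the fixed test
  function. The hypothesis asks, for every test function, for a bounded potential of the endpoints
  whose mean is controlled by H and the partition function under R; the two parts differ in how it
  is met.\<close>

lemma perturb_entropy_le:
 fixes R1 R p :: "'n::finite torus cpath measure"
 defines "l \<equiv> enn2real (lat_const TYPE('n))"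
 assumes R1: "is_reversible_brownian 1 R1" and R: "is_reversible_brownian \<nu> R" and \<nu>: "0 < \<nu>" "\<nu> \<le> 1" and \<theta>: "\<theta> * \<theta> = \<theta>"
  and p: "p \<in> space (prob_algebra borel)" and a: "mean_action p \<le> ereal a"
  and likely: "measure (noise_law R1 \<nu>) small_paths \<ge> 1 / 2"
  and G: "\<And>N F K. N > 0 ==> F \<in> borel_measurable (PiM {..N} (\<lambda>_. borel)) ==> (\<And>x. \<bar>F x\<bar> \<le> K) ==>
   \<exists>G L. G \<in> borel_measurable borel \<and> (\<forall>x. \<bar>G x\<bar> \<le> L) \<and>
    (\<forall>w. exp (- \<theta> * (norm (\<Sum>j\<in>{1..N}. path_incr N w j))\<^sup>2 / (2 * \<nu>)) *
     (\<integral>\<xi>. exp (F (bridge_walk \<theta> N (path_at w 0) (\<Sum>j\<in>{1..N}. path_incr N w j) \<xi>)) \<partial>gaussN (\<nu> / N) N)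
      \<le> exp (G (path_at w 0, path_at w 1))) \<and>
    (\<integral>w. G (path_at w 0, path_at w 1) \<partial>p) \<le> H + ln (\<integral>w. exp (F (samp N w)) \<partial>R)"
 shows "rel_entropy (perturb p (pinned_noise \<theta> R1 \<nu>)) R \<le> ereal (a / \<nu> + (8 * \<nu> * l + ln 2) + H)"
proof (rule rel_entropy_le_cyl)
 let ?W = "noise_law R1 \<nu>" and ?Q = "pinned_noise \<theta> R1 \<nu>"
 note Q = pinned_noise_space[OF R1 \<nu> likely, of \<theta>]
 have pp: "prob_space p" "sets p = sets borel" using p by (auto simp: prob_algebra_borel_iff)
 have W: "prob_space ?W" "sets ?W = sets borel" using noise_law_space[OF R1, of \<nu>] \<nu> by auto
 show "prob_space (perturb p ?Q)" "sets (perturb p ?Q) = sets borel"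
  using perturb_prob[OF p Q] by (auto simp: prob_algebra_borel_iff)
 show "prob_space R" "sets R = sets borel" using R by (auto simp: is_reversible_brownian_def prob_algebra_borel_iff)
 fix n :: nat and g :: "(nat => 'n torus) => real" and K
 assume g: "g \<in> borel_measurable (PiM {..2 ^ n} (\<lambda>_. borel))" and gK: "\<And>x. \<bar>g x\<bar> \<le> K"
 interpret p: prob_space p by (rule pp)
 interpret W: prob_space ?W by (rule W)
 interpret pW: pair_prob_space p ?W ..
 define T where "T x = g (samp (2 ^ n) (add_path (fst x) (pin \<theta> (snd x))))" for x
 have gs: "(\<lambda>\<eta>. g (samp (2 ^ n) \<eta>)) \<in> borel_measurable borel" by (rule measurable_compose[OF measurable_samp g]) simp
 have spW: "sets (p \<Otimes>\<^sub>M ?W) = sets (borel \<Otimes>\<^sub>M borel)" by (intro sets_pair_measure_cong pp W)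
 have Tm: "T \<in> borel_measurable (p \<Otimes>\<^sub>M ?W)"
 proof -
  have "(\<lambda>x. (fst x, pin \<theta> (snd x))) \<in> measurable (borel \<Otimes>\<^sub>M borel) (borel \<Otimes>\<^sub>M borel :: ('n torus cpath \<times> 'n torus cpath) measure)"
   by (intro measurable_Pair measurable_fst measurable_compose[OF measurable_snd measurable_pin])
  from measurable_compose[OF this measurable_compose[OF measurable_add_path gs]]
  have "T \<in> borel_measurable (borel \<Otimes>\<^sub>M borel)" by (simp add: T_def[abs_def] split_beta')
  then show ?thesis using measurable_cong_sets[OF spW refl] by blast
 qed
 have TK: "\<bar>T x\<bar> \<le> K" for x by (simp add: T_def gK)
 have K0: "K \<ge> 0" using gK[of undefined] by linarith
 \<comment> \<open>The indicator is kept unnormalised: numerator and probability of the event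
   converge separately.\<close>
 define \<Psi> where "\<Psi> S x = (indicator S (snd x) :: real) * T x" for S x
 have \<Psi>m: "\<Psi> S \<in> borel_measurable (p \<Otimes>\<^sub>M ?W)" if "S \<in> sets borel" for S
  unfolding \<Psi>_def by (intro borel_measurable_times Tm measurable_compose[OF measurable_snd]) (use that W(2) in simp)
 have \<Psi>K: "\<bar>\<Psi> S x\<bar> \<le> K" for S x using TK[of x] K0 by (simp add: \<Psi>_def indicator_def)
 have \<Psi>i: "integrable (p \<Otimes>\<^sub>M ?W) (\<Psi> S)" if "S \<in> sets borel" for S
  by (rule integrable_bounded_prob[OF pW.prob_space_axioms \<Psi>m[OF that] \<Psi>K])
 have iter: "(\<integral>x. \<Psi> S x \<partial>(p \<Otimes>\<^sub>M ?W)) / c = (\<integral>w. (\<integral>z. indicator S z / c * g (samp (2 ^ n) (add_path w (pin \<theta> z))) \<partial>?W) \<partial>p)"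
  if "S \<in> sets borel" for S c
 proof -
  have "(\<integral>x. \<Psi> S x \<partial>(p \<Otimes>\<^sub>M ?W)) / c = (\<integral>x. \<Psi> S x / c \<partial>(p \<Otimes>\<^sub>M ?W))" by simp
  also have "... = (\<integral>w. (\<integral>z. \<Psi> S (w, z) / c \<partial>?W) \<partial>p)"
   by (rule pW.integral_fst'[symmetric]) (use \<Psi>i[OF that] in simp)
  finally show ?thesis by (simp add: \<Psi>_def T_def)
 qed
 define c where "c m = measure ?W (small_grid m)" for m
 have grid: "range (small_grid :: nat => 'n torus cpath set) \<subseteq> sets ?W" using small_grid_sets W(2) by auto
 have cge: "c m \<ge> 1 / 2" for m
 proof -
  have "measure ?W small_paths \<le> c m" unfolding c_def
   using grid by (intro W.finite_measure_mono) (auto simp: small_paths_def)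
  then show ?thesis using likely by linarith
 qed
 have clim: "c \<longlonglongrightarrow> measure ?W small_paths"
  unfolding c_def small_paths_def using small_grid_antimono by (intro W.finite_Lim_measure_decseq grid) (auto simp: decseq_def)
 let ?B = "a / \<nu> + (8 * \<nu> * l + ln 2) + (H + ln (\<integral>w. exp (g (samp (2 ^ n) w)) \<partial>R))"
 have step: "(\<integral>x. \<Psi> (small_grid m) x \<partial>(p \<Otimes>\<^sub>M ?W)) / c m \<le> ?B" if nm: "n \<le> m" for m
 proof -
  let ?N = "2 ^ m :: nat"
  \<comment> \<open>The test function is read on the finer grid, where the conditioning event is
    visible.\<close>
  define F where "F y = g (coarsen (2 ^ n) (2 ^ (m - n)) y)" for y
  have Fm: "F \<in> borel_measurable (PiM {..?N} (\<lambda>_. borel))"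
   unfolding F_def by (rule measurable_compose[OF measurable_coarsen_refine[OF nm] g])
  have FK: "\<bar>F x\<bar> \<le> K" for x by (simp add: F_def gK)
  have Fs: "g (samp (2 ^ n) \<eta>) = F (samp ?N \<eta>)" for \<eta> by (simp only: F_def samp_refine[OF nm])
  have "0 < ?N" by simp
  from G[OF this Fm FK] obtain G L where G': "G \<in> borel_measurable borel" "\<And>x. \<bar>G x\<bar> \<le> L"
   "\<And>w. exp (- \<theta> * (norm (\<Sum>j\<in>{1..?N}. path_incr ?N w j))\<^sup>2 / (2 * \<nu>)) *
     (\<integral>\<xi>. exp (F (bridge_walk \<theta> ?N (path_at w 0) (\<Sum>j\<in>{1..?N}. path_incr ?N w j) \<xi>)) \<partial>gaussN (\<nu> / ?N) ?N)
      \<le> exp (G (path_at w 0, path_at w 1))"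
   "(\<integral>w. G (path_at w 0, path_at w 1) \<partial>p) \<le> H + ln (\<integral>w. exp (F (samp ?N w)) \<partial>R)"
   by blast
  let ?e = "\<lambda>w :: 'n torus cpath. (path_at w 0, path_at w 1)"
  have "?e \<in> borel_measurable (borel :: 'n torus cpath measure)"
   by (intro borel_measurable_continuous_onI continuous_on_Pair continuous_on_eval) auto
  then have "?e \<in> borel_measurable p" using measurable_cong_sets[OF pp(2) refl] by blast
  then have Gi: "integrable p (\<lambda>w. G (?e w))"
   by (intro integrable_bounded_prob[OF pp(1), where K = L] measurable_compose[OF _ G'(1)] G'(2))
  note en = integral_energy_le[OF p \<open>0 < ?N\<close> a]
  have "(\<integral>x. \<Psi> (small_grid m) x \<partial>(p \<Otimes>\<^sub>M ?W)) / c m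
   = (\<integral>w. (\<integral>z. indicator (small_grid m) z / c m * F (samp ?N (add_path w (pin \<theta> z))) \<partial>?W) \<partial>p)"
   unfolding iter[OF small_grid_sets] Fs ..
  also have "... \<le> (\<integral>w. energy ?N w / \<nu> + (8 * \<nu> * l + ln 2) + G (?e w) \<partial>p)"
  proof (rule integral_mono)
   have "integrable p (\<lambda>w. \<integral>z. \<Psi> (small_grid m) (w, z) / c m \<partial>?W)"
    by (rule pW.integrable_fst') (use \<Psi>i[OF small_grid_sets, of m] in simp)
   then show "integrable p (\<lambda>w. \<integral>z. indicator (small_grid m) z / c m * F (samp ?N (add_path w (pin \<theta> z))) \<partial>?W)"
    by (simp add: \<Psi>_def T_def Fs)
   show "integrable p (\<lambda>w. energy ?N w / \<nu> + (8 * \<nu> * l + ln 2) + G (?e w))" using en(1) Gi by simp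
   show "(\<integral>z. indicator (small_grid m) z / c m * F (samp ?N (add_path w (pin \<theta> z))) \<partial>?W)
    \<le> energy ?N w / \<nu> + (8 * \<nu> * l + ln 2) + G (?e w)" for w
    unfolding c_def l_def by (rule pinned_noise_pointwise[OF R1 \<nu> \<theta> _ refl Fm FK G'(3)]) (use cge[of m] in \<open>simp add: c_def\<close>)
  qed
  also have "... = (\<integral>w. energy ?N w \<partial>p) / \<nu> + (8 * \<nu> * l + ln 2) + (\<integral>w. G (?e w) \<partial>p)"
   using en(1) Gi by (simp add: p.prob_space)
  also have "... \<le> a / \<nu> + (8 * \<nu> * l + ln 2) + (H + ln (\<integral>w. exp (F (samp ?N w)) \<partial>R))"
   using en(2) \<nu>(1) G'(4) by (intro add_mono divide_right_mono) auto
  finally show ?thesis unfolding Fs .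
 qed
 have c0: "measure ?W small_paths \<noteq> 0" using likely by auto
 have "(\<lambda>m. \<integral>x. \<Psi> (small_grid m) x \<partial>(p \<Otimes>\<^sub>M ?W)) \<longlonglongrightarrow> (\<integral>x. \<Psi> small_paths x \<partial>(p \<Otimes>\<^sub>M ?W))"
 proof (rule integral_dominated_convergence[where w = "\<lambda>_. K"])
  show "AE x in p \<Otimes>\<^sub>M ?W. (\<lambda>m. \<Psi> (small_grid m) x) \<longlonglongrightarrow> \<Psi> small_paths x"
  proof (rule AE_I2)
   fix x :: "'n torus cpath \<times> 'n torus cpath"
   have "decseq (small_grid :: nat => 'n torus cpath set)" using small_grid_antimono by (auto simp: decseq_def)
   from LIMSEQ_indicator_decseq[OF this] show "(\<lambda>m. \<Psi> (small_grid m) x) \<longlonglongrightarrow> \<Psi> small_paths x"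
    unfolding \<Psi>_def small_paths_def by (intro tendsto_intros)
  qed
 qed (use \<Psi>m[OF small_paths_sets] \<Psi>m[OF small_grid_sets] \<Psi>K in auto)
 then have "(\<lambda>m. (\<integral>x. \<Psi> (small_grid m) x \<partial>(p \<Otimes>\<^sub>M ?W)) / c m) \<longlonglongrightarrow> (\<integral>x. \<Psi> small_paths x \<partial>(p \<Otimes>\<^sub>M ?W)) / measure ?W small_paths"
  by (intro tendsto_divide clim c0)
 then have "(\<integral>x. \<Psi> small_paths x \<partial>(p \<Otimes>\<^sub>M ?W)) / measure ?W small_paths \<le> ?B"
  by (rule LIMSEQ_le_const2) (use step in blast)
 moreover have "(\<integral>\<eta>. g (samp (2 ^ n) \<eta>) \<partial>perturb p ?Q) = (\<integral>x. \<Psi> small_paths x \<partial>(p \<Otimes>\<^sub>M ?W)) / measure ?W small_paths"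
  unfolding iter[OF small_paths_sets] integral_perturb[OF p Q gs gK]
  by (intro Bochner_Integration.integral_cong refl integral_pinned_noise[OF R1 \<nu> likely] integral_add_path_measurable(2)[OF p Q gs])
 ultimately show "(\<integral>\<eta>. g (samp (2 ^ n) \<eta>) \<partial>perturb p ?Q)
  \<le> ln (\<integral>w. exp (g (samp (2 ^ n) w)) \<partial>R) + (a / \<nu> + (8 * \<nu> * l + ln 2) + H)"
  by simp
qed

section \<open>Potentials of the endpoints\<close>

lemma measurable_walk_pair:
 "(\<lambda>(x, \<xi>). walk N x \<xi>) \<in> measurable (borel \<Otimes>\<^sub>M gaussN v N) (PiM {..N} (\<lambda>_. borel :: 'n::finite torus measure))"
 unfolding walk_def split_beta'
proof (rule measurable_restrict)
 fix i assume "i \<in> {..N}"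
 then have [measurable]: "(\<lambda>\<xi>. \<Sum>j\<in>{1..i}. \<xi> j) \<in> borel_measurable (gaussN v N :: (nat => real ^ 'n) measure)"
  by (intro measurable_partial_sum) simp
 have 1: "fst \<in> borel_measurable (borel \<Otimes>\<^sub>M gaussN v N :: ('n torus \<times> (nat => real ^ 'n)) measure)" by (rule measurable_fst)
 have 2: "(\<lambda>z. proj (\<Sum>j\<in>{1..i}. snd z j)) \<in> borel_measurable (borel \<Otimes>\<^sub>M gaussN v N :: ('n torus \<times> (nat => real ^ 'n)) measure)" by measurable
 show "(\<lambda>z. fst z + proj (\<Sum>j\<in>{1..i}. snd z j)) \<in> borel_measurable (borel \<Otimes>\<^sub>M gaussN v N :: ('n torus \<times> (nat => real ^ 'n)) measure)"
  by (rule borel_measurable_add_torus[OF 1 2])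
qed

lemma measurable_walk1: "walk N x \<in> measurable (gaussN v N) (PiM {..N} (\<lambda>_. borel :: 'n::finite torus measure))"
 using measurable_compose[OF measurable_Pair1' measurable_walk_pair, of x] by simp

lemma bridge_walk_0: "bridge_walk 0 N x y \<xi> = walk N x \<xi>"
 by (simp add: bridge_walk_def walk_def)

text \<open>Every increment takes an equal share of the missing displacement, the form that
  \<open>gaussian_bridge_dominated\<close> handles.\<close>

lemma bridge_walk_1:
 assumes N: "N > 0"
 shows "bridge_walk 1 N x y \<xi> = walk N x (\<lambda>j\<in>{1..N}. \<xi> j + (1 / real N) *\<^sub>R (y - (\<Sum>j\<in>{1..N}. \<xi> j)))"
 unfolding bridge_walk_def walk_def
proof (rule restrict_ext)
 fix i assume i: "i \<in> {..N}"
 let ?S = "\<Sum>j\<in>{1..N}. \<xi> j"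
 have "(\<Sum>j\<in>{1..i}. (\<lambda>j\<in>{1..N}. \<xi> j + (1 / real N) *\<^sub>R (y - ?S)) j) = (\<Sum>j\<in>{1..i}. \<xi> j + (1 / real N) *\<^sub>R (y - ?S))"
  using i by (intro sum.cong) auto
 also have "... = (\<Sum>j\<in>{1..i}. \<xi> j) + real i *\<^sub>R (1 / real N) *\<^sub>R (y - ?S)"
  by (simp only: sum.distrib sum_constant_scaleR card_atLeastAtMost) simp
 finally show "x + proj ((1 * (real i / real N)) *\<^sub>R y + (\<Sum>j\<in>{1..i}. \<xi> j) - (1 * (real i / real N)) *\<^sub>R ?S)
  = x + proj (\<Sum>j\<in>{1..i}. (\<lambda>j\<in>{1..N}. \<xi> j + (1 / real N) *\<^sub>R (y - ?S)) j)"
  by (simp add: scaleR_diff_right add.commute add_diff_eq)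
qed

context
 fixes F :: "(nat => 'n::finite torus) => real" and N :: nat and K \<nu> :: real and R :: "'n torus cpath measure"
 assumes R: "is_reversible_brownian \<nu> R" and \<nu>: "\<nu> > 0" and N: "N > 0"
  and F: "F \<in> borel_measurable (PiM {..N} (\<lambda>_. borel))" "\<And>x. \<bar>F x\<bar> \<le> K"
begin

abbreviation "\<Gamma> \<equiv> gaussN (\<nu> / N) N :: (nat => real ^ 'n) measure"

lemma prob_\<Gamma>: "prob_space \<Gamma>"
 using \<nu> N by (intro prob_space_gaussN) simp

lemma expF: "(\<lambda>x. ennreal (exp (F x))) \<in> borel_measurable (PiM {..N} (\<lambda>_. borel))"
 using F(1) by measurable

lemma F_le: "F x \<le> K" and F_ge: "- K \<le> F x"
 using F(2)[of x] by linarith+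

lemma nn_integral_walk_partition:
 "(\<integral>\<^sup>+ x. \<integral>\<^sup>+ \<xi>. ennreal (exp (F (walk N x \<xi>))) \<partial>\<Gamma> \<partial>leb_torus) = ennreal (\<integral>w. exp (F (samp N w)) \<partial>R)"
proof -
 have pR: "prob_space R" "sets R = sets borel" using R by (auto simp: is_reversible_brownian_def prob_algebra_borel_iff)
 interpret G: prob_space \<Gamma> by (rule prob_\<Gamma>)
 interpret L: prob_space "leb_torus :: 'n torus measure" by (rule prob_space_leb_torus)
 interpret pair_sigma_finite "leb_torus :: 'n torus measure" \<Gamma> ..
 have "samp N \<in> measurable R (PiM {..N} (\<lambda>_. borel))" using measurable_samp[OF N] measurable_cong_sets[OF pR(2) refl] by blast
 then have sF: "(\<lambda>w. F (samp N w)) \<in> borel_measurable R" by (rule measurable_compose[OF _ F(1)])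
 have m: "(\<lambda>(x, \<xi>). ennreal (exp (F (walk N x \<xi>)))) \<in> borel_measurable (leb_torus \<Otimes>\<^sub>M \<Gamma>)"
 proof -
  have "(\<lambda>(x, \<xi>). ennreal (exp (F (walk N x \<xi>)))) \<in> borel_measurable (borel \<Otimes>\<^sub>M \<Gamma>)"
   using measurable_compose[OF measurable_walk_pair expF] by (simp add: split_beta')
  moreover have "sets (leb_torus \<Otimes>\<^sub>M \<Gamma>) = sets (borel \<Otimes>\<^sub>M \<Gamma>)" by (intro sets_pair_measure_cong) auto
  ultimately show ?thesis using measurable_cong_sets by blast
 qed
 have "(\<integral>\<^sup>+ x. \<integral>\<^sup>+ \<xi>. ennreal (exp (F (walk N x \<xi>))) \<partial>\<Gamma> \<partial>leb_torus)
  = (\<integral>\<^sup>+ \<xi>. \<integral>\<^sup>+ x. ennreal (exp (F (walk N x \<xi>))) \<partial>leb_torus \<partial>gaussN (\<nu> * 1 / N) N)"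
  using Fubini'[OF m] by simp
 also have "... = (\<integral>\<^sup>+ w. ennreal (exp (F (\<lambda>i\<in>{..N}. path_at w (1 * real i / real N)))) \<partial>R)"
  by (rule brownian_fd[OF R \<nu> zero_less_one order_refl N expF, symmetric])
 also have "... = (\<integral>\<^sup>+ w. ennreal (exp (F (samp N w))) \<partial>R)" by (simp add: samp_def)
 also have "... = ennreal (\<integral>w. exp (F (samp N w)) \<partial>R)"
  using integral_exp_bounded_pos(1)[OF pR(1) sF F(2)] by (intro nn_integral_eq_integral) auto
 finally show ?thesis .
qed

text \<open>G is the logarithm of the partition function of the walk started at x. As p starts from
  Lebesgue measure, like the reference process, Jensen's inequality bounds its mean with H =
  0.\<close>

lemma free_walk_potential:
 assumes p: "p \<in> space (prob_algebra borel)" and p0: "distr p borel (\<lambda>w. path_at w 0) = leb_torus"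
 shows "\<exists>G L. G \<in> borel_measurable borel \<and> (\<forall>x. \<bar>G x\<bar> \<le> L) \<and>
    (\<forall>w. exp (- 0 * (norm (\<Sum>j\<in>{1..N}. path_incr N w j))\<^sup>2 / (2 * \<nu>)) *
     (\<integral>\<xi>. exp (F (bridge_walk 0 N (path_at w 0) (\<Sum>j\<in>{1..N}. path_incr N w j) \<xi>)) \<partial>gaussN (\<nu> / N) N)
      \<le> exp (G (path_at w 0, path_at w 1))) \<and>
    (\<integral>w. G (path_at w 0, path_at w 1) \<partial>p) \<le> 0 + ln (\<integral>w. exp (F (samp N w)) \<partial>R)"
proof -
 interpret G: prob_space \<Gamma> by (rule prob_\<Gamma>)
 interpret L: prob_space "leb_torus :: 'n torus measure" by (rule prob_space_leb_torus)
 define I where "I x = (\<integral>\<xi>. exp (F (walk N x \<xi>)) \<partial>\<Gamma>)" for x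
 have wF: "(\<lambda>\<xi>. F (walk N x \<xi>)) \<in> borel_measurable \<Gamma>" for x by (rule measurable_compose[OF measurable_walk1 F(1)])
 have Ii: "integrable \<Gamma> (\<lambda>\<xi>. exp (F (walk N x \<xi>)))" and Ige: "exp (- K) \<le> I x" for x
  using integral_exp_bounded_pos[OF G.prob_space_axioms wF F(2)] by (auto simp: I_def)
 have Ile: "I x \<le> exp K" for x
 proof -
  have "I x \<le> (\<integral>\<xi>. exp K \<partial>\<Gamma>)" unfolding I_def by (rule integral_mono[OF Ii G.integrable_const]) (simp add: F_le)
  then show ?thesis by (simp only: lebesgue_integral_const G.prob_space scaleR_one)
 qed
 have I0: "I x > 0" for x using Ige[of x] by (rule less_le_trans[OF exp_gt_zero])
 have Im: "I \<in> borel_measurable borel"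
 proof -
  have "(\<lambda>(x, \<xi>). exp (F (walk N x \<xi>))) \<in> borel_measurable (borel \<Otimes>\<^sub>M \<Gamma>)"
   using measurable_compose[OF measurable_walk_pair measurable_compose[OF F(1) borel_measurable_exp]] by (simp add: split_beta' comp_def)
  then show ?thesis unfolding I_def[abs_def] by (rule G.borel_measurable_lebesgue_integral)
 qed
 have lnI: "(\<lambda>x. ln (I x)) \<in> borel_measurable borel" using Im by measurable
 have lnIK: "\<bar>ln (I x)\<bar> \<le> K" for x
 proof -
  have "ln (I x) \<le> ln (exp K)" using I0[of x] Ile[of x] by (subst ln_le_cancel_iff) auto
  moreover have "ln (exp (- K)) \<le> ln (I x)" using I0[of x] Ige[of x] by (subst ln_le_cancel_iff) auto
  ultimately show ?thesis by (simp add: abs_le_iff)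
 qed
 have ev: "(\<lambda>w. path_at w 0) \<in> borel_measurable p"
  using p borel_measurable_eval[of 0, where 'a = "'n torus"] by (auto simp: prob_algebra_borel_iff cong: measurable_cong_sets)
 have lnIi: "integrable leb_torus (\<lambda>x. ln (I x))"
  by (rule integrable_bounded_prob[OF L.prob_space_axioms _ lnIK]) (use lnI in \<open>simp cong: measurable_cong_sets\<close>)
 have I_int: "integrable leb_torus I"
  by (rule integrable_bounded_prob[OF L.prob_space_axioms, where K = "exp K"])
   (use Im Ile I0 in \<open>auto simp: abs_of_pos cong: measurable_cong_sets\<close>)
 let ?Z = "\<integral>x. I x \<partial>leb_torus"
 have Zge: "?Z \<ge> exp (- K)"
  using integral_mono[OF L.integrable_const I_int Ige] by (simp only: lebesgue_integral_const L.prob_space scaleR_one)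
 have Z: "?Z > 0" using Zge by (rule less_le_trans[OF exp_gt_zero])
 have "(\<integral>w. ln (I (path_at w 0)) \<partial>p) = (\<integral>x. ln (I x) \<partial>leb_torus)"
  unfolding p0[symmetric] by (rule integral_distr[symmetric, OF ev lnI])
 also have "... \<le> (\<integral>x. I x / ?Z - 1 + ln ?Z \<partial>leb_torus)"
 proof (rule integral_mono[OF lnIi])
  show "ln (I x) \<le> I x / ?Z - 1 + ln ?Z" for x
   using ln_le_minus_one[of "I x / ?Z"] I0[of x] Z by (simp add: ln_div)
 qed (use I_int in simp)
 also have "... = ln ?Z" using I_int Z L.prob_space by (simp add: space_leb_torus)
 also have "?Z = (\<integral>w. exp (F (samp N w)) \<partial>R)"
 proof -
  have "ennreal ?Z = (\<integral>\<^sup>+ x. ennreal (I x) \<partial>leb_torus)"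
   by (rule nn_integral_eq_integral[symmetric, OF I_int]) (simp add: less_imp_le[OF I0])
  also have "... = (\<integral>\<^sup>+ x. \<integral>\<^sup>+ \<xi>. ennreal (exp (F (walk N x \<xi>))) \<partial>\<Gamma> \<partial>leb_torus)"
   unfolding I_def by (rule nn_integral_cong, rule nn_integral_eq_integral[symmetric, OF Ii]) simp
  also have "... = ennreal (\<integral>w. exp (F (samp N w)) \<partial>R)" by (rule nn_integral_walk_partition)
  finally show ?thesis using Z by (subst (asm) ennreal_inj) (auto intro!: Bochner_Integration.integral_nonneg)
 qed
 finally have fin: "(\<integral>w. ln (I (path_at w 0)) \<partial>p) \<le> ln (\<integral>w. exp (F (samp N w)) \<partial>R)" .
 have fm: "(\<lambda>x :: 'n torus \<times> 'n torus. ln (I (fst x))) \<in> borel_measurable borel"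
  by (rule measurable_compose[OF _ lnI]) (intro borel_measurable_continuous_onI continuous_on_fst continuous_on_id)
 show ?thesis
 proof (rule exI[of _ "\<lambda>x. ln (I (fst x))"], rule exI[of _ K], intro conjI allI)
  fix w :: "'n torus cpath"
  show "exp (- 0 * (norm (\<Sum>j\<in>{1..N}. path_incr N w j))\<^sup>2 / (2 * \<nu>)) *
    (\<integral>\<xi>. exp (F (bridge_walk 0 N (path_at w 0) (\<Sum>j\<in>{1..N}. path_incr N w j) \<xi>)) \<partial>\<Gamma>)
     \<le> exp (ln (I (fst (path_at w 0, path_at w 1))))"
   unfolding bridge_walk_0 I_def[symmetric] using I0 by simp
 qed (use fm lnIK fin in simp_all)
qed

text \<open>Given its endpoints, Brownian motion on the torus is a mixture of bridges over all lifts
  of the displacement; summing over the lattice makes a function of the endpoints out of a bound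
  that knows only the grid-dependent lift. The sum is integrated by unfolding the torus, and the
  entropy of \<gamma> enters through the variational formula applied to G.\<close>

lemma pinned_walk_potential:
 assumes \<nu>2: "2 * pi * \<nu> \<le> 1" and p: "p \<in> space (prob_algebra borel)"
  and \<gamma>: "distr p borel (\<lambda>w. (path_at w 0, path_at w 1)) = \<gamma>"
  and H: "rel_entropy \<gamma> (leb_torus \<Otimes>\<^sub>M leb_torus) \<le> ereal H"
 shows "\<exists>G L. G \<in> borel_measurable borel \<and> (\<forall>x. \<bar>G x\<bar> \<le> L) \<and>
    (\<forall>w. exp (- 1 * (norm (\<Sum>j\<in>{1..N}. path_incr N w j))\<^sup>2 / (2 * \<nu>)) *
     (\<integral>\<xi>. exp (F (bridge_walk 1 N (path_at w 0) (\<Sum>j\<in>{1..N}. path_incr N w j) \<xi>)) \<partial>gaussN (\<nu> / N) N)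
      \<le> exp (G (path_at w 0, path_at w 1))) \<and>
    (\<integral>w. G (path_at w 0, path_at w 1) \<partial>p) \<le> H + ln (\<integral>w. exp (F (samp N w)) \<partial>R)"
proof -
 interpret G: prob_space \<Gamma> by (rule prob_\<Gamma>)
 let ?L = "leb_torus :: 'n torus measure"
 interpret L: prob_space ?L by (rule prob_space_leb_torus)
 interpret LL: pair_prob_space ?L ?L ..
 have pp: "prob_space p" "sets p = sets borel" using p by (auto simp: prob_algebra_borel_iff)
 interpret p: prob_space p by (rule pp)
 let ?e = "\<lambda>w :: 'n torus cpath. (path_at w 0, path_at w 1)"
 have "?e \<in> borel_measurable (borel :: 'n torus cpath measure)"
  by (intro borel_measurable_continuous_onI continuous_on_Pair continuous_on_eval) auto
 then have ep: "?e \<in> borel_measurable p" using measurable_cong_sets[OF pp(2) refl] by blast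
 have sLL: "sets (?L \<Otimes>\<^sub>M ?L) = sets borel" unfolding borel_prod[symmetric] by (intro sets_pair_measure_cong) auto
 define \<Psi> where "\<Psi> x y = (\<integral>\<^sup>+ \<xi>. ennreal (exp (F (bridge_walk 1 N x y \<xi>))) \<partial>\<Gamma>)" for x y
 have \<Psi>m: "(\<lambda>z. \<Psi> (fst z) (snd z)) \<in> borel_measurable (borel \<Otimes>\<^sub>M borel)"
 proof -
  have "(\<lambda>u. bridge_walk 1 N (fst (fst u)) (snd (fst u)) (snd u)) \<in> measurable ((borel \<Otimes>\<^sub>M borel) \<Otimes>\<^sub>M \<Gamma>) (PiM {..N} (\<lambda>_. borel))"
   unfolding bridge_walk_def
  proof (rule measurable_restrict)
   fix i assume "i \<in> {..N}"
   then have [measurable]: "(\<lambda>\<xi>. \<Sum>j\<in>{1..i}. \<xi> j) \<in> borel_measurable \<Gamma>" by (intro measurable_partial_sum) simp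
   have [measurable]: "(\<lambda>\<xi>. \<Sum>j\<in>{1..N}. \<xi> j) \<in> borel_measurable \<Gamma>" by (intro measurable_partial_sum) simp
   show "(\<lambda>u. fst (fst u) + proj ((1 * (real i / real N)) *\<^sub>R snd (fst u) + (\<Sum>j\<in>{1..i}. snd u j)
     - (1 * (real i / real N)) *\<^sub>R (\<Sum>j\<in>{1..N}. snd u j))) \<in> borel_measurable ((borel \<Otimes>\<^sub>M borel) \<Otimes>\<^sub>M \<Gamma>)"
    by (rule borel_measurable_add_torus) measurable
  qed
  from measurable_compose[OF this expF]
  have "(\<lambda>(z, \<xi>). ennreal (exp (F (bridge_walk 1 N (fst z) (snd z) \<xi>)))) \<in> borel_measurable ((borel \<Otimes>\<^sub>M borel) \<Otimes>\<^sub>M \<Gamma>)"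
   by (simp add: split_beta')
  then show ?thesis unfolding \<Psi>_def by (rule G.borel_measurable_nn_integral)
 qed
 have \<Psi>c: "(\<lambda>z. \<Psi> (f z) (g z)) \<in> borel_measurable M" if "f \<in> borel_measurable M" "g \<in> borel_measurable M" for f g M
  using measurable_compose[OF measurable_Pair[OF that] \<Psi>m] by simp
 have \<Psi>le: "\<Psi> x y \<le> ennreal (exp K)" for x y
 proof -
  have "\<Psi> x y \<le> (\<integral>\<^sup>+ \<xi>. ennreal (exp K) \<partial>\<Gamma>)" unfolding \<Psi>_def by (intro nn_integral_mono ennreal_leI) (simp add: F_le)
  then show ?thesis by (simp only: nn_integral_const G.emeasure_space_1 mult_1_right)
 qed
 have \<Psi>ge: "ennreal (exp (- K)) \<le> \<Psi> x y" for x y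
 proof -
  have "(\<integral>\<^sup>+ \<xi>. ennreal (exp (- K)) \<partial>\<Gamma>) \<le> \<Psi> x y" unfolding \<Psi>_def by (intro nn_integral_mono ennreal_leI) (simp add: F_ge)
  then show ?thesis by (simp only: nn_integral_const G.emeasure_space_1 mult_1_right)
 qed
 have \<Psi>r: "\<Psi> x y = ennreal (\<integral>\<xi>. exp (F (bridge_walk 1 N x y \<xi>)) \<partial>\<Gamma>)" for x y
  unfolding \<Psi>_def
  by (rule nn_integral_eq_integral[OF integral_exp_bounded_pos(1)[OF G.prob_space_axioms measurable_compose[OF measurable_bridge_walk1 F(1)] F(2)]]) simp
 let ?g = "\<lambda>y :: real ^ 'n. ennreal (exp (- (norm y)\<^sup>2 / (2 * \<nu>)))"
 have gm: "?g \<in> borel_measurable borel" by measurable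
 \<comment> \<open>Gaussian weight times bridge partition function, summed over all lifts of q. The
   sum of the path increments is one of these lifts, so its term is at most the sum.\<close>
 define M where "M x q = (\<integral>\<^sup>+ k. ?g (tlog q + k) * \<Psi> x (tlog q + k) \<partial>count_space zlat)" for x q
 have Mc: "(\<lambda>z. M (f z) (g z)) \<in> borel_measurable M'" if "f \<in> borel_measurable M'" "g \<in> borel_measurable M'" for f g M'
  unfolding M_def
 proof (rule measurable_nn_integral_zlat)
  fix k :: "real ^ 'n"
  have tk: "(\<lambda>z. tlog (g z) + k) \<in> borel_measurable M'"
   by (intro borel_measurable_add borel_measurable_const measurable_compose[OF that(2) borel_measurable_tlog])
  show "(\<lambda>z. ?g (tlog (g z) + k) * \<Psi> (f z) (tlog (g z) + k)) \<in> borel_measurable M'"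
   by (intro borel_measurable_times_ennreal measurable_compose[OF tk gm] \<Psi>c that(1) tk)
 qed
 have Mterm: "?g (tlog q + k) * \<Psi> x (tlog q + k) \<le> M x q" if "k \<in> zlat" for x q k
  unfolding M_def by (rule nn_integral_ge_point[OF that])
 \<comment> \<open>Truncation at exp K keeps G bounded above; it is harmless, as the quantity to be
   dominated is at most exp K as well.\<close>
 define m where "m x = min (ennreal (exp K)) (M (fst x) (snd x - fst x))" for x
 have mfin: "m x < \<infinity>" for x by (auto simp: m_def min_less_iff_disj)
 \<comment> \<open>Exponent of a lower bound from the single term k = 0, with
   \<open>CARD('n)\<close> bounding the norm of the logarithm; it keeps G bounded below.\<close>
 let ?d = "- (real CARD('n))\<^sup>2 / (2 * \<nu>) - K"
 have mge: "ennreal (exp ?d) \<le> m x" for x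
 proof -
  let ?t = "tlog (snd x - fst x)"
  have "(norm ?t)\<^sup>2 \<le> (real CARD('n))\<^sup>2" by (intro power_mono norm_tlog_bound) simp
  then have "- (real CARD('n))\<^sup>2 / (2 * \<nu>) \<le> - (norm ?t)\<^sup>2 / (2 * \<nu>)" using \<nu> by (intro divide_right_mono) auto
  then have "ennreal (exp (- (real CARD('n))\<^sup>2 / (2 * \<nu>))) * ennreal (exp (- K)) \<le> ?g ?t * \<Psi> (fst x) ?t"
   by (intro mult_mono \<Psi>ge ennreal_leI) auto
  also have "... \<le> M (fst x) (snd x - fst x)" using Mterm[of 0 "snd x - fst x" "fst x"] by (simp add: zlat_def)
  also have "ennreal (exp (- (real CARD('n))\<^sup>2 / (2 * \<nu>))) * ennreal (exp (- K)) = ennreal (exp ?d)"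
   by (simp add: ennreal_mult[symmetric] exp_add[symmetric])
  finally have "ennreal (exp ?d) \<le> M (fst x) (snd x - fst x)" .
  moreover have "exp ?d \<le> exp K"
  proof -
   have "K \<ge> 0" using F_le[of undefined] F_ge[of undefined] by linarith
   moreover have "0 \<le> (real CARD('n))\<^sup>2 / (2 * \<nu>)" using \<nu> by simp
   ultimately show ?thesis by simp
  qed
  ultimately show ?thesis by (simp add: m_def ennreal_leI)
 qed
 define r where "r x = enn2real (m x)" for x
 have rm: "ennreal (r x) = m x" for x using mfin[of x] by (simp add: r_def)
 have rge: "exp ?d \<le> r x" for x using mge[of x] unfolding rm[symmetric] by (subst (asm) ennreal_le_iff) (auto simp: r_def)
 have r0: "r x > 0" for x using rge[of x] by (rule less_le_trans[OF exp_gt_zero])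
 have rle: "r x \<le> exp K" for x
 proof -
  have "ennreal (r x) \<le> ennreal (exp K)" unfolding rm by (simp add: m_def)
  then show ?thesis by (subst (asm) ennreal_le_iff) auto
 qed
 have mm: "m \<in> borel_measurable borel"
  unfolding m_def borel_prod[symmetric]
  by (intro borel_measurable_min borel_measurable_const Mc borel_measurable_diff_torus measurable_fst measurable_snd)
 then have rmeas: "r \<in> borel_measurable borel" unfolding r_def by measurable
 define G where "G x = ln (r x)" for x
 have Gm: "G \<in> borel_measurable borel" unfolding G_def using rmeas by measurable
 have eG: "exp (G x) = r x" for x using r0 by (simp add: G_def)
 have GL: "\<bar>G x\<bar> \<le> K + (real CARD('n))\<^sup>2 / (2 * \<nu>)" for x
 proof -
  have "exp (G x) \<le> exp K" "exp ?d \<le> exp (G x)" unfolding eG by (rule rle, rule rge)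
  then have "G x \<le> K" "?d \<le> G x" by simp_all
  moreover have "0 \<le> (real CARD('n))\<^sup>2 / (2 * \<nu>)" using \<nu> by simp
  ultimately show ?thesis by (simp add: abs_le_iff)
 qed
 have dom: "exp (- 1 * (norm (\<Sum>j\<in>{1..N}. path_incr N w j))\<^sup>2 / (2 * \<nu>)) *
     (\<integral>\<xi>. exp (F (bridge_walk 1 N (path_at w 0) (\<Sum>j\<in>{1..N}. path_incr N w j) \<xi>)) \<partial>\<Gamma>) \<le> exp (G (?e w))" for w
 proof -
  let ?A = "\<Sum>j\<in>{1..N}. path_incr N w j" and ?q = "path_at w 1 - path_at w 0"
  have "path_at w 1 = path_at w 0 + proj ?A" using path_at_incr[of w N N] N by simp
  then have "proj ?A = proj (tlog ?q)" by simp
  then have k: "?A - tlog ?q \<in> zlat" by (simp only: proj_eq_iff_zlat)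
  have "?g ?A * \<Psi> (path_at w 0) ?A \<le> M (path_at w 0) ?q" using Mterm[OF k, of ?q "path_at w 0"] by simp
  moreover have "?g ?A * \<Psi> (path_at w 0) ?A \<le> 1 * ennreal (exp K)"
   using \<nu> by (intro mult_mono \<Psi>le) (auto simp: ennreal_le_1)
  ultimately have "?g ?A * \<Psi> (path_at w 0) ?A \<le> m (?e w)" by (simp add: m_def)
  then have "ennreal (exp (- (norm ?A)\<^sup>2 / (2 * \<nu>)) * (\<integral>\<xi>. exp (F (bridge_walk 1 N (path_at w 0) ?A \<xi>)) \<partial>\<Gamma>)) \<le> ennreal (r (?e w))"
   unfolding rm \<Psi>r by (simp add: ennreal_mult Bochner_Integration.integral_nonneg)
  then show ?thesis unfolding eG using less_imp_le[OF r0] by (subst (asm) ennreal_le_iff) auto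
 qed
 have GmL: "G \<in> borel_measurable (?L \<Otimes>\<^sub>M ?L)" using Gm measurable_cong_sets[OF sLL refl] by blast
 have Zpos: "(\<integral>x. exp (G x) \<partial>(?L \<Otimes>\<^sub>M ?L)) \<ge> exp (- (K + (real CARD('n))\<^sup>2 / (2 * \<nu>)))"
  and Zi: "integrable (?L \<Otimes>\<^sub>M ?L) (\<lambda>x. exp (G x))"
  by (rule integral_exp_bounded_pos[OF LL.prob_space_axioms GmL GL])+
 have Zle: "(\<integral>x. exp (G x) \<partial>(?L \<Otimes>\<^sub>M ?L)) \<le> (\<integral>w. exp (F (samp N w)) \<partial>R)"
 proof -
  have "ennreal (\<integral>x. exp (G x) \<partial>(?L \<Otimes>\<^sub>M ?L)) = (\<integral>\<^sup>+ x. ennreal (exp (G x)) \<partial>(?L \<Otimes>\<^sub>M ?L))"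
   by (rule nn_integral_eq_integral[symmetric, OF Zi]) simp
  also have "... \<le> (\<integral>\<^sup>+ x. M (fst x) (snd x - fst x) \<partial>(?L \<Otimes>\<^sub>M ?L))"
   unfolding eG rm by (intro nn_integral_mono) (simp add: m_def)
  also have "... = (\<integral>\<^sup>+ x. \<integral>\<^sup>+ x'. M x (x' - x) \<partial>?L \<partial>?L)"
  proof -
   have "(\<lambda>x. M (fst x) (snd x - fst x)) \<in> borel_measurable (borel :: ('n torus \<times> 'n torus) measure)"
    unfolding borel_prod[symmetric] by (intro Mc borel_measurable_diff_torus measurable_fst measurable_snd)
   then have "(\<lambda>x. M (fst x) (snd x - fst x)) \<in> borel_measurable (?L \<Otimes>\<^sub>M ?L)" using measurable_cong_sets[OF sLL refl] by blast
   from L.nn_integral_fst[OF this] show ?thesis by simp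
  qed
  also have "... \<le> (\<integral>\<^sup>+ x. \<integral>\<^sup>+ \<xi>. ennreal (exp (F (walk N x \<xi>))) \<partial>\<Gamma> \<partial>?L)"
  proof (rule nn_integral_mono)
   fix x :: "'n torus"
   have \<Psi>x: "\<Psi> x \<in> borel_measurable borel"
    by (rule \<Psi>c[of "\<lambda>_. x" borel "\<lambda>y. y"]) (rule borel_measurable_const, rule measurable_ident_sets[OF refl])
   have Mx: "M x \<in> borel_measurable borel"
    by (rule Mc[of "\<lambda>_. x" borel "\<lambda>y. y"]) (rule borel_measurable_const, rule measurable_ident_sets[OF refl])
   have "(\<integral>\<^sup>+ x'. M x (x' - x) \<partial>?L) = (\<integral>\<^sup>+ x'. M x (x' + - x) \<partial>?L)" by (simp only: diff_conv_add_uminus)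
   also have "... = (\<integral>\<^sup>+ q. M x q \<partial>?L)"
    by (rule nn_integral_leb_torus_translate[where g = "M x", OF Mx])
   also have "... = (\<integral>\<^sup>+ y. ?g y * \<Psi> x y \<partial>lborel)"
    unfolding M_def by (rule nn_integral_unfold_torus[where h = "\<lambda>y. ?g y * \<Psi> x y", symmetric])
     (intro borel_measurable_times_ennreal gm \<Psi>x)
   also have "... \<le> (\<integral>\<^sup>+ y. ennreal (gdens \<nu> y) * \<Psi> x y \<partial>lborel)"
   proof (intro nn_integral_mono mult_right_mono ennreal_leI)
    fix y :: "real ^ 'n"
    have "1 \<le> (2 * pi * \<nu>) powr (- real CARD('n) / 2)"
     using powr_mono'[of "- real CARD('n) / 2" 0 "2 * pi * \<nu>"] \<nu>2 \<nu> by simp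
    from mult_right_mono[OF this, of "exp (- (norm y)\<^sup>2 / (2 * \<nu>))"]
    show "exp (- (norm y)\<^sup>2 / (2 * \<nu>)) \<le> gdens \<nu> y" by (simp add: gdens_def)
   qed simp
   also have "... = (\<integral>\<^sup>+ y. \<Psi> x y \<partial>gauss \<nu>)" by (rule nn_integral_gauss[symmetric, OF \<Psi>x])
   \<comment> \<open>With its end y averaged over the Gaussian of variance \<nu>, the bridge is
     dominated by the free walk.\<close>
   also have "... \<le> (\<integral>\<^sup>+ \<xi>. ennreal (exp (F (walk N x \<xi>))) \<partial>\<Gamma>)"
    unfolding \<Psi>_def bridge_walk_1[OF N]
    by (rule gaussian_bridge_dominated[OF \<nu> N, where g = "\<lambda>\<xi>. ennreal (exp (F (walk N x \<xi>)))"])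
     (rule measurable_compose[OF measurable_walk1 expF])
   finally show "(\<integral>\<^sup>+ x'. M x (x' - x) \<partial>?L) \<le> (\<integral>\<^sup>+ \<xi>. ennreal (exp (F (walk N x \<xi>))) \<partial>\<Gamma>)" .
  qed
  also have "... = ennreal (\<integral>w. exp (F (samp N w)) \<partial>R)" by (rule nn_integral_walk_partition)
  finally show ?thesis by (subst (asm) ennreal_le_iff) (auto intro!: Bochner_Integration.integral_nonneg)
 qed
 have "ereal ((\<integral>x. G x \<partial>\<gamma>) - ln (\<integral>x. exp (G x) \<partial>(?L \<Otimes>\<^sub>M ?L))) \<le> rel_entropy \<gamma> (?L \<Otimes>\<^sub>M ?L)"
 proof (rule rel_entropy_ge[OF _ LL.prob_space_axioms _ _ GL])
  show "prob_space \<gamma>" unfolding \<gamma>[symmetric] by (rule p.prob_space_distr[OF ep])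
  show "sets \<gamma> = sets (?L \<Otimes>\<^sub>M ?L)" unfolding \<gamma>[symmetric] sLL by simp
  show "G \<in> borel_measurable (?L \<Otimes>\<^sub>M ?L)" by (rule GmL)
 qed
 also note H
 finally have "(\<integral>x. G x \<partial>\<gamma>) \<le> H + ln (\<integral>x. exp (G x) \<partial>(?L \<Otimes>\<^sub>M ?L))" by simp
 also have "... \<le> H + ln (\<integral>w. exp (F (samp N w)) \<partial>R)"
 proof -
  have "0 < (\<integral>x. exp (G x) \<partial>(?L \<Otimes>\<^sub>M ?L))" by (rule less_le_trans[OF exp_gt_zero Zpos])
  then show ?thesis using Zle by (simp add: ln_mono)
 qed
 also have "(\<integral>x. G x \<partial>\<gamma>) = (\<integral>w. G (?e w) \<partial>p)" unfolding \<gamma>[symmetric] by (rule integral_distr[OF ep Gm])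
 finally have "(\<integral>w. G (?e w) \<partial>p) \<le> H + ln (\<integral>w. exp (F (samp N w)) \<partial>R)" .
 then have "(\<forall>x. \<bar>G x\<bar> \<le> K + (real CARD('n))\<^sup>2 / (2 * \<nu>)) \<and> (\<integral>w. G (?e w) \<partial>p) \<le> H + ln (\<integral>w. exp (F (samp N w)) \<partial>R)"
  by (intro conjI allI GL)
 then show ?thesis
  by (intro exI[of _ G] exI[of _ "K + (real CARD('n))\<^sup>2 / (2 * \<nu>)"] conjI allI Gm dom) (elim conjE allE, assumption)+
qed

end

section \<open>The two Gamma-limits\<close>

lemma recovery_sequence:
  fixes R :: "real => 'n::finite torus cpath measure"
  assumes R: "\<And>\<nu>. \<nu> > 0 ==> is_reversible_brownian \<nu> (R \<nu>)"
    and p: "p \<in> space (prob_algebra borel)" and \<theta>: "\<theta> = 0 \<or> \<theta> = 1"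
    and le: "\<And>\<nu>. 0 < \<nu> ==> \<nu> \<le> 1 ==> 2 * pi * \<nu> \<le> 1 ==> measure (noise_law (R 1) \<nu>) small_paths \<ge> 1 / 2 ==>
      rel_entropy (perturb p (pinned_noise \<theta> (R 1) \<nu>)) (R \<nu>) \<le> ereal (a / \<nu> + (8 * \<nu> * l + ln 2) + H)"
  shows "\<exists>Q. (\<forall>\<nu>. Q \<nu> \<in> space (prob_algebra borel)) \<and> (\<theta> = 1 \<longrightarrow> (\<forall>\<nu>. AE z in Q \<nu>. path_at z 0 = 0 \<and> path_at z 1 = 0)) \<and>
    limitin narrow_topology (\<lambda>\<nu>. perturb p (Q \<nu>)) p (at_right 0) \<and>
    Limsup (at_right 0) (\<lambda>\<nu>. ereal \<nu> * rel_entropy (perturb p (Q \<nu>)) (R \<nu>)) \<le> ereal a"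
proof -
  note R1 = R[OF zero_less_one]
  let ?good = "\<lambda>\<nu>. 0 < \<nu> \<and> \<nu> \<le> 1 \<and> measure (noise_law (R 1) \<nu>) small_paths \<ge> 1 / 2"
  \<comment> \<open>Conditioning is controlled only where the small event is likely; for the other
    \<nu> the Dirac mass at the zero path leaves the flow unperturbed.\<close>
  define Q where "Q \<nu> = (if ?good \<nu> then pinned_noise \<theta> (R 1) \<nu> else return borel zero_path)" for \<nu>
  have Q: "Q \<nu> \<in> space (prob_algebra borel)" for \<nu>
    using pinned_noise_space[OF R1, of \<nu> \<theta>] prob_space_return[of zero_path "borel :: 'n torus cpath measure"]
    by (auto simp: Q_def prob_algebra_borel_iff)
  have ends: "AE z in Q \<nu>. path_at z 0 = 0 \<and> path_at z 1 = 0" if \<theta>1: "\<theta> = 1" for \<nu>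
  proof (cases "?good \<nu>")
    case True
    then have "AE z in pinned_noise 1 (R 1) \<nu>. path_at z 0 = 0 \<and> path_at z 1 = 0"
      by (intro pinned_noise_endpoints[OF R1]) auto
    moreover have "Q \<nu> = pinned_noise 1 (R 1) \<nu>" unfolding Q_def using True \<theta>1 by simp
    ultimately show ?thesis by (simp only:)
  next
    case False
    have m: "{z :: 'n torus cpath. path_at z 0 = 0 \<and> path_at z 1 = 0} \<in> sets borel"
      by (intro borel_closed closed_Collect_conj closed_Collect_eq continuous_on_eval continuous_on_const) auto
    have "AE z in return borel zero_path. path_at z 0 = (0 :: 'n torus) \<and> path_at z 1 = 0"
      by (subst AE_return) (use m in \<open>simp_all add: path_at_zero_path pred_def\<close>)
    moreover have "Q \<nu> = return borel zero_path" unfolding Q_def by (rule if_not_P[OF False])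
    ultimately show ?thesis by (simp only:)
  qed
  have ev: "\<forall>\<^sub>F \<nu> in at_right 0. ?good \<nu>"
    using small_paths_likely[OF R1] eventually_at_right_less[of "0 :: real"] by eventually_elim simp
  have conc: "((\<lambda>\<nu>. measure (Q \<nu>) {z. dist z zero_path \<ge> e}) \<longlongrightarrow> 0) (at_right 0)" if e: "e > 0" for e
  proof (rule tendsto_sandwich[where f = "\<lambda>_. 0" and h = "\<lambda>\<nu>. 2 * measure (noise_law (R 1) \<nu>) {z. dist z zero_path \<ge> e / 2}"])
    have "((\<lambda>\<nu>. 2 * measure (noise_law (R 1) \<nu>) {z. dist z zero_path \<ge> e / 2}) \<longlongrightarrow> 2 * 0) (at_right 0)"
      by (intro tendsto_intros noise_law_concentrates[OF R1]) (use e in simp)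
    then show "((\<lambda>\<nu>. 2 * measure (noise_law (R 1) \<nu>) {z. dist z zero_path \<ge> e / 2}) \<longlongrightarrow> 0) (at_right 0)" by simp
    show "\<forall>\<^sub>F \<nu> in at_right 0. measure (Q \<nu>) {z. dist z zero_path \<ge> e} \<le> 2 * measure (noise_law (R 1) \<nu>) {z. dist z zero_path \<ge> e / 2}"
      using ev by eventually_elim (use pinned_noise_tail[OF R1, of _ \<theta> e] \<theta> in \<open>auto simp: Q_def\<close>)
  qed (auto simp: measure_nonneg)
  have lim: "limitin narrow_topology (\<lambda>\<nu>. perturb p (Q \<nu>)) p (at_right 0)"
    by (rule limitin_perturb[OF p Q conc perturb_prob[OF p Q]]) auto
  \<comment> \<open>\<nu> times the entropy bound: a survives, and every other constant carries a
    factor \<nu>.\<close>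
  let ?u = "\<lambda>\<nu>. a + \<nu> * (8 * \<nu> * l + ln 2 + H)"
  have "\<forall>\<^sub>F \<nu> in at_right 0. ereal \<nu> * rel_entropy (perturb p (Q \<nu>)) (R \<nu>) \<le> ereal (?u \<nu>)"
  proof -
    have "\<forall>\<^sub>F \<nu> in at_right (0 :: real). \<nu> \<in> {0<..<1 / (2 * pi)}" by (rule eventually_at_right_real) simp
    with ev show ?thesis
    proof eventually_elim
      case (elim \<nu>)
      then have "2 * pi * \<nu> \<le> 1" by (simp add: field_simps)
      then have "rel_entropy (perturb p (Q \<nu>)) (R \<nu>) \<le> ereal (a / \<nu> + (8 * \<nu> * l + ln 2) + H)"
        using le[of \<nu>] elim by (simp add: Q_def)
      then have "ereal \<nu> * rel_entropy (perturb p (Q \<nu>)) (R \<nu>) \<le> ereal \<nu> * ereal (a / \<nu> + (8 * \<nu> * l + ln 2) + H)"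
        using elim by (intro ereal_mult_left_mono) auto
      also have "... = ereal (?u \<nu>)" using elim by (simp add: field_simps)
      finally show ?case .
    qed
  qed
  then have "Limsup (at_right 0) (\<lambda>\<nu>. ereal \<nu> * rel_entropy (perturb p (Q \<nu>)) (R \<nu>)) \<le> Limsup (at_right 0) (\<lambda>\<nu>. ereal (?u \<nu>))"
    by (rule Limsup_mono)
  also have "... = ereal a"
  proof (rule lim_imp_Limsup)
    have "(?u \<longlongrightarrow> a + 0 * (8 * 0 * l + ln 2 + H)) (at_right 0)" by (intro tendsto_intros)
    then show "((\<lambda>\<nu>. ereal (?u \<nu>)) \<longlongrightarrow> ereal a) (at_right 0)" by simp
  qed simp
  finally show ?thesis using Q ends lim by blast
qed

text \<open>The constraint is an abstract J with values 0 and \<infinity>, closed under narrow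
  limits and preserved by the perturbation, so that both parts are instances. A flow of infinite
  cost is recovered by the constant family.\<close>

lemma Gamma_lim_constraint:
  fixes R :: "real => 'n::finite torus cpath measure" and J :: "'n torus cpath measure => ereal"
  assumes R: "\<And>\<nu>. \<nu> > 0 ==> is_reversible_brownian \<nu> (R \<nu>)" and \<theta>: "\<theta> = 0 \<or> \<theta> = 1"
    and J: "\<And>q. J q = 0 \<or> J q = \<infinity>"
    and closed: "\<And>(P :: real => 'n torus cpath measure) p. (\<And>\<nu>. \<nu> > 0 ==> P \<nu> \<in> space (prob_algebra borel)) ==> limitin narrow_topology P p (at_right 0) ==>
      \<exists>\<^sub>F \<nu> in at_right 0. J (P \<nu>) = 0 ==> J p = 0"
    and pert: "\<And>p Q. p \<in> space (prob_algebra borel) ==> Q \<in> space (prob_algebra borel) ==> J p = 0 ==>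
      (\<theta> = 1 \<longrightarrow> (AE z in Q. path_at z 0 = 0 \<and> path_at z 1 = 0)) ==> J (perturb p Q) = 0"
    and le: "\<And>p a \<nu>. p \<in> space (prob_algebra borel) ==> J p = 0 ==> mean_action p \<le> ereal a ==> 0 < \<nu> ==> \<nu> \<le> 1 ==> 2 * pi * \<nu> \<le> 1 ==>
      measure (noise_law (R 1) \<nu>) small_paths \<ge> 1 / 2 ==>
      rel_entropy (perturb p (pinned_noise \<theta> (R 1) \<nu>)) (R \<nu>) \<le> ereal (a / \<nu> + (8 * \<nu> * l + ln 2) + H)"
  shows "Gamma_lim narrow_topology (\<lambda>\<nu> P. ereal \<nu> * rel_entropy P (R \<nu>) + J P) (\<lambda>P. mean_action P + J P)"
  unfolding Gamma_lim_def topspace_narrow_topology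
proof (intro conjI allI impI ballI)
  fix P :: "real => 'n torus cpath measure" and p assume "(\<forall>\<nu>>0. P \<nu> \<in> space (prob_algebra borel)) \<and> limitin narrow_topology P p (at_right 0)"
  then have P: "\<And>\<nu>. \<nu> > 0 ==> P \<nu> \<in> space (prob_algebra borel)" and lim: "limitin narrow_topology P p (at_right 0)" by auto
  show "mean_action p + J p \<le> Liminf (at_right 0) (\<lambda>\<nu>. ereal \<nu> * rel_entropy (P \<nu>) (R \<nu>) + J (P \<nu>))"
  proof (rule Gamma_liminf_constraint[OF R P lim J])
    show "J p = 0" if "\<exists>\<^sub>F \<nu> in at_right 0. J (P \<nu>) = 0" by (rule closed[OF P lim that])
  qed
next
  fix p :: "'n torus cpath measure" assume p: "p \<in> space (prob_algebra borel)"
  have ma: "mean_action p \<ge> 0" by (simp add: mean_action_def)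
  show "\<exists>P. (\<forall>\<nu>>0. P \<nu> \<in> space (prob_algebra borel)) \<and> limitin narrow_topology P p (at_right 0) \<and>
     Limsup (at_right 0) (\<lambda>\<nu>. ereal \<nu> * rel_entropy (P \<nu>) (R \<nu>) + J (P \<nu>)) \<le> mean_action p + J p"
  proof (cases "J p = 0 \<and> mean_action p \<noteq> \<infinity>")
    case True
    then obtain a where a: "mean_action p = ereal a" using ma by (cases "mean_action p") auto
    have "\<exists>Q. (\<forall>\<nu>. Q \<nu> \<in> space (prob_algebra borel)) \<and> (\<theta> = 1 \<longrightarrow> (\<forall>\<nu>. AE z in Q \<nu>. path_at z 0 = 0 \<and> path_at z 1 = 0)) \<and>
      limitin narrow_topology (\<lambda>\<nu>. perturb p (Q \<nu>)) p (at_right 0) \<and>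
      Limsup (at_right 0) (\<lambda>\<nu>. ereal \<nu> * rel_entropy (perturb p (Q \<nu>)) (R \<nu>)) \<le> ereal a"
      by (rule recovery_sequence[OF R p \<theta>]) (use le[OF p] True a in auto)
    then obtain Q where Q: "\<And>\<nu>. Q \<nu> \<in> space (prob_algebra borel)" "\<And>\<nu>. \<theta> = 1 \<longrightarrow> (AE z in Q \<nu>. path_at z 0 = 0 \<and> path_at z 1 = 0)"
      "limitin narrow_topology (\<lambda>\<nu>. perturb p (Q \<nu>)) p (at_right 0)"
      "Limsup (at_right 0) (\<lambda>\<nu>. ereal \<nu> * rel_entropy (perturb p (Q \<nu>)) (R \<nu>)) \<le> ereal a" by blast
    have "J (perturb p (Q \<nu>)) = 0" for \<nu> using pert[OF p Q(1) _ Q(2)] True by blast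
    then show ?thesis using perturb_prob[OF p Q(1)] Q(3,4) True a by (intro exI[of _ "\<lambda>\<nu>. perturb p (Q \<nu>)"]) simp
  next
    case False
    then have inf: "mean_action p + J p = \<infinity>" using J[of p] ma by auto
    show ?thesis unfolding inf using p by (intro exI[of _ "\<lambda>_. p"]) (simp add: limitin_const)
  qed
qed

lemma iota_inc_eq_0: "iota_inc P = 0 \<longleftrightarrow> (\<forall>t\<in>{0..1}. distr P borel (\<lambda>w. path_at w t) = leb_torus)"
  by (simp add: iota_inc_def)

lemma iota_endpoints_eq_0: "iota_endpoints \<gamma> P = 0 \<longleftrightarrow> distr P borel (\<lambda>w. (path_at w 0, path_at w 1)) = \<gamma>"
  by (simp add: iota_endpoints_def)

lemma iota_inc_closed:
  fixes P :: "real => 'n::finite torus cpath measure"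
  assumes P: "\<And>\<nu>. \<nu> > 0 ==> P \<nu> \<in> space (prob_algebra borel)" and lim: "limitin narrow_topology P p (at_right 0)"
    and fr: "\<exists>\<^sub>F \<nu> in at_right 0. iota_inc (P \<nu>) = 0"
  shows "iota_inc p = 0"
  unfolding iota_inc_eq_0
proof
  fix t :: real assume t: "t \<in> {0..1}"
  show "distr p borel (\<lambda>w. path_at w t) = leb_torus"
    by (rule distr_narrow_limit[OF P lim continuous_on_eval[OF t] frequently_elim1[OF fr]]) (use t in \<open>simp_all add: iota_inc_eq_0\<close>)
qed

theorem theorem2p2:
  fixes R :: "real \<Rightarrow> 'n::finite torus cpath measure"
  assumes R: "\<And>\<nu>. \<nu> > 0 \<Longrightarrow> is_reversible_brownian \<nu> (R \<nu>)"
  shows "Gamma_lim narrow_topology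
           (\<lambda>\<nu> P. ereal \<nu> * rel_entropy P (R \<nu>) + iota_inc P)
           (\<lambda>P. mean_action P + iota_inc P)
       \<and> (\<forall>\<gamma> :: ('n torus \<times> 'n torus) measure.
            bistochastic \<gamma> \<and> rel_entropy \<gamma> (leb_torus \<Otimes>\<^sub>M leb_torus) < \<infinity> \<longrightarrow>
            Gamma_lim narrow_topology
              (\<lambda>\<nu> P. ereal \<nu> * rel_entropy P (R \<nu>) + iota_inc P + iota_endpoints \<gamma> P)
              (\<lambda>P. mean_action P + iota_inc P + iota_endpoints \<gamma> P))"
proof (intro conjI allI impI)
  note R1 = R[OF zero_less_one]
  show "Gamma_lim narrow_topology (\<lambda>\<nu> P. ereal \<nu> * rel_entropy P (R \<nu>) + iota_inc P) (\<lambda>P. mean_action P + iota_inc P)"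
  proof (rule Gamma_lim_constraint[OF R, where \<theta> = 0 and H = 0 and l = "enn2real (lat_const TYPE('n))"])
    show "iota_inc q = 0 \<or> iota_inc q = \<infinity>" for q :: "'n torus cpath measure" by (simp add: iota_inc_def)
    show "iota_inc p = 0" if "\<And>\<nu>. \<nu> > 0 ==> P \<nu> \<in> space (prob_algebra borel)" "limitin narrow_topology P p (at_right 0)"
      "\<exists>\<^sub>F \<nu> in at_right 0. iota_inc (P \<nu>) = 0" for P :: "real => 'n torus cpath measure" and p by (rule iota_inc_closed[OF that])
    show "iota_inc (perturb p Q) = 0" if "p \<in> space (prob_algebra borel)" "Q \<in> space (prob_algebra borel)" "iota_inc p = 0"
      for p Q :: "'n torus cpath measure"
      using perturb_marginal[OF that(1,2)] that(3) by (simp add: iota_inc_eq_0)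
    fix p :: "'n torus cpath measure" and a \<nu> :: real
    assume p: "p \<in> space (prob_algebra borel)" and inc: "iota_inc p = 0" and a: "mean_action p \<le> ereal a"
      and \<nu>: "0 < \<nu>" "\<nu> \<le> 1" and likely: "1 / 2 \<le> measure (noise_law (R 1) \<nu>) small_paths"
    have p0: "distr p borel (\<lambda>w. path_at w 0) = leb_torus" using inc by (simp add: iota_inc_eq_0)
    show "rel_entropy (perturb p (pinned_noise 0 (R 1) \<nu>)) (R \<nu>)
      \<le> ereal (a / \<nu> + (8 * \<nu> * enn2real (lat_const TYPE('n)) + ln 2) + 0)"
      by (rule perturb_entropy_le[OF R1 R[OF \<nu>(1)] \<nu> _ p a likely])
        (simp, rule free_walk_potential[OF R[OF \<nu>(1)] \<nu>(1) _ _ _ p p0])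
  qed simp_all
  fix \<gamma> :: "('n torus \<times> 'n torus) measure"
  assume "bistochastic \<gamma> \<and> rel_entropy \<gamma> (leb_torus \<Otimes>\<^sub>M leb_torus) < \<infinity>"
  then obtain H where H: "rel_entropy \<gamma> (leb_torus \<Otimes>\<^sub>M leb_torus) \<le> ereal H"
    by (cases "rel_entropy \<gamma> (leb_torus \<Otimes>\<^sub>M leb_torus)") auto
  \<comment> \<open>Both constraints together form again one function with values 0 and
    \<infinity>.\<close>
  let ?J = "\<lambda>P. iota_inc P + iota_endpoints \<gamma> P"
  have J0: "?J P = 0 \<longleftrightarrow> iota_inc P = 0 \<and> iota_endpoints \<gamma> P = 0" for P
    by (simp add: iota_inc_def iota_endpoints_def)
  have "Gamma_lim narrow_topology (\<lambda>\<nu> P. ereal \<nu> * rel_entropy P (R \<nu>) + ?J P) (\<lambda>P. mean_action P + ?J P)"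
  proof (rule Gamma_lim_constraint[OF R, where \<theta> = 1 and H = H and l = "enn2real (lat_const TYPE('n))"])
    show "?J q = 0 \<or> ?J q = \<infinity>" for q by (simp add: iota_inc_def iota_endpoints_def)
    show "?J p = 0" if P: "\<And>\<nu>. \<nu> > 0 ==> P \<nu> \<in> space (prob_algebra borel)" and lim: "limitin narrow_topology P p (at_right 0)"
      and fr: "\<exists>\<^sub>F \<nu> in at_right 0. ?J (P \<nu>) = 0" for P :: "real => 'n torus cpath measure" and p
      unfolding J0
    proof
      show "iota_inc p = 0" by (rule iota_inc_closed[OF P lim frequently_elim1[OF fr]]) (simp_all add: J0)
      have "continuous_on UNIV (\<lambda>w :: 'n torus cpath. (path_at w 0, path_at w 1))"
        by (intro continuous_on_Pair continuous_on_eval) auto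
      then show "iota_endpoints \<gamma> p = 0" unfolding iota_endpoints_eq_0
        by (rule distr_narrow_limit[OF P lim _ frequently_elim1[OF fr], rotated]) (simp_all add: J0 iota_endpoints_eq_0)
    qed
    show "?J (perturb p Q) = 0" if "p \<in> space (prob_algebra borel)" "Q \<in> space (prob_algebra borel)" "?J p = 0"
      "(1 :: real) = 1 \<longrightarrow> (AE z in Q. path_at z 0 = 0 \<and> path_at z 1 = 0)" for p Q
      using perturb_marginal[OF that(1,2)] perturb_endpoints[OF that(1,2)] that(3,4)
      unfolding J0 iota_inc_eq_0 iota_endpoints_eq_0 by simp
    fix p :: "'n torus cpath measure" and a \<nu> :: real
    assume p: "p \<in> space (prob_algebra borel)" and inc: "?J p = 0" and a: "mean_action p \<le> ereal a"
      and \<nu>: "0 < \<nu>" "\<nu> \<le> 1" and \<nu>2: "2 * pi * \<nu> \<le> 1" and likely: "1 / 2 \<le> measure (noise_law (R 1) \<nu>) small_paths"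
    have \<gamma>: "distr p borel (\<lambda>w. (path_at w 0, path_at w 1)) = \<gamma>" using inc unfolding J0 iota_endpoints_eq_0 by blast
    show "rel_entropy (perturb p (pinned_noise 1 (R 1) \<nu>)) (R \<nu>)
      \<le> ereal (a / \<nu> + (8 * \<nu> * enn2real (lat_const TYPE('n)) + ln 2) + H)"
      by (rule perturb_entropy_le[OF R1 R[OF \<nu>(1)] \<nu> _ p a likely])
        (simp, rule pinned_walk_potential[OF R[OF \<nu>(1)] \<nu>(1) _ _ _ \<nu>2 p \<gamma> H])
  qed simp_all
  then show "Gamma_lim narrow_topology
      (\<lambda>\<nu> P. ereal \<nu> * rel_entropy P (R \<nu>) + iota_inc P + iota_endpoints \<gamma> P)
      (\<lambda>P. mean_action P + iota_inc P + iota_endpoints \<gamma> P)"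
    by (simp only: add.assoc)
qed

end
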